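(* Assume that there exist a positive sequence $(\lambda^N)_{N\in\mathbb N^*}$ and two positive constants $\bar M,\mathcal E$ such that $(X^N)_{N\in\mathbb N^*}\in\mathcal X(\bar M,\mathcal E)$. Assume moreover that $\bar M^{1/3}r_0$ is small enough. Then there exists $N(r_0,\bar M,\mathcal E)\in\mathbb N^*$, depending on $r_0,\bar M,\mathcal E$, such that for all $N\ge N(r_0,\bar M,\mathcal E)$ and all $1\le i\le N$ $$V_i=\kappa g+6\pi R\sum_{j\ne i}\Phi(x_i-x_j)\,\kappa g+O(d_{\min}^N),\qquad R\,\Omega_i=O(d_{\min}^N),$$ where the constants in $O(\cdot)$ are independent of $N$ and $i$ and depend only on $r_0,\bar M,\mathcal E,\kappa|g|$.
   Context: Fix $r_0>0$, $\kappa>0$, $g\in\mathbb R^3$ (all independent of $N$), and set $R=r_0/N$ for $N\in\mathbb N^*=\{1,2,\dots\}$. Everything is considered at a fixed time. Configurations. For each $N$ let $X^N=(x_1,\dots,x_N)$ be a configuration of points of $\mathbb R^3$ (the dependence of $x_i$ on $N$ is not displayed) and $d_{\min}^N=\min_{i\neq j}|x_i-x_j|$. For a positive sequence $(\lambda^N)$ put $M^N=\sup_{x\in\mathbb R^3}\#\{i: x_i\in\overline{B_\infty(x,\lambda^N)}\}$, where $B_\infty(x,r)$ is the ball for the $\ell^\infty$ norm. Given $\bar M,\mathcal E>0$ and $(\lambda^N)$, $\mathcal X(\bar M,\mathcal E)$ is the set of sequences $(X^N)_N$ such that $\sup_N \frac{M^N}{N|\lambda^N|^3}\le\bar M$, $\sup_N\frac{|\lambda^N|^3}{|d_{\min}^N|^2}\le\mathcal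 E$, $\lambda^N\ge d_{\min}^N/2$ for all $N$, and $\lim_{N\to\infty}\lambda^N=0$. Stokes problem. For a configuration with disjoint closed balls $\overline{B_i}$, $B_i=B(x_i,R)$, let $(u^N,p^N)$ and $(V_i,\Omega_i)_{1\le i\le N}\in(\mathbb R^3\times\mathbb R^3)^N$ be the unique solution of $-\Delta u^N+\nabla p^N=0$, $\operatorname{div}u^N=0$ in $\mathbb R^3\setminus\bigcup_i\overline{B_i}$, $u^N=V_i+\Omega_i\times(x-x_i)$ on $\partial B_i$, $|u^N(x)|\to0$ as $|x|\to\infty$, with finite Dirichlet energy, $p^N\in L^2$, and $\int_{\partial B_i}\sigma(u^N,p^N)n=-mg$, $\int_{\partial B_i}(x-x_i)\times[\sigma(u^N,p^N)n]=0$ for all $i$, where $\sigma(u,p)=\nabla u+\nabla u^\top-p\mathbb I$, $n$ is the unit outer normal to $\partial B_i$, and $mg=6\pi R\,\kappa g$. Oseen tensor: $\Phi(x)=\frac1{8\pi}\left(\frac{1}{|x|}\mathbb I_3+\frac{x\otimes x}{|x|^3}\right)$, $x\ne0$. *)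

theory Defs
  imports "HOL-Analysis.Analysis"
begin

text \<open>
  A configuration of \<open>N\<close> points is a function \<open>x :: nat \<Rightarrow> real^3\<close>, of which only the values at
  the indices \<open>1, \<dots>, N\<close> matter.
\<close>

definition min_dist :: "nat \<Rightarrow> (nat \<Rightarrow> real^3) \<Rightarrow> real" where
  "min_dist N x = Min {dist (x i) (x j) | i j. i \<in> {1..N} \<and> j \<in> {1..N} \<and> i \<noteq> j}"

text \<open>The supremum is that of a set of natural numbers bounded by \<open>N\<close>.\<close>

definition max_count :: "nat \<Rightarrow> (nat \<Rightarrow> real^3) \<Rightarrow> real \<Rightarrow> nat" where
  "max_count N x l = (SUP y. card {i \<in> {1..N}. infnorm (x i - y) \<le> l})"

text \<open>
  The bounds on suprema over \<open>N\<close> are written pointwise. The minimal distance of one point is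
  undefined, so the conditions that involve it start at \<open>N = 2\<close>. Its positivity is what
  finiteness of the quotient \<open>\<lambda>\<^sup>3 / d\<^sup>2\<close> means; it has to be stated because division by
  zero gives zero.
\<close>

definition admissible :: "(nat \<Rightarrow> real) \<Rightarrow> real \<Rightarrow> real \<Rightarrow> (nat \<Rightarrow> nat \<Rightarrow> real^3) set" where
  "admissible lam M E = {X.
     (\<forall>N\<ge>1. real (max_count N (X N) (lam N)) / (real N * \<bar>lam N\<bar> ^ 3) \<le> M) \<and>
     (\<forall>N\<ge>2. min_dist N (X N) > 0 \<and>
             \<bar>lam N\<bar> ^ 3 / \<bar>min_dist N (X N)\<bar> ^ 2 \<le> E \<and>
             lam N \<ge> min_dist N (X N) / 2) \<and>
     lam \<longlonglongrightarrow> 0}"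

definition partial :: "3 \<Rightarrow> (real^3 \<Rightarrow> 'a::real_normed_vector) \<Rightarrow> real^3 \<Rightarrow> 'a" where
  "partial k f x = frechet_derivative f (at x) (axis k 1)"

text \<open>These two are meant for open sets \<open>S\<close>.\<close>

definition C1_on :: "(real^3) set \<Rightarrow> (real^3 \<Rightarrow> 'a::real_normed_vector) \<Rightarrow> bool" where
  "C1_on S f \<longleftrightarrow> (\<forall>x\<in>S. f differentiable (at x)) \<and> (\<forall>k. continuous_on S (partial k f))"

definition C2_on :: "(real^3) set \<Rightarrow> (real^3 \<Rightarrow> 'a::real_normed_vector) \<Rightarrow> bool" where
  "C2_on S f \<longleftrightarrow> C1_on S f \<and> (\<forall>k. C1_on S (partial k f))"

definition grad :: "(real^3 \<Rightarrow> real) \<Rightarrow> real^3 \<Rightarrow> real^3" where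
  "grad p x = (\<chi> k. partial k p x)"

definition jacobian :: "(real^3 \<Rightarrow> real^3) \<Rightarrow> real^3 \<Rightarrow> real^3^3" where
  "jacobian u x = matrix (frechet_derivative u (at x))"

definition divergence :: "(real^3 \<Rightarrow> real^3) \<Rightarrow> real^3 \<Rightarrow> real" where
  "divergence u x = (\<Sum>k\<in>UNIV. partial k u x $ k)"

definition laplacian :: "(real^3 \<Rightarrow> real^3) \<Rightarrow> real^3 \<Rightarrow> real^3" where
  "laplacian u x = (\<Sum>k\<in>UNIV. partial k (partial k u) x)"

definition sph :: "real \<Rightarrow> real \<Rightarrow> real^3" where
  "sph \<theta> \<phi> = vector [sin \<theta> * cos \<phi>, sin \<theta> * sin \<phi>, cos \<theta>]"

text \<open>The surface element of the sphere of radius \<open>r\<close> in these coordinates is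
  \<open>r\<^sup>2 sin \<theta> d\<theta> d\<phi>\<close>.\<close>

definition sphere_integral :: "real^3 \<Rightarrow> real \<Rightarrow> (real^3 \<Rightarrow> real^3) \<Rightarrow> real^3" where
  "sphere_integral a r f =
     set_lebesgue_integral lborel ({0..pi} \<times> {0..2 * pi})
       (\<lambda>(\<theta>, \<phi>). (r\<^sup>2 * sin \<theta>) *\<^sub>R f (a + r *\<^sub>R sph \<theta> \<phi>))"

definition fluid_domain :: "nat \<Rightarrow> real \<Rightarrow> (nat \<Rightarrow> real^3) \<Rightarrow> (real^3) set" where
  "fluid_domain N R x = UNIV - (\<Union>i\<in>{1..N}. cball (x i) R)"

text \<open>The stress \<open>\<sigma>(u,p)\<close> as a function of the value \<open>G\<close> of the velocity gradient and
  the value \<open>q\<close> of the pressure.\<close>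

definition stress :: "real^3^3 \<Rightarrow> real \<Rightarrow> real^3^3" where
  "stress G q = G + transpose G - q *\<^sub>R mat 1"

text \<open>
  Classical solutions of the Stokes problem outside \<open>N\<close> rigid spheres of radius \<open>R\<close>, each of
  which carries the force \<open>F\<close>: the surface forces sum to \<open>-F\<close> and the torques vanish. The
  equations hold in the open fluid domain; \<open>G\<close> is the continuous extension of the velocity
  gradient to its closure, through which the stress is evaluated on the spheres. Since the
  boundary and the boundary data are smooth, the finite energy solution has this regularity
  whenever the closed balls are disjoint.
\<close>

definition stokes_solution ::
  "nat \<Rightarrow> real \<Rightarrow> (nat \<Rightarrow> real^3) \<Rightarrow> real^3 \<Rightarrow>
   (real^3 \<Rightarrow> real^3) \<Rightarrow> (real^3 \<Rightarrow> real) \<Rightarrow> (nat \<Rightarrow> real^3) \<Rightarrow> (nat \<Rightarrow> real^3) \<Rightarrow> bool" where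
  "stokes_solution N R x F u p V \<Omega> \<longleftrightarrow>
     (let D = fluid_domain N R x in
      C2_on D u \<and> C1_on D p \<and> continuous_on (closure D) u \<and> continuous_on (closure D) p \<and>
      (\<forall>y\<in>D. - laplacian u y + grad p y = 0) \<and>
      (\<forall>y\<in>D. divergence u y = 0) \<and>
      (\<forall>i\<in>{1..N}. \<forall>y\<in>sphere (x i) R. u y = V i + cross3 (\<Omega> i) (y - x i)) \<and>
      (u \<longlongrightarrow> 0) at_infinity \<and>
      set_integrable lborel D (\<lambda>y. (norm (jacobian u y))\<^sup>2) \<and>
      set_integrable lborel D (\<lambda>y. (p y)\<^sup>2) \<and>
      (\<exists>G. continuous_on (closure D) G \<and> (\<forall>y\<in>D. G y = jacobian u y) \<and>
           (\<forall>i\<in>{1..N}.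
              sphere_integral (x i) R
                (\<lambda>y. stress (G y) (p y) *v ((1 / R) *\<^sub>R (y - x i))) = - F \<and>
              sphere_integral (x i) R
                (\<lambda>y. cross3 (y - x i) (stress (G y) (p y) *v ((1 / R) *\<^sub>R (y - x i)))) = 0)))"

definition oseen :: "real^3 \<Rightarrow> real^3^3" where
  "oseen x = (1 / (8 * pi)) *\<^sub>R
     ((1 / norm x) *\<^sub>R mat 1 + (1 / norm x ^ 3) *\<^sub>R (\<chi> i j. x $ i * x $ j))"

end

theory Submission
  imports Defs
begin

text \<open>
  Compare \<open>u\<close> with the sum of the explicit Stokes flows of the spheres \<open>B_j\<close> translating alone with
  velocity \<open>e = \<kappa> g\<close>. These carry exactly the prescribed forces and no torques. On \<open>\<partial>B_i\<close> the
  flows of the other particles vary by \<open>O(\<Sum>\<^bsub>j\<noteq>i\<^esub> R\<^sup>2 |e| / |x_i - x_j|\<^sup>2)\<close>; a divergence free corrector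
  supported in \<open>B(x_i, 2R)\<close> removes this variation, so that the difference \<open>w\<close> is rigid on every
  sphere, with velocity \<open>V_i - a_i\<close> and rotation \<open>\<Omega>_i\<close>, where \<open>a_i\<close> is \<open>e\<close> plus the velocity at \<open>x_i\<close>
  of the flows of the others. Testing the two weak formulations with \<open>w\<close>, the forces
  cancel and the Dirichlet energy of \<open>w\<close> is bounded by that of the correctors, which is
  \<open>O(R\<^sup>2)\<close> because they have disjoint supports and \<open>\<Sum>\<^bsub>j\<noteq>i\<^esub> |x_i - x_j|\<^sup>-\<^sup>2 = O(N)\<close>. Testing with the stress
  of the flow of one translating or rotating sphere, whose energy is
  explicit, gives \<open>|V_i - a_i|, R |\<Omega>_i| = O(R\<^sup>1\<^sup>/\<^sup>2)\<close>. This is \<open>O(d_min)\<close>: every cube count is at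
  least one, hence \<open>1 \<le> N M \<lambda>\<^sup>3 \<le> N M E d_min\<^sup>2\<close>.
\<close>

section \<open>The divergence theorem with a cutoff\<close>

text \<open>The test field of the energy identity has to be divergence free, since it removes the
  pressure from both weak formulations. The correctors are therefore curls of truncated vector
  potentials, and the potential loses its affine Taylor part before truncation, so that the two
  derivatives that fall on a cutoff of width \<open>R\<close> are paid for. A single slip is never
  isolated: it costs energy of order \<open>R * |slip|^2\<close> and is bounded by the energy of the
  errors around all particles, of order \<open>N * R^3\<close>. Disjoint supports of the correctors
  require \<open>4 * R \<le> d_min\<close>; this is where \<open>N\<close> has to be large, and it
  follows from \<open>R = O(d_min^2)\<close> once more. Two limit passages carry the integration by
  parts. The flux \<open>\<sigma> \<phi>\<close> is differentiable in the open domain but merely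
  continuous up to the spheres, so Green's formula is obtained with cutoffs that approach the
  spheres. At infinity only finite energy and convergence of \<open>u\<close> to zero are given, so
  the flux through large spheres is controlled by an averaged growth bound against the tail of a
  square integrable stress.\<close>

definition jacobian_on :: "(real^3) set \<Rightarrow> (real^3 \<Rightarrow> real^3) \<Rightarrow> (real^3 \<Rightarrow> real^3^3) \<Rightarrow> bool" where
  "jacobian_on S h J \<longleftrightarrow>
     (\<forall>x\<in>S. (h has_derivative (\<lambda>v. J x *v v)) (at x)) \<and> continuous_on S J"

text \<open>The derivative is a parameter rather than \<open>frechet_derivative\<close>, so that the
  calculus rules carry explicit formulas along. Its continuity is included because the divergence
  theorem integrates it.\<close>

definition gradient_on :: "(real^3) set \<Rightarrow> (real^3 \<Rightarrow> real) \<Rightarrow> (real^3 \<Rightarrow> real^3) \<Rightarrow> bool" where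
  "gradient_on S f G \<longleftrightarrow>
     (\<forall>x\<in>S. (f has_derivative (\<lambda>v. G x \<bullet> v)) (at x)) \<and> continuous_on S G"

text \<open>Translation invariance makes the integral of every difference quotient along
  \<open>e\<close> vanish. The mean value theorem bounds the quotients by the supremum of
  \<open>g\<close>, their supports stay in one ball, and dominated convergence passes to the
  derivative.\<close>

lemma integral_directional_derivative_eq_0:
  fixes f g :: "'a::euclidean_space \<Rightarrow> real"
  assumes deriv: "\<And>x. ((\<lambda>t. f (x + t *\<^sub>R e)) has_real_derivative g x) (at 0)"
    and contf: "continuous_on UNIV f" and contg: "continuous_on UNIV g"
    and K: "compact K" and supp: "\<And>x. x \<notin> K \<Longrightarrow> f x = 0"
  shows "integrable lborel g" "integral\<^sup>L lborel g = 0"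
proof -
  have g0: "g x = 0" if "x \<notin> K" for x
  proof -
    have op: "open (- K)" using K compact_imp_closed by auto
    have "isCont (\<lambda>t. x + t *\<^sub>R e) 0" by (intro continuous_intros)
    then have "((\<lambda>t. x + t *\<^sub>R e) \<longlongrightarrow> x) (at 0)" by (simp add: isCont_def)
    then have "\<forall>\<^sub>F t in at 0. x + t *\<^sub>R e \<in> - K"
      using topological_tendstoD[OF _ op] that by blast
    then have ev: "\<forall>\<^sub>F t in nhds 0. f (x + t *\<^sub>R e) = 0"
      unfolding eventually_at_filter
      by (rule eventually_mono) (use supp that in \<open>auto\<close>)
    have "((\<lambda>t. f (x + t *\<^sub>R e)) has_real_derivative 0) (at 0)"
      using DERIV_cong_ev[OF refl ev refl, of 0] by simp
    then show ?thesis using deriv[of x] DERIV_unique by blast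
  qed
  obtain B0 where B0: "\<And>x. x \<in> K \<Longrightarrow> \<bar>g x\<bar> \<le> B0"
    using compact_imp_bounded[OF compact_continuous_image[OF continuous_on_subset[OF contg] K]]
    unfolding bounded_iff by auto
  define B where "B = max B0 0"
  have B: "\<bar>g x\<bar> \<le> B" for x using B0[of x] g0[of x] unfolding B_def by (cases "x \<in> K") auto
  have lip: "\<bar>f (x + h *\<^sub>R e) - f x\<bar> \<le> B * h" if h0: "h > 0" for x h
  proof -
    have d: "((\<lambda>t. f (x + t *\<^sub>R e)) has_real_derivative g (x + t *\<^sub>R e)) (at t)" for t
    proof -
      have "((\<lambda>s. f ((x + t *\<^sub>R e) + (s - t) *\<^sub>R e)) has_real_derivative g (x + t *\<^sub>R e)) (at t)"
        using DERIV_shift[of "\<lambda>s. f (x + t *\<^sub>R e + (s - t) *\<^sub>R e)" "g (x + t *\<^sub>R e)" 0 t] deriv[of "x + t *\<^sub>R e"]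
        by simp
      then show ?thesis by (simp add: algebra_simps)
    qed
    obtain z where "f (x + h *\<^sub>R e) - f (x + 0 *\<^sub>R e) = (h - 0) * g (x + z *\<^sub>R e)"
      using MVT2[OF h0, of "\<lambda>t. f (x + t *\<^sub>R e)" "\<lambda>t. g (x + t *\<^sub>R e)"] d by auto
    then show ?thesis using B[of "x + z *\<^sub>R e"] h0
      by (simp add: abs_mult mult.commute mult_left_mono)
  qed
  obtain r where r: "r > 0" "K \<subseteq> ball 0 r"
    using bounded_subset_ballD[OF compact_imp_bounded[OF K]] by blast
  let ?h = "\<lambda>n::nat. 1 / real (Suc n)"
  define s where "s = (\<lambda>n x. (f (x + ?h n *\<^sub>R e) - f x) / ?h n)"
  have intf: "integrable lborel f"
  proof -
    have "integrable lborel (\<lambda>x. indicator K x *\<^sub>R f x)"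
      by (rule borel_integrable_compact[OF K continuous_on_subset[OF contf]]) simp
    moreover have "(\<lambda>x. indicator K x *\<^sub>R f x) = f"
      by (rule ext) (use supp in \<open>auto simp: indicator_def\<close>)
    ultimately show ?thesis by simp
  qed
  have tr: "has_bochner_integral lborel (\<lambda>x. f (x + c)) (integral\<^sup>L lborel f)" for c
  proof -
    have mf: "f \<in> borel_measurable borel" using contf by (rule borel_measurable_continuous_onI)
    have "has_bochner_integral (distr lborel borel ((+) c)) f (integral\<^sup>L lborel f)"
      unfolding lborel_distr_plus using intf by (simp add: has_bochner_integral_iff)
    then have "has_bochner_integral lborel (\<lambda>x. f (c + x)) (integral\<^sup>L lborel f)"
      by (simp add: mf has_bochner_integral_iff integral_distr integrable_distr_eq)
    then show ?thesis by (simp add: add.commute)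
  qed
  have s0: "has_bochner_integral lborel (s n) 0" for n
  proof -
    have "has_bochner_integral lborel (\<lambda>x. (f (x + ?h n *\<^sub>R e) - f x) / ?h n)
        ((integral\<^sup>L lborel f - integral\<^sup>L lborel f) / ?h n)"
      by (intro has_bochner_integral_divide has_bochner_integral_diff tr has_bochner_integral_integrable intf)
    then show ?thesis by (simp add: s_def)
  qed
  have lim: "(\<lambda>n. s n x) \<longlonglongrightarrow> g x" for x
  proof -
    have "((\<lambda>h. (f (x + h *\<^sub>R e) - f x) / h) \<longlongrightarrow> g x) (at 0)"
      using deriv[of x] by (simp add: DERIV_def)
    moreover have "filterlim ?h (at 0) sequentially"
      using LIMSEQ_inverse_real_of_nat by (simp add: filterlim_at inverse_eq_divide)
    ultimately show ?thesis unfolding s_def by (rule filterlim_compose)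
  qed
  \<comment> \<open>The increments are at most \<open>norm e\<close> long, so outside this ball both
    points of a difference quotient miss \<open>K\<close>.\<close>
  let ?w = "\<lambda>x. B * indicator (cball 0 (r + norm e)) x :: real"
  have wi: "integrable lborel ?w"
    by (intro integrable_mult_right integrable_real_indicator) (auto simp: emeasure_lborel_cball_finite[unfolded infinity_ennreal_def])
  have bound: "norm (s n x) \<le> ?w x" for n x
  proof (cases "x \<in> cball 0 (r + norm e)")
    case True
    have *: "\<bar>A / k\<bar> \<le> B" if "\<bar>A\<bar> \<le> B * k" "k > 0" for A k
      using that by (simp add: pos_divide_le_eq)
    show ?thesis using *[OF lip[of "?h n" x]] True by (simp add: s_def del: of_nat_Suc)
  next
    case False
    have "x \<notin> K" using r False by (auto) (smt (verit, best) norm_ge_zero mem_ball_0 subsetD)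
    moreover have "x + ?h n *\<^sub>R e \<notin> K"
    proof
      assume "x + ?h n *\<^sub>R e \<in> K"
      then have "norm (x + ?h n *\<^sub>R e) < r" using r by auto
      moreover have "norm (?h n *\<^sub>R e) \<le> norm e"
        by (simp add: divide_le_eq mult_left_le field_simps)
      moreover have "norm x \<le> norm (x + ?h n *\<^sub>R e) + norm (?h n *\<^sub>R e)"
        using norm_triangle_ineq4[of "x + ?h n *\<^sub>R e" "?h n *\<^sub>R e"] by simp
      ultimately show False using False by (simp add: dist_norm)
    qed
    ultimately show ?thesis using supp by (simp add: s_def B_def)
  qed
  have m1: "g \<in> borel_measurable lborel" using contg by (simp add: borel_measurable_continuous_onI)
  have m2: "s n \<in> borel_measurable lborel" for n
    using s0[of n] borel_measurable_integrable by (auto simp: has_bochner_integral_iff)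
  show "integrable lborel g"
    by (rule integrable_dominated_convergence[where s = s, OF m1 m2 wi]) (intro AE_I2 lim bound)+
  have "(\<lambda>n. integral\<^sup>L lborel (s n)) \<longlonglongrightarrow> integral\<^sup>L lborel g"
    by (rule integral_dominated_convergence[where s = s, OF m1 m2 wi]) (intro AE_I2 lim bound)+
  moreover have "integral\<^sup>L lborel (s n) = 0" for n using s0 by (simp add: has_bochner_integral_iff)
  ultimately show "integral\<^sup>L lborel g = 0" by (simp add: LIMSEQ_const_iff)
qed

text \<open>The open sets \<open>S\<close> and \<open>- K\<close> cover the space, so the product of
  \<open>\<eta>\<close> and \<open>h\<close>, extended by zero, is continuously differentiable
  everywhere. Its divergence is the sum over \<open>k\<close> of the partial derivative
  \<open>g k\<close> of \<open>f k\<close> in direction \<open>k\<close>, and each of these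
  integrates to zero.\<close>

lemma integral_divergence_cutoff:
  assumes S: "open S" and h: "jacobian_on S h J" and \<eta>: "gradient_on UNIV \<eta> G"
    and K: "compact K" "K \<subseteq> S" and supp: "\<And>x. x \<notin> K \<Longrightarrow> \<eta> x = 0"
  shows "set_integrable lborel S (\<lambda>x. \<eta> x * trace (J x) + G x \<bullet> h x)"
    and "(LINT x:S|lborel. \<eta> x * trace (J x) + G x \<bullet> h x) = 0"
proof -
  define f where "f = (\<lambda>k x. if x \<in> S then \<eta> x * h x $ k else 0)"
  define g where "g = (\<lambda>k x. if x \<in> S then \<eta> x * J x $ k $ k + G x $ k * h x $ k else 0)"
  have hd: "\<And>x. x \<in> S \<Longrightarrow> (h has_derivative (\<lambda>v. J x *v v)) (at x)" and cJ: "continuous_on S J"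
    using h by (auto simp: jacobian_on_def)
  have \<eta>d: "\<And>x. (\<eta> has_derivative (\<lambda>v. G x \<bullet> v)) (at x)" and cG: "continuous_on UNIV G"
    using \<eta> by (auto simp: gradient_on_def)
  have ch: "continuous_on S h" by (rule has_derivative_continuous_on) (use hd has_derivative_at_withinI in blast)
  have c\<eta>: "continuous_on UNIV \<eta>" by (rule has_derivative_continuous_on) (use \<eta>d has_derivative_at_withinI in blast)
  have opK: "open (- K)" using K compact_imp_closed by auto
  have G0: "G x = 0" if "x \<notin> K" for x
  proof -
    have "(\<eta> has_derivative (\<lambda>v. 0)) (at x)"
      by (rule has_derivative_transform_within_open[of "\<lambda>_. 0", OF has_derivative_const opK])
        (use that supp in auto)
    then have "(\<lambda>v. G x \<bullet> v) = (\<lambda>v. 0)" using \<eta>d has_derivative_unique by blast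
    then have "G x \<bullet> G x = 0" by meson
    then show ?thesis by simp
  qed
  have un: "UNIV = S \<union> - K" using K by auto
  have contU: "continuous_on UNIV F" if "continuous_on S F" "\<And>x. x \<notin> K \<Longrightarrow> F x = 0"
    for F :: "real^3 \<Rightarrow> real"
    unfolding un using continuous_on_open_Un[OF S opK that(1)] that(2)
      continuous_on_cong[OF refl, of "- K" F "\<lambda>_. 0"] by simp
  have cf: "continuous_on UNIV (f k)" for k
  proof (rule contU)
    show "continuous_on S (f k)"
      by (rule continuous_on_eq[of _ "\<lambda>x. \<eta> x * h x $ k"])
        (auto simp: f_def intro!: continuous_on_mult continuous_on_component ch continuous_on_subset[OF c\<eta>])
  qed (auto simp: f_def supp)
  have cg: "continuous_on UNIV (g k)" for k
  proof (rule contU)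
    show "continuous_on S (g k)"
      by (rule continuous_on_eq[of _ "\<lambda>x. \<eta> x * J x $ k $ k + G x $ k * h x $ k"])
        (auto simp: g_def intro!: continuous_on_add continuous_on_mult continuous_on_component ch cJ continuous_on_subset[OF c\<eta>] continuous_on_subset[OF cG])
  qed (auto simp: g_def supp G0)
  have dl: "((\<lambda>t. f k (x + t *\<^sub>R axis k 1)) has_real_derivative g k x) (at 0)" for k x
  proof -
    have d1: "((\<lambda>t. x + t *\<^sub>R axis k 1) has_derivative (\<lambda>t. t *\<^sub>R axis k 1)) (at 0)"
      by (auto intro!: derivative_eq_intros)
    have fd: "(f k has_derivative (\<lambda>v. if x \<in> S then \<eta> x * (J x *v v) $ k + (G x \<bullet> v) * h x $ k else 0)) (at x)"
    proof (cases "x \<in> S")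
      case True
      have "((\<lambda>x. \<eta> x * h x $ k) has_derivative (\<lambda>v. \<eta> x * (J x *v v) $ k + (G x \<bullet> v) * h x $ k)) (at x)"
        using bounded_linear.has_derivative[OF bounded_linear_vec_nth hd[OF True], of k]
        by (intro has_derivative_mult \<eta>d)
      then show ?thesis using True
        by (auto simp: f_def intro: has_derivative_transform_within_open[OF _ S True])
    next
      case False
      then have "x \<in> - K" using K by auto
      then show ?thesis using False
        by (auto simp: f_def supp intro!: has_derivative_transform_within_open[OF has_derivative_const opK])
    qed
    have "(f k \<circ> (\<lambda>t. x + t *\<^sub>R axis k 1) has_derivative
       (\<lambda>v. if x \<in> S then \<eta> x * (J x *v v) $ k + (G x \<bullet> v) * h x $ k else 0) \<circ> (\<lambda>t. t *\<^sub>R axis k 1)) (at 0)"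
      by (rule diff_chain_at[OF d1]) (use fd in simp)
    moreover have "(\<lambda>v. if x \<in> S then \<eta> x * (J x *v v) $ k + (G x \<bullet> v) * h x $ k else 0) \<circ> (\<lambda>t. t *\<^sub>R axis k 1)
       = (*) (g k x)"
      by (auto simp: fun_eq_iff g_def matrix_vector_mult_scaleR matrix_vector_mult_basis column_def
          inner_axis algebra_simps)
    ultimately show ?thesis by (simp add: has_field_derivative_def o_def)
  qed
  have fs: "\<And>k x. x \<notin> K \<Longrightarrow> f k x = 0" by (auto simp: f_def supp)
  note I = integral_directional_derivative_eq_0[OF dl cf cg K(1) fs]
  have eq: "(\<lambda>x. indicator S x *\<^sub>R (\<eta> x * trace (J x) + G x \<bullet> h x)) = (\<lambda>x. \<Sum>k\<in>UNIV. g k x)"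
    by (auto simp: fun_eq_iff indicator_def g_def trace_def inner_vec_def sum.distrib sum_distrib_left)
  show "set_integrable lborel S (\<lambda>x. \<eta> x * trace (J x) + G x \<bullet> h x)"
    unfolding set_integrable_def eq by (intro Bochner_Integration.integrable_sum I)
  show "(LINT x:S|lborel. \<eta> x * trace (J x) + G x \<bullet> h x) = 0"
    unfolding set_lebesgue_integral_def eq by (subst Bochner_Integration.integral_sum) (auto simp: I)
qed

text \<open>The second difference over the parallelogram with sides \<open>h a\<close> and
  \<open>h b\<close> equals \<open>h^2\<close> times either iterated derivative at some nearby
  point, by two mean value steps in either order; continuity at \<open>x\<close> then lets
  \<open>h\<close> shrink. This is needed for the divergence of the transposed velocity
  gradient.\<close>

lemma mixed_partial_derivatives_commute:
  fixes f :: "'a::real_normed_vector \<Rightarrow> real"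
  assumes r: "r > 0"
    and f: "\<And>y. y \<in> ball x r \<Longrightarrow> (f has_derivative f' y) (at y)"
    and fa: "\<And>y. y \<in> ball x r \<Longrightarrow> ((\<lambda>z. f' z a) has_derivative fa' y) (at y)"
    and fb: "\<And>y. y \<in> ball x r \<Longrightarrow> ((\<lambda>z. f' z b) has_derivative fb' y) (at y)"
    and ca: "continuous (at x) (\<lambda>y. fa' y b)" and cb: "continuous (at x) (\<lambda>y. fb' y a)"
  shows "fa' x b = fb' x a"
proof -
  \<comment> \<open>The summand 1 keeps the parallelogram strictly inside the ball of radius
    \<open>h * m\<close>, even if \<open>a\<close> and \<open>b\<close> vanish.\<close>
  define m where "m = norm a + norm b + 1"
  have m: "m > 0" by (simp add: m_def add_nonneg_pos)
  have pt: "x + s *\<^sub>R c + t *\<^sub>R d \<in> ball x (h * m)"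
    if "0 \<le> s" "s \<le> h" "0 \<le> t" "t \<le> h" "0 < h" "norm c + norm d + 1 = m" for s t h c d
  proof -
    have "norm (s *\<^sub>R c + t *\<^sub>R d) \<le> s * norm c + t * norm d"
      using norm_triangle_ineq[of "s *\<^sub>R c" "t *\<^sub>R d"] that by simp
    also have "\<dots> \<le> h * norm c + h * norm d" using that by (intro add_mono mult_right_mono) auto
    also have "\<dots> < h * m" using that by (auto simp: algebra_simps simp flip: that(6))
    finally show ?thesis by (simp add: dist_norm norm_minus_commute algebra_simps)
  qed
  have key: "\<exists>p\<in>ball x (h * m). f (x + h *\<^sub>R c + h *\<^sub>R d) - f (x + h *\<^sub>R c) - f (x + h *\<^sub>R d) + f x = h\<^sup>2 * fc' p d"
    if h: "0 < h" "h * m \<le> r" and cd: "norm c + norm d + 1 = m"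
      and fc: "\<And>y. y \<in> ball x r \<Longrightarrow> ((\<lambda>z. f' z c) has_derivative fc' y) (at y)" for h c d fc'
  proof -
    have inb: "x + s *\<^sub>R c + t *\<^sub>R d \<in> ball x r" if "0 \<le> s" "s \<le> h" "0 \<le> t" "t \<le> h" for s t
      using pt[OF that h(1) cd] h(2) by auto
    define \<phi> where "\<phi> = (\<lambda>s. f (x + s *\<^sub>R c + h *\<^sub>R d) - f (x + s *\<^sub>R c))"
    have d1: "((\<lambda>s. f (x + s *\<^sub>R c + t *\<^sub>R d)) has_real_derivative f' (x + s *\<^sub>R c + t *\<^sub>R d) c) (at s)"
      if "0 \<le> s" "s \<le> h" "0 \<le> t" "t \<le> h" for s t
    proof -
      have L: "((\<lambda>s. x + s *\<^sub>R c + t *\<^sub>R d) has_derivative (\<lambda>s. s *\<^sub>R c)) (at s)"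
        by (auto intro!: derivative_eq_intros)
      have "(f \<circ> (\<lambda>s. x + s *\<^sub>R c + t *\<^sub>R d) has_derivative f' (x + s *\<^sub>R c + t *\<^sub>R d) \<circ> (\<lambda>s. s *\<^sub>R c)) (at s)"
        by (rule diff_chain_at[OF L f[OF inb[OF that]]])
      moreover have "f' (x + s *\<^sub>R c + t *\<^sub>R d) \<circ> (\<lambda>s. s *\<^sub>R c) = (*) (f' (x + s *\<^sub>R c + t *\<^sub>R d) c)"
        using linear_scale[OF has_derivative_linear[OF f[OF inb[OF that]]]] by (auto simp: fun_eq_iff)
      ultimately show ?thesis by (simp add: has_field_derivative_def o_def)
    qed
    have d2: "((\<lambda>t. f' (x + s *\<^sub>R c + t *\<^sub>R d) c) has_real_derivative fc' (x + s *\<^sub>R c + t *\<^sub>R d) d) (at t)"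
      if "0 \<le> s" "s \<le> h" "0 \<le> t" "t \<le> h" for s t
    proof -
      have L: "((\<lambda>t. x + s *\<^sub>R c + t *\<^sub>R d) has_derivative (\<lambda>t. t *\<^sub>R d)) (at t)"
        by (auto intro!: derivative_eq_intros)
      have "((\<lambda>z. f' z c) \<circ> (\<lambda>t. x + s *\<^sub>R c + t *\<^sub>R d) has_derivative fc' (x + s *\<^sub>R c + t *\<^sub>R d) \<circ> (\<lambda>t. t *\<^sub>R d)) (at t)"
        by (rule diff_chain_at[OF L fc[OF inb[OF that]]])
      moreover have "fc' (x + s *\<^sub>R c + t *\<^sub>R d) \<circ> (\<lambda>t. t *\<^sub>R d) = (*) (fc' (x + s *\<^sub>R c + t *\<^sub>R d) d)"
        using linear_scale[OF has_derivative_linear[OF fc[OF inb[OF that]]]] by (auto simp: fun_eq_iff)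
      ultimately show ?thesis by (simp add: has_field_derivative_def o_def)
    qed
    have "(\<phi> has_real_derivative (f' (x + s *\<^sub>R c + h *\<^sub>R d) c - f' (x + s *\<^sub>R c) c)) (at s)"
      if "0 \<le> s" "s \<le> h" for s
      unfolding \<phi>_def using d1[OF that, of h] d1[OF that, of 0] h
      by (intro DERIV_diff) auto
    then obtain \<xi> where \<xi>: "0 < \<xi>" "\<xi> < h"
      "\<phi> h - \<phi> 0 = (h - 0) * (f' (x + \<xi> *\<^sub>R c + h *\<^sub>R d) c - f' (x + \<xi> *\<^sub>R c) c)"
      using MVT2[of 0 h \<phi> "\<lambda>s. f' (x + s *\<^sub>R c + h *\<^sub>R d) c - f' (x + s *\<^sub>R c) c"] h by auto
    obtain \<zeta> where \<zeta>: "0 < \<zeta>" "\<zeta> < h"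
      "f' (x + \<xi> *\<^sub>R c + h *\<^sub>R d) c - f' (x + \<xi> *\<^sub>R c + 0 *\<^sub>R d) c = (h - 0) * fc' (x + \<xi> *\<^sub>R c + \<zeta> *\<^sub>R d) d"
      using MVT2[of 0 h "\<lambda>t. f' (x + \<xi> *\<^sub>R c + t *\<^sub>R d) c" "\<lambda>t. fc' (x + \<xi> *\<^sub>R c + t *\<^sub>R d) d"]
        d2[of \<xi>] \<xi> h by auto
    show ?thesis
    proof (rule bexI[of _ "x + \<xi> *\<^sub>R c + \<zeta> *\<^sub>R d"])
      show "x + \<xi> *\<^sub>R c + \<zeta> *\<^sub>R d \<in> ball x (h * m)"
        using pt[of \<xi> h \<zeta> c d] \<xi> \<zeta> cd by simp
      have "h\<^sup>2 * fc' (x + \<xi> *\<^sub>R c + \<zeta> *\<^sub>R d) d = \<phi> h - \<phi> 0"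
        using \<xi>(3) \<zeta>(3) by (simp add: power2_eq_square)
      then show "f (x + h *\<^sub>R c + h *\<^sub>R d) - f (x + h *\<^sub>R c) - f (x + h *\<^sub>R d) + f x
        = h\<^sup>2 * fc' (x + \<xi> *\<^sub>R c + \<zeta> *\<^sub>R d) d" by (simp add: \<phi>_def)
    qed
  qed
  show ?thesis
  proof (rule ccontr)
    assume ne: "\<not> ?thesis"
    define e where "e = \<bar>fa' x b - fb' x a\<bar> / 2"
    have e: "e > 0" using ne by (simp add: e_def)
    obtain d1 where d1: "d1 > 0" "\<And>y. dist y x < d1 \<Longrightarrow> \<bar>fa' y b - fa' x b\<bar> < e"
      using ca e unfolding continuous_at_eps_delta dist_real_def by metis
    obtain d2 where d2: "d2 > 0" "\<And>y. dist y x < d2 \<Longrightarrow> \<bar>fb' y a - fb' x a\<bar> < e"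
      using cb e unfolding continuous_at_eps_delta dist_real_def by metis
    define h where "h = min r (min d1 d2) / m"
    have h: "0 < h" "h * m \<le> r" "h * m \<le> d1" "h * m \<le> d2"
      using r d1 d2 m by (auto simp: h_def)
    obtain p where p: "p \<in> ball x (h * m)"
      "f (x + h *\<^sub>R a + h *\<^sub>R b) - f (x + h *\<^sub>R a) - f (x + h *\<^sub>R b) + f x = h\<^sup>2 * fa' p b"
      using key[OF h(1,2) _ fa, of b] by (auto simp: m_def)
    obtain q where q: "q \<in> ball x (h * m)"
      "f (x + h *\<^sub>R b + h *\<^sub>R a) - f (x + h *\<^sub>R b) - f (x + h *\<^sub>R a) + f x = h\<^sup>2 * fb' q a"
      using key[OF h(1,2) _ fb, of a] by (auto simp: m_def add.commute)
    have "h\<^sup>2 * fa' p b = h\<^sup>2 * fb' q a" using p(2) q(2) by (simp add: algebra_simps)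
    then have "fa' p b = fb' q a" using h by simp
    moreover have "\<bar>fa' p b - fa' x b\<bar> < e" "\<bar>fb' q a - fb' x a\<bar> < e"
      using d1(2)[of p] d2(2)[of q] p(1) q(1) h by (auto simp: dist_commute)
    ultimately show False unfolding e_def by (auto simp: abs_if split: if_splits)
  qed
qed

section \<open>A twice differentiable cutoff profile\<close>

definition pos_pow :: "nat \<Rightarrow> real \<Rightarrow> real" where
  "pos_pow n t = (max t 0) ^ n"

text \<open>The only delicate point is \<open>0\<close>, where the difference quotient is at most
  \<open>|h|^(n - 1)\<close> and hence tends to zero for \<open>n \<ge> 2\<close>.\<close>

lemma pos_pow_has_derivative:
  assumes "n \<ge> 2"
  shows "(pos_pow n has_real_derivative real n * pos_pow (n - 1) t) (at t)"
proof -
  consider "t > 0" | "t < 0" | "t = 0" by linarith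
  then show ?thesis
  proof cases
    case 1
    have "((\<lambda>t. t ^ n) has_real_derivative real n * t ^ (n - 1)) (at t)" using DERIV_pow[of n t] by simp
    moreover have ev: "\<forall>\<^sub>F s in nhds t. s ^ n = pos_pow n s"
      using eventually_nhds_in_open[OF open_greaterThan, of t 0] 1
      by (auto elim!: eventually_mono simp: pos_pow_def)
    ultimately have "(pos_pow n has_real_derivative real n * t ^ (n - 1)) (at t)"
      using DERIV_cong_ev[OF refl ev refl] by blast
    then show ?thesis using 1 by (simp add: pos_pow_def)
  next
    case 2
    have ev: "\<forall>\<^sub>F s in nhds t. 0 = pos_pow n s"
      using eventually_nhds_in_open[OF open_lessThan, of t 0] 2 assms
      by (auto elim!: eventually_mono simp: pos_pow_def)
    then have "(pos_pow n has_real_derivative 0) (at t)"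
      using DERIV_cong_ev[OF refl ev refl] DERIV_const by blast
    then show ?thesis using 2 assms by (simp add: pos_pow_def power_0_left)
  next
    case 3
    have "((\<lambda>h. (pos_pow n (0 + h) - pos_pow n 0) / h) \<longlongrightarrow> 0) (at 0)"
    proof (rule Lim_null_comparison)
      show "((\<lambda>h::real. \<bar>h\<bar> ^ (n - 1)) \<longlongrightarrow> 0) (at 0)"
      proof -
        have "((\<lambda>h::real. \<bar>h\<bar> ^ (n - 1)) \<longlongrightarrow> \<bar>0\<bar> ^ (n - 1)) (at 0)" by (intro tendsto_intros)
        also have "\<bar>0 :: real\<bar> ^ (n - 1) = 0" using assms by (simp add: power_0_left)
        finally show ?thesis .
      qed
      show "\<forall>\<^sub>F h in at 0. norm ((pos_pow n (0 + h) - pos_pow n 0) / h) \<le> \<bar>h\<bar> ^ (n - 1)"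
      proof (rule always_eventually, rule allI)
        fix h :: real
        obtain m where n: "n = Suc m" using assms by (cases n) auto
        have "\<bar>pos_pow n h\<bar> \<le> \<bar>h\<bar> ^ n" unfolding pos_pow_def power_abs by (rule power_mono) auto
        then show "norm ((pos_pow n (0 + h) - pos_pow n 0) / h) \<le> \<bar>h\<bar> ^ (n - 1)"
          using n by (cases "h = 0") (simp_all add: pos_pow_def pos_divide_le_eq mult.commute)
      qed
    qed
    then have "(pos_pow n has_real_derivative 0) (at 0)" unfolding DERIV_def .
    moreover have "real n * pos_pow (n - 1) 0 = 0" using assms by (simp add: pos_pow_def power_0_left)
    ultimately show ?thesis unfolding 3 by (simp only:)
  qed
qed

lemma continuous_pos_pow [continuous_intros]:
  "continuous_on S f \<Longrightarrow> continuous_on S (\<lambda>x. pos_pow n (f x))"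
  unfolding pos_pow_def by (intro continuous_intros)

text \<open>The quintic smoothstep, written with truncated powers so that it is visibly \<open>C\<^sup>2\<close>.\<close>

definition step :: "real \<Rightarrow> real" where
  "step t = 10 * pos_pow 3 t - 15 * pos_pow 4 t + 6 * pos_pow 5 t
     - 10 * pos_pow 3 (t - 1) - 15 * pos_pow 4 (t - 1) - 6 * pos_pow 5 (t - 1)"

definition step' :: "real \<Rightarrow> real" where
  "step' t = 30 * pos_pow 2 t - 60 * pos_pow 3 t + 30 * pos_pow 4 t
     - 30 * pos_pow 2 (t - 1) - 60 * pos_pow 3 (t - 1) - 30 * pos_pow 4 (t - 1)"

definition step'' :: "real \<Rightarrow> real" where
  "step'' t = 60 * pos_pow 1 t - 180 * pos_pow 2 t + 120 * pos_pow 3 t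
     - 60 * pos_pow 1 (t - 1) - 180 * pos_pow 2 (t - 1) - 120 * pos_pow 3 (t - 1)"

lemma pos_pow_shift_has_derivative:
  "n \<ge> 2 \<Longrightarrow> ((\<lambda>t. pos_pow n (t - 1)) has_real_derivative real n * pos_pow (n - 1) (t - 1)) (at t)"
  using DERIV_shift[of "pos_pow n" _ t "- 1"] pos_pow_has_derivative[of n "t - 1"] by simp

lemma step_has_derivative: "(step has_real_derivative step' t) (at t)"
  unfolding step_def step'_def
  by (auto intro!: derivative_eq_intros pos_pow_has_derivative pos_pow_shift_has_derivative)

lemma step'_has_derivative: "(step' has_real_derivative step'' t) (at t)"
  unfolding step'_def step''_def
  by (auto intro!: derivative_eq_intros pos_pow_has_derivative pos_pow_shift_has_derivative)

lemma step_eq_0: "t \<le> 0 \<Longrightarrow> step t = 0"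
  by (simp add: step_def pos_pow_def)

text \<open>The terms in \<open>t - 1\<close> are the expansion at \<open>1\<close> of the quintic
  minus its value \<open>1\<close> there; beyond \<open>1\<close> they cancel everything but that
  value.\<close>

lemma step_eq_1: "t \<ge> 1 \<Longrightarrow> step t = 1"
  by (simp add: step_def pos_pow_def max_def) algebra

text \<open>The truncated powers exhibit smoothness, this closed form exhibits sign, support and
  size.\<close>

lemma step'_eq: "step' t = (if 0 < t \<and> t < 1 then 30 * (t * (1 - t))\<^sup>2 else 0)"
proof -
  consider "t \<le> 0" | "t \<ge> 1" | "0 < t \<and> t < 1" by linarith
  then show ?thesis
    by cases (simp_all add: step'_def pos_pow_def max_def, algebra+)
qed

lemma step''_eq_0: "t \<le> 0 \<or> 1 \<le> t \<Longrightarrow> step'' t = 0"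
  by (auto simp: step''_def pos_pow_def max_def) algebra+

lemma step'_nonneg: "step' t \<ge> 0" by (simp add: step'_eq)

lemma step_mono: "s \<le> t \<Longrightarrow> step s \<le> step t"
  by (rule DERIV_nonneg_imp_nondecreasing) (use step_has_derivative step'_nonneg in blast)+

lemma step_nonneg: "step t \<ge> 0" and step_le_1: "step t \<le> 1"
  using step_mono[of 0 t] step_mono[of t 0] step_mono[of t 1] step_mono[of 1 t] step_eq_0[of 0] step_eq_0[of t] step_eq_1[of 1] step_eq_1[of t]
  by linarith+

lemma continuous_on_step': "continuous_on S f \<Longrightarrow> continuous_on S (\<lambda>x. step' (f x))"
  and continuous_on_step'': "continuous_on S f \<Longrightarrow> continuous_on S (\<lambda>x. step'' (f x))"
  unfolding step_def step'_def step''_def by (intro continuous_intros; assumption)+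

lemma step'_le: "\<bar>step' t\<bar> \<le> 30"
proof -
  have "(t * (1 - t))\<^sup>2 \<le> 1" if "0 < t" "t < 1"
    using that by (intro power_le_one mult_nonneg_nonneg mult_le_one) auto
  then show ?thesis by (auto simp: step'_eq)
qed

lemma step''_bound: "\<exists>B. \<forall>t. \<bar>step'' t\<bar> \<le> B"
proof -
  have "bounded (step'' ` {0..1})"
    by (intro compact_imp_bounded compact_continuous_image continuous_on_step''[of _ "\<lambda>x. x"] continuous_on_id compact_Icc)
  then obtain B where "\<And>t. t \<in> {0..1} \<Longrightarrow> \<bar>step'' t\<bar> \<le> B"
    unfolding bounded_iff by (metis imageI real_norm_def)
  then have "\<bar>step'' t\<bar> \<le> max B 0" for t
    using step''_eq_0[of t] by (cases "t \<in> {0..1}") (auto simp: le_max_iff_disj)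
  then show ?thesis by blast
qed

section \<open>Polar coordinates\<close>

lemma has_derivative_vec_componentwise:
  fixes f :: "'a::real_normed_vector \<Rightarrow> real^'n"
  assumes "\<And>i. ((\<lambda>x. f x $ i) has_derivative (\<lambda>v. f' v $ i)) (at x within S)"
  shows "(f has_derivative f') (at x within S)"
  using assms by (subst has_derivative_componentwise_within) (auto simp: Basis_vec_def inner_axis)

lemma continuous_on_vec_componentwise:
  fixes f :: "'a::topological_space \<Rightarrow> real^'n"
  assumes "\<And>i. continuous_on S (\<lambda>x. f x $ i)"
  shows "continuous_on S f"
  using continuous_on_vec_lambda[of S "\<lambda>i x. f x $ i"] assms by simp

lemma continuous_on_vector_3:
  "continuous_on UNIV (\<lambda>(x::real, y, z). vector [x, y, z] :: real^3)"
proof (rule continuous_on_vec_componentwise)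
  show "continuous_on UNIV (\<lambda>p. ((\<lambda>(x::real, y, z). vector [x, y, z] :: real^3) p) $ i)" for i
    using exhaust_3[of i] by (elim disjE; simp add: split_beta; intro continuous_intros)
qed

lemma emeasure_lborel_Times:
  fixes A :: "'a::euclidean_space set" and B :: "'b::euclidean_space set"
  assumes "A \<in> sets borel" "B \<in> sets borel"
  shows "emeasure lborel (A \<times> B) = emeasure lborel A * emeasure lborel B"
  by (subst lborel_prod[symmetric], rule lborel.emeasure_pair_measure_Times) (use assms in simp_all)

text \<open>The change of variables formula lives on \<open>real^3\<close>, whereas Fubini and
  \<open>sphere_integral\<close> live on products of lines; this identification connects them.
  Lebesgue measure is determined by its values on boxes.\<close>

lemma lborel_distr_vector_3:
  "distr lborel borel (\<lambda>(x, y, z). vector [x, y, z] :: real^3) = lborel"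
proof (rule lborel_eqI[symmetric])
  fix l u :: "real^3"
  assume le: "\<And>b. b \<in> Basis \<Longrightarrow> l \<bullet> b \<le> u \<bullet> b"
  have lei: "l $ i \<le> u $ i" for i
    using le[of "axis i 1"] by (auto simp: Basis_vec_def inner_axis)
  note cont = continuous_on_vector_3
  have m: "(\<lambda>(x, y, z). vector [x, y, z] :: real^3) \<in> borel_measurable lborel"
    using borel_measurable_continuous_onI[OF cont] by simp
  have "(\<lambda>(x, y, z). vector [x, y, z] :: real^3) -` box l u \<inter> space lborel
      = box (l $ 1) (u $ 1) \<times> (box (l $ 2) (u $ 2) \<times> box (l $ 3) (u $ 3))"
    by (auto simp: mem_box_cart forall_3 box_real)
  then have "emeasure (distr lborel borel (\<lambda>(x, y, z). vector [x, y, z] :: real^3)) (box l u)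
      = emeasure (lborel \<Otimes>\<^sub>M (lborel \<Otimes>\<^sub>M lborel)) (box (l $ 1) (u $ 1) \<times> (box (l $ 2) (u $ 2) \<times> box (l $ 3) (u $ 3)))"
    by (subst emeasure_distr[OF m]) (auto simp: lborel_prod)
  also have "\<dots> = ennreal (u $ 1 - l $ 1) * (ennreal (u $ 2 - l $ 2) * ennreal (u $ 3 - l $ 3))"
  proof -
    have "emeasure (lborel :: (real \<times> real) measure) (box (l $ 2) (u $ 2) \<times> box (l $ 3) (u $ 3))
        = emeasure lborel (box (l $ 2) (u $ 2)) * emeasure lborel (box (l $ 3) (u $ 3))"
      by (rule emeasure_lborel_Times) auto
    moreover have "emeasure (lborel :: (real \<times> real \<times> real) measure) (box (l $ 1) (u $ 1) \<times> (box (l $ 2) (u $ 2) \<times> box (l $ 3) (u $ 3)))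
        = emeasure lborel (box (l $ 1) (u $ 1)) * emeasure lborel (box (l $ 2) (u $ 2) \<times> box (l $ 3) (u $ 3))"
      by (rule emeasure_lborel_Times) (auto intro!: borel_open open_Times)
    moreover have "emeasure lborel (box (l $ i) (u $ i)) = ennreal (u $ i - l $ i)" for i
      using lei[of i] by (simp add: box_real)
    ultimately show ?thesis by (simp only: lborel_prod)
  qed
  also have "\<dots> = ennreal ((u $ 1 - l $ 1) * ((u $ 2 - l $ 2) * (u $ 3 - l $ 3)))"
    using lei by (simp add: ennreal_mult)
  also have "(u $ 1 - l $ 1) * ((u $ 2 - l $ 2) * (u $ 3 - l $ 3)) = prod (\<lambda>i. u $ i - l $ i) UNIV"
    by (subst UNIV_3) simp
  also have "prod (\<lambda>i. u $ i - l $ i) UNIV = measure lborel (cbox l u)"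
    using lei by (subst content_cbox_cart) (auto simp: interval_ne_empty_cart)
  also have "\<dots> = (\<Prod>b\<in>Basis. (u - l) \<bullet> b)" using le by (simp add: content_cbox')
  finally show "emeasure (distr lborel borel (\<lambda>(x, y, z). vector [x, y, z] :: real^3)) (box l u)
      = ennreal (\<Prod>b\<in>Basis. (u - l) \<bullet> b)" .
qed simp

lemma set_integrable_compact:
  fixes f :: "'a::euclidean_space \<Rightarrow> 'b::{banach, second_countable_topology}"
  assumes "compact K" "continuous_on K f"
  shows "set_integrable lborel K f"
  unfolding set_integrable_def by (rule borel_integrable_compact[OF assms])

lemma integral_cbox_vector_3:
  fixes h :: "real^3 \<Rightarrow> real"
  assumes h: "continuous_on (cbox A B) h"
  shows "integral (cbox A B) h
    = integral (cbox (A $ 1, A $ 2, A $ 3) (B $ 1, B $ 2, B $ 3)) (\<lambda>(x, y, z). h (vector [x, y, z]))"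
proof -
  let ?T = "\<lambda>(x, y, z). vector [x, y, z] :: real^3"
  have cont: "continuous_on UNIV ?T" by (rule continuous_on_vector_3)
  have m: "?T \<in> measurable lborel borel"
    using borel_measurable_continuous_onI[OF cont] by simp
  let ?C = "cbox (A $ 1, A $ 2, A $ 3) (B $ 1, B $ 2, B $ 3)"
  have mem: "?T p \<in> cbox A B \<longleftrightarrow> p \<in> ?C" for p
    by (cases p) (auto simp: mem_box_cart forall_3 cbox_Pair_iff)
  have hT: "continuous_on ?C (\<lambda>p. h (?T p))"
    by (rule continuous_on_compose2[OF h continuous_on_subset[OF cont]]) (use mem in auto)
  have hm: "(\<lambda>x. indicator (cbox A B) x *\<^sub>R h x) \<in> borel_measurable borel"
    by (intro borel_measurable_continuous_on_indicator h) auto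
  have "integral (cbox A B) h = (LINT x:cbox A B|lborel. h x)"
    by (rule set_borel_integral_eq_integral(2)[symmetric] set_integrable_compact h compact_cbox)+
  also have "\<dots> = (LINT x|distr lborel borel ?T. indicator (cbox A B) x *\<^sub>R h x)"
    unfolding set_lebesgue_integral_def lborel_distr_vector_3 ..
  also have "\<dots> = (LINT p|lborel. indicator (cbox A B) (?T p) *\<^sub>R h (?T p))"
    by (rule integral_distr[OF m hm])
  also have "\<dots> = (LINT p:?C|lborel. h (?T p))"
    unfolding set_lebesgue_integral_def using mem by (intro Bochner_Integration.integral_cong) (auto simp: indicator_def)
  also have "\<dots> = integral ?C (\<lambda>p. h (?T p))"
    by (rule set_borel_integral_eq_integral(2) set_integrable_compact hT compact_cbox)+
  also have "(\<lambda>p. h (?T p)) = (\<lambda>(x, y, z). h (vector [x, y, z]))" by auto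
  finally show ?thesis .
qed

lemma sph_component [simp]:
  "sph \<theta> \<phi> $ 1 = sin \<theta> * cos \<phi>" "sph \<theta> \<phi> $ 2 = sin \<theta> * sin \<phi>" "sph \<theta> \<phi> $ 3 = cos \<theta>"
  by (simp_all add: sph_def)

lemma norm_sph [simp]: "norm (sph \<theta> \<phi>) = 1"
proof -
  have "sph \<theta> \<phi> \<bullet> sph \<theta> \<phi> = (sin \<theta> * cos \<phi>)\<^sup>2 + (sin \<theta> * sin \<phi>)\<^sup>2 + (cos \<theta>)\<^sup>2"
    by (simp add: inner_vec_def sum_3 power2_eq_square)
  also have "\<dots> = (sin \<theta>)\<^sup>2 * ((cos \<phi>)\<^sup>2 + (sin \<phi>)\<^sup>2) + (cos \<theta>)\<^sup>2"
    by (simp only: power_mult_distrib distrib_left)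
  also have "\<dots> = 1" by simp
  finally have "sph \<theta> \<phi> \<bullet> sph \<theta> \<phi> = 1" .
  then show ?thesis by (simp add: norm_eq_sqrt_inner)
qed

lemma continuous_on_sph [continuous_intros]:
  fixes f g :: "'a::t2_space \<Rightarrow> real"
  assumes "continuous_on S f" "continuous_on S g"
  shows "continuous_on S (\<lambda>x. sph (f x) (g x))"
proof (rule continuous_on_vec_componentwise)
  have "continuous_on S (\<lambda>x. sin (f x) * cos (g x))" "continuous_on S (\<lambda>x. sin (f x) * sin (g x))"
    "continuous_on S (\<lambda>x. cos (f x))"
    using assms by (auto intro!: continuous_intros)
  then show "continuous_on S (\<lambda>x. sph (f x) (g x) $ i)" for i
    using exhaust_3[of i] by auto
qed

lemma sph_inj:
  assumes "0 < \<theta>" "\<theta> < pi" "0 < \<theta>'" "\<theta>' < pi" "0 < \<phi>" "\<phi> < 2 * pi" "0 < \<phi>'" "\<phi>' < 2 * pi"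
    and eq: "sph \<theta> \<phi> = sph \<theta>' \<phi>'"
  shows "\<theta> = \<theta>'" "\<phi> = \<phi>'"
proof -
  have "cos \<theta> = cos \<theta>'" using arg_cong[OF eq, of "\<lambda>v. v $ 3"] by simp
  then show 1: "\<theta> = \<theta>'" using cos_inj_pi assms by simp
  have "sin \<theta> > 0" using assms by (simp add: sin_gt_zero)
  then have "sin \<phi> = sin \<phi>'" "cos \<phi> = cos \<phi>'"
    using arg_cong[OF eq, of "\<lambda>v. v $ 1"] arg_cong[OF eq, of "\<lambda>v. v $ 2"] 1 by auto
  then obtain n :: int where n: "\<phi> = \<phi>' + 2 * pi * n" using sin_cos_eq_iff by blast
  have "\<bar>2 * pi * n\<bar> < 2 * pi" using n assms by linarith
  then have "\<bar>real_of_int n\<bar> < 1" by (simp add: abs_mult)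
  then have "n = 0" by linarith
  then show "\<phi> = \<phi>'" using n by simp
qed

text \<open>The scalar counterpart of \<open>sphere_integral\<close>, as a gauge integral over a
  box, where iterated integration and the fundamental theorem apply directly.
  \<open>sphere_integral_inner\<close> translates between the two for continuous integrands.\<close>

definition sphint :: "real^3 \<Rightarrow> real \<Rightarrow> (real^3 \<Rightarrow> real) \<Rightarrow> real" where
  "sphint a r f = integral (cbox (0, 0) (pi, 2 * pi)) (\<lambda>(\<theta>, \<phi>). r\<^sup>2 * sin \<theta> * f (a + r *\<^sub>R sph \<theta> \<phi>))"

lemma continuous_on_sphint_integrand:
  assumes f: "continuous_on S f" and "\<And>\<theta> \<phi>. a + r *\<^sub>R sph \<theta> \<phi> \<in> S"
  shows "continuous_on C (\<lambda>(\<theta>, \<phi>). r\<^sup>2 * sin \<theta> * f (a + r *\<^sub>R sph \<theta> \<phi>))"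
  unfolding split_beta
  by (intro continuous_intros continuous_on_compose2[OF f]) (use assms(2) in auto)

lemma sphere_integral_inner:
  assumes F: "continuous_on (sphere a r) F" and r: "r \<ge> 0"
  shows "c \<bullet> sphere_integral a r F = sphint a r (\<lambda>y. c \<bullet> F y)"
proof -
  have mem: "a + r *\<^sub>R sph \<theta> \<phi> \<in> sphere a r" for \<theta> \<phi> using r by (simp add: dist_norm)
  have cb: "{0..pi} \<times> {0..2 * pi} = cbox (0, 0) (pi, 2 * pi)" by (auto simp: cbox_Pair_iff)
  let ?g = "\<lambda>(\<theta>, \<phi>). (r\<^sup>2 * sin \<theta>) *\<^sub>R F (a + r *\<^sub>R sph \<theta> \<phi>)"
  have cg: "continuous_on (cbox (0, 0) (pi, 2 * pi)) ?g"
    unfolding split_beta by (intro continuous_intros continuous_on_compose2[OF F]) (use mem in auto)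
  have "c \<bullet> sphere_integral a r F = c \<bullet> (LINT p:cbox (0, 0) (pi, 2 * pi)|lborel. ?g p)"
    unfolding sphere_integral_def cb ..
  also have "\<dots> = (LINT p|lborel. c \<bullet> (indicator (cbox (0, 0) (pi, 2 * pi)) p *\<^sub>R ?g p))"
    unfolding set_lebesgue_integral_def
    by (rule integral_inner_right[symmetric])
      (use set_integrable_compact[OF compact_cbox cg] in \<open>simp add: set_integrable_def\<close>)
  also have "\<dots> = (LINT p:cbox (0, 0) (pi, 2 * pi)|lborel. (\<lambda>(\<theta>, \<phi>). r\<^sup>2 * sin \<theta> * (c \<bullet> F (a + r *\<^sub>R sph \<theta> \<phi>))) p)"
    unfolding set_lebesgue_integral_def by (intro Bochner_Integration.integral_cong) (auto simp: indicator_def)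
  also have "\<dots> = sphint a r (\<lambda>y. c \<bullet> F y)"
    unfolding sphint_def
    by (rule set_borel_integral_eq_integral(2), rule set_integrable_compact[OF compact_cbox],
        rule continuous_on_sphint_integrand[of "sphere a r"])
      (use mem F in \<open>auto intro!: continuous_intros\<close>)
  finally show ?thesis .
qed

text \<open>Radius, polar angle and azimuth are packed into one vector, so that the derivative is a
  square matrix with a determinant.\<close>

definition polar :: "real^3 \<Rightarrow> real^3 \<Rightarrow> real^3" where
  "polar a y = a + y $ 1 *\<^sub>R sph (y $ 2) (y $ 3)"

definition polar' :: "real^3 \<Rightarrow> real^3 \<Rightarrow> real^3" where
  "polar' y v = v $ 1 *\<^sub>R sph (y $ 2) (y $ 3)
     + y $ 1 *\<^sub>R (v $ 2 *\<^sub>R vector [cos (y $ 2) * cos (y $ 3), cos (y $ 2) * sin (y $ 3), - sin (y $ 2)]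
                 + v $ 3 *\<^sub>R vector [- sin (y $ 2) * sin (y $ 3), sin (y $ 2) * cos (y $ 3), 0])"

lemma polar_has_derivative: "(polar a has_derivative polar' y) (at y within S)"
proof (rule has_derivative_vec_componentwise)
  fix i :: 3
  have D: "((\<lambda>x. x $ k) has_derivative (\<lambda>v. v $ k)) (at y within S)" for k :: 3
    by (rule bounded_linear.has_derivative[OF bounded_linear_vec_nth has_derivative_ident])
  note I = has_derivative_add has_derivative_const has_derivative_mult
    has_derivative_sin[OF D] has_derivative_cos[OF D] D
  have 1: "((\<lambda>y. a $ 1 + y $ 1 * (sin (y $ 2) * cos (y $ 3))) has_derivative (\<lambda>v. polar' y v $ 1)) (at y within S)"
    by (rule has_derivative_eq_rhs, (rule I)+) (simp add: polar'_def fun_eq_iff algebra_simps)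
  have 2: "((\<lambda>y. a $ 2 + y $ 1 * (sin (y $ 2) * sin (y $ 3))) has_derivative (\<lambda>v. polar' y v $ 2)) (at y within S)"
    by (rule has_derivative_eq_rhs, (rule I)+) (simp add: polar'_def fun_eq_iff algebra_simps)
  have 3: "((\<lambda>y. a $ 3 + y $ 1 * cos (y $ 2)) has_derivative (\<lambda>v. polar' y v $ 3)) (at y within S)"
    by (rule has_derivative_eq_rhs, (rule I)+) (simp add: polar'_def fun_eq_iff algebra_simps)
  show "((\<lambda>y. polar a y $ i) has_derivative (\<lambda>v. polar' y v $ i)) (at y within S)"
    using exhaust_3[of i] 1 2 3 by (elim disjE) (simp_all add: polar_def)
qed

lemma det_polar': "det (matrix (polar' y)) = (y $ 1)\<^sup>2 * sin (y $ 2)"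
proof -
  have aux: "(r * c * q) * (r * s * q) * c + (r * s * p) * (s * p) * (r * s) + (s * q) * (r * s * q) * (r * s)
      + (r * s * p) * (r * c * p) * c = r\<^sup>2 * s * ((c\<^sup>2 + s\<^sup>2) * (q\<^sup>2 + p\<^sup>2))" for r s c p q :: real
    by (simp add: algebra_simps power2_eq_square)
  have "det (matrix (polar' y)) = (y $ 1)\<^sup>2 * sin (y $ 2) *
      (((cos (y $ 2))\<^sup>2 + (sin (y $ 2))\<^sup>2) * ((cos (y $ 3))\<^sup>2 + (sin (y $ 3))\<^sup>2))"
    unfolding aux[symmetric] by (simp add: det_3 matrix_def polar'_def axis_def)
  also have "\<dots> = (y $ 1)\<^sup>2 * sin (y $ 2)" by simp
  finally show ?thesis .
qed

lemma polar_inj: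
  assumes "0 < R1"
  shows "inj_on (polar a) (box (vector [R1, 0, 0]) (vector [R2, pi, 2 * pi]))"
proof (rule inj_onI)
  fix y z assume y: "y \<in> box (vector [R1, 0, 0]) (vector [R2, pi, 2 * pi])"
    and z: "z \<in> box (vector [R1, 0, 0]) (vector [R2, pi, 2 * pi])" and eq: "polar a y = polar a z"
  have ry: "y $ 1 > 0" "z $ 1 > 0" using y z assms by (auto simp: mem_box_cart forall_3)
  have eq': "y $ 1 *\<^sub>R sph (y $ 2) (y $ 3) = z $ 1 *\<^sub>R sph (z $ 2) (z $ 3)"
    using eq by (simp add: polar_def)
  have 1: "y $ 1 = z $ 1" using ry arg_cong[OF eq', of norm] by simp
  then have "sph (y $ 2) (y $ 3) = sph (z $ 2) (z $ 3)" using eq' ry by simp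
  then have "y $ 2 = z $ 2" "y $ 3 = z $ 3"
    using sph_inj[of "y $ 2" "z $ 2" "y $ 3" "z $ 3"] y z by (auto simp: mem_box_cart forall_3)
  then show "y = z" using 1 by (simp add: vec_eq_iff forall_3)
qed

text \<open>The open parameter box misses the polar axis and the half plane of azimuth
  \<open>0\<close>; both lie in the hyperplane that is removed here.\<close>

lemma shell_subset_polar_image:
  "{x. R1 < dist a x \<and> dist a x < R2} - {x. x $ 2 = a $ 2}
     \<subseteq> polar a ` box (vector [R1, 0, 0]) (vector [R2, pi, 2 * pi])"
proof
  fix x assume x: "x \<in> {x. R1 < dist a x \<and> dist a x < R2} - {x. x $ 2 = a $ 2}"
  define w where "w = x - a"
  define r where "r = norm w"
  have w2: "w $ 2 \<noteq> 0" using x by (simp add: w_def)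
  then have r0: "r > 0" by (auto simp: r_def)
  have rr: "R1 < r" "r < R2" using x by (auto simp: r_def w_def dist_norm norm_minus_commute)
  have n2: "r\<^sup>2 = (w $ 1)\<^sup>2 + (w $ 2)\<^sup>2 + (w $ 3)\<^sup>2"
    by (simp add: r_def norm_vec_def L2_set_def sum_3 real_sqrt_pow2 del: real_sqrt_pow2_iff)
  define q where "q = sqrt ((w $ 1)\<^sup>2 + (w $ 2)\<^sup>2)"
  have q0: "q > 0" using w2 by (simp add: q_def add_nonneg_pos)
  have q2: "q\<^sup>2 = (w $ 1)\<^sup>2 + (w $ 2)\<^sup>2" by (simp add: q_def)
  have "(w $ 3 / r)\<^sup>2 + (q / r)\<^sup>2 = (w $ 3 * w $ 3 + q * q) / (r * r)"
    by (simp add: power2_eq_square add_divide_distrib)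
  also have "w $ 3 * w $ 3 + q * q = r * r" using n2 q2 by (simp add: power2_eq_square)
  also have "r * r / (r * r) = 1" using r0 by simp
  finally obtain \<theta> where \<theta>: "0 \<le> \<theta>" "\<theta> \<le> pi" "w $ 3 / r = cos \<theta>" "q / r = sin \<theta>"
    using sincos_total_pi[of "q / r" "w $ 3 / r"] q0 r0 by auto
  have "sin \<theta> > 0" using \<theta>(4) q0 r0 by (metis divide_pos_pos)
  then have \<theta>': "0 < \<theta>" "\<theta> < pi" using \<theta> by (auto simp: order_less_le)
  have "(w $ 1 / q)\<^sup>2 + (w $ 2 / q)\<^sup>2 = (w $ 1 * w $ 1 + w $ 2 * w $ 2) / (q * q)"
    by (simp add: power2_eq_square add_divide_distrib)
  also have "w $ 1 * w $ 1 + w $ 2 * w $ 2 = q * q" using q2 by (simp add: power2_eq_square)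
  also have "q * q / (q * q) = 1" using q0 by simp
  finally obtain \<phi> where \<phi>: "0 \<le> \<phi>" "\<phi> < 2 * pi" "w $ 1 / q = cos \<phi>" "w $ 2 / q = sin \<phi>"
    using sincos_total_2pi by metis
  have "sin \<phi> \<noteq> 0" using \<phi>(4) w2 q0 by (metis divide_eq_0_iff less_irrefl)
  then have \<phi>': "0 < \<phi>" using \<phi> by (cases "\<phi> = 0") auto
  have "x = polar a (vector [r, \<theta>, \<phi>])"
  proof -
    have "w $ 1 = r * (sin \<theta> * cos \<phi>)" "w $ 2 = r * (sin \<theta> * sin \<phi>)" "w $ 3 = r * cos \<theta>"
      using q0 r0 by (simp_all add: \<theta>(3,4)[symmetric] \<phi>(3,4)[symmetric])
    then show ?thesis by (simp add: polar_def vec_eq_iff forall_3 w_def algebra_simps)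
  qed
  moreover have "vector [r, \<theta>, \<phi>] \<in> box (vector [R1, 0, 0]) (vector [R2, pi, 2 * pi] :: real^3)"
    using rr \<theta>' \<phi> \<phi>' by (simp add: mem_box_cart forall_3)
  ultimately show "x \<in> polar a ` box (vector [R1, 0, 0]) (vector [R2, pi, 2 * pi])" by blast
qed

text \<open>Polar coordinates are injective on the open parameter box. The part of the closed shell
  that its image misses lies in a hyperplane and two spheres, so it is negligible, and Fubini splits
  off the radius.\<close>

lemma integral_shell_polar:
  assumes R: "0 < R1" "R1 \<le> R2" and f: "continuous_on {x. R1 \<le> dist a x \<and> dist a x \<le> R2} f"
  shows "(LINT x:{x. R1 \<le> dist a x \<and> dist a x \<le> R2}|lborel. f x) = integral {R1..R2} (\<lambda>r. sphint a r f)"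
proof -
  let ?K = "{x. R1 \<le> dist a x \<and> dist a x \<le> R2}"
  let ?A = "vector [R1, 0, 0] :: real^3" and ?B = "vector [R2, pi, 2 * pi] :: real^3"
  let ?S = "box ?A ?B"
  have "?K = cball a R2 - ball a R1" by auto
  then have cK: "compact ?K" by (simp add: compact_diff)
  have inK: "polar a y \<in> ?K" if "y \<in> cbox ?A ?B" for y
    using that R by (simp add: polar_def dist_norm mem_box_cart forall_3)
  define F where "F = (\<lambda>y. (y $ 1)\<^sup>2 * sin (y $ 2) * f (polar a y))"
  have cF: "continuous_on (cbox ?A ?B) F"
    unfolding F_def
    by (intro continuous_intros continuous_on_compose2[OF f])
      (use inK in \<open>auto simp: polar_def intro!: continuous_intros\<close>)
  have fK: "set_integrable lborel ?K f" by (rule set_integrable_compact[OF cK f])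
  have img: "polar a ` ?S \<subseteq> ?K" using inK box_subset_cbox by blast
  have neg: "negligible (?K - polar a ` ?S)"
  proof (rule negligible_subset)
    show "negligible ({x. x $ 2 = a $ 2} \<union> sphere a R1 \<union> sphere a R2)"
      using negligible_hyperplane[of "axis 2 1 :: real^3" "a $ 2"]
      by (intro negligible_Un negligible_sphere) (simp add: inner_axis' axis_eq_0_iff)
    show "?K - polar a ` ?S \<subseteq> {x. x $ 2 = a $ 2} \<union> sphere a R1 \<union> sphere a R2"
    proof
      fix x assume x: "x \<in> ?K - polar a ` ?S"
      then have "\<not> (R1 < dist a x \<and> dist a x < R2 \<and> x $ 2 \<noteq> a $ 2)"
        using shell_subset_polar_image[of R1 a R2] by blast
      then show "x \<in> {x. x $ 2 = a $ 2} \<union> sphere a R1 \<union> sphere a R2" using x by auto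
    qed
  qed
  \<comment> \<open>The change of variables formula speaks of values in some \<open>real^'n\<close>,
    so the scalar integrand is wrapped as a vector with one entry and unwrapped afterwards.\<close>
  let ?v = "vec :: real \<Rightarrow> real^1"
  have fK': "(\<lambda>x. ?v (f x)) absolutely_integrable_on ?K"
  proof -
    have c: "continuous_on ?K (\<lambda>x. ?v (f x))"
      by (rule continuous_on_vec_componentwise) (use f in simp)
    have "integrable lborel (\<lambda>x. indicator ?K x *\<^sub>R ?v (f x))"
      by (rule borel_integrable_compact[OF cK c])
    then show ?thesis unfolding set_integrable_def
      by (subst integrable_completion) (auto dest: borel_measurable_integrable)
  qed
  have aint: "(\<lambda>x. ?v (f x)) absolutely_integrable_on polar a ` ?S"
  proof (rule set_integrable_subset[OF fK' _ img])
    \<comment> \<open>The image is measurable because it is a compact set minus a negligible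
      one.\<close>
    have "?K - (?K - polar a ` ?S) \<in> sets lebesgue"
      by (rule sets.Diff[OF fmeasurableD[OF lmeasurable_compact[OF cK]] negligible_imp_sets[OF neg]])
    moreover have "?K - (?K - polar a ` ?S) = polar a ` ?S" using img by blast
    ultimately show "polar a ` ?S \<in> sets lebesgue" by simp
  qed
  let ?D = "\<lambda>y. \<bar>det (matrix (polar' y))\<bar> *\<^sub>R ?v (f (polar a y))"
  have "?D absolutely_integrable_on ?S \<and> integral ?S ?D = integral (polar a ` ?S) (\<lambda>x. ?v (f x))"
    using has_absolute_integral_change_of_variables[OF _ polar_has_derivative polar_inj[OF R(1)], where f="\<lambda>x. ?v (f x)"] aint
    by auto
  then have DS: "?D integrable_on ?S" and cov: "integral ?S ?D = integral (polar a ` ?S) (\<lambda>x. ?v (f x))"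
    using set_lebesgue_integral_eq_integral(1) by blast+
  have bl: "bounded_linear (\<lambda>v::real^1. v $ 1)" by (rule bounded_linear_vec_nth)
  have "(LINT x:?K|lborel. f x) = integral ?K f"
    by (rule set_borel_integral_eq_integral(2)[OF fK])
  also have "\<dots> = integral (polar a ` ?S) f"
    by (rule integral_subset_negligible[OF img neg, symmetric])
  also have "\<dots> = integral (polar a ` ?S) (\<lambda>x. ?v (f x)) $ 1"
    using integral_linear[OF set_lebesgue_integral_eq_integral(1)[OF aint] bl] by (simp add: o_def)
  also have "\<dots> = integral ?S ?D $ 1" using cov by simp
  also have "\<dots> = integral ?S (\<lambda>y. ?D y $ 1)"
    using integral_linear[OF DS bl] by (simp add: o_def)
  also have "\<dots> = integral ?S F"
    by (rule integral_cong) (auto simp: F_def det_polar' abs_mult mem_box_cart forall_3 sin_ge_zero)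
  also have "\<dots> = integral (cbox ?A ?B) F" by (rule integral_open_interval)
  also have "\<dots> = integral (cbox (R1, 0, 0) (R2, pi, 2 * pi)) (\<lambda>(r, \<theta>, \<phi>). F (vector [r, \<theta>, \<phi>]))"
    using integral_cbox_vector_3[OF cF] by simp
  also have "\<dots> = integral (cbox R1 R2) (\<lambda>r. integral (cbox (0, 0) (pi, 2 * pi)) (\<lambda>p. (\<lambda>(r, \<theta>, \<phi>). F (vector [r, \<theta>, \<phi>])) (r, p)))"
  proof (rule integral_prod_continuous)
    have "continuous_on (cbox (R1, 0, 0) (R2, pi, 2 * pi)) (\<lambda>p. F ((\<lambda>(r, \<theta>, \<phi>). vector [r, \<theta>, \<phi>]) p))"
      by (rule continuous_on_compose2[OF cF continuous_on_subset[OF continuous_on_vector_3]])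
        (auto simp: mem_box_cart forall_3 cbox_Pair_iff)
    then show "continuous_on (cbox (R1, 0, 0) (R2, pi, 2 * pi)) (\<lambda>(r, \<theta>, \<phi>). F (vector [r, \<theta>, \<phi>]))"
      by (simp add: split_beta)
  qed
  also have "\<dots> = integral {R1..R2} (\<lambda>r. sphint a r f)"
    by (simp add: sphint_def F_def polar_def case_prod_beta')
  finally show ?thesis .
qed

lemma continuous_on_sphint:
  assumes R: "0 < R1" and f: "continuous_on {x. R1 \<le> dist a x \<and> dist a x \<le> R2} f"
  shows "continuous_on {R1..R2} (\<lambda>r. sphint a r f)"
  unfolding sphint_def
proof (rule integral_continuous_on_param)
  let ?C = "{R1..R2} \<times> cbox (0, 0) (pi, 2 * pi)"
  have c: "continuous_on ?C (\<lambda>p. a + fst p *\<^sub>R sph (fst (snd p)) (snd (snd p)))"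
    by (intro continuous_intros)
  have "continuous_on ?C (\<lambda>p. f (a + fst p *\<^sub>R sph (fst (snd p)) (snd (snd p))))"
    by (rule continuous_on_compose2[OF f c]) (use R in \<open>auto simp: dist_norm\<close>)
  then have "continuous_on ?C (\<lambda>p. (fst p)\<^sup>2 * sin (fst (snd p)) * f (a + fst p *\<^sub>R sph (fst (snd p)) (snd (snd p))))"
    by (intro continuous_on_mult continuous_on_power continuous_on_sin continuous_on_fst continuous_on_snd continuous_on_id)
  then show "continuous_on ?C (\<lambda>(r, p). (\<lambda>(\<theta>, \<phi>). r\<^sup>2 * sin \<theta> * f (a + r *\<^sub>R sph \<theta> \<phi>)) p)"
    by (simp only: case_prod_beta')
qed

section \<open>Green's formula at one sphere\<close>

text \<open>The cutoff is a function of the squared distance, which is smooth even at the centre;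
  accordingly \<open>s\<close> and \<open>t\<close> are squares of radii.\<close>

definition bump :: "real^3 \<Rightarrow> real \<Rightarrow> real \<Rightarrow> real^3 \<Rightarrow> real" where
  "bump a s t x = 1 - step (((norm (x - a))\<^sup>2 - s) / (t - s))"

definition bumpg :: "real^3 \<Rightarrow> real \<Rightarrow> real \<Rightarrow> real^3 \<Rightarrow> real^3" where
  "bumpg a s t x = - (2 * step' (((norm (x - a))\<^sup>2 - s) / (t - s)) / (t - s)) *\<^sub>R (x - a)"

lemma norm_diff_sq_has_derivative:
  "((\<lambda>x::'a::real_inner. (norm (x - a))\<^sup>2) has_derivative (\<lambda>v. 2 * ((x - a) \<bullet> v))) (at x within S)"
  unfolding power2_norm_eq_inner
  by (auto intro!: derivative_eq_intros simp: inner_commute algebra_simps)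

lemma bump_gradient: "gradient_on UNIV (bump a s t) (bumpg a s t)"
  unfolding gradient_on_def
proof (intro conjI ballI)
  fix x
  have "((\<lambda>x. ((norm (x - a))\<^sup>2 - s) / (t - s)) has_derivative (\<lambda>v. 2 * ((x - a) \<bullet> v) / (t - s))) (at x)"
    using bounded_linear.has_derivative[OF bounded_linear_divide
        has_derivative_diff[OF norm_diff_sq_has_derivative[of a x UNIV] has_derivative_const[of s]], of "t - s"]
    by simp
  from has_derivative_compose[OF this step_has_derivative[unfolded has_field_derivative_def]]
  have "((\<lambda>x. step (((norm (x - a))\<^sup>2 - s) / (t - s))) has_derivative
     (\<lambda>v. step' (((norm (x - a))\<^sup>2 - s) / (t - s)) * (2 * ((x - a) \<bullet> v) / (t - s)))) (at x)" .
  from has_derivative_diff[OF has_derivative_const[of 1] this]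
  have "(bump a s t has_derivative (\<lambda>v. 0 - step' (((norm (x - a))\<^sup>2 - s) / (t - s)) * (2 * ((x - a) \<bullet> v) / (t - s)))) (at x)"
    unfolding bump_def[abs_def] .
  moreover have "(\<lambda>v. 0 - step' (((norm (x - a))\<^sup>2 - s) / (t - s)) * (2 * ((x - a) \<bullet> v) / (t - s))) = (\<bullet>) (bumpg a s t x)"
    by (auto simp: fun_eq_iff bumpg_def)
  ultimately show "(bump a s t has_derivative (\<bullet>) (bumpg a s t x)) (at x)" by (simp only:)
next
  show "continuous_on UNIV (bumpg a s t)"
    unfolding bumpg_def[abs_def] divide_inverse
    by (intro continuous_intros continuous_on_step')
qed

lemma continuous_on_bump: "continuous_on S (bump a s t)" and continuous_on_bumpg: "continuous_on S (bumpg a s t)"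
proof -
  have "continuous_on UNIV (bump a s t)"
    by (rule has_derivative_continuous_on) (use bump_gradient[of a s t] in \<open>auto simp: gradient_on_def\<close>)
  then show "continuous_on S (bump a s t)" using continuous_on_subset by blast
  show "continuous_on S (bumpg a s t)"
    using bump_gradient[of a s t] continuous_on_subset unfolding gradient_on_def by blast
qed

lemma bump_eq_1: "s < t \<Longrightarrow> (norm (x - a))\<^sup>2 \<le> s \<Longrightarrow> bump a s t x = 1"
  by (simp add: bump_def step_eq_0 divide_nonpos_pos)

lemma bump_eq_0: "s < t \<Longrightarrow> t \<le> (norm (x - a))\<^sup>2 \<Longrightarrow> bump a s t x = 0"
  by (simp add: bump_def step_eq_1)

lemma bump_nonneg: "0 \<le> bump a s t x" and bump_le_1: "bump a s t x \<le> 1"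
  by (simp_all add: bump_def step_nonneg step_le_1)

lemma bumpg_eq_0: "s < t \<Longrightarrow> (norm (x - a))\<^sup>2 \<le> s \<or> t \<le> (norm (x - a))\<^sup>2 \<Longrightarrow> bumpg a s t x = 0"
  by (auto simp: bumpg_def step'_eq divide_simps)

lemma norm_bumpg_le: "s < t \<Longrightarrow> norm (bumpg a s t x) \<le> 60 * norm (x - a) / (t - s)"
proof -
  assume "s < t"
  then have "norm (bumpg a s t x) = 2 * \<bar>step' (((norm (x - a))\<^sup>2 - s) / (t - s))\<bar> * norm (x - a) / (t - s)"
    by (simp add: bumpg_def abs_mult)
  also have "\<dots> \<le> 60 * norm (x - a) / (t - s)"
    using step'_le[of "((norm (x - a))\<^sup>2 - s) / (t - s)"] \<open>s < t\<close>
    by (intro divide_right_mono mult_right_mono) auto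
  finally show ?thesis .
qed

lemma gradient_on_diff:
  "gradient_on S f F \<Longrightarrow> gradient_on S g G \<Longrightarrow> gradient_on S (\<lambda>x. f x - g x) (\<lambda>x. F x - G x)"
  unfolding gradient_on_def
  by (auto simp: inner_diff_left intro!: derivative_eq_intros continuous_intros)

lemma sphint_cong:
  assumes "r \<ge> 0" "\<And>y. y \<in> sphere a r \<Longrightarrow> f y = g y"
  shows "sphint a r f = sphint a r g"
  unfolding sphint_def
  by (rule integral_cong) (use assms in \<open>auto simp: dist_norm\<close>)

lemma sphint_cmult: "sphint a r (\<lambda>y. c * f y) = c * sphint a r f"
proof -
  have "(\<lambda>(\<theta>, \<phi>). r\<^sup>2 * sin \<theta> * (c * f (a + r *\<^sub>R sph \<theta> \<phi>))) = (\<lambda>p. c * (\<lambda>(\<theta>, \<phi>). r\<^sup>2 * sin \<theta> * f (a + r *\<^sub>R sph \<theta> \<phi>)) p)"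
    by (auto simp: fun_eq_iff)
  then show ?thesis unfolding sphint_def by (simp only: integral_mult_right)
qed

lemma sphint_add:
  assumes "r \<ge> 0" "continuous_on (sphere a r) f" "continuous_on (sphere a r) g"
  shows "sphint a r (\<lambda>y. f y + g y) = sphint a r f + sphint a r g"
proof -
  have I: "(\<lambda>(\<theta>, \<phi>). r\<^sup>2 * sin \<theta> * h (a + r *\<^sub>R sph \<theta> \<phi>)) integrable_on cbox (0, 0) (pi, 2 * pi)"
    if "continuous_on (sphere a r) h" for h
    by (rule integrable_continuous, rule continuous_on_sphint_integrand[OF that]) (use assms in \<open>auto simp: dist_norm\<close>)
  have "(\<lambda>(\<theta>, \<phi>). r\<^sup>2 * sin \<theta> * (f (a + r *\<^sub>R sph \<theta> \<phi>) + g (a + r *\<^sub>R sph \<theta> \<phi>)))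
    = (\<lambda>p. (\<lambda>(\<theta>, \<phi>). r\<^sup>2 * sin \<theta> * f (a + r *\<^sub>R sph \<theta> \<phi>)) p + (\<lambda>(\<theta>, \<phi>). r\<^sup>2 * sin \<theta> * g (a + r *\<^sub>R sph \<theta> \<phi>)) p)"
    by (auto simp: fun_eq_iff algebra_simps)
  then show ?thesis unfolding sphint_def
    using integral_add[OF I[OF assms(2)] I[OF assms(3)]] by simp
qed

lemma set_integrable_compact_support:
  fixes f :: "'a::euclidean_space \<Rightarrow> real"
  assumes "compact K" "continuous_on K f" "S \<in> sets borel" "\<And>x. x \<in> S - K \<Longrightarrow> f x = 0"
  shows "set_integrable lborel S f"
proof -
  have "set_integrable lborel (K \<inter> S) f"
    by (rule set_integrable_subset[OF set_integrable_compact[OF assms(1,2)]])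
      (use assms borel_compact in auto)
  moreover have "(\<lambda>x. indicator (K \<inter> S) x *\<^sub>R f x) = (\<lambda>x. indicator S x *\<^sub>R f x)"
    using assms(4) by (auto simp: fun_eq_iff indicator_def)
  ultimately show ?thesis unfolding set_integrable_def by simp
qed

text \<open>The kernel \<open>k n\<close> is the derivative of a \<open>step\<close> in
  \<open>r^2\<close> that rises between \<open>R^2 + \<epsilon> n\<close> and
  \<open>R^2 + 2 * \<epsilon> n\<close>, so it has mass one and concentrates at \<open>R\<close>.
  The gap \<open>\<epsilon> n\<close> above \<open>R^2\<close> keeps the corresponding cutoffs
  constant near the sphere itself.\<close>

lemma integral_approximate_identity:
  fixes H :: "real \<Rightarrow> real"
  assumes R: "0 < R" "R < Rm" and H: "continuous_on {R..Rm} H"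
  defines "\<epsilon> \<equiv> \<lambda>n. (Rm\<^sup>2 - R\<^sup>2) / (2 * real (Suc n))"
  defines "k \<equiv> \<lambda>n r. 2 * r * step' ((r\<^sup>2 - (R\<^sup>2 + \<epsilon> n)) / \<epsilon> n) / \<epsilon> n"
  shows "(\<lambda>n. integral {R..Rm} (\<lambda>r. k n r * H r)) \<longlonglongrightarrow> H R"
proof -
  have d: "Rm\<^sup>2 - R\<^sup>2 > 0" using R by (simp add: power_strict_mono)
  then have e: "\<epsilon> n > 0" for n by (simp add: \<epsilon>_def)
  have e2: "2 * \<epsilon> n \<le> Rm\<^sup>2 - R\<^sup>2" for n
  proof -
    have "2 * \<epsilon> n = (Rm\<^sup>2 - R\<^sup>2) / real (Suc n)" by (simp add: \<epsilon>_def field_simps)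
    also have "\<dots> \<le> (Rm\<^sup>2 - R\<^sup>2) / 1" using d by (intro divide_left_mono) auto
    finally show ?thesis by simp
  qed
  have "(\<lambda>n. (Rm\<^sup>2 - R\<^sup>2) / 2 * inverse (real (Suc n))) \<longlonglongrightarrow> (Rm\<^sup>2 - R\<^sup>2) / 2 * 0"
    by (intro tendsto_mult tendsto_const LIMSEQ_inverse_real_of_nat)
  then have elim: "\<epsilon> \<longlonglongrightarrow> 0" by (simp add: \<epsilon>_def field_simps)
  have ck: "continuous_on S (k n)" for n S
    unfolding k_def using e[of n] by (intro continuous_intros continuous_on_step') auto
  have knn: "k n r \<ge> 0" if "r \<ge> 0" for n r
    unfolding k_def using that e[of n] step'_nonneg by (simp add: less_imp_le)
  have k0: "k n r = 0" if "r\<^sup>2 > R\<^sup>2 + 2 * \<epsilon> n" for n r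
    unfolding k_def using that e[of n] by (simp add: step'_eq field_simps)
  have kint: "(k n has_integral 1) {R..Rm}" for n
  proof -
    let ?f = "\<lambda>r. step ((r\<^sup>2 - (R\<^sup>2 + \<epsilon> n)) / \<epsilon> n)"
    have "(k n has_integral (?f Rm - ?f R)) {R..Rm}"
    proof (rule fundamental_theorem_of_calculus)
      fix r
      have "((\<lambda>r. (r\<^sup>2 - (R\<^sup>2 + \<epsilon> n)) / \<epsilon> n) has_real_derivative 2 * r / \<epsilon> n) (at r)"
        using e[of n] by (auto intro!: derivative_eq_intros)
      from DERIV_chain2[OF step_has_derivative this]
      have "(?f has_real_derivative k n r) (at r)" by (simp add: k_def mult_ac)
      then show "(?f has_vector_derivative k n r) (at r within {R..Rm})"
        by (metis has_real_derivative_iff_has_vector_derivative has_vector_derivative_at_within)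
    qed (use R in simp)
    moreover have "?f Rm = 1" using e2[of n] e[of n] by (intro step_eq_1) (simp add: field_simps)
    moreover have "?f R = 0" using e[of n] by (intro step_eq_0) (simp add: field_simps)
    ultimately show ?thesis by simp
  qed
  show ?thesis
  proof (rule LIMSEQ_I)
    fix \<delta> :: real assume \<delta>: "\<delta> > 0"
    obtain \<eta> where \<eta>: "\<eta> > 0" "\<And>r. r \<in> {R..Rm} \<Longrightarrow> dist r R < \<eta> \<Longrightarrow> dist (H r) (H R) < \<delta> / 2"
      using H R \<delta> unfolding continuous_on_iff
      by (metis atLeastAtMost_iff half_gt_zero less_eq_real_def)
    have "\<eta> * R > 0" using \<eta> R by simp
    then have "\<forall>\<^sub>F n in sequentially. 2 * \<epsilon> n < \<eta> * R"
      by (rule order_tendstoD(2)[OF tendsto_mult_right_zero[OF elim]])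
    then obtain n0 where n0: "\<And>n. n \<ge> n0 \<Longrightarrow> 2 * \<epsilon> n < \<eta> * R"
      unfolding eventually_sequentially by blast
    show "\<exists>no. \<forall>n\<ge>no. norm (integral {R..Rm} (\<lambda>r. k n r * H r) - H R) < \<delta>"
    proof (intro exI allI impI)
      fix n assume n: "n \<ge> n0"
      have I1: "(\<lambda>r. k n r * H r) integrable_on {R..Rm}"
        by (intro integrable_continuous_interval continuous_intros ck H)
      have I2: "((\<lambda>r. k n r * H R) has_integral 1 * H R) {R..Rm}"
        by (intro has_integral_mult_left kint)
      have I3: "((\<lambda>r. k n r * (\<delta> / 2)) has_integral 1 * (\<delta> / 2)) {R..Rm}"
        by (intro has_integral_mult_left kint)
      have "integral {R..Rm} (\<lambda>r. k n r * H r) - H R = integral {R..Rm} (\<lambda>r. k n r * H r - k n r * H R)"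
        using integral_diff[OF I1 has_integral_integrable[OF I2]] integral_unique[OF I2] by simp
      also have "norm \<dots> \<le> integral {R..Rm} (\<lambda>r. k n r * (\<delta> / 2))"
      proof (rule integral_norm_bound_integral)
        show "(\<lambda>r. k n r * H r - k n r * H R) integrable_on {R..Rm}"
          using I1 I2 by (intro integrable_diff) (auto simp: has_integral_integrable)
        show "(\<lambda>r. k n r * (\<delta> / 2)) integrable_on {R..Rm}" using I3 by (auto simp: has_integral_integrable)
        fix r assume r: "r \<in> {R..Rm}"
        show "norm (k n r * H r - k n r * H R) \<le> k n r * (\<delta> / 2)"
        proof (cases "r\<^sup>2 > R\<^sup>2 + 2 * \<epsilon> n")
          case True then show ?thesis by (simp add: k0)
        next
          case False
          \<comment> \<open>On the support of the kernel \<open>r^2 - R^2\<close> is at most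
            \<open>2 * \<epsilon> n\<close>, and \<open>r + R \<ge> R\<close> turns this into a
            bound on \<open>r - R\<close>.\<close>
          have "(r - R) * R \<le> (r - R) * (r + R)" using r R by (intro mult_left_mono) auto
          also have "\<dots> \<le> 2 * \<epsilon> n" using False by (simp add: power2_eq_square algebra_simps)
          also have "\<dots> < \<eta> * R" using n0 n by simp
          finally have "r - R < \<eta>" using R by simp
          then have "\<bar>H r - H R\<bar> \<le> \<delta> / 2" using \<eta>(2)[OF r] r by (simp add: dist_real_def)
          then have "k n r * \<bar>H r - H R\<bar> \<le> k n r * (\<delta> / 2)"
            using knn[of r n] r R by (intro mult_left_mono) auto
          then show ?thesis using knn[of r n] r R by (simp add: abs_mult flip: right_diff_distrib)
        qed
      qed
      also have "\<dots> = \<delta> / 2" using integral_unique[OF I3] by simp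
      finally show "norm (integral {R..Rm} (\<lambda>r. k n r * H r) - H R) < \<delta>" using \<delta> by simp
    qed
  qed
qed

text \<open>The field \<open>h\<close> is differentiable only in the open shell, so the boundary is
  reached as a limit: subtracting a second cutoff \<open>z n\<close> that equals one next to the
  inner sphere gives a compactly supported weight and hence integral zero, and the gradient of
  \<open>z n\<close> acts on the radial component of \<open>h\<close> as an approximate identity at
  \<open>R\<close>. The sign is negative because the normal points from the particle into the shell.
  Integrability of the divergence is assumed since \<open>J\<close> need not be bounded near the
  sphere.\<close>

theorem local_green:
  assumes R: "0 < R" "R\<^sup>2 < s" "s < t" "t < R2\<^sup>2" "0 < R2"
    and h: "jacobian_on {x. R < dist a x \<and> dist a x < R2} h J"
    and ch: "continuous_on {x. R \<le> dist a x \<and> dist a x < R2} h"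
    and int: "set_integrable lborel {x. R < dist a x \<and> dist a x < R2} (\<lambda>x. bump a s t x * trace (J x))"
  shows "set_integrable lborel {x. R < dist a x \<and> dist a x < R2} (\<lambda>x. bumpg a s t x \<bullet> h x)"
    and "(LINT x:{x. R < dist a x \<and> dist a x < R2}|lborel. bump a s t x * trace (J x) + bumpg a s t x \<bullet> h x)
      = - sphint a R (\<lambda>y. h y \<bullet> ((1 / R) *\<^sub>R (y - a)))"
proof -
  let ?S = "{x. R < dist a x \<and> dist a x < R2}"
  have "?S = ball a R2 - cball a R" by auto
  then have oS: "open ?S" by (simp add: open_Diff)
  then have bS: "?S \<in> sets borel" by simp
  define Rm where "Rm = sqrt s"
  have s0: "0 < s" using R by (meson dual_order.strict_trans zero_less_power)
  have Rm2: "Rm\<^sup>2 = s" using s0 by (simp add: Rm_def)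
  have Rm: "R < Rm" using R s0 unfolding Rm_def by (simp add: real_less_rsqrt)
  have sqd: "(norm (x - a))\<^sup>2 = (dist a x)\<^sup>2" for x by (simp add: dist_norm norm_minus_commute)
  have RmR2: "Rm < R2" using R Rm2 by (intro power_less_imp_less_base[of Rm 2 R2]) auto
  define \<epsilon> where "\<epsilon> = (\<lambda>n. (Rm\<^sup>2 - R\<^sup>2) / (2 * real (Suc n)))"
  have d: "Rm\<^sup>2 - R\<^sup>2 > 0" using R Rm2 by simp
  then have e: "\<epsilon> n > 0" for n by (simp add: \<epsilon>_def)
  have e2: "R\<^sup>2 + 2 * \<epsilon> n \<le> s" for n
  proof -
    have "2 * \<epsilon> n = (Rm\<^sup>2 - R\<^sup>2) / real (Suc n)" by (simp add: \<epsilon>_def field_simps)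
    also have "\<dots> \<le> (Rm\<^sup>2 - R\<^sup>2) / 1" using d by (intro divide_left_mono) auto
    finally show ?thesis by (simp add: Rm2)
  qed
  have "(\<lambda>n. (Rm\<^sup>2 - R\<^sup>2) / 2 * inverse (real (Suc n))) \<longlonglongrightarrow> (Rm\<^sup>2 - R\<^sup>2) / 2 * 0"
    by (intro tendsto_mult tendsto_const LIMSEQ_inverse_real_of_nat)
  then have elim: "\<epsilon> \<longlonglongrightarrow> 0" by (simp add: \<epsilon>_def field_simps)
  \<comment> \<open>\<open>z n\<close> is one near the inner sphere and zero shortly beyond it,
    where the outer cutoff is still one; so the difference of the two is supported in a compact part
    of the open shell.\<close>
  define z where "z = (\<lambda>n. bump a (R\<^sup>2 + \<epsilon> n) (R\<^sup>2 + 2 * \<epsilon> n))"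
  define zg where "zg = (\<lambda>n. bumpg a (R\<^sup>2 + \<epsilon> n) (R\<^sup>2 + 2 * \<epsilon> n))"
  define K where "K = {x. R \<le> dist a x \<and> dist a x \<le> sqrt t}"
  have t0: "0 < t" using s0 R by simp
  have "K = cball a (sqrt t) - ball a R" by (auto simp: K_def)
  then have cK: "compact K" by (simp add: compact_diff)
  have "sqrt t < R2" using R by (simp add: real_less_lsqrt)
  then have Ksub: "K \<subseteq> {x. R \<le> dist a x \<and> dist a x < R2}" by (auto simp: K_def)
  have out: "t \<le> (norm (x - a))\<^sup>2" if "x \<in> ?S - K" for x
  proof -
    have "sqrt t < dist a x" using that by (auto simp: K_def)
    then have "(sqrt t)\<^sup>2 < (dist a x)\<^sup>2" using t0 by (intro power_strict_mono) auto
    then show ?thesis using t0 by (simp add: sqd)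
  qed
  show i2: "set_integrable lborel ?S (\<lambda>x. bumpg a s t x \<bullet> h x)"
  proof (rule set_integrable_compact_support[OF cK _ bS])
    show "continuous_on K (\<lambda>x. bumpg a s t x \<bullet> h x)"
      by (intro continuous_intros continuous_on_bumpg continuous_on_subset[OF ch Ksub])
    show "bumpg a s t x \<bullet> h x = 0" if "x \<in> ?S - K" for x
      using bumpg_eq_0[OF R(3)] out[OF that] by simp
  qed
  define f where "f = (\<lambda>n x. (bump a s t x - z n x) * trace (J x) + (bumpg a s t x - zg n x) \<bullet> h x)"
  have core: "set_integrable lborel ?S (f n)" "(LINT x:?S|lborel. f n x) = 0" for n
  proof -
    define L where "L = {x. R\<^sup>2 + \<epsilon> n \<le> (dist a x)\<^sup>2 \<and> (dist a x)\<^sup>2 \<le> t}"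
    have "closed L" unfolding L_def by (intro closed_Collect_conj closed_Collect_le continuous_intros)
    moreover have "L \<subseteq> cball a (sqrt t)" unfolding L_def
      by (auto simp: real_le_rsqrt)
    ultimately have cL: "compact L" by (meson bounded_cball bounded_subset compact_eq_bounded_closed)
    have LS: "L \<subseteq> ?S"
    proof
      fix x assume "x \<in> L"
      then have "R\<^sup>2 < (dist a x)\<^sup>2" "(dist a x)\<^sup>2 < R2\<^sup>2" using e[of n] R by (auto simp: L_def)
      then show "x \<in> ?S" using R by (auto intro: power_less_imp_less_base)
    qed
    have g: "gradient_on UNIV (\<lambda>x. bump a s t x - z n x) (\<lambda>x. bumpg a s t x - zg n x)"
      unfolding z_def zg_def by (intro gradient_on_diff bump_gradient)
    have supp: "bump a s t x - z n x = 0" if "x \<notin> L" for x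
    proof (cases "(dist a x)\<^sup>2 \<le> R\<^sup>2 + \<epsilon> n")
      case True
      then show ?thesis using e[of n] e2[of n] R unfolding z_def
        by (simp add: bump_eq_1 sqd)
    next
      case False
      then have "t \<le> (dist a x)\<^sup>2" using that by (auto simp: L_def)
      then show ?thesis using e[of n] e2[of n] R unfolding z_def
        by (simp add: bump_eq_0 sqd)
    qed
    show "set_integrable lborel ?S (f n)" "(LINT x:?S|lborel. f n x) = 0"
      unfolding f_def
      using integral_divergence_cutoff[OF oS h g cL LS supp] by auto
  qed
  \<comment> \<open>Dividing by \<open>dist a y\<close> instead of \<open>R\<close> gives the normal
    component on all nearby concentric spheres; on the inner sphere the two agree.\<close>
  define nrm where "nrm = (\<lambda>y. h y \<bullet> ((1 / dist a y) *\<^sub>R (y - a)))"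
  define K' where "K' = {x. R \<le> dist a x \<and> dist a x \<le> Rm}"
  have "K' = cball a Rm - ball a R" by (auto simp: K'_def)
  then have cK': "compact K'" by (simp add: compact_diff)
  have K'sub: "K' \<subseteq> {x. R \<le> dist a x \<and> dist a x < R2}" using RmR2 by (auto simp: K'_def)
  have cn: "continuous_on K' nrm"
    unfolding nrm_def using R by (intro continuous_intros continuous_on_subset[OF ch K'sub]) (auto simp: K'_def)
  have zg0: "zg n x \<bullet> h x = 0" if "x \<in> ?S - K' \<union> (K' - ?S)" for n x
  proof -
    have "(norm (x - a))\<^sup>2 \<le> R\<^sup>2 + \<epsilon> n \<or> R\<^sup>2 + 2 * \<epsilon> n \<le> (norm (x - a))\<^sup>2"
    proof (cases "x \<in> ?S")
      case True
      then have "Rm < dist a x" using that by (auto simp: K'_def)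
      then have "Rm\<^sup>2 < (dist a x)\<^sup>2" using Rm R by (intro power_strict_mono) auto
      then show ?thesis using e2[of n] Rm2 sqd by simp
    next
      case False
      then have "dist a x = R" using that RmR2 by (auto simp: K'_def)
      then show ?thesis using e[of n] sqd by simp
    qed
    then show ?thesis unfolding zg_def using e[of n] by (simp add: bumpg_eq_0)
  qed
  have zc: "continuous_on K' (\<lambda>x. zg n x \<bullet> h x)" for n
    unfolding zg_def by (intro continuous_intros continuous_on_bumpg continuous_on_subset[OF ch K'sub])
  have zi: "set_integrable lborel ?S (\<lambda>x. zg n x \<bullet> h x)" for n
    by (rule set_integrable_compact_support[OF cK' zc bS]) (use zg0 in auto)
  define k where "k = (\<lambda>n r. 2 * r * step' ((r\<^sup>2 - (R\<^sup>2 + \<epsilon> n)) / \<epsilon> n) / \<epsilon> n)"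
  have zI: "(LINT x:?S|lborel. zg n x \<bullet> h x) = - integral {R..Rm} (\<lambda>r. k n r * sphint a r nrm)" for n
  proof -
    have "(LINT x:?S|lborel. zg n x \<bullet> h x) = (LINT x:K'|lborel. zg n x \<bullet> h x)"
      unfolding set_lebesgue_integral_def
      by (rule Bochner_Integration.integral_cong) (use zg0 in \<open>auto simp: indicator_def\<close>)
    also have "\<dots> = integral {R..Rm} (\<lambda>r. sphint a r (\<lambda>x. zg n x \<bullet> h x))"
      using integral_shell_polar[of R Rm a] zc R Rm unfolding K'_def by auto
    also have "\<dots> = integral {R..Rm} (\<lambda>r. - (k n r * sphint a r nrm))"
    proof (rule integral_cong)
      fix r assume r: "r \<in> {R..Rm}"
      have "sphint a r (\<lambda>x. zg n x \<bullet> h x) = sphint a r (\<lambda>x. (- k n r) * nrm x)"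
      proof (rule sphint_cong)
        fix y assume "y \<in> sphere a r"
        then have y: "dist a y = r" by simp
        then show "zg n y \<bullet> h y = - k n r * nrm y"
        proof -
          have r0: "r \<noteq> 0" using r R by auto
          have "zg n y = - (k n r / r) *\<^sub>R (y - a)"
            using r0 by (simp add: zg_def bumpg_def k_def sqd y)
          then have "zg n y \<bullet> h y = - (k n r / r) * ((y - a) \<bullet> h y)" by simp
          moreover have "nrm y = (1 / r) * ((y - a) \<bullet> h y)" by (simp add: nrm_def y inner_commute)
          ultimately show ?thesis by simp
        qed
      qed (use r R in auto)
      then show "sphint a r (\<lambda>x. zg n x \<bullet> h x) = - (k n r * sphint a r nrm)"
        using sphint_cmult[of a r "- k n r" nrm] by simp
    qed
    also have "\<dots> = - integral {R..Rm} (\<lambda>r. k n r * sphint a r nrm)" by simp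
    finally show ?thesis .
  qed
  have HR: "(\<lambda>n. integral {R..Rm} (\<lambda>r. k n r * sphint a r nrm)) \<longlonglongrightarrow> sphint a R nrm"
    unfolding k_def \<epsilon>_def
    by (rule integral_approximate_identity[OF R(1) Rm continuous_on_sphint[OF R(1)]]) (use cn in \<open>simp add: K'_def\<close>)
  define A where "A = (\<lambda>x. bump a s t x * trace (J x) + bumpg a s t x \<bullet> h x)"
  \<comment> \<open>The gradient of \<open>z n\<close> is unbounded in \<open>n\<close> and is left
    to the approximate identity. What remains, \<open>B n\<close>, converges with domination because
    \<open>z n\<close> lies between zero and the outer cutoff.\<close>
  define B where "B = (\<lambda>n x. (bump a s t x - z n x) * trace (J x) + bumpg a s t x \<bullet> h x)"
  have Bf: "B n x = f n x + zg n x \<bullet> h x" for n x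
    by (simp add: B_def f_def inner_diff_left)
  have Bint: "set_integrable lborel ?S (B n)" for n
    unfolding Bf[abs_def] by (intro set_integral_add core zi)
  have BI: "(LINT x:?S|lborel. B n x) = - integral {R..Rm} (\<lambda>r. k n r * sphint a r nrm)" for n
    unfolding Bf using core[of n] zi[of n] zI[of n] by (subst set_integral_add) auto
  have Aint: "set_integrable lborel ?S A" unfolding A_def by (intro set_integral_add int i2)
  have zle: "0 \<le> z n x" "z n x \<le> bump a s t x" for n x
  proof -
    show "0 \<le> z n x" by (simp add: z_def bump_nonneg)
    show "z n x \<le> bump a s t x"
    proof (cases "(norm (x - a))\<^sup>2 \<le> s")
      case True then show ?thesis using R by (simp add: z_def bump_le_1 bump_eq_1)
    next
      case False then show ?thesis using e[of n] e2[of n] by (simp add: z_def bump_eq_0 bump_nonneg)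
    qed
  qed
  have "(\<lambda>n. LINT x|lborel. indicator ?S x *\<^sub>R B n x) \<longlonglongrightarrow> (LINT x|lborel. indicator ?S x *\<^sub>R A x)"
  proof (rule integral_dominated_convergence)
    show "(\<lambda>x. indicator ?S x *\<^sub>R A x) \<in> borel_measurable lborel"
      using Aint unfolding set_integrable_def by (rule borel_measurable_integrable)
    show "(\<lambda>x. indicator ?S x *\<^sub>R B n x) \<in> borel_measurable lborel" for n
      using Bint unfolding set_integrable_def by (rule borel_measurable_integrable)
    show "integrable lborel (\<lambda>x. norm (indicator ?S x *\<^sub>R (bump a s t x * trace (J x))) + norm (indicator ?S x *\<^sub>R (bumpg a s t x \<bullet> h x)))"
      using int i2 unfolding set_integrable_def by (intro Bochner_Integration.integrable_add integrable_norm)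
    show "AE x in lborel. (\<lambda>n. indicator ?S x *\<^sub>R B n x) \<longlonglongrightarrow> indicator ?S x *\<^sub>R A x"
    proof (rule AE_I2)
      fix x
      show "(\<lambda>n. indicator ?S x *\<^sub>R B n x) \<longlonglongrightarrow> indicator ?S x *\<^sub>R A x"
      proof (cases "x \<in> ?S")
        case True
        then have "R\<^sup>2 < (dist a x)\<^sup>2" using R by (intro power_strict_mono) auto
        then have "\<forall>\<^sub>F n in sequentially. 2 * \<epsilon> n < (dist a x)\<^sup>2 - R\<^sup>2"
          using order_tendstoD(2)[OF tendsto_mult_right_zero[OF elim, of 2]] by simp
        then have ev: "\<forall>\<^sub>F n in sequentially. indicator ?S x *\<^sub>R A x = indicator ?S x *\<^sub>R B n x"
        proof eventually_elim
          case (elim n)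
          have "z n x = 0" unfolding z_def using elim e[of n] by (intro bump_eq_0) (auto simp: sqd)
          then show ?case by (simp add: A_def B_def)
        qed
        show ?thesis by (rule Lim_transform_eventually[OF tendsto_const ev])
      qed simp
    qed
    show "AE x in lborel. norm (indicator ?S x *\<^sub>R B n x) \<le> norm (indicator ?S x *\<^sub>R (bump a s t x * trace (J x))) + norm (indicator ?S x *\<^sub>R (bumpg a s t x \<bullet> h x))" for n
    proof (rule AE_I2)
      fix x
      have "\<bar>(bump a s t x - z n x) * trace (J x)\<bar> \<le> \<bar>bump a s t x * trace (J x)\<bar>"
        unfolding abs_mult using zle[where n=n and x=x] by (intro mult_right_mono) auto
      then show "norm (indicator ?S x *\<^sub>R B n x) \<le> norm (indicator ?S x *\<^sub>R (bump a s t x * trace (J x))) + norm (indicator ?S x *\<^sub>R (bumpg a s t x \<bullet> h x))"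
        by (auto simp: B_def indicator_def intro: order_trans[OF abs_triangle_ineq])
    qed
  qed
  then have "(\<lambda>n. - integral {R..Rm} (\<lambda>r. k n r * sphint a r nrm)) \<longlonglongrightarrow> (LINT x:?S|lborel. A x)"
    unfolding BI[symmetric] set_lebesgue_integral_def .
  then have "(LINT x:?S|lborel. A x) = - sphint a R nrm"
    using LIMSEQ_unique tendsto_minus[OF HR] by blast
  also have "sphint a R nrm = sphint a R (\<lambda>y. h y \<bullet> ((1 / R) *\<^sub>R (y - a)))"
    by (rule sphint_cong) (use R in \<open>auto simp: nrm_def\<close>)
  finally show "(LINT x:?S|lborel. bump a s t x * trace (J x) + bumpg a s t x \<bullet> h x)
      = - sphint a R (\<lambda>y. h y \<bullet> ((1 / R) *\<^sub>R (y - a)))" unfolding A_def .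
qed

section \<open>Moments over spheres and calculus of Jacobians\<close>

lemma has_integral_times_2:
  fixes p q :: "real \<Rightarrow> real"
  assumes "continuous_on {0..pi} p" "continuous_on {0..2 * pi} q"
    and "(p has_integral A) {0..pi}" "(q has_integral B) {0..2 * pi}"
  shows "((\<lambda>(\<theta>, \<phi>). p \<theta> * q \<phi>) has_integral A * B) (cbox (0, 0) (pi, 2 * pi))"
proof -
  have c: "continuous_on (cbox (0, 0) (pi, 2 * pi)) (\<lambda>(\<theta>, \<phi>). p \<theta> * q \<phi>)"
    unfolding case_prod_beta'
    by (intro continuous_on_mult continuous_on_compose2[OF assms(1)] continuous_on_compose2[OF assms(2)]
        continuous_intros) (auto simp: cbox_Pair_iff)
  have "integral (cbox (0, 0) (pi, 2 * pi)) (\<lambda>(\<theta>, \<phi>). p \<theta> * q \<phi>)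
      = integral (cbox 0 pi) (\<lambda>\<theta>. integral (cbox 0 (2 * pi)) (\<lambda>\<phi>. p \<theta> * q \<phi>))"
    using integral_prod_continuous[OF c] by simp
  also have "\<dots> = A * B"
    using assms(3,4) by (simp add: integral_unique)
  finally show ?thesis using integrable_integral[OF integrable_continuous[OF c]] by simp
qed

lemma has_integral_antiderivative:
  fixes F f :: "real \<Rightarrow> real"
  assumes "\<And>x. (F has_real_derivative f x) (at x)" "a \<le> b"
  shows "(f has_integral (F b - F a)) {a..b}"
  by (rule fundamental_theorem_of_calculus[OF assms(2)])
    (use assms(1) in \<open>metis has_real_derivative_iff_has_vector_derivative has_vector_derivative_at_within\<close>)

lemma has_integral_trig_pi:
  "((\<lambda>t. sin t) has_integral 2) {0..pi}"
  "((\<lambda>t. sin t * cos t) has_integral 0) {0..pi}"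
  "((\<lambda>t. sin t * (cos t)\<^sup>2) has_integral 2 / 3) {0..pi}"
  "((\<lambda>t. (sin t) ^ 3) has_integral 4 / 3) {0..pi}"
proof -
  have "((\<lambda>t. sin t) has_integral (- cos pi - (- cos 0))) {0..pi}"
    by (rule has_integral_antiderivative) (auto intro!: derivative_eq_intros)
  then show 1: "((\<lambda>t. sin t) has_integral 2) {0..pi}" by simp
  have "((\<lambda>t. sin t * cos t) has_integral ((sin pi)\<^sup>2 / 2 - (sin 0)\<^sup>2 / 2)) {0..pi}"
    by (rule has_integral_antiderivative) (auto intro!: derivative_eq_intros)
  then show "((\<lambda>t. sin t * cos t) has_integral 0) {0..pi}" by simp
  have "((\<lambda>t. sin t * (cos t)\<^sup>2) has_integral (- ((cos pi) ^ 3 / 3) - (- ((cos 0) ^ 3 / 3)))) {0..pi}"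
    by (rule has_integral_antiderivative) (auto intro!: derivative_eq_intros)
  then show 3: "((\<lambda>t. sin t * (cos t)\<^sup>2) has_integral 2 / 3) {0..pi}" by simp
  have "(sin t) ^ 3 = sin t - sin t * (cos t)\<^sup>2" for t :: real
  proof -
    have "(sin t) ^ 3 = sin t * (sin t)\<^sup>2" by (simp add: power3_eq_cube power2_eq_square)
    also have "\<dots> = sin t - sin t * (cos t)\<^sup>2" by (simp only: sin_squared_eq right_diff_distrib mult_1_right)
    finally show ?thesis .
  qed
  then show "((\<lambda>t. (sin t) ^ 3) has_integral 4 / 3) {0..pi}"
    using has_integral_diff[OF 1 3] by simp
qed

lemma has_integral_trig_2pi:
  "((\<lambda>t. 1) has_integral 2 * pi) {0..2 * pi}"
  "((\<lambda>t. cos t) has_integral 0) {0..2 * pi}"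
  "((\<lambda>t. sin t) has_integral 0) {0..2 * pi}"
  "((\<lambda>t. cos t * sin t) has_integral 0) {0..2 * pi}"
  "((\<lambda>t. (cos t)\<^sup>2) has_integral pi) {0..2 * pi}"
  "((\<lambda>t. (sin t)\<^sup>2) has_integral pi) {0..2 * pi}"
proof -
  show 1: "((\<lambda>t. 1) has_integral 2 * pi) {0..2 * pi}"
    using has_integral_const_real[of "1::real" 0 "2 * pi"] by simp
  have "((\<lambda>t. cos t) has_integral (sin (2 * pi) - sin 0)) {0..2 * pi}"
    by (rule has_integral_antiderivative) (auto intro!: derivative_eq_intros)
  then show "((\<lambda>t. cos t) has_integral 0) {0..2 * pi}" by simp
  have "((\<lambda>t. sin t) has_integral (- cos (2 * pi) - (- cos 0))) {0..2 * pi}"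
    by (rule has_integral_antiderivative) (auto intro!: derivative_eq_intros)
  then show "((\<lambda>t. sin t) has_integral 0) {0..2 * pi}" by simp
  have "((\<lambda>t. cos t * sin t) has_integral ((sin (2 * pi))\<^sup>2 / 2 - (sin 0)\<^sup>2 / 2)) {0..2 * pi}"
    by (rule has_integral_antiderivative) (auto intro!: derivative_eq_intros)
  then show "((\<lambda>t. cos t * sin t) has_integral 0) {0..2 * pi}" by simp
  have "1 / 2 + (cos t * cos t - sin t * sin t) / 2 = (cos t)\<^sup>2" for t :: real
    using sin_cos_squared_add[of t] by (simp add: power2_eq_square field_simps)
  then have "((\<lambda>t. (cos t)\<^sup>2) has_integral ((2 * pi / 2 + sin (2 * pi) * cos (2 * pi) / 2) - (0 / 2 + sin 0 * cos 0 / 2))) {0..2 * pi}"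
    by (intro has_integral_antiderivative) (auto intro!: derivative_eq_intros simp: field_simps)
  then show 5: "((\<lambda>t. (cos t)\<^sup>2) has_integral pi) {0..2 * pi}" by simp
  show "((\<lambda>t. (sin t)\<^sup>2) has_integral pi) {0..2 * pi}"
    using has_integral_diff[OF 1 5] by (simp add: sin_squared_eq)
qed

lemma sphint_const: "sphint a r (\<lambda>y. c) = 4 * pi * r\<^sup>2 * c"
proof -
  have "((\<lambda>(\<theta>, \<phi>). sin \<theta> * 1) has_integral 2 * (2 * pi)) (cbox (0, 0) (pi, 2 * pi))"
    by (rule has_integral_times_2) (auto intro!: continuous_intros has_integral_trig_pi has_integral_trig_2pi)
  from has_integral_mult_right[OF this, of "r\<^sup>2 * c"]
  have "((\<lambda>(\<theta>, \<phi>). r\<^sup>2 * sin \<theta> * c) has_integral r\<^sup>2 * c * (2 * (2 * pi))) (cbox (0, 0) (pi, 2 * pi))"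
    by (rule has_integral_eq[rotated]) auto
  from integral_unique[OF this] show ?thesis unfolding sphint_def by simp
qed

lemma sphint_linear: "sphint a r (\<lambda>y. b \<bullet> (y - a)) = 0"
proof -
  let ?C = "cbox (0, 0) (pi, 2 * pi)"
  note T = has_integral_times_2
  note I = continuous_intros has_integral_trig_pi has_integral_trig_2pi
  have "((\<lambda>(\<theta>, \<phi>). (sin \<theta>)\<^sup>2 * cos \<phi>) has_integral integral {0..pi} (\<lambda>\<theta>. (sin \<theta>)\<^sup>2) * 0) ?C"
    by (rule T) (auto intro!: I integrable_integral integrable_continuous_interval)
  moreover have "((\<lambda>(\<theta>, \<phi>). (sin \<theta>)\<^sup>2 * sin \<phi>) has_integral integral {0..pi} (\<lambda>\<theta>. (sin \<theta>)\<^sup>2) * 0) ?C"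
    by (rule T) (auto intro!: I integrable_integral integrable_continuous_interval)
  moreover have "((\<lambda>(\<theta>, \<phi>). (sin \<theta> * cos \<theta>) * 1) has_integral 0 * (2 * pi)) ?C"
    by (rule T) (auto intro!: I)
  ultimately have "((\<lambda>p. r ^ 3 * b $ 1 * (\<lambda>(\<theta>, \<phi>). (sin \<theta>)\<^sup>2 * cos \<phi>) p
      + r ^ 3 * b $ 2 * (\<lambda>(\<theta>, \<phi>). (sin \<theta>)\<^sup>2 * sin \<phi>) p
      + r ^ 3 * b $ 3 * (\<lambda>(\<theta>, \<phi>). (sin \<theta> * cos \<theta>) * 1) p) has_integral
       (r ^ 3 * b $ 1 * (integral {0..pi} (\<lambda>\<theta>. (sin \<theta>)\<^sup>2) * 0)
      + r ^ 3 * b $ 2 * (integral {0..pi} (\<lambda>\<theta>. (sin \<theta>)\<^sup>2) * 0)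
      + r ^ 3 * b $ 3 * (0 * (2 * pi)))) ?C"
    by (intro has_integral_add has_integral_mult_right)
  then have "((\<lambda>(\<theta>, \<phi>). r\<^sup>2 * sin \<theta> * (b \<bullet> (a + r *\<^sub>R sph \<theta> \<phi> - a))) has_integral
       (r ^ 3 * b $ 1 * (integral {0..pi} (\<lambda>\<theta>. (sin \<theta>)\<^sup>2) * 0)
      + r ^ 3 * b $ 2 * (integral {0..pi} (\<lambda>\<theta>. (sin \<theta>)\<^sup>2) * 0)
      + r ^ 3 * b $ 3 * (0 * (2 * pi)))) ?C"
    by (rule has_integral_eq[rotated])
      (simp add: case_prod_beta' inner_vec_def sum_3 algebra_simps power2_eq_square power3_eq_cube)
  then have "((\<lambda>(\<theta>, \<phi>). r\<^sup>2 * sin \<theta> * (b \<bullet> (a + r *\<^sub>R sph \<theta> \<phi> - a))) has_integral 0) ?C" by simp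
  then show ?thesis unfolding sphint_def by (rule integral_unique)
qed

text \<open>The squares of the three components of the normal have the same mean 1/3 and the mixed
  products have mean zero. The formula enters the work of the rotlet stress, where the square of a
  cross product is integrated.\<close>

lemma sphint_quadratic: "sphint a r (\<lambda>y. (b \<bullet> (y - a))\<^sup>2) = 4 * pi / 3 * r ^ 4 * (norm b)\<^sup>2"
proof -
  let ?C = "cbox (0, 0) (pi, 2 * pi)"
  note T = has_integral_times_2
  note I = continuous_intros has_integral_trig_pi has_integral_trig_2pi
  let ?S = "integral {0..pi} (\<lambda>\<theta>. (sin \<theta>)\<^sup>2 * cos \<theta>)"
  have 1: "((\<lambda>(\<theta>, \<phi>). (sin \<theta>) ^ 3 * (cos \<phi>)\<^sup>2) has_integral 4 / 3 * pi) ?C"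
    by (rule T) (auto intro!: I)
  have 2: "((\<lambda>(\<theta>, \<phi>). (sin \<theta>) ^ 3 * (sin \<phi>)\<^sup>2) has_integral 4 / 3 * pi) ?C"
    by (rule T) (auto intro!: I)
  have 3: "((\<lambda>(\<theta>, \<phi>). (sin \<theta> * (cos \<theta>)\<^sup>2) * 1) has_integral 2 / 3 * (2 * pi)) ?C"
    by (rule T) (auto intro!: I)
  have 4: "((\<lambda>(\<theta>, \<phi>). (sin \<theta>) ^ 3 * (cos \<phi> * sin \<phi>)) has_integral 4 / 3 * 0) ?C"
    by (rule T) (auto intro!: I)
  have 5: "((\<lambda>(\<theta>, \<phi>). ((sin \<theta>)\<^sup>2 * cos \<theta>) * cos \<phi>) has_integral ?S * 0) ?C"
    by (rule T) (auto intro!: I integrable_integral integrable_continuous_interval)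
  have 6: "((\<lambda>(\<theta>, \<phi>). ((sin \<theta>)\<^sup>2 * cos \<theta>) * sin \<phi>) has_integral ?S * 0) ?C"
    by (rule T) (auto intro!: I integrable_integral integrable_continuous_interval)
  from 1 2 3 4 5 6 have "((\<lambda>p. r ^ 4 * (b $ 1)\<^sup>2 * (\<lambda>(\<theta>, \<phi>). (sin \<theta>) ^ 3 * (cos \<phi>)\<^sup>2) p
      + r ^ 4 * (b $ 2)\<^sup>2 * (\<lambda>(\<theta>, \<phi>). (sin \<theta>) ^ 3 * (sin \<phi>)\<^sup>2) p
      + r ^ 4 * (b $ 3)\<^sup>2 * (\<lambda>(\<theta>, \<phi>). (sin \<theta> * (cos \<theta>)\<^sup>2) * 1) p
      + r ^ 4 * (2 * b $ 1 * b $ 2) * (\<lambda>(\<theta>, \<phi>). (sin \<theta>) ^ 3 * (cos \<phi> * sin \<phi>)) p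
      + r ^ 4 * (2 * b $ 1 * b $ 3) * (\<lambda>(\<theta>, \<phi>). ((sin \<theta>)\<^sup>2 * cos \<theta>) * cos \<phi>) p
      + r ^ 4 * (2 * b $ 2 * b $ 3) * (\<lambda>(\<theta>, \<phi>). ((sin \<theta>)\<^sup>2 * cos \<theta>) * sin \<phi>) p) has_integral
      (r ^ 4 * (b $ 1)\<^sup>2 * (4 / 3 * pi) + r ^ 4 * (b $ 2)\<^sup>2 * (4 / 3 * pi) + r ^ 4 * (b $ 3)\<^sup>2 * (2 / 3 * (2 * pi))
       + r ^ 4 * (2 * b $ 1 * b $ 2) * (4 / 3 * 0) + r ^ 4 * (2 * b $ 1 * b $ 3) * (?S * 0)
       + r ^ 4 * (2 * b $ 2 * b $ 3) * (?S * 0))) ?C"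
    by (intro has_integral_add has_integral_mult_right)
  then have "((\<lambda>(\<theta>, \<phi>). r\<^sup>2 * sin \<theta> * (b \<bullet> (a + r *\<^sub>R sph \<theta> \<phi> - a))\<^sup>2) has_integral
      (r ^ 4 * (b $ 1)\<^sup>2 * (4 / 3 * pi) + r ^ 4 * (b $ 2)\<^sup>2 * (4 / 3 * pi) + r ^ 4 * (b $ 3)\<^sup>2 * (2 / 3 * (2 * pi))
       + r ^ 4 * (2 * b $ 1 * b $ 2) * (4 / 3 * 0) + r ^ 4 * (2 * b $ 1 * b $ 3) * (?S * 0)
       + r ^ 4 * (2 * b $ 2 * b $ 3) * (?S * 0))) ?C"
    by (rule has_integral_eq[rotated])
      (simp add: case_prod_beta' inner_vec_def sum_3 algebra_simps power2_eq_square power3_eq_cube power4_eq_xxxx)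
  from integral_unique[OF this] have "sphint a r (\<lambda>y. (b \<bullet> (y - a))\<^sup>2)
      = 4 * pi / 3 * r ^ 4 * ((b $ 1)\<^sup>2 + (b $ 2)\<^sup>2 + (b $ 3)\<^sup>2)"
    unfolding sphint_def by (simp add: algebra_simps)
  also have "(b $ 1)\<^sup>2 + (b $ 2)\<^sup>2 + (b $ 3)\<^sup>2 = (norm b)\<^sup>2"
    unfolding power2_norm_eq_inner by (simp add: inner_vec_def sum_3 power2_eq_square)
  finally show ?thesis .
qed

section \<open>Tensor products and rules for gradients and Jacobians\<close>

definition outer :: "real^3 \<Rightarrow> real^3 \<Rightarrow> real^3^3" where
  "outer a b = (\<chi> i j. a $ i * b $ j)"

lemma outer_component: "outer a b $ i $ j = a $ i * b $ j" and outer_row: "outer a b $ i = a $ i *\<^sub>R b"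
  by (simp_all add: outer_def vec_eq_iff)

lemma outer_mult: "outer a b *v v = (b \<bullet> v) *\<^sub>R a"
  by (simp add: vec_eq_iff matrix_vector_mult_def outer_def inner_vec_def sum_distrib_left mult_ac)

lemma trace_outer: "trace (outer a b) = a \<bullet> b"
  by (simp add: trace_def outer_def inner_vec_def)

lemma norm_outer: "norm (outer a b) = norm a * norm b"
proof -
  have "outer a b \<bullet> outer a b = (a \<bullet> a) * (b \<bullet> b)"
    by (simp add: inner_vec_def outer_def sum_product mult_ac)
  then show ?thesis by (simp add: norm_eq_sqrt_inner real_sqrt_mult)
qed

lemma trace_scaleR: "trace (c *\<^sub>R A) = c * trace A" for A :: "real^'n^'n"
  by (simp add: trace_def sum_distrib_left)

lemma trace_sum: "trace (\<Sum>i\<in>I. A i) = (\<Sum>i\<in>I. trace (A i))" for A :: "'i \<Rightarrow> real^'n^'n"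
  by (induction I rule: infinite_finite_induct) (auto simp: trace_def sum.distrib)

text \<open>Row by row, every rule for vector fields reduces to the rule for scalar
  functions.\<close>

lemma jacobian_on_iff:
  "jacobian_on S h J \<longleftrightarrow> (\<forall>i. gradient_on S (\<lambda>x. h x $ i) (\<lambda>x. J x $ i))"
proof
  assume h: "jacobian_on S h J"
  show "\<forall>i. gradient_on S (\<lambda>x. h x $ i) (\<lambda>x. J x $ i)"
  proof (intro allI, unfold gradient_on_def, intro conjI ballI)
    fix i x assume "x \<in> S"
    then have "(h has_derivative (\<lambda>v. J x *v v)) (at x)" using h by (auto simp: jacobian_on_def)
    from bounded_linear.has_derivative[OF bounded_linear_vec_nth this, of i]
    show "((\<lambda>x. h x $ i) has_derivative (\<bullet>) (J x $ i)) (at x)"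
      by (simp add: matrix_vector_mul_component)
  qed (use h in \<open>auto simp: jacobian_on_def intro!: continuous_intros\<close>)
next
  assume g: "\<forall>i. gradient_on S (\<lambda>x. h x $ i) (\<lambda>x. J x $ i)"
  show "jacobian_on S h J"
    unfolding jacobian_on_def
  proof (intro conjI ballI)
    fix x assume "x \<in> S"
    then show "(h has_derivative (*v) (J x)) (at x)"
      using g by (intro has_derivative_vec_componentwise) (auto simp: gradient_on_def matrix_vector_mul_component)
  next
    have "continuous_on S (\<lambda>x. \<chi> i. J x $ i)"
      using g by (intro continuous_on_vec_lambda) (auto simp: gradient_on_def)
    then show "continuous_on S J" by simp
  qed
qed

lemma gradient_on_continuous: "gradient_on S f G \<Longrightarrow> continuous_on S f"
  unfolding gradient_on_def
  by (meson has_derivative_at_withinI has_derivative_continuous_on)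

lemma jacobian_on_continuous: "jacobian_on S f G \<Longrightarrow> continuous_on S f"
  unfolding jacobian_on_def
  by (meson has_derivative_at_withinI has_derivative_continuous_on)

lemma gradient_on_subset: "gradient_on S f G \<Longrightarrow> T \<subseteq> S \<Longrightarrow> gradient_on T f G"
  unfolding gradient_on_def using continuous_on_subset by blast

lemma jacobian_on_subset: "jacobian_on S f G \<Longrightarrow> T \<subseteq> S \<Longrightarrow> jacobian_on T f G"
  unfolding jacobian_on_def using continuous_on_subset by blast

lemma gradient_on_const: "gradient_on S (\<lambda>x. c) (\<lambda>x. 0)"
  by (simp add: gradient_on_def)

lemma gradient_on_add:
  "gradient_on S f F \<Longrightarrow> gradient_on S g G \<Longrightarrow> gradient_on S (\<lambda>x. f x + g x) (\<lambda>x. F x + G x)"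
  unfolding gradient_on_def
  by (auto simp: inner_add_left fun_eq_iff intro!: has_derivative_eq_rhs[OF has_derivative_add] continuous_intros)

lemma gradient_on_sum:
  "(\<And>i. i \<in> I \<Longrightarrow> gradient_on S (f i) (F i)) \<Longrightarrow> gradient_on S (\<lambda>x. \<Sum>i\<in>I. f i x) (\<lambda>x. \<Sum>i\<in>I. F i x)"
  by (induction I rule: infinite_finite_induct) (auto intro!: gradient_on_const gradient_on_add)

lemma gradient_on_mult:
  assumes "gradient_on S f F" "gradient_on S g G"
  shows "gradient_on S (\<lambda>x. f x * g x) (\<lambda>x. f x *\<^sub>R G x + g x *\<^sub>R F x)"
  using assms gradient_on_continuous[OF assms(1)] gradient_on_continuous[OF assms(2)]
  unfolding gradient_on_def
  by (auto intro!: continuous_intros has_derivative_eq_rhs[OF has_derivative_mult] simp: inner_add_left fun_eq_iff)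

lemma gradient_on_cmult:
  "gradient_on S f F \<Longrightarrow> gradient_on S (\<lambda>x. c * f x) (\<lambda>x. c *\<^sub>R F x)"
  using gradient_on_mult[OF gradient_on_const[of S c]] by simp

lemma gradient_on_component: "gradient_on S (\<lambda>x. x $ i) (\<lambda>x. axis i 1)"
  unfolding gradient_on_def
  by (auto simp: inner_axis' fun_eq_iff
      intro!: has_derivative_eq_rhs[OF bounded_linear.has_derivative[OF bounded_linear_vec_nth has_derivative_ident]])

lemma gradient_on_shift:
  assumes "gradient_on S f F"
  shows "gradient_on {x. x - a \<in> S} (\<lambda>x. f (x - a)) (\<lambda>x. F (x - a))"
  unfolding gradient_on_def
proof (intro conjI ballI)
  fix x assume "x \<in> {x. x - a \<in> S}"
  then have "(f has_derivative (\<bullet>) (F (x - a))) (at (x - a))" using assms by (auto simp: gradient_on_def)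
  from has_derivative_compose[OF has_derivative_diff[OF has_derivative_ident has_derivative_const] this]
  show "((\<lambda>x. f (x - a)) has_derivative (\<bullet>) (F (x - a))) (at x)" by simp
next
  show "continuous_on {x. x - a \<in> S} (\<lambda>x. F (x - a))"
    by (rule continuous_on_compose2[of S F]) (use assms in \<open>auto simp: gradient_on_def intro!: continuous_intros\<close>)
qed

lemma gradient_on_transform:
  assumes "gradient_on S f F" "open S" "\<And>x. x \<in> S \<Longrightarrow> f x = g x"  "\<And>x. x \<in> S \<Longrightarrow> F x = G x"
  shows "gradient_on S g G"
  unfolding gradient_on_def
proof (intro conjI ballI)
  fix x assume x: "x \<in> S"
  then have "(f has_derivative (\<bullet>) (G x)) (at x)" using assms by (auto simp: gradient_on_def)
  then show "(g has_derivative (\<bullet>) (G x)) (at x)"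
    using has_derivative_transform_within_open[OF _ assms(2) x] assms(3) by blast
next
  show "continuous_on S G" using assms by (auto simp: gradient_on_def cong: continuous_on_cong_simp)
qed

lemma jacobian_on_add:
  "jacobian_on S f F \<Longrightarrow> jacobian_on S g G \<Longrightarrow> jacobian_on S (\<lambda>x. f x + g x) (\<lambda>x. F x + G x)"
  by (simp add: jacobian_on_iff gradient_on_add)

lemma jacobian_on_diff:
  "jacobian_on S f F \<Longrightarrow> jacobian_on S g G \<Longrightarrow> jacobian_on S (\<lambda>x. f x - g x) (\<lambda>x. F x - G x)"
  by (simp add: jacobian_on_iff gradient_on_diff)

lemma jacobian_on_const: "jacobian_on S (\<lambda>x. c) (\<lambda>x. 0)"
  by (simp add: jacobian_on_iff gradient_on_const)

lemma jacobian_on_sum: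
  "(\<And>i. i \<in> I \<Longrightarrow> jacobian_on S (f i) (F i)) \<Longrightarrow> jacobian_on S (\<lambda>x. \<Sum>i\<in>I. f i x) (\<lambda>x. \<Sum>i\<in>I. F i x)"
  by (simp add: jacobian_on_iff gradient_on_sum)

lemma jacobian_on_scaleR:
  assumes "gradient_on S f F" "jacobian_on S g G"
  shows "jacobian_on S (\<lambda>x. f x *\<^sub>R g x) (\<lambda>x. f x *\<^sub>R G x + outer (g x) (F x))"
  using assms by (simp add: jacobian_on_iff gradient_on_mult outer_row)

lemma jacobian_on_shift:
  "jacobian_on S f F \<Longrightarrow> jacobian_on {x. x - a \<in> S} (\<lambda>x. f (x - a)) (\<lambda>x. F (x - a))"
  using gradient_on_shift[of S "\<lambda>x. f x $ i" "\<lambda>x. F x $ i" a for i] by (simp add: jacobian_on_iff)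

lemma jacobian_on_transform:
  "jacobian_on S f F \<Longrightarrow> open S \<Longrightarrow> (\<And>x. x \<in> S \<Longrightarrow> f x = g x) \<Longrightarrow> (\<And>x. x \<in> S \<Longrightarrow> F x = G x) \<Longrightarrow> jacobian_on S g G"
  unfolding jacobian_on_iff
  using gradient_on_transform[of S "\<lambda>x. f x $ i" "\<lambda>x. F x $ i" "\<lambda>x. g x $ i" "\<lambda>x. G x $ i" for i] by simp

lemma jacobian_on_Un:
  assumes "jacobian_on S f F" "jacobian_on T f F" "open S" "open T"
  shows "jacobian_on (S \<union> T) f F"
  using assms unfolding jacobian_on_def by (auto intro: continuous_on_open_Un)

text \<open>Symmetric tensor fields with vanishing divergence, row by row.\<close>

definition stress_on :: "(real^3) set \<Rightarrow> (real^3 \<Rightarrow> real^3^3) \<Rightarrow> bool" where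
  "stress_on S \<sigma> \<longleftrightarrow> (\<forall>x\<in>S. transpose (\<sigma> x) = \<sigma> x) \<and>
     (\<forall>i. \<exists>T. jacobian_on S (\<lambda>x. \<sigma> x $ i) T \<and> (\<forall>x\<in>S. trace (T x) = 0))"

lemma stress_on_subset: "stress_on S \<sigma> \<Longrightarrow> T \<subseteq> S \<Longrightarrow> stress_on T \<sigma>"
  unfolding stress_on_def by (meson jacobian_on_subset subset_iff)

lemma stress_on_continuous: "stress_on S \<sigma> \<Longrightarrow> continuous_on S \<sigma>"
  unfolding stress_on_def
  using continuous_on_vec_lambda[of S "\<lambda>i x. \<sigma> x $ i"] jacobian_on_continuous by fastforce

text \<open>By symmetry \<open>\<sigma> \<phi>\<close> is the combination of the rows of
  \<open>\<sigma>\<close> with the components of \<open>\<phi>\<close> as weights. The product rule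
  leaves \<open>\<sigma> : J\<close>, because the rows are divergence free.\<close>

lemma stress_on_mult:
  assumes \<sigma>: "stress_on S \<sigma>" and \<phi>: "jacobian_on S \<phi> J" and S: "open S"
  obtains H where "jacobian_on S (\<lambda>x. \<sigma> x *v \<phi> x) H" "\<And>x. x \<in> S \<Longrightarrow> trace (H x) = \<sigma> x \<bullet> J x"
proof -
  obtain T where T: "\<And>i. jacobian_on S (\<lambda>x. \<sigma> x $ i) (T i)" "\<And>i x. x \<in> S \<Longrightarrow> trace (T i x) = 0"
    using \<sigma> unfolding stress_on_def by metis
  have sym: "\<sigma> x $ i $ j = \<sigma> x $ j $ i" if "x \<in> S" for x i j
  proof -
    have "transpose (\<sigma> x) = \<sigma> x" using \<sigma> that by (auto simp: stress_on_def)
    then have "transpose (\<sigma> x) $ i $ j = \<sigma> x $ i $ j" by simp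
    then show ?thesis by (simp add: transpose_def)
  qed
  define H where "H = (\<lambda>x. \<Sum>i\<in>UNIV. \<phi> x $ i *\<^sub>R T i x + outer (\<sigma> x $ i) (J x $ i))"
  have "jacobian_on S (\<lambda>x. \<Sum>i\<in>UNIV. \<phi> x $ i *\<^sub>R \<sigma> x $ i) H"
    unfolding H_def using \<phi> by (intro jacobian_on_sum jacobian_on_scaleR T) (auto simp: jacobian_on_iff)
  then have 1: "jacobian_on S (\<lambda>x. \<sigma> x *v \<phi> x) H"
    by (rule jacobian_on_transform[OF _ S])
      (auto simp: vec_eq_iff matrix_vector_mult_def sym mult_ac)
  have "trace (H x) = \<sigma> x \<bullet> J x" if "x \<in> S" for x
    using T(2)[OF that] by (simp add: H_def trace_sum trace_add trace_scaleR trace_outer inner_vec_def[of "\<sigma> x"])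
  then show ?thesis using that 1 by blast
qed

section \<open>Green's formula in the fluid domain\<close>

lemma fluid_domain_eq: "fluid_domain N R x = {y. \<forall>i\<in>{1..N}. R < dist (x i) y}"
  by (auto simp: fluid_domain_def not_le)

lemma open_fluid_domain: "open (fluid_domain N R x)"
  unfolding fluid_domain_def by (intro open_Diff closed_UN) auto

lemma matrix_vector_mult_norm_le: "norm (A *v v) \<le> norm A * norm v" for A :: "real^'n^'m"
proof -
  have "norm (A *v v) = L2_set (\<lambda>i. \<bar>A $ i \<bullet> v\<bar>) UNIV"
    by (simp add: norm_vec_def matrix_vector_mul_component)
  also have "\<dots> \<le> L2_set (\<lambda>i. norm (A $ i) * norm v) UNIV"
    by (intro L2_set_mono Cauchy_Schwarz_ineq2) auto
  also have "\<dots> = norm A * norm v"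
    by (simp add: L2_set_left_distrib norm_vec_def)
  finally show ?thesis .
qed

lemma matrix_vector_mult_continuous_on:
  fixes A :: "real^3 \<Rightarrow> real^3^3" and f :: "real^3 \<Rightarrow> real^3"
  assumes "continuous_on S A" "continuous_on S f"
  shows "continuous_on S (\<lambda>x. A x *v f x)"
  by (rule continuous_on_vec_componentwise)
    (auto simp: matrix_vector_mul_component intro!: continuous_intros assms)

lemma set_integrable_bound_continuous:
  fixes f :: "real^3 \<Rightarrow> real" and g :: "real^3 \<Rightarrow> real"
  assumes "set_integrable lborel S g" "S \<in> sets borel" "continuous_on S f" "\<And>x. x \<in> S \<Longrightarrow> \<bar>f x\<bar> \<le> g x"
  shows "set_integrable lborel S f"
  unfolding set_integrable_def
proof (rule Bochner_Integration.integrable_bound)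
  show "integrable lborel (\<lambda>x. indicator S x *\<^sub>R g x)" using assms(1) by (simp add: set_integrable_def)
  show "(\<lambda>x. indicator S x *\<^sub>R f x) \<in> borel_measurable lborel"
    using borel_measurable_continuous_on_indicator[OF assms(2,3)] by simp
  show "AE x in lborel. norm (indicator S x *\<^sub>R f x) \<le> norm (indicator S x *\<^sub>R g x)"
    by (rule AE_I2) (use assms(4) in \<open>fastforce simp: indicator_def\<close>)
qed

lemma set_integral_cong_support:
  fixes f :: "real^3 \<Rightarrow> real"
  assumes "\<And>x. x \<in> A \<Longrightarrow> x \<notin> B \<Longrightarrow> f x = 0" "\<And>x. x \<in> B \<Longrightarrow> x \<notin> A \<Longrightarrow> f x = 0"
  shows "set_integrable lborel A f = set_integrable lborel B f"
    "(LINT x:A|lborel. f x) = (LINT x:B|lborel. f x)"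
proof -
  have "(\<lambda>x. indicator A x *\<^sub>R f x) = (\<lambda>x. indicator B x *\<^sub>R f x)"
    using assms by (auto simp: fun_eq_iff indicator_def)
  then show "set_integrable lborel A f = set_integrable lborel B f"
    "(LINT x:A|lborel. f x) = (LINT x:B|lborel. f x)"
    by (simp_all add: set_integrable_def set_lebesgue_integral_def)
qed

lemma set_integral_sum:
  fixes f :: "'i \<Rightarrow> real^3 \<Rightarrow> real"
  assumes "finite I" "\<And>i. i \<in> I \<Longrightarrow> set_integrable lborel A (f i)"
  shows "set_integrable lborel A (\<lambda>x. \<Sum>i\<in>I. f i x)"
    "(LINT x:A|lborel. (\<Sum>i\<in>I. f i x)) = (\<Sum>i\<in>I. LINT x:A|lborel. f i x)"
  unfolding set_integrable_def set_lebesgue_integral_def scaleR_sum_right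
  by (intro Bochner_Integration.integrable_sum Bochner_Integration.integral_sum
      assms(2)[unfolded set_integrable_def], assumption)+

text \<open>Separation by \<open>4 * R\<close> makes the open balls of radius \<open>2 * R\<close>
  disjoint, so that cutoffs and correctors around different particles do not interact.\<close>

locale suspension =
  fixes N :: nat and R :: real and x :: "nat \<Rightarrow> real^3"
  assumes R: "0 < R" and sep: "\<And>i j. i \<in> {1..N} \<Longrightarrow> j \<in> {1..N} \<Longrightarrow> i \<noteq> j \<Longrightarrow> 4 * R \<le> dist (x i) (x j)"
begin

abbreviation "D \<equiv> fluid_domain N R x"

lemma shell_subset: "i \<in> {1..N} \<Longrightarrow> {y. R < dist (x i) y \<and> dist (x i) y < 2 * R} \<subseteq> D"
proof
  fix y assume i: "i \<in> {1..N}" and y: "y \<in> {y. R < dist (x i) y \<and> dist (x i) y < 2 * R}"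
  have "R < dist (x j) y" if "j \<in> {1..N}" for j
  proof (cases "j = i")
    case False
    then have "4 * R \<le> dist (x j) (x i)" using sep i that by auto
    also have "\<dots> \<le> dist (x j) y + dist (x i) y" by (metis dist_commute dist_triangle)
    finally show ?thesis using y R by auto
  qed (use y in auto)
  then show "y \<in> D" by (simp add: fluid_domain_eq)
qed

lemma closed_shell_subset: "i \<in> {1..N} \<Longrightarrow> {y. R \<le> dist (x i) y \<and> dist (x i) y < 2 * R} \<subseteq> closure D"
proof
  fix y assume i: "i \<in> {1..N}" and y: "y \<in> {y. R \<le> dist (x i) y \<and> dist (x i) y < 2 * R}"
  show "y \<in> closure D"
  proof (cases "R < dist (x i) y")
    case True
    then show ?thesis using shell_subset[OF i] y closure_subset by blast
  next
    case False
    then have yR: "norm (y - x i) = R" using y by (simp add: dist_norm norm_minus_commute)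
    show ?thesis
    proof (unfold closure_approachable, intro allI impI)
      fix e :: real assume e: "e > 0"
      \<comment> \<open>The point at distance \<open>(1 + t) * R\<close> on the ray through
        \<open>y\<close> has to stay in the shell, hence \<open>1/2\<close>, and within
        \<open>e\<close> of \<open>y\<close>.\<close>
      define t where "t = min (1/2) (e / (2 * R))"
      have t: "0 < t" "t \<le> 1/2" "t * R < e" using e R by (auto simp: t_def min_def field_simps)
      define z where "z = x i + (1 + t) *\<^sub>R (y - x i)"
      have "dist (x i) z = (1 + t) * R" using t yR by (simp add: z_def dist_norm)
      then have "R < dist (x i) z" "dist (x i) z < 2 * R" using t R by (auto simp: distrib_right) 
      then have "z \<in> D" using shell_subset[OF i] by auto
      moreover have "dist z y = norm (t *\<^sub>R (y - x i))" by (simp add: z_def dist_norm algebra_simps)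
      then have "dist z y < e" using t yR by simp
      ultimately show "\<exists>z\<in>D. dist z y < e" by blast
    qed
  qed
qed

lemma sphere_subset_closure: "i \<in> {1..N} \<Longrightarrow> sphere (x i) R \<subseteq> closure D"
  using closed_shell_subset R by force

text \<open>One cutoff \<open>\<theta> i\<close> isolates each sphere and
  \<open>\<omega> \<rho>\<close> cuts off at infinity. The weight
  \<open>\<omega> \<rho> - (\<Sum>i. \<theta> i)\<close> has compact support in the open domain and
  contributes nothing, while each \<open>\<theta> i\<close> contributes its sphere by
  \<open>local_green\<close>. As \<open>\<rho>\<close> grows, the flux term is at most a constant
  times \<open>1 / \<rho>\<close>, times the norm of \<open>\<phi>\<close> on the annulus, which
  \<open>growth\<close> bounds by a multiple of \<open>\<rho>\<close>, times the norm of
  \<open>\<sigma>\<close> there, which tends to zero.\<close>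

theorem green:
  assumes \<sigma>: "stress_on D \<sigma>" and c\<sigma>: "continuous_on (closure D) \<sigma>"
    and \<sigma>2: "set_integrable lborel D (\<lambda>y. (norm (\<sigma> y))\<^sup>2)"
    and \<phi>: "jacobian_on D \<phi> J" and c\<phi>: "continuous_on (closure D) \<phi>"
    and J2: "set_integrable lborel D (\<lambda>y. (norm (J y))\<^sup>2)"
    and growth: "\<And>\<rho>. \<rho> \<ge> \<rho>0 \<Longrightarrow> (LINT y:{y \<in> D. \<rho>\<^sup>2 \<le> (norm y)\<^sup>2 \<and> (norm y)\<^sup>2 \<le> 2 * \<rho>\<^sup>2}|lborel. (norm (\<phi> y))\<^sup>2) \<le> C * \<rho>\<^sup>2"
  shows "set_integrable lborel D (\<lambda>y. \<sigma> y \<bullet> J y)"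
    and "(LINT y:D|lborel. \<sigma> y \<bullet> J y) = - (\<Sum>i\<in>{1..N}. sphint (x i) R (\<lambda>y. (\<sigma> y *v \<phi> y) \<bullet> ((1 / R) *\<^sub>R (y - x i))))"
proof -
  have oD: "open D" by (rule open_fluid_domain)
  then have bD: "D \<in> sets borel" by simp
  define h where "h = (\<lambda>y. \<sigma> y *v \<phi> y)"
  obtain H where H: "jacobian_on D h H" "\<And>y. y \<in> D \<Longrightarrow> trace (H y) = \<sigma> y \<bullet> J y"
  proof (rule stress_on_mult[OF \<sigma> \<phi> oD])
    fix H assume "jacobian_on D (\<lambda>y. \<sigma> y *v \<phi> y) H" "\<And>y. y \<in> D \<Longrightarrow> trace (H y) = \<sigma> y \<bullet> J y"
    then show thesis by (rule that[unfolded h_def])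
  qed
  have ch: "continuous_on (closure D) h"
    unfolding h_def by (intro matrix_vector_mult_continuous_on c\<sigma> c\<phi>)
  have c\<sigma>D: "continuous_on D \<sigma>" and c\<phi>D: "continuous_on D \<phi>"
    using c\<sigma> ch c\<phi> closure_subset continuous_on_subset by blast+
  have cJ: "continuous_on D J" using \<phi> by (simp add: jacobian_on_def)
  have half: "a * b \<le> a\<^sup>2 + b\<^sup>2" for a b :: real
  proof -
    have "2 * (a * b) \<le> a\<^sup>2 + b\<^sup>2" using sum_squares_bound[of a b] by (simp add: mult.assoc)
    moreover have "0 \<le> a\<^sup>2 + b\<^sup>2" by simp
    ultimately show ?thesis by linarith
  qed
  show \<sigma>J: "set_integrable lborel D (\<lambda>y. \<sigma> y \<bullet> J y)"
  proof (rule set_integrable_bound_continuous[OF set_integral_add(1)[OF \<sigma>2 J2] bD])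
    show "continuous_on D (\<lambda>y. \<sigma> y \<bullet> J y)" by (intro continuous_intros c\<sigma>D cJ)
    show "\<bar>\<sigma> y \<bullet> J y\<bar> \<le> (norm (\<sigma> y))\<^sup>2 + (norm (J y))\<^sup>2" for y
      using Cauchy_Schwarz_ineq2[of "\<sigma> y" "J y"] half[of "norm (\<sigma> y)" "norm (J y)"] by linarith
  qed
  \<comment> \<open>The squared radii \<open>2 * R^2\<close> and \<open>3 * R^2\<close> lie strictly
    between \<open>R^2\<close> and \<open>(2 * R)^2\<close>, so the transition takes place inside
    the shell that belongs to particle \<open>i\<close> alone.\<close>
  define \<theta> where "\<theta> = (\<lambda>i. bump (x i) (2 * R\<^sup>2) (3 * R\<^sup>2))"
  define \<theta>g where "\<theta>g = (\<lambda>i. bumpg (x i) (2 * R\<^sup>2) (3 * R\<^sup>2))"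
  have R2: "R\<^sup>2 > 0" using R by simp
  have nd: "norm (y - a) = dist a y" for y a :: "real^3" by (simp add: dist_norm norm_minus_commute)
  have \<theta>0: "\<theta> i y = 0" "\<theta>g i y = 0" if "3 * R\<^sup>2 \<le> (dist (x i) y)\<^sup>2" for i y
    using that R2 by (auto simp: \<theta>_def \<theta>g_def bump_eq_0 bumpg_eq_0 nd)
  have far: "3 * R\<^sup>2 \<le> (dist (x i) y)\<^sup>2" if "2 * R \<le> dist (x i) y" for i y
  proof -
    have "(2 * R)\<^sup>2 \<le> (dist (x i) y)\<^sup>2" using that R by (intro power_mono) auto
    then have "4 * R\<^sup>2 \<le> (dist (x i) y)\<^sup>2" by (simp add: power_mult_distrib)
    then show ?thesis using R2 by linarith
  qed
  have loc: "set_integrable lborel D (\<lambda>y. \<theta> i y * (\<sigma> y \<bullet> J y) + \<theta>g i y \<bullet> h y)"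
    "(LINT y:D|lborel. \<theta> i y * (\<sigma> y \<bullet> J y) + \<theta>g i y \<bullet> h y) = - sphint (x i) R (\<lambda>y. h y \<bullet> ((1 / R) *\<^sub>R (y - x i)))"
    if i: "i \<in> {1..N}" for i
  proof -
    let ?S = "{y. R < dist (x i) y \<and> dist (x i) y < 2 * R}"
    have SD: "?S \<subseteq> D" by (rule shell_subset[OF i])
    have "?S = ball (x i) (2 * R) - cball (x i) R" by auto
    then have oS: "open ?S" by (simp add: open_Diff)
    then have bS: "?S \<in> sets borel" by simp
    have \<sigma>JS: "set_integrable lborel ?S (\<lambda>y. \<theta> i y * (\<sigma> y \<bullet> J y))"
    proof (rule set_integrable_bound_continuous[OF _ bS])
      show "set_integrable lborel ?S (\<lambda>y. \<bar>\<sigma> y \<bullet> J y\<bar>)"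
        using set_integrable_subset[OF set_integrable_abs[OF \<sigma>J] _ SD] bS by simp
      show "continuous_on ?S (\<lambda>y. \<theta> i y * (\<sigma> y \<bullet> J y))" unfolding \<theta>_def
        by (intro continuous_intros continuous_on_bump continuous_on_subset[OF c\<sigma>D SD] continuous_on_subset[OF cJ SD])
      show "\<bar>\<theta> i y * (\<sigma> y \<bullet> J y)\<bar> \<le> \<bar>\<sigma> y \<bullet> J y\<bar>" for y
        unfolding abs_mult \<theta>_def by (rule mult_left_le_one_le) (auto simp: bump_nonneg bump_le_1)
    qed
    have eqS: "\<theta> i y * trace (H y) = \<theta> i y * (\<sigma> y \<bullet> J y)" if "y \<in> ?S" for y
      using H(2) SD that by auto
    have int: "set_integrable lborel ?S (\<lambda>y. \<theta> i y * trace (H y))"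
      by (subst set_integrable_cong[OF refl refl eqS]) (assumption | rule \<sigma>JS)+
    have HS: "jacobian_on ?S h H" by (rule jacobian_on_subset[OF H(1) SD])
    have chS: "continuous_on {y. R \<le> dist (x i) y \<and> dist (x i) y < 2 * R} h"
      by (rule continuous_on_subset[OF ch closed_shell_subset[OF i]])
    have a: "R\<^sup>2 < 2 * R\<^sup>2" "2 * R\<^sup>2 < 3 * R\<^sup>2" "3 * R\<^sup>2 < (2 * R)\<^sup>2" "0 < 2 * R"
      using R R2 by (auto simp: power_mult_distrib)
    note L = local_green[OF R a HS chS int[unfolded \<theta>_def]]
    have LI: "set_integrable lborel ?S (\<lambda>y. \<theta> i y * (\<sigma> y \<bullet> J y) + \<theta>g i y \<bullet> h y)"
      using set_integral_add(1)[OF \<sigma>JS] L(1) unfolding \<theta>g_def by blast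
    have supp: "\<theta> i y * (\<sigma> y \<bullet> J y) + \<theta>g i y \<bullet> h y = 0" if "y \<in> D" "y \<notin> ?S" for y
    proof -
      have "2 * R \<le> dist (x i) y" using that i by (auto simp: fluid_domain_eq)
      then show ?thesis using \<theta>0[OF far] by simp
    qed
    note eq = set_integral_cong_support[of D ?S "\<lambda>y. \<theta> i y * (\<sigma> y \<bullet> J y) + \<theta>g i y \<bullet> h y", OF supp]
    show "set_integrable lborel D (\<lambda>y. \<theta> i y * (\<sigma> y \<bullet> J y) + \<theta>g i y \<bullet> h y)"
      using eq(1) LI SD by auto
    have "(LINT y:D|lborel. \<theta> i y * (\<sigma> y \<bullet> J y) + \<theta>g i y \<bullet> h y) = (LINT y:?S|lborel. \<theta> i y * (\<sigma> y \<bullet> J y) + \<theta>g i y \<bullet> h y)"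
      by (rule eq(2)) (use SD in auto)
    also have "\<dots> = (LINT y:?S|lborel. \<theta> i y * trace (H y) + \<theta>g i y \<bullet> h y)"
      by (rule set_lebesgue_integral_cong) (use bS H(2) SD in \<open>auto simp: subset_iff\<close>)
    also have "\<dots> = - sphint (x i) R (\<lambda>y. h y \<bullet> ((1 / R) *\<^sub>R (y - x i)))"
      using L(2) unfolding \<theta>_def \<theta>g_def .
    finally show "(LINT y:D|lborel. \<theta> i y * (\<sigma> y \<bullet> J y) + \<theta>g i y \<bullet> h y) = - sphint (x i) R (\<lambda>y. h y \<bullet> ((1 / R) *\<^sub>R (y - x i)))" .
  qed
  let ?T = "- (\<Sum>i\<in>{1..N}. sphint (x i) R (\<lambda>y. h y \<bullet> ((1 / R) *\<^sub>R (y - x i))))"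
  \<comment> \<open>Beyond this radius the ball where \<open>\<omega> \<rho>\<close> equals one
    contains all balls of radius \<open>2 * R\<close> around particles.\<close>
  define \<rho>1 where "\<rho>1 = 1 + \<bar>\<rho>0\<bar> + (\<Sum>i\<in>{1..N}. norm (x i)) + 2 * R"
  have \<rho>1: "\<rho>1 \<ge> 1" "\<rho>1 \<ge> \<rho>0" "\<And>i. i \<in> {1..N} \<Longrightarrow> norm (x i) + 2 * R \<le> \<rho>1"
  proof -
    have "0 \<le> (\<Sum>i\<in>{1..N}. norm (x i))" by (simp add: sum_nonneg)
    then show "\<rho>1 \<ge> 1" "\<rho>1 \<ge> \<rho>0" using R by (auto simp: \<rho>1_def)
    fix i assume "i \<in> {1..N}"
    then have "norm (x i) \<le> (\<Sum>i\<in>{1..N}. norm (x i))" by (intro member_le_sum) auto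
    then show "norm (x i) + 2 * R \<le> \<rho>1" by (auto simp: \<rho>1_def)
  qed
  define \<omega> where "\<omega> = (\<lambda>\<rho>. bump 0 (\<rho>\<^sup>2) (2 * \<rho>\<^sup>2))"
  define \<omega>g where "\<omega>g = (\<lambda>\<rho>. bumpg 0 (\<rho>\<^sup>2) (2 * \<rho>\<^sup>2))"
  have tot: "set_integrable lborel D (\<lambda>y. \<omega> \<rho> y * (\<sigma> y \<bullet> J y) + \<omega>g \<rho> y \<bullet> h y)"
    "(LINT y:D|lborel. \<omega> \<rho> y * (\<sigma> y \<bullet> J y) + \<omega>g \<rho> y \<bullet> h y) = ?T" if \<rho>: "\<rho> \<ge> \<rho>1" for \<rho>
  proof -
    have \<rho>0': "\<rho> > 0" using \<rho> \<rho>1 by linarith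
    then have \<rho>2: "\<rho>\<^sup>2 > 0" by simp
    define K where "K = {y. (norm y)\<^sup>2 \<le> 2 * \<rho>\<^sup>2} \<inter> (\<Inter>i\<in>{1..N}. {y. 2 * R\<^sup>2 \<le> (dist (x i) y)\<^sup>2})"
    have "closed K" unfolding K_def
      by (intro closed_Int closed_INT ballI closed_Collect_le continuous_intros)
    moreover have "K \<subseteq> cball 0 (sqrt (2 * \<rho>\<^sup>2))" unfolding K_def by (auto simp: real_le_rsqrt)
    ultimately have cK: "compact K" by (meson bounded_cball bounded_subset compact_eq_bounded_closed)
    have KD: "K \<subseteq> D"
    proof
      fix y assume y: "y \<in> K"
      have "R < dist (x i) y" if "i \<in> {1..N}" for i
      proof -
        have "2 * R\<^sup>2 \<le> (dist (x i) y)\<^sup>2" using y that by (auto simp: K_def)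
        then have "R\<^sup>2 < (dist (x i) y)\<^sup>2" using R2 by linarith
        then show ?thesis using R by (intro power_less_imp_less_base[of R 2]) auto
      qed
      then show "y \<in> D" by (simp add: fluid_domain_eq)
    qed
    have g: "gradient_on UNIV (\<lambda>y. \<omega> \<rho> y - (\<Sum>i\<in>{1..N}. \<theta> i y)) (\<lambda>y. \<omega>g \<rho> y - (\<Sum>i\<in>{1..N}. \<theta>g i y))"
      unfolding \<omega>_def \<omega>g_def \<theta>_def \<theta>g_def
      by (intro gradient_on_diff gradient_on_sum bump_gradient)
    have supp: "\<omega> \<rho> y - (\<Sum>i\<in>{1..N}. \<theta> i y) = 0" if "y \<notin> K" for y
    proof (cases "\<exists>i\<in>{1..N}. (dist (x i) y)\<^sup>2 < 2 * R\<^sup>2")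
      case True
      then obtain i where i: "i \<in> {1..N}" "(dist (x i) y)\<^sup>2 < 2 * R\<^sup>2" by blast
      \<comment> \<open>\<open>3 / 2\<close> is a rational bound above the square root of 2.\<close>
      have "(dist (x i) y)\<^sup>2 < (3 / 2 * R)\<^sup>2" using i R2 by (simp add: power_mult_distrib power2_eq_square)
      have "0 \<le> 3 / 2 * R" using R by simp
      with \<open>(dist (x i) y)\<^sup>2 < (3 / 2 * R)\<^sup>2\<close> have di: "dist (x i) y < 3 / 2 * R"
        by (rule power_less_imp_less_base)
      have "\<theta> j y = (if j = i then 1 else 0)" if "j \<in> {1..N}" for j
      proof (cases "j = i")
        case True
        then show ?thesis using i R2 by (simp add: \<theta>_def bump_eq_1 nd)
      next
        case False
        have "4 * R \<le> dist (x j) (x i)" using sep i that False by auto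
        also have "\<dots> \<le> dist (x j) y + dist (x i) y" by (metis dist_commute dist_triangle)
        finally have "2 * R \<le> dist (x j) y" using di R by linarith
        then show ?thesis using \<theta>0(1)[OF far] False by simp
      qed
      then have "(\<Sum>j\<in>{1..N}. \<theta> j y) = (\<Sum>j\<in>{1..N}. if j = i then 1 else 0)" by (intro sum.cong) auto
      also have "\<dots> = 1" using i by simp
      finally have s1: "(\<Sum>j\<in>{1..N}. \<theta> j y) = 1" .
      have "norm y \<le> norm (x i) + dist (x i) y"
        by (metis dist_norm norm_minus_commute norm_triangle_sub)
      also have "\<dots> \<le> \<rho>" using di \<rho>1(3)[OF i(1)] \<rho> R by linarith
      finally have "(norm y)\<^sup>2 \<le> \<rho>\<^sup>2" by (intro power_mono) auto
      then show ?thesis using s1 \<rho>2 by (simp add: \<omega>_def bump_eq_1)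
    next
      case False
      then have "2 * \<rho>\<^sup>2 < (norm y)\<^sup>2" using that by (auto simp: K_def not_le not_less)
      then have c0: "\<omega> \<rho> y = 0" using \<rho>2 by (simp add: \<omega>_def bump_eq_0)
      have "\<rho>\<^sup>2 \<le> (norm y)\<^sup>2" using \<open>2 * \<rho>\<^sup>2 < (norm y)\<^sup>2\<close> \<rho>2 by linarith
      then have "\<rho> \<le> norm y" using \<rho>0' by (intro power2_le_imp_le[of \<rho>]) auto
      have "\<theta> i y = 0" if "i \<in> {1..N}" for i
      proof -
        have "norm y \<le> norm (x i) + dist (x i) y"
          by (metis dist_norm norm_minus_commute norm_triangle_sub)
        then have "2 * R \<le> dist (x i) y" using \<open>\<rho> \<le> norm y\<close> \<rho> \<rho>1(3)[OF that] by linarith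
        then show ?thesis using \<theta>0(1)[OF far] by simp
      qed
      then show ?thesis using c0 by simp
    qed
    note C = integral_divergence_cutoff[OF oD H(1) g cK KD supp]
    define f where "f = (\<lambda>y. (\<omega> \<rho> y - (\<Sum>i\<in>{1..N}. \<theta> i y)) * (\<sigma> y \<bullet> J y) + (\<omega>g \<rho> y - (\<Sum>i\<in>{1..N}. \<theta>g i y)) \<bullet> h y)"
    have feq: "(\<omega> \<rho> y - (\<Sum>i\<in>{1..N}. \<theta> i y)) * trace (H y) + (\<omega>g \<rho> y - (\<Sum>i\<in>{1..N}. \<theta>g i y)) \<bullet> h y = f y" if "y \<in> D" for y
      using H(2)[OF that] by (simp add: f_def)
    have fI: "set_integrable lborel D f" "(LINT y:D|lborel. f y) = 0"
    proof -
      show "set_integrable lborel D f"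
        by (subst set_integrable_cong[OF refl refl feq, symmetric]) (assumption | rule C(1))+
      have "(LINT y:D|lborel. f y) = (LINT y:D|lborel. (\<omega> \<rho> y - (\<Sum>i\<in>{1..N}. \<theta> i y)) * trace (H y) + (\<omega>g \<rho> y - (\<Sum>i\<in>{1..N}. \<theta>g i y)) \<bullet> h y)"
        by (rule set_lebesgue_integral_cong) (use H(2) bD in \<open>auto simp: f_def\<close>)
      then show "(LINT y:D|lborel. f y) = 0" using C(2) by simp
    qed
    have split: "\<omega> \<rho> y * (\<sigma> y \<bullet> J y) + \<omega>g \<rho> y \<bullet> h y = f y + (\<Sum>i\<in>{1..N}. \<theta> i y * (\<sigma> y \<bullet> J y) + \<theta>g i y \<bullet> h y)" for y
      by (simp add: f_def sum.distrib inner_diff_left inner_sum_left algebra_simps sum_distrib_left sum_distrib_right)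
    note sI = set_integral_sum[of "{1..N}" D "\<lambda>i y. \<theta> i y * (\<sigma> y \<bullet> J y) + \<theta>g i y \<bullet> h y", OF _ loc(1)]
    show "set_integrable lborel D (\<lambda>y. \<omega> \<rho> y * (\<sigma> y \<bullet> J y) + \<omega>g \<rho> y \<bullet> h y)"
      unfolding split using sI(1) fI(1) by (intro set_integral_add(1)) auto
    have "(LINT y:D|lborel. \<omega> \<rho> y * (\<sigma> y \<bullet> J y) + \<omega>g \<rho> y \<bullet> h y)
       = 0 + (\<Sum>i\<in>{1..N}. (LINT y:D|lborel. \<theta> i y * (\<sigma> y \<bullet> J y) + \<theta>g i y \<bullet> h y))"
      unfolding split using sI fI by (subst set_integral_add(2)) auto
    also have "\<dots> = ?T" by (simp add: loc(2) sum_negf)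
    finally show "(LINT y:D|lborel. \<omega> \<rho> y * (\<sigma> y \<bullet> J y) + \<omega>g \<rho> y \<bullet> h y) = ?T" .
  qed
  have \<omega>J: "set_integrable lborel D (\<lambda>y. \<omega> \<rho> y * (\<sigma> y \<bullet> J y))" for \<rho>
  proof (rule set_integrable_bound_continuous[OF set_integrable_abs[OF \<sigma>J] bD])
    show "continuous_on D (\<lambda>y. \<omega> \<rho> y * (\<sigma> y \<bullet> J y))" unfolding \<omega>_def
      by (intro continuous_intros continuous_on_bump c\<sigma>D cJ)
    show "\<bar>\<omega> \<rho> y * (\<sigma> y \<bullet> J y)\<bar> \<le> \<bar>\<sigma> y \<bullet> J y\<bar>" for y
      unfolding abs_mult \<omega>_def by (rule mult_left_le_one_le) (auto simp: bump_nonneg bump_le_1)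
  qed
  have \<omega>h: "set_integrable lborel D (\<lambda>y. \<omega>g \<rho> y \<bullet> h y)"
    "(LINT y:D|lborel. \<omega> \<rho> y * (\<sigma> y \<bullet> J y)) + (LINT y:D|lborel. \<omega>g \<rho> y \<bullet> h y) = ?T" if "\<rho> \<ge> \<rho>1" for \<rho>
  proof -
    show 1: "set_integrable lborel D (\<lambda>y. \<omega>g \<rho> y \<bullet> h y)"
      using set_integral_diff(1)[OF tot(1)[OF that] \<omega>J[of \<rho>]] by simp
    show "(LINT y:D|lborel. \<omega> \<rho> y * (\<sigma> y \<bullet> J y)) + (LINT y:D|lborel. \<omega>g \<rho> y \<bullet> h y) = ?T"
      using set_integral_add(2)[OF \<omega>J 1] tot(2)[OF that] by simp
  qed
  have limA: "(\<lambda>n. LINT y:D|lborel. \<omega> (real n) y * (\<sigma> y \<bullet> J y)) \<longlonglongrightarrow> (LINT y:D|lborel. \<sigma> y \<bullet> J y)"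
    unfolding set_lebesgue_integral_def
  proof (rule integral_dominated_convergence)
    show "(\<lambda>y. indicator D y *\<^sub>R (\<sigma> y \<bullet> J y)) \<in> borel_measurable lborel"
      using \<sigma>J unfolding set_integrable_def by (rule borel_measurable_integrable)
    show "(\<lambda>y. indicator D y *\<^sub>R (\<omega> (real n) y * (\<sigma> y \<bullet> J y))) \<in> borel_measurable lborel" for n
      using \<omega>J unfolding set_integrable_def by (rule borel_measurable_integrable)
    show "integrable lborel (\<lambda>y. norm (indicator D y *\<^sub>R (\<sigma> y \<bullet> J y)))"
      using \<sigma>J unfolding set_integrable_def by (rule integrable_norm)
    show "AE y in lborel. (\<lambda>n. indicator D y *\<^sub>R (\<omega> (real n) y * (\<sigma> y \<bullet> J y))) \<longlonglongrightarrow> indicator D y *\<^sub>R (\<sigma> y \<bullet> J y)"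
    proof (rule AE_I2)
      fix y :: "real^3"
      obtain n0 :: nat where n0: "norm y < real n0" "n0 > 0"
        by (metis reals_Archimedean2 norm_ge_zero of_nat_0_less_iff order_le_less_trans)
      have "\<forall>\<^sub>F n in sequentially. indicator D y *\<^sub>R (\<sigma> y \<bullet> J y) = indicator D y *\<^sub>R (\<omega> (real n) y * (\<sigma> y \<bullet> J y))"
        unfolding eventually_sequentially
      proof (intro exI allI impI)
        fix n assume "n \<ge> n0"
        then have "norm y \<le> real n" "real n > 0" using n0 by linarith+
        then have "\<omega> (real n) y = 1" unfolding \<omega>_def by (intro bump_eq_1) (auto intro: power_mono)
        then show "indicator D y *\<^sub>R (\<sigma> y \<bullet> J y) = indicator D y *\<^sub>R (\<omega> (real n) y * (\<sigma> y \<bullet> J y))" by simp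
      qed
      then show "(\<lambda>n. indicator D y *\<^sub>R (\<omega> (real n) y * (\<sigma> y \<bullet> J y))) \<longlonglongrightarrow> indicator D y *\<^sub>R (\<sigma> y \<bullet> J y)"
        by (rule Lim_transform_eventually[OF tendsto_const])
    qed
    show "AE y in lborel. norm (indicator D y *\<^sub>R (\<omega> (real n) y * (\<sigma> y \<bullet> J y))) \<le> norm (indicator D y *\<^sub>R (\<sigma> y \<bullet> J y))" for n
    proof (rule AE_I2)
      fix y :: "real^3"
      have "\<bar>\<omega> (real n) y * (\<sigma> y \<bullet> J y)\<bar> \<le> \<bar>\<sigma> y \<bullet> J y\<bar>"
        unfolding abs_mult \<omega>_def by (rule mult_left_le_one_le) (auto simp: bump_nonneg bump_le_1)
      then show "norm (indicator D y *\<^sub>R (\<omega> (real n) y * (\<sigma> y \<bullet> J y))) \<le> norm (indicator D y *\<^sub>R (\<sigma> y \<bullet> J y))"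
        by (simp add: indicator_def)
    qed
  qed
  \<comment> \<open>The stress outside large balls; its smallness has to beat the factor from
    \<open>\<phi>\<close>, which is only bounded.\<close>
  define tail where "tail = (\<lambda>n::nat. LINT y:{y \<in> D. (real n)\<^sup>2 \<le> (norm y)\<^sup>2}|lborel. (norm (\<sigma> y))\<^sup>2)"
  have bT: "{y \<in> D. (real n)\<^sup>2 \<le> (norm y)\<^sup>2} \<in> sets borel" for n
  proof -
    have "{y \<in> D. (real n)\<^sup>2 \<le> (norm y)\<^sup>2} = D \<inter> {y. (real n)\<^sup>2 \<le> (norm y)\<^sup>2}" by auto
    moreover have "closed {y::real^3. (real n)\<^sup>2 \<le> (norm y)\<^sup>2}" by (intro closed_Collect_le continuous_intros)
    ultimately show ?thesis using bD by auto
  qed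
  have tI: "set_integrable lborel {y \<in> D. (real n)\<^sup>2 \<le> (norm y)\<^sup>2} (\<lambda>y. (norm (\<sigma> y))\<^sup>2)" for n
    by (rule set_integrable_subset[OF \<sigma>2]) (use bT in auto)
  have limT: "tail \<longlonglongrightarrow> (LINT y|(lborel :: (real^3) measure). (0::real))"
    unfolding tail_def set_lebesgue_integral_def
  proof (rule integral_dominated_convergence)
    show "(\<lambda>y. indicator {y \<in> D. (real n)\<^sup>2 \<le> (norm y)\<^sup>2} y *\<^sub>R (norm (\<sigma> y))\<^sup>2) \<in> borel_measurable lborel" for n
      using tI unfolding set_integrable_def by (rule borel_measurable_integrable)
    show "integrable lborel (\<lambda>y. indicator D y *\<^sub>R (norm (\<sigma> y))\<^sup>2)" using \<sigma>2 by (simp add: set_integrable_def)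
    show "AE y in lborel. (\<lambda>n. indicator {y \<in> D. (real n)\<^sup>2 \<le> (norm y)\<^sup>2} y *\<^sub>R (norm (\<sigma> y))\<^sup>2) \<longlonglongrightarrow> 0"
    proof (rule AE_I2)
      fix y :: "real^3"
      obtain n0 :: nat where n0: "norm y < real n0" by (metis reals_Archimedean2)
      have "\<forall>\<^sub>F n in sequentially. 0 = indicator {y \<in> D. (real n)\<^sup>2 \<le> (norm y)\<^sup>2} y *\<^sub>R (norm (\<sigma> y))\<^sup>2"
        unfolding eventually_sequentially
      proof (intro exI allI impI)
        fix n assume "n \<ge> n0"
        then have "norm y < real n" using n0 by linarith
        then have "(norm y)\<^sup>2 < (real n)\<^sup>2" by (intro power_strict_mono) auto
        then have "y \<notin> {y \<in> D. (real n)\<^sup>2 \<le> (norm y)\<^sup>2}" by (metis (mono_tags, lifting) mem_Collect_eq not_le)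
        then have "indicator {y \<in> D. (real n)\<^sup>2 \<le> (norm y)\<^sup>2} y = (0::real)" by (rule indicator_simps(2))
        then show "0 = indicator {y \<in> D. (real n)\<^sup>2 \<le> (norm y)\<^sup>2} y *\<^sub>R (norm (\<sigma> y))\<^sup>2"
          by (simp only: scaleR_zero_left)
      qed
      then show "(\<lambda>n. indicator {y \<in> D. (real n)\<^sup>2 \<le> (norm y)\<^sup>2} y *\<^sub>R (norm (\<sigma> y))\<^sup>2) \<longlonglongrightarrow> 0"
        by (rule Lim_transform_eventually[OF tendsto_const])
    qed
    show "AE y in lborel. norm (indicator {y \<in> D. (real n)\<^sup>2 \<le> (norm y)\<^sup>2} y *\<^sub>R (norm (\<sigma> y))\<^sup>2) \<le> indicator D y *\<^sub>R (norm (\<sigma> y))\<^sup>2" for n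
      by (rule AE_I2) (simp add: indicator_def)
  qed simp
  \<comment> \<open>Young's inequality with free weight \<open>\<mu>\<close>: first
    \<open>\<mu>\<close> is chosen to make \<open>\<mu> * C\<close> small, then \<open>n\<close> to
    make \<open>tail n / \<mu>\<close> small.\<close>
  have bound: "\<bar>LINT y:D|lborel. \<omega>g (real n) y \<bullet> h y\<bar> \<le> 60 * (\<mu> * C + tail n / \<mu>)"
    if n: "real n \<ge> \<rho>1" and \<mu>: "\<mu> > 0" for n \<mu>
  proof -
    define \<rho> where "\<rho> = real n"
    have \<rho>: "\<rho> \<ge> \<rho>1" "\<rho> \<ge> 1" using n \<rho>1 by (auto simp: \<rho>_def)
    define T where "T = {y \<in> D. (real n)\<^sup>2 \<le> (norm y)\<^sup>2}"
    define A where "A = {y \<in> D. \<rho>\<^sup>2 \<le> (norm y)\<^sup>2 \<and> (norm y)\<^sup>2 \<le> 2 * \<rho>\<^sup>2}"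
    have Amem: "y \<in> D" "\<rho>\<^sup>2 \<le> (norm y)\<^sup>2" "(norm y)\<^sup>2 \<le> 2 * \<rho>\<^sup>2" if "y \<in> A" for y
      using that unfolding A_def mem_Collect_eq by blast+
    have AD: "A \<subseteq> D" using Amem(1) by blast
    have AT: "A \<subseteq> T" unfolding A_def T_def \<rho>_def by blast
    have "closed {y::real^3. (norm y)\<^sup>2 \<le> 2 * \<rho>\<^sup>2}" by (intro closed_Collect_le continuous_intros)
    then have "T \<inter> {y. (norm y)\<^sup>2 \<le> 2 * \<rho>\<^sup>2} \<in> sets borel"
      unfolding T_def by (intro sets.Int bT borel_closed)
    also have "T \<inter> {y. (norm y)\<^sup>2 \<le> 2 * \<rho>\<^sup>2} = A" unfolding A_def T_def \<rho>_def by blast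
    finally have bA: "A \<in> sets lborel" unfolding sets_lborel .
    have cc: "compact (closure D \<inter> cball 0 (2 * \<rho>))" by (simp add: compact_Int closed_Int_compact)
    have AK: "A \<subseteq> closure D \<inter> cball 0 (2 * \<rho>)"
    proof
      fix y assume y: "y \<in> A"
      have "2 * \<rho>\<^sup>2 \<le> (2 * \<rho>)\<^sup>2" by (simp add: power_mult_distrib)
      then have "(norm y)\<^sup>2 \<le> (2 * \<rho>)\<^sup>2" using Amem(3)[OF y] by linarith
      then have "norm y \<le> 2 * \<rho>" by (rule power2_le_imp_le) (use \<rho> in simp)
      then show "y \<in> closure D \<inter> cball 0 (2 * \<rho>)" using Amem(1)[OF y] closure_subset by auto
    qed
    have \<phi>A: "set_integrable lborel A (\<lambda>y. (norm (\<phi> y))\<^sup>2)"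
    proof (rule set_integrable_subset[OF set_integrable_compact[OF cc] _ AK])
      have "continuous_on (closure D \<inter> cball 0 (2 * \<rho>)) \<phi>" by (rule continuous_on_subset[OF c\<phi>]) blast
      then show "continuous_on (closure D \<inter> cball 0 (2 * \<rho>)) (\<lambda>y. (norm (\<phi> y))\<^sup>2)"
        by (intro continuous_on_power continuous_on_norm)
    qed (rule bA)
    have \<sigma>A: "set_integrable lborel A (\<lambda>y. (norm (\<sigma> y))\<^sup>2)"
      by (rule set_integrable_subset[OF \<sigma>2 bA AD])
    have z: "\<omega>g \<rho> y \<bullet> h y = 0" if "y \<in> D" "y \<notin> A" for y
    proof -
      have "(norm (y - 0))\<^sup>2 \<le> \<rho>\<^sup>2 \<or> 2 * \<rho>\<^sup>2 \<le> (norm (y - 0))\<^sup>2"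
        using that unfolding A_def mem_Collect_eq diff_zero by linarith
      moreover have "\<rho>\<^sup>2 < 2 * \<rho>\<^sup>2" using \<rho> by simp
      ultimately have "\<omega>g \<rho> y = 0" unfolding \<omega>g_def by (intro bumpg_eq_0)
      then show ?thesis by simp
    qed
    have pt: "\<bar>\<omega>g \<rho> y \<bullet> h y\<bar> \<le> 60 * \<mu> / \<rho>\<^sup>2 * (norm (\<phi> y))\<^sup>2 + 60 / \<mu> * (norm (\<sigma> y))\<^sup>2" if y: "y \<in> A" for y
    proof -
      have ny: "norm y \<le> 2 * \<rho>" using AK y by auto
      have "norm (\<omega>g \<rho> y) \<le> 60 * norm y / \<rho>\<^sup>2"
        using norm_bumpg_le[of "\<rho>\<^sup>2" "2 * \<rho>\<^sup>2" 0 y] \<rho> by (simp add: \<omega>g_def)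
      also have "\<dots> \<le> 60 * (2 * \<rho>) / \<rho>\<^sup>2" using ny by (intro divide_right_mono) auto
      also have "\<dots> = 120 / \<rho>" using \<rho> by (simp add: power2_eq_square)
      finally have g: "norm (\<omega>g \<rho> y) \<le> 120 / \<rho>" .
      have "\<bar>\<omega>g \<rho> y \<bullet> h y\<bar> \<le> norm (\<omega>g \<rho> y) * norm (h y)" by (rule Cauchy_Schwarz_ineq2)
      also have "\<dots> \<le> (120 / \<rho>) * (norm (\<sigma> y) * norm (\<phi> y))"
        unfolding h_def using \<rho> by (intro mult_mono g matrix_vector_mult_norm_le) auto
      also have "\<dots> = 60 * (2 * (sqrt \<mu> * norm (\<phi> y) / \<rho>) * (norm (\<sigma> y) / sqrt \<mu>))"
        using \<mu> by (simp add: field_simps)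
      also have "\<dots> \<le> 60 * ((sqrt \<mu> * norm (\<phi> y) / \<rho>)\<^sup>2 + (norm (\<sigma> y) / sqrt \<mu>)\<^sup>2)"
        by (intro mult_left_mono sum_squares_bound) auto
      also have "\<dots> = 60 * \<mu> / \<rho>\<^sup>2 * (norm (\<phi> y))\<^sup>2 + 60 / \<mu> * (norm (\<sigma> y))\<^sup>2"
        using \<mu> by (simp add: power_mult_distrib power_divide algebra_simps)
      finally show ?thesis .
    qed
    have i1: "set_integrable lborel A (\<lambda>y. 60 * \<mu> / \<rho>\<^sup>2 * (norm (\<phi> y))\<^sup>2)"
      by (rule set_integrable_mult_right) (rule \<phi>A)
    have i2: "set_integrable lborel A (\<lambda>y. 60 / \<mu> * (norm (\<sigma> y))\<^sup>2)"
      by (rule set_integrable_mult_right) (rule \<sigma>A)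
    have hA: "set_integrable lborel A (\<lambda>y. \<omega>g \<rho> y \<bullet> h y)"
      by (rule set_integrable_subset[OF \<omega>h(1)[OF \<rho>(1)] bA AD])
    have "(LINT y:D|lborel. \<omega>g \<rho> y \<bullet> h y) = (LINT y:A|lborel. \<omega>g \<rho> y \<bullet> h y)"
      by (rule set_integral_cong_support(2)) (use z AD in blast)+
    also have "\<bar>\<dots>\<bar> \<le> (LINT y:A|lborel. \<bar>\<omega>g \<rho> y \<bullet> h y\<bar>)"
      using set_integral_norm_bound[OF hA] by simp
    also have "\<dots> \<le> (LINT y:A|lborel. 60 * \<mu> / \<rho>\<^sup>2 * (norm (\<phi> y))\<^sup>2 + 60 / \<mu> * (norm (\<sigma> y))\<^sup>2)"
      by (rule set_integral_mono[OF set_integrable_abs[OF hA] set_integral_add(1)[OF i1 i2] pt])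
    also have "\<dots> = 60 * \<mu> / \<rho>\<^sup>2 * (LINT y:A|lborel. (norm (\<phi> y))\<^sup>2) + 60 / \<mu> * (LINT y:A|lborel. (norm (\<sigma> y))\<^sup>2)"
      unfolding set_integral_add(2)[OF i1 i2] set_integral_mult_right ..
    also have "\<dots> \<le> 60 * \<mu> / \<rho>\<^sup>2 * (C * \<rho>\<^sup>2) + 60 / \<mu> * tail n"
    proof (intro add_mono mult_left_mono)
      show "(LINT y:A|lborel. (norm (\<phi> y))\<^sup>2) \<le> C * \<rho>\<^sup>2" unfolding A_def using \<rho> \<rho>1(2) by (intro growth) linarith
      show "(LINT y:A|lborel. (norm (\<sigma> y))\<^sup>2) \<le> tail n"
        unfolding tail_def T_def[symmetric] set_lebesgue_integral_def
      proof (rule integral_mono)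
        show "integrable lborel (\<lambda>y. indicat_real A y *\<^sub>R (norm (\<sigma> y))\<^sup>2)"
          using \<sigma>A unfolding set_integrable_def .
        show "integrable lborel (\<lambda>y. indicat_real T y *\<^sub>R (norm (\<sigma> y))\<^sup>2)"
          using tI[of n] unfolding set_integrable_def T_def .
        show "indicat_real A y *\<^sub>R (norm (\<sigma> y))\<^sup>2 \<le> indicat_real T y *\<^sub>R (norm (\<sigma> y))\<^sup>2" for y
          by (rule scaleR_right_mono[OF indicator_leI]) (use AT in auto)
      qed
    qed (use \<mu> in simp_all)
    also have "\<dots> = 60 * (\<mu> * C + tail n / \<mu>)" using \<rho> \<mu> by (simp add: field_simps)
    finally show ?thesis unfolding \<rho>_def .
  qed
  have limB: "(\<lambda>n. LINT y:D|lborel. \<omega>g (real n) y \<bullet> h y) \<longlonglongrightarrow> 0"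
  proof (rule LIMSEQ_I)
    fix \<epsilon> :: real assume \<epsilon>: "\<epsilon> > 0"
    define \<mu> where "\<mu> = \<epsilon> / (120 * (\<bar>C\<bar> + 1))"
    have \<mu>: "\<mu> > 0" using \<epsilon> by (simp add: \<mu>_def)
    have "60 * \<mu> * C \<le> 60 * \<mu> * (\<bar>C\<bar> + 1)" using \<mu> by (intro mult_left_mono) auto
    also have "\<dots> = \<epsilon> / 2" by (simp add: \<mu>_def field_simps)
    finally have mC: "60 * \<mu> * C \<le> \<epsilon> / 2" .
    have "\<forall>\<^sub>F n in sequentially. tail n < \<epsilon> * \<mu> / 120"
      using order_tendstoD(2)[OF limT, of "\<epsilon> * \<mu> / 120"] \<epsilon> \<mu> by simp
    then obtain n0 where n0: "\<And>n. n \<ge> n0 \<Longrightarrow> tail n < \<epsilon> * \<mu> / 120"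
      unfolding eventually_sequentially by blast
    obtain n1 :: nat where n1: "\<rho>1 \<le> real n1" using real_arch_simple by blast
    show "\<exists>no. \<forall>n\<ge>no. norm ((LINT y:D|lborel. \<omega>g (real n) y \<bullet> h y) - 0) < \<epsilon>"
    proof (intro exI allI impI)
      fix n assume n: "n \<ge> max n0 n1"
      then have "real n \<ge> \<rho>1" using n1 by linarith
      from bound[OF this \<mu>] have "\<bar>LINT y:D|lborel. \<omega>g (real n) y \<bullet> h y\<bar> \<le> 60 * \<mu> * C + 60 * (tail n / \<mu>)"
        by (simp add: algebra_simps)
      also have "tail n / \<mu> < \<epsilon> / 120" using n0[of n] n \<mu> by (simp add: divide_less_eq)
      finally show "norm ((LINT y:D|lborel. \<omega>g (real n) y \<bullet> h y) - 0) < \<epsilon>" using mC by simp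
    qed
  qed
  have "(LINT y:D|lborel. \<sigma> y \<bullet> J y) = ?T"
  proof -
    obtain n1 :: nat where n1: "\<rho>1 \<le> real n1" using real_arch_simple by blast
    have ev: "\<forall>\<^sub>F n in sequentially. (LINT y:D|lborel. \<omega> (real n) y * (\<sigma> y \<bullet> J y)) + (LINT y:D|lborel. \<omega>g (real n) y \<bullet> h y) = ?T"
      unfolding eventually_sequentially using \<omega>h(2) n1 by (intro exI[of _ n1]) fastforce
    have "(\<lambda>n::nat. ?T) \<longlonglongrightarrow> (LINT y:D|lborel. \<sigma> y \<bullet> J y) + 0"
      by (rule Lim_transform_eventually[OF tendsto_add[OF limA limB] ev])
    then show ?thesis by (simp add: LIMSEQ_const_iff)
  qed
  then show "(LINT y:D|lborel. \<sigma> y \<bullet> J y) = - (\<Sum>i\<in>{1..N}. sphint (x i) R (\<lambda>y. (\<sigma> y *v \<phi> y) \<bullet> ((1 / R) *\<^sub>R (y - x i))))"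
    unfolding h_def .
qed

end

section \<open>Decay at infinity\<close>

lemma nn_integral_lborel_scale:
  fixes f :: "real^3 \<Rightarrow> ennreal"
  assumes "f \<in> borel_measurable borel" "c > 0"
  shows "(\<integral>\<^sup>+x. f (c *\<^sub>R x) \<partial>lborel) = ennreal (1 / c ^ 3) * (\<integral>\<^sup>+x. f x \<partial>lborel)"
proof -
  have "(\<integral>\<^sup>+x. f x \<partial>lborel) = (\<integral>\<^sup>+x. f x \<partial>(density (distr lborel borel (\<lambda>x. 0 + c *\<^sub>R x)) (\<lambda>_. ennreal (\<bar>c\<bar> ^ DIM(real^3)))))"
    by (subst lborel_affine[of c 0]) (use assms in auto)
  also have "\<dots> = (\<integral>\<^sup>+x. ennreal (c ^ 3) * f x \<partial>(distr lborel borel (\<lambda>x. c *\<^sub>R x)))"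
    using assms by (subst nn_integral_density) auto
  also have "\<dots> = (\<integral>\<^sup>+x. ennreal (c ^ 3) * f (c *\<^sub>R x) \<partial>lborel)"
    using assms by (subst nn_integral_distr) auto
  also have "\<dots> = ennreal (c ^ 3) * (\<integral>\<^sup>+x. f (c *\<^sub>R x) \<partial>lborel)"
    using assms by (intro nn_integral_cmult) auto
  finally have "ennreal (1 / c ^ 3) * (\<integral>\<^sup>+x. f x \<partial>lborel)
      = (ennreal (1 / c ^ 3) * ennreal (c ^ 3)) * (\<integral>\<^sup>+x. f (c *\<^sub>R x) \<partial>lborel)"
    by (simp add: mult.assoc)
  also have "ennreal (1 / c ^ 3) * ennreal (c ^ 3) = 1"
    using assms by (subst ennreal_mult[symmetric]) auto
  finally show ?thesis by simp
qed

text \<open>Along a ray, \<open>u (x) - u (T\<^sup>2 x)\<close> is the integral of \<open>2 t (\<nabla>u) (t\<^sup>2 x) x\<close>; the weights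
  \<open>t\<^sup>-\<^sup>2\<close> and \<open>t\<^sup>4\<close> are chosen so that both factors of the Cauchy-Schwarz inequality
  stay integrable after the scaling in \<open>x\<close>.\<close>

lemma ray_difference_bound:
  fixes u :: "real^3 \<Rightarrow> real^3"
  assumes u: "jacobian_on {y. \<rho>0 < norm y} u J" and x: "\<rho>0 < norm x" "0 \<le> \<rho>0" and T: "1 \<le> T"
  shows "(norm (u (T\<^sup>2 *\<^sub>R x) - u x))\<^sup>2 \<le> 4 * integral {1..T} (\<lambda>t. t ^ 4 * (norm x)\<^sup>2 * (norm (J (t\<^sup>2 *\<^sub>R x)))\<^sup>2)"
proof -
  have mem: "t\<^sup>2 *\<^sub>R x \<in> {y. \<rho>0 < norm y}" if "t \<ge> 1" for t :: real
  proof -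
    have "1 * norm x \<le> t\<^sup>2 * norm x" using that by (intro mult_right_mono) (auto simp: one_le_power)
    then show ?thesis using x by simp
  qed
  have cJ: "continuous_on {1..T} (\<lambda>t. J (t\<^sup>2 *\<^sub>R x))"
    by (rule continuous_on_compose2[of "{y. \<rho>0 < norm y}" J])
      (use u mem in \<open>auto simp: jacobian_on_def intro!: continuous_intros\<close>)
  define K where "K = integral {1..T} (\<lambda>t. t ^ 4 * (norm x)\<^sup>2 * (norm (J (t\<^sup>2 *\<^sub>R x)))\<^sup>2)"
  have ki: "(\<lambda>t. t ^ 4 * (norm x)\<^sup>2 * (norm (J (t\<^sup>2 *\<^sub>R x)))\<^sup>2) integrable_on {1..T}"
    by (intro integrable_continuous_interval continuous_intros cJ)
  have K0: "K \<ge> 0" unfolding K_def by (intro integral_nonneg ki) auto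
  define g where "g = (\<lambda>t::real. u (t\<^sup>2 *\<^sub>R x))"
  define g' where "g' = (\<lambda>t::real. J (t\<^sup>2 *\<^sub>R x) *v ((2 * t) *\<^sub>R x))"
  have gd: "(g has_vector_derivative g' t) (at t within {1..T})" if t: "t \<in> {1..T}" for t
  proof -
    have 1: "((\<lambda>t::real. t\<^sup>2 *\<^sub>R x) has_derivative (\<lambda>s. (s * (2 * t)) *\<^sub>R x)) (at t)"
      by (auto intro!: derivative_eq_intros simp: algebra_simps)
    have 2: "(u has_derivative (*v) (J (t\<^sup>2 *\<^sub>R x))) (at (t\<^sup>2 *\<^sub>R x))"
      using u mem[of t] t by (simp add: jacobian_on_def)
    from has_derivative_compose[OF 1 2] have "(g has_derivative (\<lambda>s. s *\<^sub>R g' t)) (at t)"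
      unfolding g_def g'_def by (simp add: matrix_vector_mult_scaleR flip: scaleR_scaleR)
    then show ?thesis
      unfolding has_vector_derivative_def by (rule has_derivative_at_withinI)
  qed
  have gi: "(g' has_integral (g T - g 1)) {1..T}"
    by (rule fundamental_theorem_of_calculus[OF T gd])
  have inv: "((\<lambda>t::real. 1 / t\<^sup>2) has_integral (- 1 / T - (- 1 / 1))) {1..T}"
  proof (rule fundamental_theorem_of_calculus[OF T])
    fix t assume t: "t \<in> {1..T}"
    have "((\<lambda>t::real. - 1 / t) has_real_derivative 1 / t\<^sup>2) (at t)"
      using t by (auto intro!: derivative_eq_intros simp: power2_eq_square)
    then show "((\<lambda>t::real. - 1 / t) has_vector_derivative 1 / t\<^sup>2) (at t within {1..T})"
      by (metis has_real_derivative_iff_has_vector_derivative has_vector_derivative_at_within)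
  qed
  \<comment> \<open>Young's inequality under the integral, with the integral of
    \<open>1 / t^2\<close> over \<open>{1..T}\<close> bounded by one. The choice
    \<open>\<mu> = sqrt K\<close> recovers Cauchy-Schwarz; for \<open>K = 0\<close> the weight tends
    to zero instead.\<close>
  have key: "norm (g T - g 1) \<le> \<mu> + K / \<mu>" if \<mu>: "\<mu> > 0" for \<mu>
  proof -
    have bi: "((\<lambda>t. \<mu> * (1 / t\<^sup>2) + (t ^ 4 * (norm x)\<^sup>2 * (norm (J (t\<^sup>2 *\<^sub>R x)))\<^sup>2) / \<mu>) has_integral
        (\<mu> * (- 1 / T - (- 1 / 1)) + K / \<mu>)) {1..T}"
      unfolding K_def
      by (intro has_integral_add has_integral_mult_right has_integral_divide inv integrable_integral ki)
    have "norm (g T - g 1) = norm (integral {1..T} g')" using gi by (simp add: integral_unique)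
    also have "\<dots> \<le> integral {1..T} (\<lambda>t. \<mu> * (1 / t\<^sup>2) + (t ^ 4 * (norm x)\<^sup>2 * (norm (J (t\<^sup>2 *\<^sub>R x)))\<^sup>2) / \<mu>)"
    proof (rule integral_norm_bound_integral)
      show "g' integrable_on {1..T}" using gi by (rule has_integral_integrable)
      show "(\<lambda>t. \<mu> * (1 / t\<^sup>2) + (t ^ 4 * (norm x)\<^sup>2 * (norm (J (t\<^sup>2 *\<^sub>R x)))\<^sup>2) / \<mu>) integrable_on {1..T}"
        using bi by (rule has_integral_integrable)
      fix t :: real assume t: "t \<in> {1..T}"
      then have t1: "t \<ge> 1" by simp
      define n where "n = norm (J (t\<^sup>2 *\<^sub>R x)) * norm x"
      have "norm (g' t) \<le> norm (J (t\<^sup>2 *\<^sub>R x)) * norm ((2 * t) *\<^sub>R x)"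
        unfolding g'_def by (rule matrix_vector_mult_norm_le)
      also have "\<dots> = 2 * t * n" using t1 by (simp add: n_def)
      also have "\<dots> = 2 * (sqrt \<mu> / t) * (t\<^sup>2 * n / sqrt \<mu>)"
        using \<mu> t1 by (simp add: power2_eq_square)
      also have "\<dots> \<le> (sqrt \<mu> / t)\<^sup>2 + (t\<^sup>2 * n / sqrt \<mu>)\<^sup>2" by (rule sum_squares_bound)
      also have "(sqrt \<mu> / t)\<^sup>2 = \<mu> * (1 / t\<^sup>2)" using \<mu> by (simp add: power_divide)
      also have "(t\<^sup>2 * n / sqrt \<mu>)\<^sup>2 = (t ^ 4 * (norm x)\<^sup>2 * (norm (J (t\<^sup>2 *\<^sub>R x)))\<^sup>2) / \<mu>"
        using \<mu> by (simp add: power_divide power_mult_distrib n_def mult_ac flip: power_mult)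
      finally show "norm (g' t) \<le> \<mu> * (1 / t\<^sup>2) + (t ^ 4 * (norm x)\<^sup>2 * (norm (J (t\<^sup>2 *\<^sub>R x)))\<^sup>2) / \<mu>" .
    qed
    also have "\<dots> = \<mu> * (- 1 / T - (- 1 / 1)) + K / \<mu>" using bi by (rule integral_unique)
    also have "\<dots> \<le> \<mu> * 1 + K / \<mu>" using \<mu> T by (intro add_right_mono mult_left_mono) auto
    finally show ?thesis by simp
  qed
  have "(norm (g T - g 1))\<^sup>2 \<le> 4 * K"
  proof (cases "K = 0")
    case True
    have "norm (g T - g 1) \<le> 0"
      by (rule field_le_epsilon) (use key True in force)
    then show ?thesis using True by simp
  next
    case False
    then have k: "sqrt K > 0" using K0 by simp
    have "norm (g T - g 1) \<le> sqrt K + K / sqrt K" by (rule key[OF k])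
    also have "K / sqrt K = sqrt K" using K0 by (simp add: real_div_sqrt)
    finally have "(norm (g T - g 1))\<^sup>2 \<le> (2 * sqrt K)\<^sup>2" by (intro power_mono) auto
    also have "\<dots> = 4 * K" using K0 by (simp add: power_mult_distrib)
    finally show ?thesis .
  qed
  then show ?thesis unfolding K_def g_def by simp
qed

text \<open>The ray estimate is integrated over the annulus. The far end points of all rays are so
  distant that \<open>u\<close> is small there by assumption, and the ray integrals are controlled
  by the Dirichlet energy. The constant 16 is the product of 2 from splitting a square, 4 from the
  ray estimate and 2 from \<open>|y|^2 \<le> 2 * \<rho>^2\<close>.\<close>

lemma far_field_bound:
  fixes u :: "real^3 \<Rightarrow> real^3"
  assumes u: "jacobian_on {y. \<rho>0 < norm y} u J" and \<rho>0: "0 \<le> \<rho>0"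
    and J2: "set_integrable lborel {y. \<rho>0 < norm y} (\<lambda>y. (norm (J y))\<^sup>2)"
    and u0: "(u \<longlongrightarrow> 0) at_infinity" and \<rho>: "\<rho>0 < \<rho>"
  shows "(LINT y:{y. \<rho>\<^sup>2 \<le> (norm y)\<^sup>2 \<and> (norm y)\<^sup>2 \<le> 2 * \<rho>\<^sup>2}|lborel. (norm (u y))\<^sup>2)
    \<le> 16 * (LINT y:{y. \<rho>0 < norm y}|lborel. (norm (J y))\<^sup>2) * \<rho>\<^sup>2"
proof -
  define E where "E = {y::real^3. \<rho>0 < norm y}"
  define A where "A = {y::real^3. \<rho>\<^sup>2 \<le> (norm y)\<^sup>2 \<and> (norm y)\<^sup>2 \<le> 2 * \<rho>\<^sup>2}"
  define I where "I = (LINT y:E|lborel. (norm (J y))\<^sup>2)"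
  have \<rho>p: "\<rho> > 0" using \<rho> \<rho>0 by simp
  have An: "\<rho> \<le> norm y" "(norm y)\<^sup>2 \<le> 2 * \<rho>\<^sup>2" if "y \<in> A" for y
  proof -
    have "\<rho>\<^sup>2 \<le> (norm y)\<^sup>2" using that unfolding A_def mem_Collect_eq by blast
    then show "\<rho> \<le> norm y" by (rule power2_le_imp_le) simp
    show "(norm y)\<^sup>2 \<le> 2 * \<rho>\<^sup>2" using that unfolding A_def mem_Collect_eq by blast
  qed
  have cA: "closed A" unfolding A_def by (intro closed_Collect_conj closed_Collect_le continuous_intros)
  have "A \<subseteq> cball 0 (sqrt (2 * \<rho>\<^sup>2))" using real_le_rsqrt[OF An(2)] by (simp add: subset_iff)
  with cA have kA: "compact A" by (meson bounded_cball bounded_subset compact_eq_bounded_closed)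
  have AE: "A \<subseteq> E" using An(1) \<rho> unfolding E_def by force
  have bA: "A \<in> sets borel" using cA by simp
  have oE: "open E" unfolding E_def by (intro open_Collect_less continuous_intros)
  have cu: "continuous_on E u" using jacobian_on_continuous[OF u] by (simp add: E_def)
  have cJ: "continuous_on E J" using u by (simp add: E_def jacobian_on_def)
  have I: "(\<integral>\<^sup>+y. ennreal (indicator E y * (norm (J y))\<^sup>2) \<partial>lborel) = ennreal I"
    using J2 unfolding I_def E_def set_integrable_def set_lebesgue_integral_def
    by (subst nn_integral_eq_integral) auto
  have I0: "I \<ge> 0" unfolding I_def set_lebesgue_integral_def by (intro Bochner_Integration.integral_nonneg) auto
  have uA: "set_integrable lborel A (\<lambda>y. (norm (u y))\<^sup>2)"
    by (intro set_integrable_compact kA continuous_intros continuous_on_subset[OF cu AE])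
  \<comment> \<open>Scaling by \<open>t^2\<close> contributes \<open>t^-6\<close> in three
    dimensions; the weight \<open>t^4\<close> leaves \<open>t^-2\<close>, which is integrable in
    \<open>t\<close>.\<close>
  have scal: "(\<integral>\<^sup>+y. ennreal (indicator A y * (t ^ 4 * (norm y)\<^sup>2 * (norm (J (t\<^sup>2 *\<^sub>R y)))\<^sup>2)) \<partial>lborel) \<le> ennreal (2 * \<rho>\<^sup>2 * I / t\<^sup>2)"
    if t: "t \<ge> 1" for t :: real
  proof -
    have m: "(\<lambda>y. ennreal (indicator E y * (norm (J y))\<^sup>2)) \<in> borel_measurable borel"
      using borel_measurable_continuous_on_indicator[OF borel_open[OF oE] continuous_on_power[OF continuous_on_norm[OF cJ], of 2]]
      by simp
    have "(\<integral>\<^sup>+y. ennreal (indicator A y * (t ^ 4 * (norm y)\<^sup>2 * (norm (J (t\<^sup>2 *\<^sub>R y)))\<^sup>2)) \<partial>lborel)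
       \<le> (\<integral>\<^sup>+y. ennreal (t ^ 4 * (2 * \<rho>\<^sup>2)) * ennreal (indicator E (t\<^sup>2 *\<^sub>R y) * (norm (J (t\<^sup>2 *\<^sub>R y)))\<^sup>2) \<partial>lborel)"
    proof (rule nn_integral_mono)
      fix y
      show "ennreal (indicator A y * (t ^ 4 * (norm y)\<^sup>2 * (norm (J (t\<^sup>2 *\<^sub>R y)))\<^sup>2))
        \<le> ennreal (t ^ 4 * (2 * \<rho>\<^sup>2)) * ennreal (indicator E (t\<^sup>2 *\<^sub>R y) * (norm (J (t\<^sup>2 *\<^sub>R y)))\<^sup>2)"
      proof (cases "y \<in> A")
        case True
        have "1 * norm y \<le> t\<^sup>2 * norm y" using t by (intro mult_right_mono) (auto simp: one_le_power)
        then have "t\<^sup>2 *\<^sub>R y \<in> E" using An(1)[OF True] \<rho> by (simp add: E_def)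
        moreover have "t ^ 4 * (norm y)\<^sup>2 * (norm (J (t\<^sup>2 *\<^sub>R y)))\<^sup>2 \<le> t ^ 4 * (2 * \<rho>\<^sup>2) * (norm (J (t\<^sup>2 *\<^sub>R y)))\<^sup>2"
          by (intro mult_right_mono mult_left_mono An(2)[OF True]) auto
        ultimately show ?thesis using True
          by (subst ennreal_mult[symmetric]) (auto intro!: ennreal_leI)
      qed simp
    qed
    also have "\<dots> = ennreal (t ^ 4 * (2 * \<rho>\<^sup>2)) * (\<integral>\<^sup>+y. ennreal (indicator E (t\<^sup>2 *\<^sub>R y) * (norm (J (t\<^sup>2 *\<^sub>R y)))\<^sup>2) \<partial>lborel)"
      by (rule nn_integral_cmult) (use measurable_compose[OF _ m, of "\<lambda>y. t\<^sup>2 *\<^sub>R y" lborel] in simp)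
    also have "(\<integral>\<^sup>+y. ennreal (indicator E (t\<^sup>2 *\<^sub>R y) * (norm (J (t\<^sup>2 *\<^sub>R y)))\<^sup>2) \<partial>lborel) = ennreal (1 / (t\<^sup>2) ^ 3) * ennreal I"
      using nn_integral_lborel_scale[OF m, of "t\<^sup>2"] t I by simp
    also have "ennreal (t ^ 4 * (2 * \<rho>\<^sup>2)) * (ennreal (1 / (t\<^sup>2) ^ 3) * ennreal I) = ennreal (t ^ 4 * (2 * \<rho>\<^sup>2) * (1 / (t\<^sup>2) ^ 3 * I))"
    proof -
      have *: "ennreal a * (ennreal b * ennreal c) = ennreal (a * (b * c))" if "0 \<le> a" "0 \<le> b" "0 \<le> c" for a b c :: real
        using that by (simp add: ennreal_mult)
      show ?thesis by (rule *) (use I0 in auto)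
    qed
    also have "t ^ 4 * (2 * \<rho>\<^sup>2) * (1 / (t\<^sup>2) ^ 3 * I) = 2 * \<rho>\<^sup>2 * I / t\<^sup>2"
      using t by (simp add: field_simps flip: power_mult)
    finally show ?thesis .
  qed
  \<comment> \<open>Exchange of the integrals in \<open>t\<close> and \<open>y\<close>, with values
    in \<open>ennreal\<close> so that measurability of the integrand suffices.\<close>
  have KA: "(\<integral>\<^sup>+y. ennreal (indicator A y * integral {1..T} (\<lambda>t. t ^ 4 * (norm y)\<^sup>2 * (norm (J (t\<^sup>2 *\<^sub>R y)))\<^sup>2)) \<partial>lborel) \<le> ennreal (2 * \<rho>\<^sup>2 * I)"
    "(\<lambda>y. ennreal (indicator A y * integral {1..T} (\<lambda>t. t ^ 4 * (norm y)\<^sup>2 * (norm (J (t\<^sup>2 *\<^sub>R y)))\<^sup>2))) \<in> borel_measurable lborel"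
    if T: "T \<ge> 1" for T
  proof -
    define F where "F = (\<lambda>(t, y). indicator ({1..T} \<times> A) (t, y) * (t ^ 4 * (norm y)\<^sup>2 * (norm (J (t\<^sup>2 *\<^sub>R y)))\<^sup>2))"
    have cF: "continuous_on ({1..T} \<times> A) (\<lambda>p. fst p ^ 4 * (norm (snd p))\<^sup>2 * (norm (J ((fst p)\<^sup>2 *\<^sub>R snd p)))\<^sup>2)"
    proof -
      have "continuous_on ({1..T} \<times> A) (\<lambda>p. J ((fst p)\<^sup>2 *\<^sub>R snd p))"
      proof (rule continuous_on_compose2[OF cJ])
        show "continuous_on ({1..T} \<times> A) (\<lambda>p. (fst p)\<^sup>2 *\<^sub>R snd p)" by (intro continuous_intros)
        show "(\<lambda>p. (fst p)\<^sup>2 *\<^sub>R snd p) ` ({1..T} \<times> A) \<subseteq> E"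
        proof clarify
          fix t :: real and y assume t: "t \<in> {1..T}" and y: "y \<in> A"
          have "1 * norm y \<le> t\<^sup>2 * norm y" using t by (intro mult_right_mono) (auto simp: one_le_power)
          then show "(fst (t, y))\<^sup>2 *\<^sub>R snd (t, y) \<in> E" using An(1)[OF y] \<rho> by (simp add: E_def)
        qed
      qed
      then show ?thesis
        by (intro continuous_on_mult continuous_on_power continuous_on_norm continuous_on_fst continuous_on_snd continuous_on_id)
    qed
    have "closed ({1..T} \<times> A)" using cA by (intro closed_Times) auto
    from borel_measurable_continuous_on_indicator[OF borel_closed[OF this] cF]
    have "(\<lambda>p. indicator ({1..T} \<times> A) p *\<^sub>R (fst p ^ 4 * (norm (snd p))\<^sup>2 * (norm (J ((fst p)\<^sup>2 *\<^sub>R snd p)))\<^sup>2)) \<in> borel_measurable borel" .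
    then have "F \<in> borel_measurable borel" by (simp add: F_def case_prod_beta')
    then have mF: "(\<lambda>p. ennreal (F p)) \<in> borel_measurable (lborel \<Otimes>\<^sub>M lborel)" by (simp add: lborel_prod)
    have Keq: "ennreal (indicator A y * integral {1..T} (\<lambda>t. t ^ 4 * (norm y)\<^sup>2 * (norm (J (t\<^sup>2 *\<^sub>R y)))\<^sup>2)) = (\<integral>\<^sup>+t. ennreal (F (t, y)) \<partial>lborel)" for y
    proof -
      show "ennreal (indicator A y * integral {1..T} (\<lambda>t. t ^ 4 * (norm y)\<^sup>2 * (norm (J (t\<^sup>2 *\<^sub>R y)))\<^sup>2)) = (\<integral>\<^sup>+t. ennreal (F (t, y)) \<partial>lborel)"
      proof (cases "y \<in> A")
        case True
        have c: "continuous_on {1..T} (\<lambda>t. t ^ 4 * (norm y)\<^sup>2 * (norm (J (t\<^sup>2 *\<^sub>R y)))\<^sup>2)"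
          by (rule continuous_on_compose2[OF cF, of _ "\<lambda>t. (t, y)", simplified]) (use True in \<open>auto intro!: continuous_intros\<close>)
        have si: "set_integrable lborel {1..T} (\<lambda>t. t ^ 4 * (norm y)\<^sup>2 * (norm (J (t\<^sup>2 *\<^sub>R y)))\<^sup>2)"
          by (rule set_integrable_compact[OF compact_Icc c])
        have "integral {1..T} (\<lambda>t. t ^ 4 * (norm y)\<^sup>2 * (norm (J (t\<^sup>2 *\<^sub>R y)))\<^sup>2) = (LINT t:{1..T}|lborel. t ^ 4 * (norm y)\<^sup>2 * (norm (J (t\<^sup>2 *\<^sub>R y)))\<^sup>2)"
          by (rule set_borel_integral_eq_integral(2)[OF si, symmetric])
        also have "ennreal \<dots> = (\<integral>\<^sup>+t. ennreal (indicator {1..T} t *\<^sub>R (t ^ 4 * (norm y)\<^sup>2 * (norm (J (t\<^sup>2 *\<^sub>R y)))\<^sup>2)) \<partial>lborel)"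
          unfolding set_lebesgue_integral_def
          by (rule nn_integral_eq_integral[symmetric]) (use si in \<open>auto simp: set_integrable_def\<close>)
        also have "\<dots> = (\<integral>\<^sup>+t. ennreal (F (t, y)) \<partial>lborel)"
          using True by (intro nn_integral_cong) (auto simp: F_def indicator_def)
        finally show ?thesis using True by simp
      qed (simp add: F_def)
    qed
    show "(\<lambda>y. ennreal (indicator A y * integral {1..T} (\<lambda>t. t ^ 4 * (norm y)\<^sup>2 * (norm (J (t\<^sup>2 *\<^sub>R y)))\<^sup>2))) \<in> borel_measurable lborel"
      unfolding Keq
      by (rule lborel.borel_measurable_nn_integral[of "\<lambda>y t. ennreal (F (t, y))"])
        (use measurable_pair_swap[OF mF] in \<open>simp add: case_prod_beta'\<close>)
    have "(\<integral>\<^sup>+y. ennreal (indicator A y * integral {1..T} (\<lambda>t. t ^ 4 * (norm y)\<^sup>2 * (norm (J (t\<^sup>2 *\<^sub>R y)))\<^sup>2)) \<partial>lborel)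
       = (\<integral>\<^sup>+y. \<integral>\<^sup>+t. ennreal (F (t, y)) \<partial>lborel \<partial>lborel)"
      unfolding Keq ..
    also have "\<dots> = (\<integral>\<^sup>+t. \<integral>\<^sup>+y. ennreal (F (t, y)) \<partial>lborel \<partial>lborel)"
      by (rule lborel_pair.Fubini'[of "\<lambda>t y. ennreal (F (t, y))"]) (use mF in \<open>simp add: case_prod_beta'\<close>)
    also have "\<dots> \<le> (\<integral>\<^sup>+t. ennreal (indicator {1..T} t *\<^sub>R (2 * \<rho>\<^sup>2 * I / t\<^sup>2)) \<partial>lborel)"
    proof (rule nn_integral_mono)
      fix t :: real
      show "(\<integral>\<^sup>+y. ennreal (F (t, y)) \<partial>lborel) \<le> ennreal (indicator {1..T} t *\<^sub>R (2 * \<rho>\<^sup>2 * I / t\<^sup>2))"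
      proof (cases "t \<in> {1..T}")
        case True
        then have "(\<integral>\<^sup>+y. ennreal (F (t, y)) \<partial>lborel) = (\<integral>\<^sup>+y. ennreal (indicator A y * (t ^ 4 * (norm y)\<^sup>2 * (norm (J (t\<^sup>2 *\<^sub>R y)))\<^sup>2)) \<partial>lborel)"
          by (intro nn_integral_cong) (auto simp: F_def indicator_def)
        also have "\<dots> \<le> ennreal (2 * \<rho>\<^sup>2 * I / t\<^sup>2)" using True by (intro scal) auto
        finally show ?thesis using True by simp
      next
        case False
        then have "F (t, y) = 0" for y by (auto simp: F_def)
        then show ?thesis by simp
      qed
    qed
    also have "\<dots> \<le> ennreal (2 * \<rho>\<^sup>2 * I)"
    proof -
      have c: "continuous_on {1..T} (\<lambda>t::real. 2 * \<rho>\<^sup>2 * I / t\<^sup>2)" by (intro continuous_intros) auto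
      note si = set_integrable_compact[OF compact_Icc c]
      have inv: "((\<lambda>t::real. 2 * \<rho>\<^sup>2 * I / t\<^sup>2) has_integral (2 * \<rho>\<^sup>2 * I * (- 1 / T) - 2 * \<rho>\<^sup>2 * I * (- 1 / 1))) {1..T}"
      proof (rule fundamental_theorem_of_calculus[OF T])
        fix t assume t: "t \<in> {1..T}"
        have "((\<lambda>t::real. 2 * \<rho>\<^sup>2 * I * (- 1 / t)) has_real_derivative 2 * \<rho>\<^sup>2 * I / t\<^sup>2) (at t)"
          using t by (auto intro!: derivative_eq_intros simp: power2_eq_square)
        then show "((\<lambda>t::real. 2 * \<rho>\<^sup>2 * I * (- 1 / t)) has_vector_derivative 2 * \<rho>\<^sup>2 * I / t\<^sup>2) (at t within {1..T})"
          by (metis has_real_derivative_iff_has_vector_derivative has_vector_derivative_at_within)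
      qed
      have "(\<integral>\<^sup>+t. ennreal (indicator {1..T} t *\<^sub>R (2 * \<rho>\<^sup>2 * I / t\<^sup>2)) \<partial>lborel) = ennreal (LINT t:{1..T}|lborel. 2 * \<rho>\<^sup>2 * I / t\<^sup>2)"
        unfolding set_lebesgue_integral_def
        by (rule nn_integral_eq_integral) (use si I0 in \<open>auto simp: set_integrable_def\<close>)
      also have "(LINT t:{1..T}|lborel. 2 * \<rho>\<^sup>2 * I / t\<^sup>2) = 2 * \<rho>\<^sup>2 * I * (- 1 / T) - 2 * \<rho>\<^sup>2 * I * (- 1 / 1)"
        using set_borel_integral_eq_integral(2)[OF si] integral_unique[OF inv] by simp
      also have "\<dots> \<le> 2 * \<rho>\<^sup>2 * I" using T I0 by simp
      finally show ?thesis by (simp add: ennreal_leI)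
    qed
    finally show "(\<integral>\<^sup>+y. ennreal (indicator A y * integral {1..T} (\<lambda>t. t ^ 4 * (norm y)\<^sup>2 * (norm (J (t\<^sup>2 *\<^sub>R y)))\<^sup>2)) \<partial>lborel) \<le> ennreal (2 * \<rho>\<^sup>2 * I)" .
  qed
  have main: "(LINT y:A|lborel. (norm (u y))\<^sup>2) \<le> 16 * \<rho>\<^sup>2 * I + 2 * \<epsilon>\<^sup>2 * measure lborel A" if \<epsilon>: "\<epsilon> > 0" for \<epsilon>
  proof -
    obtain b where b: "\<And>y. b \<le> norm y \<Longrightarrow> norm (u y) < \<epsilon>"
      using u0 \<epsilon> unfolding tendsto_iff eventually_at_infinity by (auto simp: dist_norm)
    \<comment> \<open>For \<open>|y| \<ge> \<rho>\<close> the point \<open>T^2 y\<close> has norm at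
      least \<open>T * \<rho> \<ge> b\<close>, where \<open>u\<close> is already below
      \<open>\<epsilon>\<close>.\<close>
    define T where "T = max 1 (b / \<rho>)"
    have T: "T \<ge> 1" by (simp add: T_def)
    have pt: "(norm (u y))\<^sup>2 \<le> 2 * \<epsilon>\<^sup>2 + 8 * integral {1..T} (\<lambda>t. t ^ 4 * (norm y)\<^sup>2 * (norm (J (t\<^sup>2 *\<^sub>R y)))\<^sup>2)" if y: "y \<in> A" for y
    proof -
      have "b \<le> T * \<rho>" using \<rho>p by (simp add: T_def max_def field_simps)
      also have "\<dots> \<le> T\<^sup>2 * norm y"
        using T An(1)[OF y] \<rho>p by (intro mult_mono) (auto simp: power2_eq_square)
      finally have "norm (u (T\<^sup>2 *\<^sub>R y)) < \<epsilon>" using b by simp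
      then have 1: "(norm (u (T\<^sup>2 *\<^sub>R y)))\<^sup>2 \<le> \<epsilon>\<^sup>2" by (intro power_mono) auto
      have 2: "(norm (u (T\<^sup>2 *\<^sub>R y) - u y))\<^sup>2 \<le> 4 * integral {1..T} (\<lambda>t. t ^ 4 * (norm y)\<^sup>2 * (norm (J (t\<^sup>2 *\<^sub>R y)))\<^sup>2)"
        by (rule ray_difference_bound[OF u _ \<rho>0 T]) (use An(1)[OF y] \<rho> in simp)
      have "norm (u y) \<le> norm (u (T\<^sup>2 *\<^sub>R y)) + norm (u (T\<^sup>2 *\<^sub>R y) - u y)"
        by (metis norm_triangle_sub norm_minus_commute add.commute)
      then have "(norm (u y))\<^sup>2 \<le> (norm (u (T\<^sup>2 *\<^sub>R y)) + norm (u (T\<^sup>2 *\<^sub>R y) - u y))\<^sup>2" by (intro power_mono) auto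
      also have "\<dots> \<le> 2 * (norm (u (T\<^sup>2 *\<^sub>R y)))\<^sup>2 + 2 * (norm (u (T\<^sup>2 *\<^sub>R y) - u y))\<^sup>2"
        using sum_squares_bound[of "norm (u (T\<^sup>2 *\<^sub>R y))" "norm (u (T\<^sup>2 *\<^sub>R y) - u y)"] by (simp add: power2_sum)
      finally show ?thesis using 1 2 by linarith
    qed
    have K0: "integral {1..T} (\<lambda>t. t ^ 4 * (norm y)\<^sup>2 * (norm (J (t\<^sup>2 *\<^sub>R y)))\<^sup>2) \<ge> 0" for y
      by (cases "(\<lambda>t. t ^ 4 * (norm y)\<^sup>2 * (norm (J (t\<^sup>2 *\<^sub>R y)))\<^sup>2) integrable_on {1..T}")
        (auto intro!: integral_nonneg simp: not_integrable_integral)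
    have "ennreal (LINT y:A|lborel. (norm (u y))\<^sup>2) = (\<integral>\<^sup>+y. ennreal (indicator A y *\<^sub>R (norm (u y))\<^sup>2) \<partial>lborel)"
      unfolding set_lebesgue_integral_def
      by (rule nn_integral_eq_integral[symmetric]) (use uA in \<open>auto simp: set_integrable_def\<close>)
    also have "\<dots> \<le> (\<integral>\<^sup>+y. ennreal (2 * \<epsilon>\<^sup>2) * indicator A y + 8 * ennreal (indicator A y * integral {1..T} (\<lambda>t. t ^ 4 * (norm y)\<^sup>2 * (norm (J (t\<^sup>2 *\<^sub>R y)))\<^sup>2)) \<partial>lborel)"
    proof (rule nn_integral_mono)
      fix y
      show "ennreal (indicator A y *\<^sub>R (norm (u y))\<^sup>2) \<le> ennreal (2 * \<epsilon>\<^sup>2) * indicator A y + 8 * ennreal (indicator A y * integral {1..T} (\<lambda>t. t ^ 4 * (norm y)\<^sup>2 * (norm (J (t\<^sup>2 *\<^sub>R y)))\<^sup>2))"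
      proof (cases "y \<in> A")
        case True
        have "ennreal ((norm (u y))\<^sup>2) \<le> ennreal (2 * \<epsilon>\<^sup>2 + 8 * integral {1..T} (\<lambda>t. t ^ 4 * (norm y)\<^sup>2 * (norm (J (t\<^sup>2 *\<^sub>R y)))\<^sup>2))"
          by (rule ennreal_leI[OF pt[OF True]])
        also have "\<dots> = ennreal (2 * \<epsilon>\<^sup>2) + 8 * ennreal (integral {1..T} (\<lambda>t. t ^ 4 * (norm y)\<^sup>2 * (norm (J (t\<^sup>2 *\<^sub>R y)))\<^sup>2))"
          using K0[of y] by (simp add: ennreal_plus ennreal_mult)
        finally show ?thesis using True by simp
      qed simp
    qed
    also have "\<dots> = (\<integral>\<^sup>+y. ennreal (2 * \<epsilon>\<^sup>2) * indicator A y \<partial>lborel)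
        + (\<integral>\<^sup>+y. 8 * ennreal (indicator A y * integral {1..T} (\<lambda>t. t ^ 4 * (norm y)\<^sup>2 * (norm (J (t\<^sup>2 *\<^sub>R y)))\<^sup>2)) \<partial>lborel)"
      by (rule nn_integral_add) (use bA KA(2)[OF T] in auto)
    also have "(\<integral>\<^sup>+y. ennreal (2 * \<epsilon>\<^sup>2) * indicator A y \<partial>lborel) = ennreal (2 * \<epsilon>\<^sup>2) * emeasure lborel A"
      by (rule nn_integral_cmult_indicator) (use bA in auto)
    also have "emeasure lborel A = ennreal (measure lborel A)"
      using emeasure_compact_finite[OF kA] by (intro emeasure_eq_ennreal_measure) auto
    also have "(\<integral>\<^sup>+y. 8 * ennreal (indicator A y * integral {1..T} (\<lambda>t. t ^ 4 * (norm y)\<^sup>2 * (norm (J (t\<^sup>2 *\<^sub>R y)))\<^sup>2)) \<partial>lborel)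
        = 8 * (\<integral>\<^sup>+y. ennreal (indicator A y * integral {1..T} (\<lambda>t. t ^ 4 * (norm y)\<^sup>2 * (norm (J (t\<^sup>2 *\<^sub>R y)))\<^sup>2)) \<partial>lborel)"
      by (rule nn_integral_cmult) (use KA(2)[OF T] in auto)
    also have "ennreal (2 * \<epsilon>\<^sup>2) * ennreal (measure lborel A) = ennreal (2 * \<epsilon>\<^sup>2 * measure lborel A)"
      by (rule ennreal_mult[symmetric]) auto
    also have "ennreal (2 * \<epsilon>\<^sup>2 * measure lborel A) + 8 * (\<integral>\<^sup>+y. ennreal (indicator A y * integral {1..T} (\<lambda>t. t ^ 4 * (norm y)\<^sup>2 * (norm (J (t\<^sup>2 *\<^sub>R y)))\<^sup>2)) \<partial>lborel)
      \<le> ennreal (2 * \<epsilon>\<^sup>2 * measure lborel A) + 8 * ennreal (2 * \<rho>\<^sup>2 * I)"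
      by (intro add_left_mono mult_left_mono KA(1)[OF T]) auto
    also have "\<dots> = ennreal (16 * \<rho>\<^sup>2 * I + 2 * \<epsilon>\<^sup>2 * measure lborel A)"
    proof -
      have "8 * ennreal (2 * \<rho>\<^sup>2 * I) = ennreal (16 * \<rho>\<^sup>2 * I)"
        using ennreal_mult[of 8 "2 * \<rho>\<^sup>2 * I"] I0 by (simp add: mult.assoc)
      then show ?thesis using I0 by (simp add: ennreal_plus add.commute)
    qed
    finally show ?thesis using I0 by (subst (asm) ennreal_le_iff) (auto intro!: add_nonneg_nonneg mult_nonneg_nonneg)
  qed
  have "(LINT y:A|lborel. (norm (u y))\<^sup>2) \<le> 16 * \<rho>\<^sup>2 * I"
  proof (rule field_le_epsilon)
    fix e :: real assume e: "e > 0"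
    define m where "m = measure lborel A + 1"
    have m: "m > 0" by (simp add: m_def add_nonneg_pos)
    have "sqrt (e / (2 * m)) > 0" using e m by simp
    from main[OF this] have "(LINT y:A|lborel. (norm (u y))\<^sup>2) \<le> 16 * \<rho>\<^sup>2 * I + 2 * (e / (2 * m)) * measure lborel A"
      using e m by simp
    also have "2 * (e / (2 * m)) * measure lborel A \<le> 2 * (e / (2 * m)) * m"
      using e m by (intro mult_left_mono) (auto simp: m_def)
    also have "\<dots> = e" using m by simp
    finally show "(LINT y:A|lborel. (norm (u y))\<^sup>2) \<le> 16 * \<rho>\<^sup>2 * I + e" by simp
  qed
  then show ?thesis unfolding A_def I_def E_def by (simp add: mult_ac)
qed

section \<open>The weak form of the Stokes problem\<close>

lemma jacobian_component: "jacobian f x $ i $ k = partial k f x $ i"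
  by (simp add: jacobian_def matrix_def partial_def)

lemma C1_on_jacobian:
  assumes "C1_on S f"
  shows "jacobian_on S f (jacobian f)"
  unfolding jacobian_on_def
proof (intro conjI ballI)
  fix x assume "x \<in> S"
  then have d: "(f has_derivative frechet_derivative f (at x)) (at x)"
    using assms by (simp add: C1_on_def frechet_derivative_works)
  have "(*v) (jacobian f x) = frechet_derivative f (at x)"
    unfolding jacobian_def using matrix_vector_mul(2)[OF has_derivative_linear[OF d]] by simp
  then show "(f has_derivative (*v) (jacobian f x)) (at x)" using d by simp
next
  have "continuous_on S (\<lambda>x. jacobian f x $ i $ k)" for i k
    unfolding jacobian_component using assms by (auto simp: C1_on_def intro!: continuous_intros)
  then have "continuous_on S (\<lambda>x. \<chi> i k. jacobian f x $ i $ k)" by (intro continuous_on_vec_lambda)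
  then show "continuous_on S (jacobian f)" by simp
qed

lemma C1_on_gradient:
  assumes "C1_on S p"
  shows "gradient_on S p (grad p)"
  unfolding gradient_on_def
proof (intro conjI ballI)
  fix x assume "x \<in> S"
  then have d: "(p has_derivative frechet_derivative p (at x)) (at x)"
    using assms by (simp add: C1_on_def frechet_derivative_works)
  interpret linear "frechet_derivative p (at x)" by (rule has_derivative_linear[OF d])
  have "grad p x \<bullet> v = frechet_derivative p (at x) v" for v
  proof -
    have "frechet_derivative p (at x) v = frechet_derivative p (at x) (\<Sum>k\<in>UNIV. v $ k *\<^sub>R axis k 1)"
      by (simp add: basis_expansion flip: scalar_mult_eq_scaleR)
    also have "\<dots> = (\<Sum>k\<in>UNIV. v $ k * frechet_derivative p (at x) (axis k 1))"
      by (simp add: sum scale)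
    also have "\<dots> = grad p x \<bullet> v" by (simp add: grad_def partial_def inner_vec_def mult.commute)
    finally show ?thesis by simp
  qed
  then have "(\<bullet>) (grad p x) = frechet_derivative p (at x)" by (rule ext)
  then show "(p has_derivative (\<bullet>) (grad p x)) (at x)" using d by simp
next
  show "continuous_on S (grad p)"
    unfolding grad_def[abs_def] using assms by (intro continuous_on_vec_lambda) (auto simp: C1_on_def)
qed

text \<open>Twice the rate of strain. Without the usual factor 1/2 the viscous part of
  \<open>stress\<close> is exactly \<open>symm\<close> of the gradient.\<close>

definition symm :: "real^3^3 \<Rightarrow> real^3^3" where
  "symm A = A + transpose A"

lemma stress_symm: "stress A q = symm A - q *\<^sub>R mat 1"
  by (simp add: stress_def symm_def)

lemma transpose_stress: "transpose (stress A q) = stress A q"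
  by (simp add: stress_def transpose_def vec_eq_iff mat_def)

lemma mat_inner: "mat 1 \<bullet> A = trace A" for A :: "real^3^3"
  by (simp add: inner_vec_def mat_def trace_def if_distrib[of "\<lambda>c. c * _"] cong: if_cong)

lemma stress_inner: "stress A q \<bullet> J = symm A \<bullet> J - q * trace J"
  by (simp add: stress_symm inner_diff_left mat_inner)

lemma norm_transpose: "norm (transpose A) = norm A" for A :: "real^3^3"
proof -
  have "transpose A \<bullet> transpose A = A \<bullet> A"
    unfolding inner_vec_def transpose_def by (simp, rule sum.swap)
  then show ?thesis by (simp add: norm_eq_sqrt_inner)
qed

lemma norm_symm_le: "norm (symm A) \<le> 2 * norm A"
  using norm_triangle_ineq[of A "transpose A"] by (simp add: symm_def norm_transpose)

lemma norm_stress_sq_le: "(norm (stress A q))\<^sup>2 \<le> 8 * (norm A)\<^sup>2 + 8 * q\<^sup>2"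
proof -
  have "(norm (mat 1 :: real^3^3))\<^sup>2 = 3"
    unfolding power2_norm_eq_inner mat_inner by (simp add: trace_def mat_def)
  then have "norm (mat 1 :: real^3^3) = sqrt 3" by (metis norm_ge_zero real_sqrt_unique)
  also have "\<dots> \<le> 2" by (rule real_le_lsqrt) auto
  finally have m: "norm (mat 1 :: real^3^3) \<le> 2" .
  have "norm (stress A q) \<le> norm (symm A) + norm (q *\<^sub>R (mat 1 :: real^3^3))"
    unfolding stress_symm by (rule norm_triangle_ineq4)
  also have "\<dots> \<le> 2 * norm A + 2 * \<bar>q\<bar>"
    using norm_symm_le[of A] mult_left_mono[OF m, of "\<bar>q\<bar>"] by simp
  finally have "(norm (stress A q))\<^sup>2 \<le> (2 * norm A + 2 * \<bar>q\<bar>)\<^sup>2" by (intro power_mono) auto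
  also have "\<dots> \<le> 8 * (norm A)\<^sup>2 + 8 * q\<^sup>2"
    using sum_squares_bound[of "norm A" "\<bar>q\<bar>"] by (simp add: power2_sum power_mult_distrib)
  finally show ?thesis .
qed

lemma matrix_inner_transpose: "(A *v v) \<bullet> w = v \<bullet> (transpose A *v w)" for A :: "real^3^3"
  by (metis dot_lmul_matrix inner_commute transpose_matrix_vector)

text \<open>The divergence of row \<open>i\<close> is the sum of the Laplacian of
  \<open>u i\<close>, the derivative in direction \<open>i\<close> of the divergence of
  \<open>u\<close>, and minus that derivative of \<open>p\<close>. The middle term arises by
  exchanging mixed derivatives and vanishes because \<open>u\<close> is divergence free on an open
  set; the rest is the momentum equation.\<close>

lemma stokes_stress_on:
  assumes D: "open D" and u: "C2_on D u" and p: "C1_on D p"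
    and eq: "\<And>y. y \<in> D \<Longrightarrow> - laplacian u y + grad p y = 0"
    and div: "\<And>y. y \<in> D \<Longrightarrow> divergence u y = 0"
  shows "stress_on D (\<lambda>y. stress (jacobian u y) (p y))"
proof -
  have ju: "jacobian_on D u (jacobian u)" using u by (intro C1_on_jacobian) (simp add: C2_on_def)
  have jpu: "jacobian_on D (partial k u) (jacobian (partial k u))" for k
    using u by (intro C1_on_jacobian) (simp add: C2_on_def)
  have gp: "gradient_on D p (grad p)" by (rule C1_on_gradient[OF p])
  have gc: "gradient_on D (\<lambda>y. partial k u y $ i) (\<lambda>y. jacobian (partial k u) y $ i)" for k i
    using jpu[of k] by (simp add: jacobian_on_iff)
  have mixed: "jacobian (partial i u) y $ m $ j = jacobian (partial j u) y $ m $ i" if y: "y \<in> D" for i j m y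
  proof -
    obtain r where r: "r > 0" "ball y r \<subseteq> D" using D y open_contains_ball by blast
    have "(jacobian (partial i u) y *v axis j 1) $ m = (jacobian (partial j u) y *v axis i 1) $ m"
    proof (rule mixed_partial_derivatives_commute[OF r(1), where f="\<lambda>y. u y $ m" and f'="\<lambda>y v. (jacobian u y *v v) $ m"
          and fa'="\<lambda>y v. (jacobian (partial i u) y *v v) $ m" and fb'="\<lambda>y v. (jacobian (partial j u) y *v v) $ m"])
      fix z assume "z \<in> ball y r"
      then have z: "z \<in> D" using r by blast
      have "(u has_derivative (*v) (jacobian u z)) (at z)" using ju z by (simp add: jacobian_on_def)
      from bounded_linear.has_derivative[OF bounded_linear_vec_nth this]
      show "((\<lambda>y. u y $ m) has_derivative (\<lambda>v. (jacobian u z *v v) $ m)) (at z)" .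
      have *: "((\<lambda>z. (jacobian u z *v axis k 1) $ m) has_derivative (\<lambda>v. (jacobian (partial k u) z *v v) $ m)) (at z)" for k
      proof -
        have "(partial k u has_derivative (*v) (jacobian (partial k u) z)) (at z)"
          using jpu[of k] z by (simp add: jacobian_on_def)
        from bounded_linear.has_derivative[OF bounded_linear_vec_nth this, of m]
        show ?thesis by (simp add: matrix_vector_mult_basis column_def jacobian_component)
      qed
      show "((\<lambda>z. (jacobian u z *v axis i 1) $ m) has_derivative (\<lambda>v. (jacobian (partial i u) z *v v) $ m)) (at z)"
        "((\<lambda>z. (jacobian u z *v axis j 1) $ m) has_derivative (\<lambda>v. (jacobian (partial j u) z *v v) $ m)) (at z)"
        by (rule *)+
    next
      have *: "continuous (at y) (\<lambda>y. (jacobian (partial k u) y *v axis l 1) $ m)" for k l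
      proof -
        have "continuous_on D (\<lambda>y. jacobian (partial k u) y $ m $ l)"
          using jpu[of k] by (auto simp: jacobian_on_def intro!: continuous_intros)
        then show ?thesis using D y by (simp add: matrix_vector_mult_basis column_def continuous_on_eq_continuous_at)
      qed
      show "continuous (at y) (\<lambda>y. (jacobian (partial i u) y *v axis j 1) $ m)"
        "continuous (at y) (\<lambda>y. (jacobian (partial j u) y *v axis i 1) $ m)" by (rule *)+
    qed
    then show ?thesis by (simp add: matrix_vector_mult_basis column_def)
  qed
  have divgrad: "(\<Sum>k\<in>UNIV. jacobian (partial k u) y $ k) = 0" if y: "y \<in> D" for y
  proof -
    have "gradient_on D (\<lambda>y. \<Sum>k\<in>UNIV. partial k u y $ k) (\<lambda>y. \<Sum>k\<in>UNIV. jacobian (partial k u) y $ k)"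
      by (intro gradient_on_sum gc)
    then have "((\<lambda>y. \<Sum>k\<in>UNIV. partial k u y $ k) has_derivative (\<bullet>) (\<Sum>k\<in>UNIV. jacobian (partial k u) y $ k)) (at y)"
      using y by (simp add: gradient_on_def)
    moreover have "((\<lambda>y. \<Sum>k\<in>UNIV. partial k u y $ k) has_derivative (\<lambda>v. 0)) (at y)"
      by (rule has_derivative_transform_within_open[OF has_derivative_const D y])
        (use div in \<open>simp add: divergence_def\<close>)
    ultimately have "(\<bullet>) (\<Sum>k\<in>UNIV. jacobian (partial k u) y $ k) = (\<lambda>v. 0)" by (rule has_derivative_unique)
    then have "(\<Sum>k\<in>UNIV. jacobian (partial k u) y $ k) \<bullet> (\<Sum>k\<in>UNIV. jacobian (partial k u) y $ k) = 0" by metis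
    then show ?thesis by simp
  qed
  show ?thesis
    unfolding stress_on_def
  proof (intro conjI ballI allI)
    show "transpose (stress (jacobian u y) (p y)) = stress (jacobian u y) (p y)" for y
      by (rule transpose_stress)
    fix i
    \<comment> \<open>Row \<open>j\<close> of \<open>T y\<close> is the gradient of the entry of the
      stress in row \<open>i\<close> and column \<open>j\<close>.\<close>
    define T where "T = (\<lambda>y. \<chi> j. jacobian (partial j u) y $ i + jacobian (partial i u) y $ j
        - (if i = j then grad p y else 0))"
    have "jacobian_on D (\<lambda>y. stress (jacobian u y) (p y) $ i) T"
      unfolding jacobian_on_iff
    proof
      fix j
      have "gradient_on D (\<lambda>y. partial j u y $ i + partial i u y $ j - (if i = j then p y else 0))
         (\<lambda>y. jacobian (partial j u) y $ i + jacobian (partial i u) y $ j - (if i = j then grad p y else 0))"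
      proof (intro gradient_on_diff gradient_on_add gc)
        show "gradient_on D (\<lambda>y. if i = j then p y else 0) (\<lambda>y. if i = j then grad p y else 0)"
          using gp gradient_on_const by (cases "i = j") simp_all
      qed
      then show "gradient_on D (\<lambda>y. stress (jacobian u y) (p y) $ i $ j) (\<lambda>y. T y $ j)"
        by (rule gradient_on_transform[OF _ D])
          (auto simp: stress_def transpose_def jacobian_component mat_def T_def)
    qed
    moreover have "trace (T y) = 0" if y: "y \<in> D" for y
    proof -
      have "trace (T y) = (\<Sum>j\<in>UNIV. jacobian (partial j u) y $ i $ j) + (\<Sum>j\<in>UNIV. jacobian (partial i u) y $ j $ j) - grad p y $ i"
        by (simp add: trace_def T_def sum.distrib sum_subtractf if_distrib[of "\<lambda>v. v $ _"] cong: if_cong)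
      also have "(\<Sum>j\<in>UNIV. jacobian (partial i u) y $ j $ j) = (\<Sum>k\<in>UNIV. jacobian (partial k u) y $ k) $ i"
        by (simp add: sum_component mixed[OF y, of i])
      also have "\<dots> = 0" using divgrad[OF y] by simp
      also have "(\<Sum>j\<in>UNIV. jacobian (partial j u) y $ i $ j) = laplacian u y $ i"
        by (simp add: laplacian_def sum_component jacobian_component)
      also have "laplacian u y $ i + 0 - grad p y $ i = 0"
        using arg_cong[OF eq[OF y], of "\<lambda>v. v $ i"] by simp
      finally show ?thesis .
    qed
    ultimately show "\<exists>T. jacobian_on D (\<lambda>y. stress (jacobian u y) (p y) $ i) T \<and> (\<forall>y\<in>D. trace (T y) = 0)" by blast
  qed
qed

lemma stress_on_cong:
  assumes "stress_on D \<sigma>" "open D" "\<And>y. y \<in> D \<Longrightarrow> \<sigma> y = \<tau> y"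
  shows "stress_on D \<tau>"
  unfolding stress_on_def
proof (intro conjI allI ballI)
  show "transpose (\<tau> y) = \<tau> y" if "y \<in> D" for y using assms that by (auto simp: stress_on_def)
  fix i
  obtain T where T: "jacobian_on D (\<lambda>x. \<sigma> x $ i) T" "\<forall>x\<in>D. trace (T x) = 0"
    using assms(1) unfolding stress_on_def by blast
  have "jacobian_on D (\<lambda>x. \<tau> x $ i) T"
    by (rule jacobian_on_transform[OF T(1) assms(2)]) (use assms(3) in auto)
  then show "\<exists>T. jacobian_on D (\<lambda>x. \<tau> x $ i) T \<and> (\<forall>x\<in>D. trace (T x) = 0)" using T(2) by blast
qed

text \<open>Replaces the pointwise decay \<open>O(1 / |x|)\<close>, which would need a representation formula; for
  velocities of finite energy that vanish at infinity it follows from integration along rays.\<close>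

definition growth_on :: "(real^3) set \<Rightarrow> (real^3 \<Rightarrow> real^3) \<Rightarrow> bool" where
  "growth_on D \<phi> \<longleftrightarrow> (\<exists>\<rho>0 C. \<forall>\<rho>\<ge>\<rho>0.
     (LINT y:{y \<in> D. \<rho>\<^sup>2 \<le> (norm y)\<^sup>2 \<and> (norm y)\<^sup>2 \<le> 2 * \<rho>\<^sup>2}|lborel. (norm (\<phi> y))\<^sup>2) \<le> C * \<rho>\<^sup>2)"

lemma shell_facts:
  fixes D :: "(real^3) set"
  assumes "D \<in> sets borel" "0 \<le> \<rho>"
  defines "A \<equiv> {y \<in> D. \<rho>\<^sup>2 \<le> (norm y)\<^sup>2 \<and> (norm y)\<^sup>2 \<le> 2 * \<rho>\<^sup>2}"
  shows "A \<in> sets borel" "A \<subseteq> D" "y \<in> A \<Longrightarrow> \<rho> \<le> norm y" "A \<subseteq> cball 0 (2 * \<rho>)"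
proof -
  have "closed {y::real^3. \<rho>\<^sup>2 \<le> (norm y)\<^sup>2}" "closed {y::real^3. (norm y)\<^sup>2 \<le> 2 * \<rho>\<^sup>2}"
    by (intro closed_Collect_le continuous_intros)+
  then have "D \<inter> ({y. \<rho>\<^sup>2 \<le> (norm y)\<^sup>2} \<inter> {y. (norm y)\<^sup>2 \<le> 2 * \<rho>\<^sup>2}) \<in> sets borel"
    by (intro sets.Int[OF assms(1)] sets.Int borel_closed)
  also have "D \<inter> ({y. \<rho>\<^sup>2 \<le> (norm y)\<^sup>2} \<inter> {y. (norm y)\<^sup>2 \<le> 2 * \<rho>\<^sup>2}) = A" unfolding A_def by blast
  finally show "A \<in> sets borel" .
  show "A \<subseteq> D" unfolding A_def by blast
  show "\<rho> \<le> norm y" if "y \<in> A"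
  proof (rule power2_le_imp_le)
    show "\<rho>\<^sup>2 \<le> (norm y)\<^sup>2" using that unfolding A_def mem_Collect_eq by blast
  qed simp
  show "A \<subseteq> cball 0 (2 * \<rho>)"
  proof
    fix y assume "y \<in> A"
    then have "(norm y)\<^sup>2 \<le> 2 * \<rho>\<^sup>2" unfolding A_def mem_Collect_eq by blast
    also have "\<dots> \<le> (2 * \<rho>)\<^sup>2" by (simp add: power_mult_distrib)
    finally have "norm y \<le> 2 * \<rho>" by (rule power2_le_imp_le) (use assms(2) in simp)
    then show "y \<in> cball 0 (2 * \<rho>)" by simp
  qed
qed

lemma shell_integrable:
  fixes \<phi> :: "real^3 \<Rightarrow> real^3"
  assumes "D \<in> sets borel" "0 \<le> \<rho>" "continuous_on (closure D) \<phi>"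
  shows "set_integrable lborel {y \<in> D. \<rho>\<^sup>2 \<le> (norm y)\<^sup>2 \<and> (norm y)\<^sup>2 \<le> 2 * \<rho>\<^sup>2} (\<lambda>y. (norm (\<phi> y))\<^sup>2)"
proof (rule set_integrable_subset)
  have "compact (closure D \<inter> cball 0 (2 * \<rho>))" by (simp add: closed_Int_compact)
  moreover have "continuous_on (closure D \<inter> cball 0 (2 * \<rho>)) (\<lambda>y. (norm (\<phi> y))\<^sup>2)"
    by (intro continuous_on_power continuous_on_norm continuous_on_subset[OF assms(3)]) blast
  ultimately show "set_integrable lborel (closure D \<inter> cball 0 (2 * \<rho>)) (\<lambda>y. (norm (\<phi> y))\<^sup>2)"
    by (rule set_integrable_compact)
  show "{y \<in> D. \<rho>\<^sup>2 \<le> (norm y)\<^sup>2 \<and> (norm y)\<^sup>2 \<le> 2 * \<rho>\<^sup>2} \<in> sets lborel"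
    using shell_facts(1)[OF assms(1,2)] unfolding sets_lborel .
  show "{y \<in> D. \<rho>\<^sup>2 \<le> (norm y)\<^sup>2 \<and> (norm y)\<^sup>2 \<le> 2 * \<rho>\<^sup>2} \<subseteq> closure D \<inter> cball 0 (2 * \<rho>)"
    using shell_facts(2,4)[OF assms(1,2)] closure_subset by blast
qed

lemma growth_on_diff:
  assumes D: "D \<in> sets borel" and f: "growth_on D f" "continuous_on (closure D) f"
    and g: "growth_on D g" "continuous_on (closure D) g"
  shows "growth_on D (\<lambda>y. f y - g y)"
proof -
  obtain \<rho>1 C1 where 1: "\<And>\<rho>. \<rho> \<ge> \<rho>1 \<Longrightarrow> (LINT y:{y \<in> D. \<rho>\<^sup>2 \<le> (norm y)\<^sup>2 \<and> (norm y)\<^sup>2 \<le> 2 * \<rho>\<^sup>2}|lborel. (norm (f y))\<^sup>2) \<le> C1 * \<rho>\<^sup>2"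
    using f(1) unfolding growth_on_def by blast
  obtain \<rho>2 C2 where 2: "\<And>\<rho>. \<rho> \<ge> \<rho>2 \<Longrightarrow> (LINT y:{y \<in> D. \<rho>\<^sup>2 \<le> (norm y)\<^sup>2 \<and> (norm y)\<^sup>2 \<le> 2 * \<rho>\<^sup>2}|lborel. (norm (g y))\<^sup>2) \<le> C2 * \<rho>\<^sup>2"
    using g(1) unfolding growth_on_def by blast
  show ?thesis unfolding growth_on_def
  proof (intro exI allI impI)
    fix \<rho> assume \<rho>: "\<rho> \<ge> max 0 (max \<rho>1 \<rho>2)"
    then have \<rho>0: "0 \<le> \<rho>" by simp
    define A where "A = {y \<in> D. \<rho>\<^sup>2 \<le> (norm y)\<^sup>2 \<and> (norm y)\<^sup>2 \<le> 2 * \<rho>\<^sup>2}"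
    have fi: "set_integrable lborel A (\<lambda>y. 2 * (norm (f y))\<^sup>2)"
      unfolding A_def by (rule set_integrable_mult_right) (rule shell_integrable[OF D \<rho>0 f(2)])
    have gi: "set_integrable lborel A (\<lambda>y. 2 * (norm (g y))\<^sup>2)"
      unfolding A_def by (rule set_integrable_mult_right) (rule shell_integrable[OF D \<rho>0 g(2)])
    have di: "set_integrable lborel A (\<lambda>y. (norm (f y - g y))\<^sup>2)"
      unfolding A_def by (rule shell_integrable[OF D \<rho>0 continuous_on_diff[OF f(2) g(2)]])
    have "(LINT y:A|lborel. (norm (f y - g y))\<^sup>2) \<le> (LINT y:A|lborel. 2 * (norm (f y))\<^sup>2 + 2 * (norm (g y))\<^sup>2)"
    proof (rule set_integral_mono[OF di set_integral_add(1)[OF fi gi]])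
      fix y
      have "(norm (f y - g y))\<^sup>2 \<le> (norm (f y) + norm (g y))\<^sup>2" by (intro power_mono norm_triangle_ineq4) auto
      also have "\<dots> \<le> 2 * (norm (f y))\<^sup>2 + 2 * (norm (g y))\<^sup>2"
        using sum_squares_bound[of "norm (f y)" "norm (g y)"] by (simp add: power2_sum)
      finally show "(norm (f y - g y))\<^sup>2 \<le> 2 * (norm (f y))\<^sup>2 + 2 * (norm (g y))\<^sup>2" .
    qed
    also have "\<dots> = 2 * (LINT y:A|lborel. (norm (f y))\<^sup>2) + 2 * (LINT y:A|lborel. (norm (g y))\<^sup>2)"
      unfolding set_integral_add(2)[OF fi gi] set_integral_mult_right ..
    also have "\<dots> \<le> 2 * (C1 * \<rho>\<^sup>2) + 2 * (C2 * \<rho>\<^sup>2)"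
      using 1[of \<rho>] 2[of \<rho>] \<rho> unfolding A_def by (intro add_mono mult_left_mono) auto
    also have "\<dots> = (2 * C1 + 2 * C2) * \<rho>\<^sup>2" by (simp add: algebra_simps)
    finally show "(LINT y:{y \<in> D. \<rho>\<^sup>2 \<le> (norm y)\<^sup>2 \<and> (norm y)\<^sup>2 \<le> 2 * \<rho>\<^sup>2}|lborel. (norm (f y - g y))\<^sup>2) \<le> (2 * C1 + 2 * C2) * \<rho>\<^sup>2"
      unfolding A_def .
  qed
qed

text \<open>On the annulus the square of \<open>f\<close> is \<open>O(\<rho>^-2)\<close> and the
  volume is \<open>O(\<rho>^3)\<close>, so the integral is even \<open>O(\<rho>)\<close>. This
  serves the explicit flows and the compactly supported correctors.\<close>

lemma growth_on_decay:
  fixes f :: "real^3 \<Rightarrow> real^3"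
  assumes D: "D \<in> sets borel" and cf: "continuous_on (closure D) f"
    and f: "\<And>y. y \<in> D \<Longrightarrow> \<rho>0 \<le> norm y \<Longrightarrow> norm (f y) \<le> c / norm y"
  shows "growth_on D f"
  unfolding growth_on_def
proof (intro exI allI impI)
  fix \<rho> assume \<rho>: "\<rho> \<ge> max 1 \<rho>0"
  then have \<rho>0: "0 \<le> \<rho>" "1 \<le> \<rho>" "\<rho>0 \<le> \<rho>" by auto
  define A where "A = {y \<in> D. \<rho>\<^sup>2 \<le> (norm y)\<^sup>2 \<and> (norm y)\<^sup>2 \<le> 2 * \<rho>\<^sup>2}"
  note A = shell_facts[OF D \<rho>0(1), folded A_def]
  have bi: "set_integrable lborel (cball 0 (2 * \<rho>)) (\<lambda>y::real^3. c\<^sup>2 / \<rho>\<^sup>2)"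
    by (rule set_integrable_compact) auto
  have "(LINT y:A|lborel. (norm (f y))\<^sup>2) \<le> (LINT y:cball (0::real^3) (2 * \<rho>)|lborel. c\<^sup>2 / \<rho>\<^sup>2)"
    unfolding set_lebesgue_integral_def
  proof (rule integral_mono)
    show "integrable lborel (\<lambda>y. indicator A y *\<^sub>R (norm (f y))\<^sup>2)"
      using shell_integrable[OF D \<rho>0(1) cf] unfolding A_def set_integrable_def .
    show "integrable lborel (\<lambda>y. indicator (cball (0::real^3) (2 * \<rho>)) y *\<^sub>R (c\<^sup>2 / \<rho>\<^sup>2))"
      using bi unfolding set_integrable_def .
    fix y
    show "indicator A y *\<^sub>R (norm (f y))\<^sup>2 \<le> indicator (cball (0::real^3) (2 * \<rho>)) y *\<^sub>R (c\<^sup>2 / \<rho>\<^sup>2)"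
    proof (cases "y \<in> A")
      case True
      have n: "\<rho> \<le> norm y" by (rule A(3)[OF True])
      have "norm (f y) \<le> c / norm y" using f[of y] A(2) True n \<rho>0 by auto
      also have "\<dots> \<le> \<bar>c\<bar> / norm y" by (intro divide_right_mono) auto
      also have "\<dots> \<le> \<bar>c\<bar> / \<rho>" using n \<rho>0 by (intro divide_left_mono) (auto intro!: mult_pos_pos)
      finally have "(norm (f y))\<^sup>2 \<le> (\<bar>c\<bar> / \<rho>)\<^sup>2" by (intro power_mono) auto
      then show ?thesis using True A(4) by (auto simp: power_divide)
    qed simp
  qed
  also have "\<dots> = c\<^sup>2 / \<rho>\<^sup>2 * measure lborel (cball (0::real^3) (2 * \<rho>))"
    by (simp add: set_lebesgue_integral_def)
  also have "measure lborel (cball (0::real^3) (2 * \<rho>)) = unit_ball_vol 3 * (2 * \<rho>) ^ 3"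
    using content_cball[of "2 * \<rho>" "0::real^3"] \<rho>0 by simp
  also have "c\<^sup>2 / \<rho>\<^sup>2 * (unit_ball_vol 3 * (2 * \<rho>) ^ 3) = 8 * c\<^sup>2 * unit_ball_vol 3 * \<rho>"
    using \<rho>0 by (simp add: power2_eq_square power3_eq_cube)
  also have "\<dots> \<le> 8 * c\<^sup>2 * unit_ball_vol 3 * \<rho>\<^sup>2"
    using \<rho>0 by (intro mult_left_mono) (auto simp: power2_eq_square)
  finally show "(LINT y:{y \<in> D. \<rho>\<^sup>2 \<le> (norm y)\<^sup>2 \<and> (norm y)\<^sup>2 \<le> 2 * \<rho>\<^sup>2}|lborel. (norm (f y))\<^sup>2) \<le> 8 * c\<^sup>2 * unit_ball_vol 3 * \<rho>\<^sup>2"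
    unfolding A_def .
qed

context suspension
begin

lemma growth_on_stokes:
  assumes u: "jacobian_on D u J" and J2: "set_integrable lborel D (\<lambda>y. (norm (J y))\<^sup>2)"
    and u0: "(u \<longlongrightarrow> 0) at_infinity"
  shows "growth_on D u"
proof -
  define \<rho>1 where "\<rho>1 = (\<Sum>i\<in>{1..N}. norm (x i)) + R"
  have \<rho>1: "0 \<le> \<rho>1" using R by (simp add: \<rho>1_def sum_nonneg)
  have sub: "{y. \<rho>1 < norm y} \<subseteq> D"
  proof
    fix y :: "real^3" assume y: "y \<in> {y. \<rho>1 < norm y}"
    have "R < dist (x i) y" if "i \<in> {1..N}" for i
    proof -
      have "norm (x i) \<le> (\<Sum>i\<in>{1..N}. norm (x i))" using that by (intro member_le_sum) auto
      moreover have "norm y \<le> norm (x i) + dist (x i) y"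
        by (metis dist_norm norm_minus_commute norm_triangle_sub)
      ultimately show ?thesis using y by (simp add: \<rho>1_def)
    qed
    then show "y \<in> D" by (simp add: fluid_domain_eq)
  qed
  have "open {y::real^3. \<rho>1 < norm y}" by (intro open_Collect_less continuous_intros)
  then have J2': "set_integrable lborel {y. \<rho>1 < norm y} (\<lambda>y. (norm (J y))\<^sup>2)"
    by (intro set_integrable_subset[OF J2 _ sub]) simp
  note F = far_field_bound[OF jacobian_on_subset[OF u sub] \<rho>1 J2' u0]
  show ?thesis unfolding growth_on_def
  proof (intro exI allI impI)
    fix \<rho> assume \<rho>: "\<rho> \<ge> \<rho>1 + 1"
    have "{y::real^3. \<rho>\<^sup>2 \<le> (norm y)\<^sup>2 \<and> (norm y)\<^sup>2 \<le> 2 * \<rho>\<^sup>2} \<subseteq> D"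
    proof
      fix y :: "real^3" assume "y \<in> {y. \<rho>\<^sup>2 \<le> (norm y)\<^sup>2 \<and> (norm y)\<^sup>2 \<le> 2 * \<rho>\<^sup>2}"
      then have "\<rho>\<^sup>2 \<le> (norm y)\<^sup>2" by blast
      then have "\<rho> \<le> norm y" by (rule power2_le_imp_le) simp
      then show "y \<in> D" using sub \<rho> by auto
    qed
    then have "{y \<in> D. \<rho>\<^sup>2 \<le> (norm y)\<^sup>2 \<and> (norm y)\<^sup>2 \<le> 2 * \<rho>\<^sup>2} = {y. \<rho>\<^sup>2 \<le> (norm y)\<^sup>2 \<and> (norm y)\<^sup>2 \<le> 2 * \<rho>\<^sup>2}"
      by blast
    then show "(LINT y:{y \<in> D. \<rho>\<^sup>2 \<le> (norm y)\<^sup>2 \<and> (norm y)\<^sup>2 \<le> 2 * \<rho>\<^sup>2}|lborel. (norm (u y))\<^sup>2)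
        \<le> 16 * (LINT y:{y. \<rho>1 < norm y}|lborel. (norm (J y))\<^sup>2) * \<rho>\<^sup>2"
      using F[of \<rho>] \<rho> by simp
  qed
qed

text \<open>Symmetry of the stress turns the flux into the traction tested with the rigid velocity.
  The constant part sees the total force, which is \<open>- F\<close>; the rotational part, by the
  triple product, sees the torque, which is zero.\<close>

lemma sphint_rigid_stress:
  assumes cG: "continuous_on (closure D) G" and cp: "continuous_on (closure D) p" and i: "i \<in> {1..N}"
    and force: "sphere_integral (x i) R (\<lambda>y. stress (G y) (p y) *v ((1 / R) *\<^sub>R (y - x i))) = - F"
    and torque: "sphere_integral (x i) R (\<lambda>y. cross3 (y - x i) (stress (G y) (p y) *v ((1 / R) *\<^sub>R (y - x i)))) = 0"
    and \<phi>: "\<And>y. y \<in> sphere (x i) R \<Longrightarrow> \<phi> y = a + cross3 b (y - x i)"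
  shows "sphint (x i) R (\<lambda>y. (stress (G y) (p y) *v \<phi> y) \<bullet> ((1 / R) *\<^sub>R (y - x i))) = - (F \<bullet> a)"
proof -
  let ?t = "\<lambda>y. stress (G y) (p y) *v ((1 / R) *\<^sub>R (y - x i))"
  have sub: "sphere (x i) R \<subseteq> closure D" by (rule sphere_subset_closure[OF i])
  have "continuous_on (closure D) (\<lambda>y. stress (G y) (p y))"
    unfolding stress_def transpose_def
    by (intro continuous_intros cp cG)
  then have ct: "continuous_on (sphere (x i) R) ?t"
    by (intro matrix_vector_mult_continuous_on continuous_intros) (use sub continuous_on_subset in blast)
  have cc: "continuous_on (sphere (x i) R) (\<lambda>y. cross3 (y - x i) (?t y))"
    using ct by (intro continuous_on_cross continuous_intros)
  have "sphint (x i) R (\<lambda>y. (stress (G y) (p y) *v \<phi> y) \<bullet> ((1 / R) *\<^sub>R (y - x i)))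
      = sphint (x i) R (\<lambda>y. a \<bullet> ?t y + b \<bullet> cross3 (y - x i) (?t y))"
  proof (rule sphint_cong)
    fix y assume y: "y \<in> sphere (x i) R"
    have "(stress (G y) (p y) *v \<phi> y) \<bullet> ((1 / R) *\<^sub>R (y - x i)) = \<phi> y \<bullet> ?t y"
      by (simp only: matrix_inner_transpose transpose_stress)
    also have "\<dots> = a \<bullet> ?t y + b \<bullet> cross3 (y - x i) (?t y)"
      using cross_triple[of b "y - x i" "?t y"] by (simp add: \<phi>[OF y] inner_add_left inner_commute)
    finally show "(stress (G y) (p y) *v \<phi> y) \<bullet> ((1 / R) *\<^sub>R (y - x i)) = a \<bullet> ?t y + b \<bullet> cross3 (y - x i) (?t y)" .
  qed (use R in simp)
  also have "\<dots> = sphint (x i) R (\<lambda>y. a \<bullet> ?t y) + sphint (x i) R (\<lambda>y. b \<bullet> cross3 (y - x i) (?t y))"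
    using R ct cc by (intro sphint_add continuous_intros) auto
  also have "sphint (x i) R (\<lambda>y. a \<bullet> ?t y) = a \<bullet> (- F)"
    using sphere_integral_inner[OF ct, of a] force R by simp
  also have "sphint (x i) R (\<lambda>y. b \<bullet> cross3 (y - x i) (?t y)) = b \<bullet> 0"
    using sphere_integral_inner[OF cc, of b] torque R by simp
  finally show ?thesis by (simp add: inner_commute)
qed

text \<open>The pressure drops out because the test field is divergence free. On the spheres only
  its translational part works, and the sign in Green's formula cancels that of the force.\<close>

lemma stokes_weak:
  assumes u: "stokes_solution N R x F u p V \<Omega>"
    and \<phi>: "jacobian_on D \<phi> J" "continuous_on (closure D) \<phi>" "growth_on D \<phi>"
    and J: "set_integrable lborel D (\<lambda>y. (norm (J y))\<^sup>2)" "\<And>y. y \<in> D \<Longrightarrow> trace (J y) = 0"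
    and rigid: "\<And>i y. i \<in> {1..N} \<Longrightarrow> y \<in> sphere (x i) R \<Longrightarrow> \<phi> y = a i + cross3 (b i) (y - x i)"
  shows "set_integrable lborel D (\<lambda>y. symm (jacobian u y) \<bullet> J y)"
    and "(LINT y:D|lborel. symm (jacobian u y) \<bullet> J y) = (\<Sum>i\<in>{1..N}. F \<bullet> a i)"
proof -
  note s = u[unfolded stokes_solution_def Let_def]
  obtain G where G: "continuous_on (closure D) G" "\<And>y. y \<in> D \<Longrightarrow> G y = jacobian u y"
    "\<And>i. i \<in> {1..N} \<Longrightarrow> sphere_integral (x i) R (\<lambda>y. stress (G y) (p y) *v ((1 / R) *\<^sub>R (y - x i))) = - F"
    "\<And>i. i \<in> {1..N} \<Longrightarrow> sphere_integral (x i) R (\<lambda>y. cross3 (y - x i) (stress (G y) (p y) *v ((1 / R) *\<^sub>R (y - x i)))) = 0"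
    using s by blast
  have cp: "continuous_on (closure D) p" using s by blast
  have oD: "open D" by (rule open_fluid_domain)
  let ?\<sigma> = "\<lambda>y. stress (G y) (p y)"
  have st: "stress_on D ?\<sigma>"
  proof (rule stress_on_cong[OF stokes_stress_on oD])
    show "open D" "C2_on D u" "C1_on D p" using oD s by blast+
    show "- laplacian u y + grad p y = 0" "divergence u y = 0" if "y \<in> D" for y using s that by blast+
    show "stress (jacobian u y) (p y) = stress (G y) (p y)" if "y \<in> D" for y using G(2)[OF that] by simp
  qed
  have c\<sigma>: "continuous_on (closure D) ?\<sigma>"
    unfolding stress_def transpose_def by (intro continuous_intros cp G(1))
  have Ju2: "set_integrable lborel D (\<lambda>y. (norm (jacobian u y))\<^sup>2)" and p2: "set_integrable lborel D (\<lambda>y. (p y)\<^sup>2)"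
    using s by blast+
  have \<sigma>2: "set_integrable lborel D (\<lambda>y. (norm (?\<sigma> y))\<^sup>2)"
  proof (rule set_integrable_bound_continuous)
    show "set_integrable lborel D (\<lambda>y. 8 * (norm (jacobian u y))\<^sup>2 + 8 * (p y)\<^sup>2)"
      using Ju2 p2 by (intro set_integral_add(1) set_integrable_mult_right)
    show "D \<in> sets borel" using oD by simp
    show "continuous_on D (\<lambda>y. (norm (?\<sigma> y))\<^sup>2)"
      by (intro continuous_intros continuous_on_subset[OF c\<sigma> closure_subset])
    show "\<bar>(norm (?\<sigma> y))\<^sup>2\<bar> \<le> 8 * (norm (jacobian u y))\<^sup>2 + 8 * (p y)\<^sup>2" if "y \<in> D" for y
      using norm_stress_sq_le[of "G y" "p y"] G(2)[OF that] by simp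
  qed
  obtain \<rho>0 C where gr: "\<And>\<rho>. \<rho> \<ge> \<rho>0 \<Longrightarrow> (LINT y:{y \<in> D. \<rho>\<^sup>2 \<le> (norm y)\<^sup>2 \<and> (norm y)\<^sup>2 \<le> 2 * \<rho>\<^sup>2}|lborel. (norm (\<phi> y))\<^sup>2) \<le> C * \<rho>\<^sup>2"
    using \<phi>(3) unfolding growth_on_def by blast
  note gg = green[OF st c\<sigma> \<sigma>2 \<phi>(1,2) J(1) gr]
  have eq: "?\<sigma> y \<bullet> J y = symm (jacobian u y) \<bullet> J y" if "y \<in> D" for y
    using J(2)[OF that] G(2)[OF that] by (simp add: stress_inner)
  show "set_integrable lborel D (\<lambda>y. symm (jacobian u y) \<bullet> J y)"
    by (subst set_integrable_cong[OF refl refl eq, symmetric]) (assumption | rule gg(1))+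
  have "(LINT y:D|lborel. symm (jacobian u y) \<bullet> J y) = (LINT y:D|lborel. ?\<sigma> y \<bullet> J y)"
    by (rule set_lebesgue_integral_cong) (use oD eq in auto)
  also have "\<dots> = - (\<Sum>i\<in>{1..N}. sphint (x i) R (\<lambda>y. (?\<sigma> y *v \<phi> y) \<bullet> ((1 / R) *\<^sub>R (y - x i))))"
    by (rule gg(2))
  also have "\<dots> = - (\<Sum>i\<in>{1..N}. - (F \<bullet> a i))"
    by (intro arg_cong[of _ _ uminus] sum.cong refl sphint_rigid_stress[OF G(1) cp _ G(3,4) rigid])
  finally show "(LINT y:D|lborel. symm (jacobian u y) \<bullet> J y) = (\<Sum>i\<in>{1..N}. F \<bullet> a i)"
    by (simp add: sum_negf)
qed

end

section \<open>The flow past a translating sphere\<close>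

text \<open>All explicit fields below are written as polynomials in \<open>x\<close> and
  \<open>q = inverse (norm x)\<close>. This rule keeps their derivatives in the same class.\<close>

lemma gradient_on_inverse_norm_power:
  "gradient_on (- {0}) (\<lambda>x. inverse (norm x) ^ m) (\<lambda>x. - (real m * inverse (norm x) ^ (m + 2)) *\<^sub>R x)"
  unfolding gradient_on_def
proof (intro conjI ballI)
  fix x :: "real^3" assume "x \<in> - {0}"
  then have x: "x \<noteq> 0" by simp
  have 1: "(norm has_derivative (\<lambda>v. v \<bullet> sgn x)) (at x)" by (rule has_derivative_norm[OF x])
  have "((\<lambda>t. inverse t ^ m) has_real_derivative - (real m * inverse (norm x) ^ (m + 1))) (at (norm x))"
  proof (rule DERIV_cong[OF DERIV_power[OF DERIV_inverse]])
    show "norm x \<noteq> 0" using x by simp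
    show "of_nat m * (- (inverse (norm x) ^ Suc (Suc 0)) * inverse (norm x) ^ (m - Suc 0)) = - (real m * inverse (norm x) ^ (m + 1))"
      by (cases m) simp_all
  qed
  from has_derivative_compose[OF 1 this[unfolded has_field_derivative_def]]
  have "((\<lambda>x. inverse (norm x) ^ m) has_derivative (\<lambda>v. - (real m * inverse (norm x) ^ (m + 1)) * (v \<bullet> sgn x))) (at x)" .
  moreover have "(\<lambda>v. - (real m * inverse (norm x) ^ (m + 1)) * (v \<bullet> sgn x)) = (\<bullet>) (- (real m * inverse (norm x) ^ (m + 2)) *\<^sub>R x)"
    by (auto simp: fun_eq_iff sgn_div_norm inner_commute)
  ultimately show "((\<lambda>x. inverse (norm x) ^ m) has_derivative (\<bullet>) (- (real m * inverse (norm x) ^ (m + 2)) *\<^sub>R x)) (at x)"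
    by simp
next
  show "continuous_on (- {0}) (\<lambda>x::real^3. - (real m * inverse (norm x) ^ (m + 2)) *\<^sub>R x)"
    by (intro continuous_intros) auto
qed

text \<open>The only relation between \<open>q\<close> and \<open>x\<close>; modulo it, divergences
  and curls of the explicit fields become polynomial identities.\<close>

lemma inverse_norm_power_sq:
  "x \<noteq> 0 \<Longrightarrow> inverse (norm x) ^ (m + 2) * (x \<bullet> x) = inverse (norm x) ^ m" for x :: "'a::real_inner"
proof -
  assume x: "x \<noteq> 0"
  have "inverse (norm x) ^ (m + 2) * (x \<bullet> x) = inverse (norm x) ^ m * (inverse (norm x) * norm x)\<^sup>2"
    by (simp only: power2_norm_eq_inner[symmetric] power_add power_mult_distrib mult.assoc)
  also have "inverse (norm x) * norm x = 1" using x by simp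
  finally show ?thesis by simp
qed

lemma gradient_on_inner: "gradient_on S (\<lambda>x. x \<bullet> e) (\<lambda>x. e)"
  unfolding gradient_on_def
  by (auto intro!: derivative_eq_intros simp: inner_commute fun_eq_iff)

lemma jacobian_on_id: "jacobian_on S (\<lambda>x. x) (\<lambda>x. mat 1)"
proof -
  have "(*v) (mat 1 :: real^3^3) = (\<lambda>v. v)" by (rule ext) simp
  then show ?thesis unfolding jacobian_on_def by simp
qed

text \<open>The Stokes flow outside the sphere of radius \<open>R\<close> that translates with velocity \<open>e\<close>; here
  \<open>q = 1 / |x|\<close>.\<close>

definition sphere_velocity :: "real \<Rightarrow> real^3 \<Rightarrow> real^3 \<Rightarrow> real^3" where
  "sphere_velocity R e x = (let q = inverse (norm x) in
     (3 * R / 4 * q ^ 1 + R ^ 3 / 4 * q ^ 3) *\<^sub>R e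
     + ((3 * R / 4 * q ^ 3 + (- 3 * R ^ 3 / 4) * q ^ 5) * (x \<bullet> e)) *\<^sub>R x)"

definition sphere_velocity_jac :: "real \<Rightarrow> real^3 \<Rightarrow> real^3 \<Rightarrow> real^3^3" where
  "sphere_velocity_jac R e x = (let q = inverse (norm x) in
     (- (3 * R / 4 * q ^ 3 + 3 * R ^ 3 / 4 * q ^ 5)) *\<^sub>R outer e x
     + ((3 * R / 4 * q ^ 3 - 3 * R ^ 3 / 4 * q ^ 5) * (x \<bullet> e)) *\<^sub>R mat 1
     + (3 * R / 4 * q ^ 3 - 3 * R ^ 3 / 4 * q ^ 5) *\<^sub>R outer x e
     + ((- (9 * R / 4) * q ^ 5 + 15 * R ^ 3 / 4 * q ^ 7) * (x \<bullet> e)) *\<^sub>R outer x x)"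

definition sphere_pressure :: "real \<Rightarrow> real^3 \<Rightarrow> real^3 \<Rightarrow> real" where
  "sphere_pressure R e x = 3 * R / 2 * inverse (norm x) ^ 3 * (x \<bullet> e)"

text \<open>The stress of \<open>sphere_velocity\<close> with \<open>sphere_pressure\<close>,
  simplified: the parts of order \<open>R\<close> in the mixed tensor products cancel among
  themselves, and in the multiple of the identity they cancel against the pressure; they survive
  only along \<open>outer x x\<close>.\<close>

definition sphere_stress :: "real \<Rightarrow> real^3 \<Rightarrow> real^3 \<Rightarrow> real^3^3" where
  "sphere_stress R e x = (let q = inverse (norm x) in
     (- (3 * R ^ 3 / 2) * q ^ 5) *\<^sub>R (outer e x + outer x e + (x \<bullet> e) *\<^sub>R mat 1)
     + ((- (9 * R / 2) * q ^ 5 + 15 * R ^ 3 / 2 * q ^ 7) * (x \<bullet> e)) *\<^sub>R outer x x)"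

text \<open>A vector potential: \<open>sphere_velocity\<close> is its curl.\<close>

definition sphere_potential :: "real \<Rightarrow> real^3 \<Rightarrow> real^3 \<Rightarrow> real^3" where
  "sphere_potential R e x = (let q = inverse (norm x) in
     (3 * R / 4 * q ^ 1 + (- (R ^ 3 / 4)) * q ^ 3) *\<^sub>R cross3 e x)"

definition cross_mat :: "real^3 \<Rightarrow> real^3^3" where
  "cross_mat e = (\<chi> i j. cross3 e (axis j 1) $ i)"

definition sphere_potential_jac :: "real \<Rightarrow> real^3 \<Rightarrow> real^3 \<Rightarrow> real^3^3" where
  "sphere_potential_jac R e x = (let q = inverse (norm x) in
     (3 * R / 4 * q ^ 1 + (- (R ^ 3 / 4)) * q ^ 3) *\<^sub>R cross_mat e
     + (- (3 * R / 4) * q ^ 3 + 3 * R ^ 3 / 4 * q ^ 5) *\<^sub>R outer (cross3 e x) x)"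

text \<open>The curl of a field, read off its Jacobian matrix.\<close>

definition curl_mat :: "real^3^3 \<Rightarrow> real^3" where
  "curl_mat A = vector [A $ 3 $ 2 - A $ 2 $ 3, A $ 1 $ 3 - A $ 3 $ 1, A $ 2 $ 1 - A $ 1 $ 2]"

text \<open>The stress of the rotlet, the flow around a sphere that rotates with angular velocity \<open>b\<close>.\<close>

definition rotlet_stress :: "real \<Rightarrow> real^3 \<Rightarrow> real^3 \<Rightarrow> real^3^3" where
  "rotlet_stress R b x = (- (3 * R ^ 3) * inverse (norm x) ^ 5) *\<^sub>R (outer (cross3 b x) x + outer x (cross3 b x))"

lemma cross_mat_mult: "cross_mat e *v v = cross3 e v"
  by (simp add: cross_mat_def vec_eq_iff forall_3 matrix_vector_mult_def sum_3 cross3_def axis_def)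

lemma jacobian_on_cross: "jacobian_on S (cross3 e) (\<lambda>x. cross_mat e)"
  unfolding jacobian_on_def cross_mat_mult
  by (auto intro: bounded_linear_imp_has_derivative bounded_bilinear.bounded_linear_right[OF bilinear_cross[unfolded bilinear_conv_bounded_bilinear]])

lemma scaleR_outer: "outer (c *\<^sub>R a) b = c *\<^sub>R outer a b" "outer a (c *\<^sub>R b) = c *\<^sub>R outer a b"
  by (simp_all add: outer_def vec_eq_iff algebra_simps)

lemma transpose_outer: "transpose (outer a b) = outer b a"
  by (simp add: outer_def transpose_def vec_eq_iff mult.commute)

lemma transpose_add: "transpose (A + B) = transpose A + transpose B"
  and transpose_scaleR: "transpose (c *\<^sub>R A) = c *\<^sub>R transpose A" for A B :: "real^3^3"
  by (simp_all add: transpose_def vec_eq_iff)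

lemma sphere_velocity_jacobian: "jacobian_on (- {0}) (sphere_velocity R e) (sphere_velocity_jac R e)"
proof -
  note Q = gradient_on_inverse_norm_power
  have f: "gradient_on (- {0}) (\<lambda>x::real^3. 3 * R / 4 * inverse (norm x) ^ 1 + R ^ 3 / 4 * inverse (norm x) ^ 3)
     (\<lambda>x. (3 * R / 4) *\<^sub>R (- (real 1 * inverse (norm x) ^ (1 + 2)) *\<^sub>R x) + (R ^ 3 / 4) *\<^sub>R (- (real 3 * inverse (norm x) ^ (3 + 2)) *\<^sub>R x))"
    by (intro gradient_on_add gradient_on_cmult Q)
  have g: "gradient_on (- {0}) (\<lambda>x::real^3. 3 * R / 4 * inverse (norm x) ^ 3 + (- 3 * R ^ 3 / 4) * inverse (norm x) ^ 5)
     (\<lambda>x. (3 * R / 4) *\<^sub>R (- (real 3 * inverse (norm x) ^ (3 + 2)) *\<^sub>R x) + (- 3 * R ^ 3 / 4) *\<^sub>R (- (real 5 * inverse (norm x) ^ (5 + 2)) *\<^sub>R x))"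
    by (intro gradient_on_add gradient_on_cmult Q)
  note J = jacobian_on_add[OF jacobian_on_scaleR[OF f jacobian_on_const[of _ e]]
      jacobian_on_scaleR[OF gradient_on_mult[OF g gradient_on_inner[of _ e]] jacobian_on_id]]
  show ?thesis
    by (rule jacobian_on_transform[OF J])
      (auto simp: sphere_velocity_def sphere_velocity_jac_def Let_def vec_eq_iff outer_component algebra_simps power3_eq_cube)
qed

lemma sphere_velocity_stress:
  "symm (sphere_velocity_jac R e x) = sphere_stress R e x + sphere_pressure R e x *\<^sub>R mat 1"
  by (simp add: symm_def sphere_velocity_jac_def sphere_stress_def sphere_pressure_def Let_def
      vec_eq_iff transpose_def outer_component mat_def) (auto simp: algebra_simps)

lemma trace_sphere_velocity_jac:
  assumes "x \<noteq> 0"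
  shows "trace (sphere_velocity_jac R e x) = 0"
proof -
  define q where "q = inverse (norm x)"
  have q: "q ^ 5 * (x \<bullet> x) = q ^ 3" "q ^ 7 * (x \<bullet> x) = q ^ 5"
    using inverse_norm_power_sq[OF assms, of 3] inverse_norm_power_sq[OF assms, of 5] by (simp_all add: q_def)
  have t: "trace (mat 1 :: real^3^3) = 3" by (simp add: trace_def mat_def)
  have "trace (sphere_velocity_jac R e x) = (- (3 * R / 4 * q ^ 3 + 3 * R ^ 3 / 4 * q ^ 5)) * (x \<bullet> e)
     + (3 * R / 4 * q ^ 3 - 3 * R ^ 3 / 4 * q ^ 5) * (x \<bullet> e) * 3
     + (3 * R / 4 * q ^ 3 - 3 * R ^ 3 / 4 * q ^ 5) * (x \<bullet> e)
     + (- (9 * R / 4) * (q ^ 5 * (x \<bullet> x)) + 15 * R ^ 3 / 4 * (q ^ 7 * (x \<bullet> x))) * (x \<bullet> e)"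
    unfolding sphere_velocity_jac_def Let_def q_def[symmetric]
    by (simp only: trace_add trace_scaleR trace_outer t inner_commute[of e x]) (simp add: algebra_simps)
  also have "\<dots> = 0" unfolding q by (simp add: algebra_simps)
  finally show ?thesis .
qed

lemma sphere_stress_row:
  "sphere_stress R e x $ i = (- (3 * R ^ 3 / 2) * inverse (norm x) ^ 5) *\<^sub>R ((e $ i) *\<^sub>R x + x $ i *\<^sub>R e + (x \<bullet> e) *\<^sub>R axis i 1)
    + ((- (9 * R / 2) * inverse (norm x) ^ 5 + 15 * R ^ 3 / 2 * inverse (norm x) ^ 7) * ((x \<bullet> e) * x $ i)) *\<^sub>R x"
  by (auto simp: sphere_stress_def Let_def vec_eq_iff outer_component mat_def axis_def)

text \<open>The derivative of each row is assembled by the product rule. Its trace vanishes after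
  reducing powers of \<open>q\<close> by \<open>inverse_norm_power_sq\<close>.\<close>

lemma sphere_stress_on: "stress_on (- {0}) (sphere_stress R e)"
  unfolding stress_on_def
proof (intro conjI ballI allI)
  show "transpose (sphere_stress R e x) = sphere_stress R e x" for x
    by (simp only: sphere_stress_def Let_def transpose_add transpose_scaleR transpose_outer transpose_mat add.commute[of "outer x e"])
  fix i :: 3
  note Q = gradient_on_inverse_norm_power
  have k: "gradient_on (- {0}) (\<lambda>x::real^3. - (3 * R ^ 3 / 2) * inverse (norm x) ^ 5)
     (\<lambda>x. (- (3 * R ^ 3 / 2)) *\<^sub>R (- (real 5 * inverse (norm x) ^ (5 + 2)) *\<^sub>R x))"
    by (intro gradient_on_cmult Q)
  have v: "jacobian_on (- {0}) (\<lambda>x. e $ i *\<^sub>R x + x $ i *\<^sub>R e + (x \<bullet> e) *\<^sub>R axis i 1)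
     (\<lambda>x. (e $ i *\<^sub>R mat 1 + outer x 0) + (x $ i *\<^sub>R 0 + outer e (axis i 1)) + ((x \<bullet> e) *\<^sub>R 0 + outer (axis i 1) e))"
    by (intro jacobian_on_add jacobian_on_scaleR gradient_on_const jacobian_on_id gradient_on_component jacobian_on_const gradient_on_inner)
  have c: "gradient_on (- {0}) (\<lambda>x::real^3. - (9 * R / 2) * inverse (norm x) ^ 5 + 15 * R ^ 3 / 2 * inverse (norm x) ^ 7)
     (\<lambda>x. (- (9 * R / 2)) *\<^sub>R (- (real 5 * inverse (norm x) ^ (5 + 2)) *\<^sub>R x) + (15 * R ^ 3 / 2) *\<^sub>R (- (real 7 * inverse (norm x) ^ (7 + 2)) *\<^sub>R x))"
    by (intro gradient_on_add gradient_on_cmult Q)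
  note sx = gradient_on_mult[OF gradient_on_inner[of "- {0}" e] gradient_on_component[of "- {0}" i]]
  note J = jacobian_on_add[OF jacobian_on_scaleR[OF k v] jacobian_on_scaleR[OF gradient_on_mult[OF c sx] jacobian_on_id]]
  show "\<exists>T. jacobian_on (- {0}) (\<lambda>x. sphere_stress R e x $ i) T \<and> (\<forall>x\<in>- {0}. trace (T x) = 0)"
    unfolding sphere_stress_row
  proof (rule exI, rule conjI, rule J, rule ballI)
    fix x :: "real^3" assume "x \<in> - {0}"
    then have x: "x \<noteq> 0" by simp
    define q where "q = inverse (norm x)"
    have q7: "q ^ 7 * (x \<bullet> x) = q ^ 5" and q9: "q ^ 9 * (x \<bullet> x) = q ^ 7"
      using inverse_norm_power_sq[OF x, of 5] inverse_norm_power_sq[OF x, of 7] by (simp_all add: q_def)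
    have t: "trace (mat 1 :: real^3^3) = 3" "trace (outer x 0) = 0" "trace (0 :: real^3^3) = 0"
      by (simp_all add: trace_def mat_def outer_def)
    have ax: "axis i 1 \<bullet> v = v $ i" "v \<bullet> axis i 1 = v $ i" for v :: "real^3" by (simp_all add: inner_axis inner_axis')
    show "trace ((- (3 * R ^ 3 / 2) * inverse (norm x) ^ 5) *\<^sub>R
          (e $ i *\<^sub>R mat 1 + outer x 0 + (x $ i *\<^sub>R 0 + outer e (axis i 1)) + ((x \<bullet> e) *\<^sub>R 0 + outer (axis i 1) e)) +
          outer (e $ i *\<^sub>R x + x $ i *\<^sub>R e + (x \<bullet> e) *\<^sub>R axis i 1)
           (- (3 * R ^ 3 / 2) *\<^sub>R - (real 5 * inverse (norm x) ^ (5 + 2)) *\<^sub>R x) +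
          (((- (9 * R / 2) * inverse (norm x) ^ 5 + 15 * R ^ 3 / 2 * inverse (norm x) ^ 7) * ((x \<bullet> e) * x $ i)) *\<^sub>R mat 1 +
           outer x
            ((- (9 * R / 2) * inverse (norm x) ^ 5 + 15 * R ^ 3 / 2 * inverse (norm x) ^ 7) *\<^sub>R
             ((x \<bullet> e) *\<^sub>R axis i 1 + x $ i *\<^sub>R e) +
             ((x \<bullet> e) * x $ i) *\<^sub>R
             (- (9 * R / 2) *\<^sub>R - (real 5 * inverse (norm x) ^ (5 + 2)) *\<^sub>R x +
              (15 * R ^ 3 / 2) *\<^sub>R - (real 7 * inverse (norm x) ^ (7 + 2)) *\<^sub>R x)))) = 0"
      (is "?L = 0")
    proof -
      have "?L = - (3 * R ^ 3 / 2) * q ^ 5 * (5 * e $ i)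
        + 15 * R ^ 3 / 2 * (e $ i * (q ^ 7 * (x \<bullet> x)) + 2 * q ^ 7 * x $ i * (x \<bullet> e))
        + (- (9 * R / 2) * q ^ 5 + 15 * R ^ 3 / 2 * q ^ 7) * ((x \<bullet> e) * x $ i) * 5
        + ((x \<bullet> e) * x $ i) * (45 * R / 2 * (q ^ 7 * (x \<bullet> x)) - 105 * R ^ 3 / 2 * (q ^ 9 * (x \<bullet> x)))"
        unfolding q_def[symmetric]
        by (simp only: trace_add trace_scaleR trace_outer t ax inner_add_left inner_add_right
            inner_scaleR_left inner_scaleR_right inner_commute[of e x]) (simp add: algebra_simps)
      also have "\<dots> = 0" unfolding q7 q9 by (simp add: algebra_simps)
      finally show ?thesis .
    qed
  qed
qed

lemma rotlet_stress_row:
  "rotlet_stress R b x $ i = (- (3 * R ^ 3) * inverse (norm x) ^ 5) *\<^sub>R (cross3 b x $ i *\<^sub>R x + x $ i *\<^sub>R cross3 b x)"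
  by (simp add: rotlet_stress_def outer_row)

text \<open>Besides the relation for \<open>q\<close> this needs only that \<open>cross3 b x\<close>
  is orthogonal to \<open>x\<close> and that the matrix of a cross product is traceless.\<close>

lemma rotlet_stress_on: "stress_on (- {0}) (rotlet_stress R b)"
  unfolding stress_on_def
proof (intro conjI ballI allI)
  show "transpose (rotlet_stress R b x) = rotlet_stress R b x" for x
    by (simp only: rotlet_stress_def transpose_add transpose_scaleR transpose_outer add.commute[of "outer x (cross3 b x)"])
  fix i :: 3
  have k: "gradient_on (- {0}) (\<lambda>x::real^3. - (3 * R ^ 3) * inverse (norm x) ^ 5)
     (\<lambda>x. (- (3 * R ^ 3)) *\<^sub>R (- (real 5 * inverse (norm x) ^ (5 + 2)) *\<^sub>R x))"
    by (intro gradient_on_cmult gradient_on_inverse_norm_power)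
  have ci: "gradient_on (- {0}) (\<lambda>x. cross3 b x $ i) (\<lambda>x. cross_mat b $ i)"
    using jacobian_on_cross[of "- {0}" b] by (simp add: jacobian_on_iff)
  have v: "jacobian_on (- {0}) (\<lambda>x. cross3 b x $ i *\<^sub>R x + x $ i *\<^sub>R cross3 b x)
     (\<lambda>x. (cross3 b x $ i *\<^sub>R mat 1 + outer x (cross_mat b $ i)) + (x $ i *\<^sub>R cross_mat b + outer (cross3 b x) (axis i 1)))"
    by (intro jacobian_on_add jacobian_on_scaleR ci jacobian_on_id gradient_on_component jacobian_on_cross)
  note J = jacobian_on_scaleR[OF k v]
  show "\<exists>T. jacobian_on (- {0}) (\<lambda>x. rotlet_stress R b x $ i) T \<and> (\<forall>x\<in>- {0}. trace (T x) = 0)"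
    unfolding rotlet_stress_row
  proof (rule exI, rule conjI, rule J, rule ballI)
    fix x :: "real^3" assume "x \<in> - {0}"
    then have x: "x \<noteq> 0" by simp
    define q where "q = inverse (norm x)"
    have q7: "q ^ 7 * (x \<bullet> x) = q ^ 5"
      using inverse_norm_power_sq[OF x, of 5] by (simp add: q_def)
    have t: "trace (mat 1 :: real^3^3) = 3" by (simp add: trace_def mat_def)
    have tc: "trace (cross_mat b) = 0" by (simp add: trace_def cross_mat_def sum_3 cross3_def axis_def)
    have xc: "x \<bullet> cross_mat b $ i = cross3 b x $ i"
      unfolding inner_commute[of x] matrix_vector_mul_component[symmetric] cross_mat_mult ..
    have ax: "v \<bullet> axis i 1 = v $ i" for v :: "real^3" by (simp add: inner_axis)
    have cx: "cross3 b x \<bullet> x = 0" by (simp add: dot_cross_self)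
    show "trace ((- (3 * R ^ 3) * inverse (norm x) ^ 5) *\<^sub>R
          (cross3 b x $ i *\<^sub>R mat 1 + outer x (cross_mat b $ i) + (x $ i *\<^sub>R cross_mat b + outer (cross3 b x) (axis i 1))) +
          outer (cross3 b x $ i *\<^sub>R x + x $ i *\<^sub>R cross3 b x)
           (- (3 * R ^ 3) *\<^sub>R - (real 5 * inverse (norm x) ^ (5 + 2)) *\<^sub>R x)) = 0" (is "?L = 0")
    proof -
      have "?L = - (3 * R ^ 3) * q ^ 5 * (5 * cross3 b x $ i) + 15 * R ^ 3 * (cross3 b x $ i * (q ^ 7 * (x \<bullet> x)))"
        unfolding q_def[symmetric]
        by (simp only: trace_add trace_scaleR trace_outer t tc xc ax cx inner_add_left
            inner_scaleR_left inner_scaleR_right) (simp add: algebra_simps)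
      also have "\<dots> = 0" unfolding q7 by (simp add: algebra_simps)
      finally show ?thesis .
    qed
  qed
qed

lemma sphere_potential_jacobian: "jacobian_on (- {0}) (sphere_potential R e) (sphere_potential_jac R e)"
proof -
  have f: "gradient_on (- {0}) (\<lambda>x::real^3. 3 * R / 4 * inverse (norm x) ^ 1 + (- (R ^ 3 / 4)) * inverse (norm x) ^ 3)
     (\<lambda>x. (3 * R / 4) *\<^sub>R (- (real 1 * inverse (norm x) ^ (1 + 2)) *\<^sub>R x) + (- (R ^ 3 / 4)) *\<^sub>R (- (real 3 * inverse (norm x) ^ (3 + 2)) *\<^sub>R x))"
    by (intro gradient_on_add gradient_on_cmult gradient_on_inverse_norm_power)
  show ?thesis
    by (rule jacobian_on_transform[OF jacobian_on_scaleR[OF f jacobian_on_cross[of _ e]]])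
      (auto simp: sphere_potential_def sphere_potential_jac_def Let_def vec_eq_iff outer_component algebra_simps power3_eq_cube)
qed

lemma curl_mat_add: "curl_mat (A + B) = curl_mat A + curl_mat B"
  and curl_mat_diff: "curl_mat (A - B) = curl_mat A - curl_mat B"
  and curl_mat_scaleR: "curl_mat (c *\<^sub>R A) = c *\<^sub>R curl_mat A"
  and curl_mat_outer: "curl_mat (outer a b) = cross3 b a"
  and curl_mat_cross: "curl_mat (cross_mat e) = 2 *\<^sub>R e"
  by (simp_all add: curl_mat_def vec_eq_iff forall_3 outer_component cross3_def cross_mat_def axis_def algebra_simps)

text \<open>The product rule gives twice the scalar factor times \<open>e\<close> plus a multiple of
  the double cross product of \<open>x\<close> with \<open>e\<close>, which the Lagrange identity
  expands.\<close>

lemma curl_sphere_potential: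
  assumes "x \<noteq> 0"
  shows "curl_mat (sphere_potential_jac R e x) = sphere_velocity R e x"
proof -
  define q where "q = inverse (norm x)"
  have "q ^ (1 + 2) * (x \<bullet> x) = q ^ 1" "q ^ (3 + 2) * (x \<bullet> x) = q ^ 3"
    unfolding q_def by (rule inverse_norm_power_sq[OF assms])+
  moreover have "(1::nat) + 2 = 3" "(3::nat) + 2 = 5" by simp_all
  ultimately have q: "q ^ 3 * (x \<bullet> x) = q ^ 1" "q ^ 5 * (x \<bullet> x) = q ^ 3" by metis+
  have c: "cross3 x (cross3 e x) = (x \<bullet> x) *\<^sub>R e - (x \<bullet> e) *\<^sub>R x"
    by (rule Lagrange)
  have "curl_mat (sphere_potential_jac R e x) = (2 * (3 * R / 4 * q ^ 1 + (- (R ^ 3 / 4)) * q ^ 3)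
      + (- (3 * R / 4) * (q ^ 3 * (x \<bullet> x)) + 3 * R ^ 3 / 4 * (q ^ 5 * (x \<bullet> x)))) *\<^sub>R e
      - ((- (3 * R / 4) * q ^ 3 + 3 * R ^ 3 / 4 * q ^ 5) * (x \<bullet> e)) *\<^sub>R x"
    unfolding sphere_potential_jac_def Let_def q_def[symmetric] curl_mat_add curl_mat_scaleR curl_mat_outer curl_mat_cross c
    by (simp add: vec_eq_iff algebra_simps)
  also have "\<dots> = sphere_velocity R e x"
    unfolding q sphere_velocity_def Let_def q_def[symmetric]
    by (simp add: vec_eq_iff algebra_simps)
  finally show ?thesis .
qed

lemma norm_mat_1_le: "norm (mat 1 :: real^3^3) \<le> 2"
proof -
  have "(norm (mat 1 :: real^3^3))\<^sup>2 = 3"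
    unfolding power2_norm_eq_inner mat_inner by (simp add: trace_def mat_def)
  then have "norm (mat 1 :: real^3^3) = sqrt 3" by (metis norm_ge_zero real_sqrt_unique)
  also have "\<dots> \<le> 2" by (rule real_le_lsqrt) auto
  finally show ?thesis .
qed

lemma norm_cross_le: "norm (cross3 a b) \<le> norm a * norm b"
proof -
  have "(norm (cross3 a b))\<^sup>2 \<le> (norm a * norm b)\<^sup>2"
    using norm_cross_dot[of a b] by (metis le_add_same_cancel1 zero_le_power2)
  then show ?thesis by (rule power2_le_imp_le) simp
qed

lemma norm_scaleR_le: "\<bar>c\<bar> \<le> k \<Longrightarrow> norm v \<le> n \<Longrightarrow> norm (c *\<^sub>R v) \<le> k * n"
  by (simp add: mult_mono)

section \<open>Size of the explicit fields outside the sphere\<close>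

context
  fixes R :: real and x :: "real^3"
  assumes R: "0 < R" and x: "R \<le> norm x"
begin

text \<open>Outside the sphere \<open>R * q \<le> 1\<close>, so a term with \<open>R^3\<close> and
  two more powers of \<open>q\<close> is absorbed into the leading term with \<open>R\<close>. All
  bounds below are thereby those of a point force.\<close>

lemma radial_facts:
  shows "inverse (norm x) > 0" "inverse (norm x) ^ (m + 1) * norm x = inverse (norm x) ^ m"
    "R ^ 3 * inverse (norm x) ^ (m + 2) \<le> R * inverse (norm x) ^ m"
proof -
  have r: "norm x > 0" using R x by linarith
  then show q: "inverse (norm x) > 0" by simp
  show "inverse (norm x) ^ (m + 1) * norm x = inverse (norm x) ^ m" using r by simp
  have "R * inverse (norm x) \<le> 1" using R x r by (simp add: field_simps)
  then have "(R * inverse (norm x))\<^sup>2 \<le> 1" using R q by (intro power_le_one) auto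
  then have "R * inverse (norm x) ^ m * (R * inverse (norm x))\<^sup>2 \<le> R * inverse (norm x) ^ m * 1"
    using R q by (intro mult_left_mono) auto
  then show "R ^ 3 * inverse (norm x) ^ (m + 2) \<le> R * inverse (norm x) ^ m"
    by (simp add: power_add power_mult_distrib power2_eq_square power3_eq_cube mult_ac)
qed

text \<open>The coefficients appear literally as in the fields, so that they can be matched by the
  rules for the norm of a sum of scaled tensors.\<close>

lemma radial_coefficients:
  defines "q \<equiv> inverse (norm x)"
  shows "\<bar>3 * R / 4 * q ^ 1 + R ^ 3 / 4 * q ^ 3\<bar> \<le> R * q"
    "\<bar>- (3 * R / 4 * q ^ 3 + 3 * R ^ 3 / 4 * q ^ 5)\<bar> \<le> 3 / 2 * R * q ^ 3"
    "\<bar>3 * R / 4 * q ^ 3 - 3 * R ^ 3 / 4 * q ^ 5\<bar> \<le> 3 / 2 * R * q ^ 3"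
    "\<bar>3 * R / 4 * q ^ 3 + (- 3 * R ^ 3 / 4) * q ^ 5\<bar> \<le> 3 / 2 * R * q ^ 3"
    "\<bar>- (3 * R / 4) * q ^ 3 + 3 * R ^ 3 / 4 * q ^ 5\<bar> \<le> 3 / 2 * R * q ^ 3"
    "\<bar>- (9 * R / 4) * q ^ 5 + 15 * R ^ 3 / 4 * q ^ 7\<bar> \<le> 6 * R * q ^ 5"
    "\<bar>- (9 * R / 2) * q ^ 5 + 15 * R ^ 3 / 2 * q ^ 7\<bar> \<le> 12 * R * q ^ 5"
    "\<bar>- (3 * R ^ 3 / 2) * q ^ 5\<bar> \<le> 3 / 2 * R * q ^ 3"
    "\<bar>3 * R / 4 * q ^ 1 + (- (R ^ 3 / 4)) * q ^ 3\<bar> \<le> R * q"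
    "\<bar>- (3 * R ^ 3) * q ^ 5\<bar> \<le> 3 * R * q ^ 3"
proof -
  have e: "(1::nat) + 2 = 3" "(3::nat) + 2 = 5" "(5::nat) + 2 = 7" by simp_all
  have a: "R ^ 3 * q ^ 3 \<le> R * q ^ 1" "R ^ 3 * q ^ 5 \<le> R * q ^ 3" "R ^ 3 * q ^ 7 \<le> R * q ^ 5"
    using radial_facts(3)[of 1] radial_facts(3)[of 3] radial_facts(3)[of 5] unfolding q_def e by blast+
  have q: "q > 0" unfolding q_def by (rule radial_facts(1))
  have b: "0 \<le> R ^ 3 * q ^ 3" "0 \<le> R ^ 3 * q ^ 5" "0 \<le> R ^ 3 * q ^ 7" "0 \<le> R * q ^ 1" "0 \<le> R * q ^ 3" "0 \<le> R * q ^ 5"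
    using R q by simp_all
  have q1: "R * q = R * q ^ 1" by simp
  show "\<bar>3 * R / 4 * q ^ 1 + R ^ 3 / 4 * q ^ 3\<bar> \<le> R * q"
    "\<bar>- (3 * R / 4 * q ^ 3 + 3 * R ^ 3 / 4 * q ^ 5)\<bar> \<le> 3 / 2 * R * q ^ 3"
    "\<bar>3 * R / 4 * q ^ 3 - 3 * R ^ 3 / 4 * q ^ 5\<bar> \<le> 3 / 2 * R * q ^ 3"
    "\<bar>3 * R / 4 * q ^ 3 + (- 3 * R ^ 3 / 4) * q ^ 5\<bar> \<le> 3 / 2 * R * q ^ 3"
    "\<bar>- (3 * R / 4) * q ^ 3 + 3 * R ^ 3 / 4 * q ^ 5\<bar> \<le> 3 / 2 * R * q ^ 3"
    "\<bar>- (9 * R / 4) * q ^ 5 + 15 * R ^ 3 / 4 * q ^ 7\<bar> \<le> 6 * R * q ^ 5"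
    "\<bar>- (9 * R / 2) * q ^ 5 + 15 * R ^ 3 / 2 * q ^ 7\<bar> \<le> 12 * R * q ^ 5"
    "\<bar>- (3 * R ^ 3 / 2) * q ^ 5\<bar> \<le> 3 / 2 * R * q ^ 3"
    "\<bar>3 * R / 4 * q ^ 1 + (- (R ^ 3 / 4)) * q ^ 3\<bar> \<le> R * q"
    "\<bar>- (3 * R ^ 3) * q ^ 5\<bar> \<le> 3 * R * q ^ 3"
    unfolding q1 using a b by (simp_all add: abs_le_iff)
qed

lemma norm_sphere_velocity_le: "norm (sphere_velocity R e x) \<le> 3 * R * norm e * inverse (norm x)"
proof -
  define q where "q = inverse (norm x)"
  have "norm (sphere_velocity R e x) \<le> (R * q) * norm e + (3 / 2 * R * q ^ 3) * (norm x * norm e * norm x)"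
    unfolding sphere_velocity_def Let_def q_def scaleR_scaleR[symmetric]
    by (intro norm_triangle_mono norm_scaleR_le radial_coefficients)
      (auto simp: Cauchy_Schwarz_ineq2 intro!: mult_right_mono)
  also have "(3 / 2 * R * q ^ 3) * (norm x * norm e * norm x) = 3 / 2 * R * norm e * (q ^ (2 + 1) * norm x * norm x)"
    by (simp add: eval_nat_numeral)
  also have "q ^ (2 + 1) * norm x = q ^ (1 + 1)" unfolding q_def by (subst radial_facts(2)) (simp add: power2_eq_square)
  also have "q ^ (1 + 1) * norm x = q ^ 1" unfolding q_def by (rule radial_facts(2))
  finally have "norm (sphere_velocity R e x) \<le> (R * q) * norm e + 3 / 2 * R * norm e * q" by simp
  also have "\<dots> \<le> 3 * R * norm e * q"
    using R radial_facts(1) by (simp add: q_def)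
  finally show ?thesis unfolding q_def .
qed

lemma norm_sphere_velocity_jac_le: "norm (sphere_velocity_jac R e x) \<le> 12 * R * norm e * inverse (norm x) ^ 2"
proof -
  define q where "q = inverse (norm x)"
  have s: "\<bar>x \<bullet> e\<bar> \<le> norm x * norm e" by (rule Cauchy_Schwarz_ineq2)
  have "norm (sphere_velocity_jac R e x) \<le> (3 / 2 * R * q ^ 3) * (norm e * norm x)
     + (3 / 2 * R * q ^ 3) * ((norm x * norm e) * 2) + (3 / 2 * R * q ^ 3) * (norm x * norm e)
     + (6 * R * q ^ 5) * ((norm x * norm e) * (norm x * norm x))"
    unfolding sphere_velocity_jac_def Let_def q_def scaleR_scaleR[symmetric]
    by (intro norm_triangle_mono norm_scaleR_le radial_coefficients s norm_mat_1_le) (simp_all add: norm_outer)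
  also have "\<dots> = 6 * R * norm e * (q ^ (2 + 1) * norm x) + 6 * R * norm e * (q ^ (4 + 1) * norm x * norm x * norm x)"
    by (simp add: eval_nat_numeral algebra_simps)
  also have "q ^ (2 + 1) * norm x = q ^ 2" unfolding q_def by (rule radial_facts(2))
  also have "q ^ (4 + 1) * norm x = q ^ (3 + 1)" unfolding q_def by (subst radial_facts(2)) simp
  also have "q ^ (3 + 1) * norm x = q ^ (2 + 1)" unfolding q_def by (subst radial_facts(2)) simp
  also have "q ^ (2 + 1) * norm x = q ^ 2" unfolding q_def by (rule radial_facts(2))
  finally show ?thesis by (simp add: q_def)
qed

lemma norm_sphere_stress_le: "norm (sphere_stress R e x) \<le> 18 * R * norm e * inverse (norm x) ^ 2"
proof -
  define q where "q = inverse (norm x)"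
  have s: "\<bar>x \<bullet> e\<bar> \<le> norm x * norm e" by (rule Cauchy_Schwarz_ineq2)
  have "norm (sphere_stress R e x) \<le> (3 / 2 * R * q ^ 3) * (norm e * norm x + norm x * norm e + (norm x * norm e) * 2)
     + (12 * R * q ^ 5) * ((norm x * norm e) * (norm x * norm x))"
  proof -
    have "sphere_stress R e x = (- (3 * R ^ 3 / 2) * inverse (norm x) ^ 5) *\<^sub>R (outer e x + outer x e + (x \<bullet> e) *\<^sub>R mat 1)
        + (- (9 * R / 2) * inverse (norm x) ^ 5 + 15 * R ^ 3 / 2 * inverse (norm x) ^ 7) *\<^sub>R ((x \<bullet> e) *\<^sub>R outer x x)"
      by (simp only: sphere_stress_def Let_def scaleR_scaleR)
    also have "norm \<dots> \<le> (3 / 2 * R * q ^ 3) * (norm e * norm x + norm x * norm e + (norm x * norm e) * 2)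
      + (12 * R * q ^ 5) * ((norm x * norm e) * (norm x * norm x))"
      unfolding q_def
      by (intro norm_triangle_mono norm_scaleR_le radial_coefficients s norm_mat_1_le) (simp_all add: norm_outer)
    finally show ?thesis .
  qed
  also have "\<dots> = 6 * R * norm e * (q ^ (2 + 1) * norm x) + 12 * R * norm e * (q ^ (4 + 1) * norm x * norm x * norm x)"
    by (simp add: eval_nat_numeral algebra_simps)
  also have "q ^ (2 + 1) * norm x = q ^ 2" unfolding q_def by (rule radial_facts(2))
  also have "q ^ (4 + 1) * norm x = q ^ (3 + 1)" unfolding q_def by (subst radial_facts(2)) simp
  also have "q ^ (3 + 1) * norm x = q ^ (2 + 1)" unfolding q_def by (subst radial_facts(2)) simp
  also have "q ^ (2 + 1) * norm x = q ^ 2" unfolding q_def by (rule radial_facts(2))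
  finally show ?thesis by (simp add: q_def)
qed

text \<open>The rotlet stress decays like \<open>|x|^-3\<close>. One factor
  \<open>R / |x| \<le> 1\<close> is given away to reach the decay \<open>|x|^-2\<close> that it
  shares with the stress of a translating sphere.\<close>

lemma norm_rotlet_stress_le: "norm (rotlet_stress R b x) \<le> 6 * R\<^sup>2 * norm b * inverse (norm x) ^ 2"
proof -
  define q where "q = inverse (norm x)"
  have q: "q > 0" unfolding q_def by (rule radial_facts(1))
  have c: "norm (cross3 b x) \<le> norm b * norm x" by (rule norm_cross_le)
  have "norm (rotlet_stress R b x) \<le> (3 * R ^ 3 * q ^ 5) * (norm b * norm x * norm x + norm x * (norm b * norm x))"
    unfolding rotlet_stress_def q_def
    using R q c by (intro norm_triangle_mono norm_scaleR_le) (auto simp: norm_outer q_def abs_mult intro!: mult_right_mono mult_left_mono)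
  also have "\<dots> = 6 * R ^ 3 * norm b * (q ^ (4 + 1) * norm x * norm x)"
    by (simp add: eval_nat_numeral algebra_simps)
  also have "q ^ (4 + 1) * norm x = q ^ (3 + 1)" unfolding q_def by (subst radial_facts(2)) simp
  also have "q ^ (3 + 1) * norm x = q ^ 3" unfolding q_def by (rule radial_facts(2))
  also have "6 * R ^ 3 * norm b * q ^ 3 = 6 * R\<^sup>2 * norm b * q\<^sup>2 * (R * q)" by (simp add: eval_nat_numeral algebra_simps)
  also have "\<dots> \<le> 6 * R\<^sup>2 * norm b * q\<^sup>2 * 1"
  proof (rule mult_left_mono)
    have "norm x > 0" using R x by linarith
    then show "R * q \<le> 1" using x by (simp add: q_def inverse_eq_divide pos_divide_le_eq)
  qed (use R in simp)
  finally show ?thesis by (simp add: q_def)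
qed

text \<open>Since \<open>6 * pi * R / (8 * pi) = 3 * R / 4\<close>, the Oseen tensor is exactly the
  part of the flow of order \<open>R\<close>. The remainder consists of the two terms with
  \<open>R^3\<close>, whose coefficients 1/4 and 3/4 add up to one.\<close>

lemma sphere_velocity_oseen:
  "norm (sphere_velocity R e x - (6 * pi * R) *\<^sub>R (oseen x *v e)) \<le> R ^ 3 * norm e * inverse (norm x) ^ 3"
proof -
  define q where "q = inverse (norm x)"
  have q: "q > 0" unfolding q_def by (rule radial_facts(1))
  have o: "oseen x = (1 / (8 * pi)) *\<^sub>R (q *\<^sub>R mat 1 + q ^ 3 *\<^sub>R outer x x)"
    by (simp add: oseen_def outer_def q_def inverse_eq_divide power_one_over)
  have "oseen x *v e = (1 / (8 * pi)) *\<^sub>R (q *\<^sub>R e + (q ^ 3 * (x \<bullet> e)) *\<^sub>R x)"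
    unfolding o by (simp add: matrix_vector_mult_add_rdistrib outer_mult flip: scaleR_matrix_vector_assoc)
  then have "(6 * pi * R) *\<^sub>R (oseen x *v e) = (3 * R / 4 * q) *\<^sub>R e + (3 * R / 4 * q ^ 3 * (x \<bullet> e)) *\<^sub>R x"
    by (simp add: scaleR_add_right mult_ac)
  then have "sphere_velocity R e x - (6 * pi * R) *\<^sub>R (oseen x *v e) = (R ^ 3 / 4 * q ^ 3) *\<^sub>R e + (- (3 * R ^ 3 / 4) * q ^ 5) *\<^sub>R ((x \<bullet> e) *\<^sub>R x)"
    unfolding sphere_velocity_def Let_def q_def[symmetric] by (simp add: vec_eq_iff algebra_simps)
  also have "norm \<dots> \<le> (R ^ 3 / 4 * q ^ 3) * norm e + (3 * R ^ 3 / 4 * q ^ 5) * ((norm x * norm e) * norm x)"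
    using R q by (intro norm_triangle_mono norm_scaleR_le Cauchy_Schwarz_ineq2) (simp_all add: abs_mult)
  also have "\<dots> = (R ^ 3 / 4 * q ^ 3) * norm e + (3 * R ^ 3 / 4) * norm e * (q ^ (4 + 1) * norm x * norm x)"
    by (simp add: eval_nat_numeral algebra_simps)
  also have "q ^ (4 + 1) * norm x = q ^ (3 + 1)" unfolding q_def by (subst radial_facts(2)) simp
  also have "q ^ (3 + 1) * norm x = q ^ 3" unfolding q_def by (rule radial_facts(2))
  finally show ?thesis by (simp add: q_def mult_ac)
qed

end

text \<open>The traction of the translating sphere is constant; times the area
  \<open>4 * pi * R^2\<close> it is Stokes' drag \<open>6 * pi * R * e\<close>. The traction of the
  rotating sphere is tangential, so it exerts a pure torque.\<close>

lemma sphere_boundary_values: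
  assumes R: "0 < R" and x: "norm x = R"
  shows "sphere_velocity R e x = e"
    and "sphere_stress R e x *v ((1 / R) *\<^sub>R x) = - (3 / (2 * R)) *\<^sub>R e"
    and "rotlet_stress R b x *v ((1 / R) *\<^sub>R x) = - (3 / R) *\<^sub>R cross3 b x"
proof -
  have xx: "x \<bullet> x = R\<^sup>2" by (simp add: x flip: power2_norm_eq_inner)
  show "sphere_velocity R e x = e"
    using R by (simp add: sphere_velocity_def Let_def x vec_eq_iff divide_simps eval_nat_numeral)
  have "sphere_stress R e x *v x = (- (3 * R ^ 3 / 2) * inverse R ^ 5) *\<^sub>R (R\<^sup>2 *\<^sub>R e + (2 * (x \<bullet> e)) *\<^sub>R x)
     + ((- (9 * R / 2) * inverse R ^ 5 + 15 * R ^ 3 / 2 * inverse R ^ 7) * (x \<bullet> e) * R\<^sup>2) *\<^sub>R x"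
    unfolding sphere_stress_def Let_def x
    by (simp only: matrix_vector_mult_add_rdistrib scaleR_matrix_vector_assoc[symmetric] outer_mult xx inner_commute[of e x]
        matrix_vector_mul_lid) (simp add: vec_eq_iff algebra_simps)
  also have "\<dots> = - (3 / 2) *\<^sub>R e"
    using R by (simp add: vec_eq_iff divide_simps eval_nat_numeral)
  finally show "sphere_stress R e x *v ((1 / R) *\<^sub>R x) = - (3 / (2 * R)) *\<^sub>R e"
    by (simp add: matrix_vector_mult_scaleR)
  have "rotlet_stress R b x *v x = (- (3 * R ^ 3) * inverse R ^ 5) *\<^sub>R (R\<^sup>2 *\<^sub>R cross3 b x)"
    unfolding rotlet_stress_def x
    by (simp only: matrix_vector_mult_add_rdistrib scaleR_matrix_vector_assoc[symmetric] outer_mult xx dot_cross_self) simp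
  also have "\<dots> = - 3 *\<^sub>R cross3 b x" using R by (simp add: vec_eq_iff divide_simps eval_nat_numeral)
  finally show "rotlet_stress R b x *v ((1 / R) *\<^sub>R x) = - (3 / R) *\<^sub>R cross3 b x"
    by (simp add: matrix_vector_mult_scaleR)
qed

section \<open>Mean value inequalities and Taylor remainders of the explicit fields\<close>

lemma gradient_lipschitz:
  assumes "gradient_on S f G" "convex T" "T \<subseteq> S" "\<And>y. y \<in> T \<Longrightarrow> norm (G y) \<le> B" "y \<in> T" "z \<in> T"
  shows "\<bar>f y - f z\<bar> \<le> B * norm (y - z)"
proof -
  have "norm (f y - f z) \<le> B * norm (y - z)"
  proof (rule differentiable_bound[OF assms(2) _ _ assms(5,6)])
    fix w assume w: "w \<in> T"
    show "(f has_derivative (\<bullet>) (G w)) (at w within T)"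
      using assms w by (auto simp: gradient_on_def intro: has_derivative_at_withinI)
    show "onorm ((\<bullet>) (G w)) \<le> B"
    proof (rule onorm_le)
      fix v
      have "norm (G w \<bullet> v) \<le> norm (G w) * norm v" using Cauchy_Schwarz_ineq2 by simp
      also have "\<dots> \<le> B * norm v" by (rule mult_right_mono[OF assms(4)[OF w]]) simp
      finally show "norm (G w \<bullet> v) \<le> B * norm v" .
    qed
  qed
  then show ?thesis by simp
qed

lemma jacobian_lipschitz:
  assumes "jacobian_on S f J" "convex T" "T \<subseteq> S" "\<And>y. y \<in> T \<Longrightarrow> norm (J y) \<le> B" "y \<in> T" "z \<in> T"
  shows "norm (f y - f z) \<le> B * norm (y - z)"
proof (rule differentiable_bound[OF assms(2) _ _ assms(5,6)])
  fix w assume w: "w \<in> T"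
  show "(f has_derivative (*v) (J w)) (at w within T)"
    using assms w by (auto simp: jacobian_on_def intro: has_derivative_at_withinI)
  show "onorm ((*v) (J w)) \<le> B"
    using assms(4)[OF w] matrix_vector_mult_norm_le[of "J w"]
    by (intro onorm_le) (meson mult_right_mono norm_ge_zero order_trans)
qed

lemma norm_le_row_sum: "norm A \<le> (\<Sum>i\<in>UNIV. norm (A $ i))" for A :: "real^3^3"
  by (simp add: norm_vec_def L2_set_le_sum)

lemma norm_le_entry_sum: "norm A \<le> (\<Sum>i\<in>UNIV. \<Sum>j\<in>UNIV. \<bar>A $ i $ j\<bar>)" for A :: "real^3^3"
  by (rule order_trans[OF norm_le_row_sum]) (intro sum_mono norm_le_l1_cart)

lemma norm_cross_mat_row_le: "norm (cross_mat e $ i) \<le> norm e"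
proof -
  have "(norm (cross_mat e $ i))\<^sup>2 = cross3 e (cross_mat e $ i) $ i"
    unfolding power2_norm_eq_inner matrix_vector_mul_component[symmetric] cross_mat_mult ..
  also have "\<dots> \<le> norm (cross3 e (cross_mat e $ i))" using component_le_norm_cart[of _ i] abs_le_D1 by blast
  also have "\<dots> \<le> norm e * norm (cross_mat e $ i)" by (rule norm_cross_le)
  finally show ?thesis by (cases "norm (cross_mat e $ i) = 0") (auto simp: power2_eq_square)
qed

text \<open>The remainder of the affine Taylor polynomial of the potential needs its second
  derivatives. Taking them entry by entry keeps them vectors; they decay like the velocity gradient,
  because the potential is one derivative above the velocity.\<close>

lemma sphere_potential_jac_entry_gradient:
  obtains G where "gradient_on (- {0}) (\<lambda>x. sphere_potential_jac R e x $ i $ j) G"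
    "\<And>x. 0 < R \<Longrightarrow> R \<le> norm x \<Longrightarrow> norm (G x) \<le> 11 * R * norm e * inverse (norm x) ^ 2"
proof -
  have h: "gradient_on (- {0}) (\<lambda>x::real^3. 3 * R / 4 * inverse (norm x) ^ 1 + (- (R ^ 3 / 4)) * inverse (norm x) ^ 3)
     (\<lambda>x. (3 * R / 4) *\<^sub>R (- (real 1 * inverse (norm x) ^ (1 + 2)) *\<^sub>R x) + (- (R ^ 3 / 4)) *\<^sub>R (- (real 3 * inverse (norm x) ^ (3 + 2)) *\<^sub>R x))"
    by (intro gradient_on_add gradient_on_cmult gradient_on_inverse_norm_power)
  have k: "gradient_on (- {0}) (\<lambda>x::real^3. - (3 * R / 4) * inverse (norm x) ^ 3 + 3 * R ^ 3 / 4 * inverse (norm x) ^ 5)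
     (\<lambda>x. (- (3 * R / 4)) *\<^sub>R (- (real 3 * inverse (norm x) ^ (3 + 2)) *\<^sub>R x) + (3 * R ^ 3 / 4) *\<^sub>R (- (real 5 * inverse (norm x) ^ (5 + 2)) *\<^sub>R x))"
    by (intro gradient_on_add gradient_on_cmult gradient_on_inverse_norm_power)
  have ci: "gradient_on (- {0}) (\<lambda>x. cross3 e x $ i) (\<lambda>x. cross_mat e $ i)"
    using jacobian_on_cross[of "- {0}" e] by (simp add: jacobian_on_iff)
  define G where "G = (\<lambda>x::real^3. cross_mat e $ i $ j *\<^sub>R ((- (3 * R / 4) * inverse (norm x) ^ 3 + 3 * R ^ 3 / 4 * inverse (norm x) ^ 5) *\<^sub>R x)
     + ((- (3 * R / 4) * inverse (norm x) ^ 3 + 3 * R ^ 3 / 4 * inverse (norm x) ^ 5) *\<^sub>R (cross3 e x $ i *\<^sub>R axis j 1 + x $ j *\<^sub>R cross_mat e $ i)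
     + ((- (9 * R / 4) * inverse (norm x) ^ 5 + 15 * R ^ 3 / 4 * inverse (norm x) ^ 7)) *\<^sub>R (- (cross3 e x $ i * x $ j)) *\<^sub>R x))"
  note A = gradient_on_add[OF gradient_on_cmult[OF h, of "cross_mat e $ i $ j"] gradient_on_mult[OF k gradient_on_mult[OF ci gradient_on_component[of _ j]]]]
  have g: "gradient_on (- {0}) (\<lambda>x. sphere_potential_jac R e x $ i $ j) G"
  proof (rule gradient_on_transform[OF A])
    fix x :: "real^3"
    show "cross_mat e $ i $ j * (3 * R / 4 * inverse (norm x) ^ 1 + (- (R ^ 3 / 4)) * inverse (norm x) ^ 3) +
         (- (3 * R / 4) * inverse (norm x) ^ 3 + 3 * R ^ 3 / 4 * inverse (norm x) ^ 5) * (cross3 e x $ i * x $ j) =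
         sphere_potential_jac R e x $ i $ j"
      by (simp add: sphere_potential_jac_def Let_def outer_component)
  qed (auto simp: G_def vec_eq_iff algebra_simps power3_eq_cube)
  moreover have "norm (G x) \<le> 11 * R * norm e * inverse (norm x) ^ 2" if R: "0 < R" and x: "R \<le> norm x" for x
  proof -
    define q where "q = inverse (norm x)"
    have K: "\<bar>cross_mat e $ i $ j\<bar> \<le> norm e"
      using component_le_norm_cart[of "cross_mat e $ i" j] norm_cross_mat_row_le[of e i] by linarith
    have c: "\<bar>cross3 e x $ i\<bar> \<le> norm e * norm x"
      using component_le_norm_cart[of "cross3 e x" i] norm_cross_le[of e x] by linarith
    have xj: "\<bar>x $ j\<bar> \<le> norm x" by (rule component_le_norm_cart)
    have cx: "\<bar>- (cross3 e x $ i * x $ j)\<bar> \<le> norm e * norm x * norm x"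
      unfolding abs_minus abs_mult using c xj by (intro mult_mono) auto
    have "norm (G x) \<le> norm e * (3 / 2 * R * q ^ 3 * norm x)
       + (3 / 2 * R * q ^ 3 * ((norm e * norm x) * 1 + norm x * norm e) + 6 * R * q ^ 5 * ((norm e * norm x * norm x) * norm x))"
      unfolding G_def q_def
      by (intro norm_triangle_mono norm_scaleR_le radial_coefficients[OF R x] K c xj cx norm_cross_mat_row_le) simp_all
    also have "\<dots> = 9 / 2 * R * norm e * (q ^ (2 + 1) * norm x) + 6 * R * norm e * (q ^ (4 + 1) * norm x * norm x * norm x)"
      by (simp add: eval_nat_numeral algebra_simps)
    also have "q ^ (2 + 1) * norm x = q ^ 2" unfolding q_def by (rule radial_facts(2)[OF R x])
    also have "q ^ (4 + 1) * norm x = q ^ (3 + 1)" unfolding q_def by (subst radial_facts(2)[OF R x]) simp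
    also have "q ^ (3 + 1) * norm x = q ^ (2 + 1)" unfolding q_def by (subst radial_facts(2)[OF R x]) simp
    also have "q ^ (2 + 1) * norm x = q ^ 2" unfolding q_def by (rule radial_facts(2)[OF R x])
    finally have "norm (G x) \<le> 21 / 2 * (R * norm e * q\<^sup>2)" by simp
    also have "\<dots> \<le> 11 * (R * norm e * q\<^sup>2)" using R by (intro mult_right_mono) auto
    finally show ?thesis by (simp add: q_def mult_ac)
  qed
  ultimately show thesis by (rule that)
qed

text \<open>Fields of a sphere centred at \<open>a\<close>, compared at points of a ball that stays at distance
  \<open>d / 2\<close> from it.\<close>

lemma sphere_fields_on_ball:
  fixes e a c :: "real^3"
  assumes R: "0 < R" and d: "4 * R \<le> dist c a" and y: "y \<in> cball c (2 * R)"
  defines "B \<equiv> R * norm e / (dist c a)\<^sup>2"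
  shows "norm (sphere_velocity_jac R e (y - a)) \<le> 48 * B"
    and "norm (sphere_velocity R e (y - a) - sphere_velocity R e (c - a)) \<le> 96 * R * B"
    and "norm (sphere_potential_jac R e (y - a) - sphere_potential_jac R e (c - a)) \<le> 800 * R * B"
    and "norm (sphere_potential R e (y - a) - sphere_potential R e (c - a) - sphere_potential_jac R e (c - a) *v (y - c)) \<le> 1600 * R\<^sup>2 * B"
proof -
  define T where "T = cball (c - a) (2 * R)"
  have cT: "convex T" unfolding T_def by simp
  have dp: "dist c a > 0" using R d by linarith
  have mem: "y - a \<in> T" "c - a \<in> T" using y R by (auto simp: T_def dist_norm)
  \<comment> \<open>A point of \<open>T\<close> is at most \<open>2 * R\<close> away from
    \<open>c - a\<close>, which is at most half the distance of the centres; so at least half of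
    that distance remains.\<close>
  have TN: "R \<le> norm w" "inverse (norm w) ^ 2 \<le> 4 / (dist c a)\<^sup>2" "w \<noteq> 0" if w: "w \<in> T" for w
  proof -
    have "norm (c - a) \<le> norm w + norm (c - a - w)"
      using norm_triangle_ineq[of w "c - a - w"] by simp
    then have n: "dist c a / 2 \<le> norm w" using w d by (simp add: T_def dist_norm)
    then show "R \<le> norm w" using d R by linarith
    then show "w \<noteq> 0" using R by auto
    have "inverse (norm w) \<le> inverse (dist c a / 2)" using n dp by (intro le_imp_inverse_le) auto
    then have "inverse (norm w) ^ 2 \<le> inverse (dist c a / 2) ^ 2" by (intro power_mono) auto
    also have "\<dots> = 4 / (dist c a)\<^sup>2" by (simp add: power_divide inverse_eq_divide)
    finally show "inverse (norm w) ^ 2 \<le> 4 / (dist c a)\<^sup>2" .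
  qed
  have T0: "T \<subseteq> - {0}" using TN(3) by auto
  have B0: "B \<ge> 0" using R by (simp add: B_def)
  have sc: "k * R * norm e * inverse (norm w) ^ 2 \<le> k * 4 * B" if "w \<in> T" "k \<ge> 0" for w k
  proof -
    have "k * R * norm e * inverse (norm w) ^ 2 \<le> k * R * norm e * (4 / (dist c a)\<^sup>2)"
      using that R TN(2)[OF that(1)] by (intro mult_left_mono) auto
    then show ?thesis by (simp add: B_def mult_ac)
  qed
  have JW: "norm (sphere_velocity_jac R e w) \<le> 48 * B" if "w \<in> T" for w
    using norm_sphere_velocity_jac_le[OF R TN(1)[OF that], of e] sc[OF that, of 12] by simp
  show "norm (sphere_velocity_jac R e (y - a)) \<le> 48 * B" by (rule JW[OF mem(1)])
  have yc: "norm ((y - a) - (c - a)) \<le> 2 * R" using y by (simp add: dist_norm norm_minus_commute)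
  have "norm (sphere_velocity R e (y - a) - sphere_velocity R e (c - a)) \<le> 48 * B * norm ((y - a) - (c - a))"
    by (rule jacobian_lipschitz[OF sphere_velocity_jacobian cT T0 JW mem])
  also have "\<dots> \<le> 48 * B * (2 * R)" using yc B0 by (intro mult_left_mono) auto
  finally show "norm (sphere_velocity R e (y - a) - sphere_velocity R e (c - a)) \<le> 96 * R * B" by (simp add: mult_ac)
  have JA: "norm (sphere_potential_jac R e w - sphere_potential_jac R e (c - a)) \<le> 800 * R * B" if w: "w \<in> T" for w
  proof -
    have "\<bar>(sphere_potential_jac R e w - sphere_potential_jac R e (c - a)) $ i $ j\<bar> \<le> 88 * R * B" for i j
    proof -
      obtain G where G: "gradient_on (- {0}) (\<lambda>x. sphere_potential_jac R e x $ i $ j) G"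
        "\<And>x. 0 < R \<Longrightarrow> R \<le> norm x \<Longrightarrow> norm (G x) \<le> 11 * R * norm e * inverse (norm x) ^ 2"
        using sphere_potential_jac_entry_gradient by blast
      have GB: "norm (G z) \<le> 44 * B" if "z \<in> T" for z
        using G(2)[OF R TN(1)[OF that]] sc[OF that, of 11] by simp
      have "\<bar>sphere_potential_jac R e w $ i $ j - sphere_potential_jac R e (c - a) $ i $ j\<bar> \<le> 44 * B * norm (w - (c - a))"
        by (rule gradient_lipschitz[OF G(1) cT T0 GB w mem(2)])
      also have "\<dots> \<le> 44 * B * (2 * R)"
        using w B0 by (intro mult_left_mono) (auto simp: T_def dist_norm norm_minus_commute)
      finally show ?thesis by (simp add: mult_ac)
    qed
    then have "(\<Sum>i\<in>UNIV. \<Sum>j\<in>UNIV. \<bar>(sphere_potential_jac R e w - sphere_potential_jac R e (c - a)) $ i $ j\<bar>) \<le> (\<Sum>i\<in>(UNIV::3 set). \<Sum>j\<in>(UNIV::3 set). 88 * R * B)"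
      by (intro sum_mono)
    \<comment> \<open>Nine entries with the bound \<open>88 * R * B\<close> each, then rounded
      up.\<close>
    also have "\<dots> = 792 * R * B" by simp
    also have "\<dots> \<le> 800 * R * B" using R B0 by simp
    finally show ?thesis using norm_le_entry_sum order_trans by blast
  qed
  show "norm (sphere_potential_jac R e (y - a) - sphere_potential_jac R e (c - a)) \<le> 800 * R * B" by (rule JA[OF mem(1)])
  \<comment> \<open>Subtracting the derivative at \<open>c - a\<close> as a linear map makes the
    increment of \<open>h\<close> the Taylor remainder, whose derivative is bounded by
    \<open>JA\<close>; the mean value inequality gains the second factor \<open>R\<close>.\<close>
  define h where "h = (\<lambda>w. sphere_potential R e w - sphere_potential_jac R e (c - a) *v w)"
  have lin: "jacobian_on (- {0}) (\<lambda>w. sphere_potential_jac R e (c - a) *v w) (\<lambda>w. sphere_potential_jac R e (c - a))"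
    unfolding jacobian_on_def by (auto intro!: bounded_linear_imp_has_derivative)
  have hJ: "jacobian_on (- {0}) h (\<lambda>w. sphere_potential_jac R e w - sphere_potential_jac R e (c - a))"
    unfolding h_def by (rule jacobian_on_diff[OF sphere_potential_jacobian lin])
  have "norm (h (y - a) - h (c - a)) \<le> 800 * R * B * norm ((y - a) - (c - a))"
    by (rule jacobian_lipschitz[OF hJ cT T0 JA mem])
  also have "\<dots> \<le> 800 * R * B * (2 * R)" using yc B0 R by (intro mult_left_mono) auto
  also have "\<dots> = 1600 * R\<^sup>2 * B" by (simp add: power2_eq_square)
  also have "h (y - a) - h (c - a) = sphere_potential R e (y - a) - sphere_potential R e (c - a) - sphere_potential_jac R e (c - a) *v (y - c)"
  proof -
    have "sphere_potential_jac R e (c - a) *v (y - c) = sphere_potential_jac R e (c - a) *v (y - a) - sphere_potential_jac R e (c - a) *v (c - a)"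
      by (simp flip: matrix_vector_mult_diff_distrib)
    then show ?thesis by (simp add: h_def)
  qed
  finally show "norm (sphere_potential R e (y - a) - sphere_potential R e (c - a) - sphere_potential_jac R e (c - a) *v (y - c)) \<le> 1600 * R\<^sup>2 * B" .
qed

section \<open>Divergence free correctors\<close>

text \<open>In polar coordinates the integrand is \<open>4 * pi / r^2\<close>. The integral over
  shells is explicit, and monotone convergence removes the outer radius.\<close>

lemma inverse_norm_power4_integral:
  assumes R: "0 < R"
  shows "set_integrable lborel {y. R < dist a y} (\<lambda>y::real^3. inverse (norm (y - a)) ^ 4)"
    and "(LINT y:{y. R < dist a y}|lborel. inverse (norm (y - a)) ^ 4) \<le> 4 * pi / R"
proof -
  let ?f = "\<lambda>y::real^3. inverse (norm (y - a)) ^ 4"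
  define K where "K = (\<lambda>n::nat. {y. R \<le> dist a y \<and> dist a y \<le> R + real n})"
  have "K n = cball a (R + real n) - ball a R" for n by (auto simp: K_def)
  then have cK: "compact (K n)" for n by (simp add: compact_diff)
  have cf: "continuous_on (K n) ?f" for n
    using R by (intro continuous_intros) (auto simp: K_def)
  have sI: "set_integrable lborel (K n) ?f" for n by (rule set_integrable_compact[OF cK cf])
  have val: "(LINT y:K n|lborel. ?f y) = 4 * pi / R - 4 * pi / (R + real n)" for n
  proof -
    have "(LINT y:K n|lborel. ?f y) = integral {R..R + real n} (\<lambda>r. sphint a r ?f)"
      using integral_shell_polar[of R "R + real n" a ?f] R cf[of n] unfolding K_def by simp
    also have "\<dots> = integral {R..R + real n} (\<lambda>r. 4 * pi / r\<^sup>2)"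
    proof (rule integral_cong)
      fix r assume r: "r \<in> {R..R + real n}"
      have "sphint a r ?f = sphint a r (\<lambda>y. inverse r ^ 4)"
        by (rule sphint_cong) (use r R in \<open>auto simp: dist_norm norm_minus_commute\<close>)
      also have "\<dots> = 4 * pi / r\<^sup>2"
        using r R by (simp add: sphint_const field_simps eval_nat_numeral)
      finally show "sphint a r ?f = 4 * pi / r\<^sup>2" .
    qed
    also have "\<dots> = - 4 * pi / (R + real n) - (- 4 * pi / R)"
    proof (rule integral_unique, rule fundamental_theorem_of_calculus)
      fix r assume r: "r \<in> {R..R + real n}"
      have "((\<lambda>r. - 4 * pi / r) has_real_derivative 4 * pi / r\<^sup>2) (at r)"
        using r R by (auto intro!: derivative_eq_intros simp: power2_eq_square)
      then show "((\<lambda>r. - 4 * pi / r) has_vector_derivative 4 * pi / r\<^sup>2) (at r within {R..R + real n})"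
        by (metis has_real_derivative_iff_has_vector_derivative has_vector_derivative_at_within)
    qed simp
    finally show ?thesis by simp
  qed
  have lim: "(\<lambda>n. 4 * pi / R - 4 * pi / (R + real n)) \<longlonglongrightarrow> 4 * pi / R - 0"
  proof (intro tendsto_diff tendsto_const)
    have "filterlim (\<lambda>n. R + real n) at_top sequentially"
      by (rule filterlim_tendsto_add_at_top[OF tendsto_const filterlim_real_sequentially])
    then show "(\<lambda>n. 4 * pi / (R + real n)) \<longlonglongrightarrow> 0"
      by (rule real_tendsto_divide_at_top[OF tendsto_const])
  qed
  define U where "U = {y::real^3. R \<le> dist a y}"
  have bU: "U \<in> sets borel"
    unfolding U_def by (intro borel_closed closed_Collect_le continuous_intros)
  have cU: "continuous_on U ?f" using R by (intro continuous_intros) (auto simp: U_def)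
  have c1: "integrable lborel (\<lambda>y. indicator (K n) y *\<^sub>R ?f y)" for n
    using sI[of n] unfolding set_integrable_def .
  have c2: "AE y in lborel. mono (\<lambda>n. indicator (K n) y *\<^sub>R ?f y)"
    by (intro AE_I2 monoI) (auto simp: indicator_def K_def intro: order_trans)
  have c3: "AE y in lborel. (\<lambda>n. indicator (K n) y *\<^sub>R ?f y) \<longlonglongrightarrow> indicator U y *\<^sub>R ?f y"
  proof (rule AE_I2)
    fix y :: "real^3"
    obtain n0 :: nat where n0: "dist a y < real n0" by (metis reals_Archimedean2)
    have "\<forall>\<^sub>F n in sequentially. indicator U y *\<^sub>R ?f y = indicator (K n) y *\<^sub>R ?f y"
      unfolding eventually_sequentially
    proof (intro exI allI impI)
      fix n assume "n \<ge> n0"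
      then have "dist a y \<le> R + real n" using n0 R by linarith
      then show "indicator U y *\<^sub>R ?f y = indicator (K n) y *\<^sub>R ?f y" by (simp add: indicator_def U_def K_def)
    qed
    then show "(\<lambda>n. indicator (K n) y *\<^sub>R ?f y) \<longlonglongrightarrow> indicator U y *\<^sub>R ?f y"
      by (rule Lim_transform_eventually[OF tendsto_const])
  qed
  have c4: "(\<lambda>n. LINT y|lborel. indicator (K n) y *\<^sub>R ?f y) \<longlonglongrightarrow> 4 * pi / R - 0"
    using lim unfolding val[symmetric] set_lebesgue_integral_def .
  have c5: "(\<lambda>y. indicator U y *\<^sub>R ?f y) \<in> borel_measurable lborel"
    using borel_measurable_continuous_on_indicator[OF bU cU] by simp
  note M' = integral_monotone_convergence[OF c1 c2 c3 c4 c5] integrable_monotone_convergence[OF c1 c2 c3 c4 c5]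
  have SU: "{y. R < dist a y} \<subseteq> U" by (auto simp: U_def)
  have "open {y::real^3. R < dist a y}" by (intro open_Collect_less continuous_intros)
  then have bS: "{y::real^3. R < dist a y} \<in> sets borel" by simp
  show i: "set_integrable lborel {y. R < dist a y} ?f"
    by (rule set_integrable_subset[of _ U]) (use bS SU M'(2)[folded set_integrable_def] in \<open>simp_all\<close>)
  have "(LINT y:{y. R < dist a y}|lborel. ?f y) \<le> (LINT y|lborel. indicator U y *\<^sub>R ?f y)"
    unfolding set_lebesgue_integral_def
    by (rule integral_mono[OF i[unfolded set_integrable_def] M'(2)]) (use SU in \<open>auto simp: indicator_def\<close>)
  also have "\<dots> = 4 * pi / R" using M'(1) by simp
  finally show "(LINT y:{y. R < dist a y}|lborel. ?f y) \<le> 4 * pi / R" .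
qed

text \<open>The Hessian of \<open>bump\<close>. Its symmetry, in the form
  \<open>curl_bumpg_jac\<close>, is what makes the correctors divergence free.\<close>

definition bumpg_jac :: "real^3 \<Rightarrow> real \<Rightarrow> real \<Rightarrow> real^3 \<Rightarrow> real^3^3" where
  "bumpg_jac a s t x = (let w = ((norm (x - a))\<^sup>2 - s) / (t - s) in
     (- (2 * step' w / (t - s))) *\<^sub>R mat 1 + (- (4 * step'' w / (t - s)\<^sup>2)) *\<^sub>R outer (x - a) (x - a))"

lemma bumpg_jacobian: "jacobian_on UNIV (bumpg a s t) (bumpg_jac a s t)"
proof -
  let ?w = "\<lambda>x. ((norm (x - a))\<^sup>2 - s) / (t - s)"
  have w: "(?w has_derivative (\<lambda>v. 2 * ((x - a) \<bullet> v) / (t - s))) (at x)" for x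
    using bounded_linear.has_derivative[OF bounded_linear_divide
        has_derivative_diff[OF norm_diff_sq_has_derivative[of a x UNIV] has_derivative_const[of s]], of "t - s"]
    by simp
  have "gradient_on UNIV (\<lambda>x. step' (?w x)) (\<lambda>x. (2 * step'' (?w x) / (t - s)) *\<^sub>R (x - a))"
    unfolding gradient_on_def
  proof (intro conjI ballI)
    fix x
    from has_derivative_compose[OF w step'_has_derivative[unfolded has_field_derivative_def]]
    have "((\<lambda>x. step' (?w x)) has_derivative (\<lambda>v. step'' (?w x) * (2 * ((x - a) \<bullet> v) / (t - s)))) (at x)" .
    moreover have "(\<lambda>v. step'' (?w x) * (2 * ((x - a) \<bullet> v) / (t - s))) = (\<bullet>) ((2 * step'' (?w x) / (t - s)) *\<^sub>R (x - a))"
      by (auto simp: fun_eq_iff)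
    ultimately show "((\<lambda>x. step' (?w x)) has_derivative (\<bullet>) ((2 * step'' (?w x) / (t - s)) *\<^sub>R (x - a))) (at x)"
      by (simp only:)
  next
    show "continuous_on UNIV (\<lambda>x. (2 * step'' (?w x) / (t - s)) *\<^sub>R (x - a))"
      unfolding divide_inverse by (intro continuous_intros continuous_on_step'')
  qed
  note G = gradient_on_cmult[OF this, of "- (2 / (t - s))"]
  have id: "jacobian_on UNIV (\<lambda>x. x - a) (\<lambda>x. mat 1 - 0)"
    by (intro jacobian_on_diff jacobian_on_id jacobian_on_const)
  show ?thesis
    by (rule jacobian_on_transform[OF jacobian_on_scaleR[OF G id] open_UNIV])
      (auto simp: bumpg_def bumpg_jac_def Let_def scaleR_outer power2_eq_square outer_def vec_eq_iff)
qed

lemma curl_bumpg_jac: "curl_mat (bumpg_jac a s t x) = 0"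
proof -
  have "curl_mat (mat 1) = 0" by (simp add: curl_mat_def vec_eq_iff forall_3 mat_def)
  then show ?thesis
    by (simp only: bumpg_jac_def Let_def curl_mat_add curl_mat_scaleR curl_mat_outer cross_refl scaleR_zero_right add_0_right)
qed

lemma bumpg_jac_eq_0: "s < t \<Longrightarrow> t \<le> (norm (x - a))\<^sup>2 \<Longrightarrow> bumpg_jac a s t x = 0"
  by (simp add: bumpg_jac_def Let_def step'_eq step''_eq_0)

text \<open>The Jacobian of a cross product of two fields with values \<open>a\<close>,
  \<open>b\<close> and Jacobians \<open>A\<close>, \<open>B\<close>.\<close>

definition cross_jac :: "real^3 \<Rightarrow> real^3^3 \<Rightarrow> real^3 \<Rightarrow> real^3^3 \<Rightarrow> real^3^3" where
  "cross_jac a A b B = cross_mat a ** B - cross_mat b ** A"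

lemma continuous_on_matrix_mult:
  fixes A B :: "'a::t2_space \<Rightarrow> real^3^3"
  assumes "continuous_on S A" "continuous_on S B"
  shows "continuous_on S (\<lambda>x. A x ** B x)"
  unfolding matrix_matrix_mult_def
  by (intro continuous_on_vec_lambda continuous_on_sum continuous_on_mult continuous_on_component assms)

lemma continuous_on_cross_mat:
  fixes f :: "'a::t2_space \<Rightarrow> real^3"
  assumes "continuous_on S f"
  shows "continuous_on S (\<lambda>x. cross_mat (f x))"
  unfolding cross_mat_def
  by (intro continuous_on_vec_lambda continuous_on_component continuous_on_cross continuous_on_const assms)

lemma jacobian_on_cross_product:
  assumes f: "jacobian_on S f F" and g: "jacobian_on S g G"
  shows "jacobian_on S (\<lambda>x. cross3 (f x) (g x)) (\<lambda>x. cross_jac (f x) (F x) (g x) (G x))"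
  unfolding jacobian_on_def
proof (intro conjI ballI)
  fix x assume x: "x \<in> S"
  have d: "(f has_derivative (*v) (F x)) (at x)" "(g has_derivative (*v) (G x)) (at x)"
    using f g x by (auto simp: jacobian_on_def)
  have "((\<lambda>x. cross3 (f x) (g x)) has_derivative (\<lambda>v. cross3 (f x) (G x *v v) + cross3 (F x *v v) (g x))) (at x)"
    by (rule bounded_bilinear.FDERIV[OF bilinear_cross[unfolded bilinear_conv_bounded_bilinear] d])
  moreover have "(\<lambda>v. cross3 (f x) (G x *v v) + cross3 (F x *v v) (g x)) = (*v) (cross_jac (f x) (F x) (g x) (G x))"
  proof
    fix v
    show "cross3 (f x) (G x *v v) + cross3 (F x *v v) (g x) = cross_jac (f x) (F x) (g x) (G x) *v v"
      using cross_skew[of "F x *v v" "g x"]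
      by (simp add: cross_jac_def matrix_vector_mult_diff_rdistrib cross_mat_mult flip: matrix_vector_mul_assoc)
  qed
  ultimately show "((\<lambda>x. cross3 (f x) (g x)) has_derivative (*v) (cross_jac (f x) (F x) (g x) (G x))) (at x)"
    by (simp only:)
next
  show "continuous_on S (\<lambda>x. cross_jac (f x) (F x) (g x) (G x))"
    unfolding cross_jac_def using f g jacobian_on_continuous[OF f] jacobian_on_continuous[OF g]
    by (intro continuous_on_diff continuous_on_matrix_mult continuous_on_cross_mat) (auto simp: jacobian_on_def)
qed

text \<open>The vector identity for the divergence of a cross product, at the level of
  matrices.\<close>

lemma trace_cross_jac: "trace (cross_jac a A b B) = b \<bullet> curl_mat A - a \<bullet> curl_mat B"
  by (simp add: cross_jac_def trace_def matrix_matrix_mult_def sum_3 cross_mat_def cross3_def axis_def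
      curl_mat_def inner_vec_def algebra_simps)

lemma norm_cross_mat_mult_le:
  fixes B :: "real^3^3"
  shows "norm (cross_mat a ** B) \<le> 9 * norm a * norm B"
proof -
  have "norm ((cross_mat a ** B) $ i) \<le> 3 * norm a * norm B" for i
  proof -
    have "(cross_mat a ** B) $ i = (\<Sum>k\<in>UNIV. cross_mat a $ i $ k *\<^sub>R B $ k)"
      by (simp add: vec_eq_iff matrix_matrix_mult_def sum_component)
    also have "norm \<dots> \<le> (\<Sum>k\<in>(UNIV::3 set). norm a * norm B)"
    proof (rule sum_norm_le)
      fix k :: 3
      have "\<bar>cross_mat a $ i $ k\<bar> \<le> norm a"
        using component_le_norm_cart[of "cross_mat a $ i" k] norm_cross_mat_row_le[of a i] by linarith
      moreover have "norm (B $ k) \<le> norm B" by (rule Finite_Cartesian_Product.norm_nth_le)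
      ultimately show "norm (cross_mat a $ i $ k *\<^sub>R B $ k) \<le> norm a * norm B" by (rule norm_scaleR_le)
    qed
    finally show ?thesis by simp
  qed
  then have "(\<Sum>i\<in>UNIV. norm ((cross_mat a ** B) $ i)) \<le> (\<Sum>i\<in>(UNIV::3 set). 3 * norm a * norm B)" by (intro sum_mono)
  then show ?thesis using norm_le_row_sum[of "cross_mat a ** B"] by simp
qed

lemma norm_cross_jac_le: "norm (cross_jac a A b B) \<le> 9 * norm a * norm B + 9 * norm b * norm A"
  unfolding cross_jac_def
  using norm_triangle_ineq4[of "cross_mat a ** B" "cross_mat b ** A"]
    norm_cross_mat_mult_le[of a B] norm_cross_mat_mult_le[of b A] by linarith

section \<open>Correctors of a suspension\<close>

context suspension
begin

definition others :: "nat \<Rightarrow> nat set" where "others i = {1..N} - {i}"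

definition background :: "real^3 \<Rightarrow> nat \<Rightarrow> real^3 \<Rightarrow> real^3" where
  "background e i y = (\<Sum>j\<in>others i. sphere_velocity R e (y - x j))"

definition background_jac :: "real^3 \<Rightarrow> nat \<Rightarrow> real^3 \<Rightarrow> real^3^3" where
  "background_jac e i y = (\<Sum>j\<in>others i. sphere_velocity_jac R e (y - x j))"

text \<open>The vector potential of the other particles minus its first Taylor polynomial at
  \<open>x i\<close>. Its curl is the background flow minus the value at \<open>x i\<close>, and on
  the ball of radius \<open>2 * R\<close> it is of second order in \<open>R\<close>, which
  compensates two derivatives of the cutoff.\<close>

definition pot :: "real^3 \<Rightarrow> nat \<Rightarrow> real^3 \<Rightarrow> real^3" where
  "pot e i y = (\<Sum>j\<in>others i. sphere_potential R e (y - x j) - sphere_potential R e (x i - x j)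
      - sphere_potential_jac R e (x i - x j) *v (y - x i))"

definition potJ :: "real^3 \<Rightarrow> nat \<Rightarrow> real^3 \<Rightarrow> real^3^3" where
  "potJ e i y = (\<Sum>j\<in>others i. sphere_potential_jac R e (y - x j) - sphere_potential_jac R e (x i - x j))"

text \<open>A divergence free field supported in the ball of radius \<open>2 R\<close> around \<open>x i\<close> that cancels, on
  the sphere of radius \<open>R\<close>, the variation of the flow of the other particles: the curl of the
  truncated vector potential, written out.\<close>

definition corr :: "real^3 \<Rightarrow> nat \<Rightarrow> real^3 \<Rightarrow> real^3" where
  "corr e i y = bump (x i) (R\<^sup>2) (4 * R\<^sup>2) y *\<^sub>R (background e i y - background e i (x i))
     + cross3 (bumpg (x i) (R\<^sup>2) (4 * R\<^sup>2) y) (pot e i y)"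

definition corrJ :: "real^3 \<Rightarrow> nat \<Rightarrow> real^3 \<Rightarrow> real^3^3" where
  "corrJ e i y = bump (x i) (R\<^sup>2) (4 * R\<^sup>2) y *\<^sub>R background_jac e i y
     + outer (background e i y - background e i (x i)) (bumpg (x i) (R\<^sup>2) (4 * R\<^sup>2) y)
     + cross_jac (bumpg (x i) (R\<^sup>2) (4 * R\<^sup>2) y) (bumpg_jac (x i) (R\<^sup>2) (4 * R\<^sup>2) y) (pot e i y) (potJ e i y)"

text \<open>Up to a constant, a bound for the velocity gradient of the other particles near
  \<open>x i\<close>; all estimates of the corrector are proportional to it.\<close>

definition near_sum :: "real^3 \<Rightarrow> nat \<Rightarrow> real" where
  "near_sum e i = (\<Sum>j\<in>others i. R * norm e / (dist (x i) (x j))\<^sup>2)"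

lemma near_sum_nonneg: "0 \<le> near_sum e i"
  unfolding near_sum_def using R by (intro sum_nonneg) auto

lemma others_sep: "i \<in> {1..N} \<Longrightarrow> j \<in> others i \<Longrightarrow> 4 * R \<le> dist (x i) (x j)"
  using sep by (auto simp: others_def)

lemma others_away: "i \<in> {1..N} \<Longrightarrow> j \<in> others i \<Longrightarrow> y \<in> ball (x i) (3 * R) \<Longrightarrow> y - x j \<in> - {0}"
proof -
  assume *: "i \<in> {1..N}" "j \<in> others i" "y \<in> ball (x i) (3 * R)"
  have "4 * R \<le> dist (x i) (x j)" "dist (x i) y < 3 * R" using others_sep[OF *(1,2)] *(3) by simp_all
  then show ?thesis using R by auto
qed

lemma scales: "R\<^sup>2 < 4 * R\<^sup>2"
  using R by simp

lemma outside_support: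
  assumes "2 * R \<le> dist (x i) y"
  shows "corr e i y = 0" "corrJ e i y = 0"
proof -
  have "(2 * R)\<^sup>2 \<le> (dist (x i) y)\<^sup>2" using assms R by (intro power_mono) auto
  then have f: "4 * R\<^sup>2 \<le> (norm (y - x i))\<^sup>2" by (simp add: power_mult_distrib dist_norm norm_minus_commute)
  have z: "bump (x i) (R\<^sup>2) (4 * R\<^sup>2) y = 0" "bumpg (x i) (R\<^sup>2) (4 * R\<^sup>2) y = 0" "bumpg_jac (x i) (R\<^sup>2) (4 * R\<^sup>2) y = 0"
    using bump_eq_0[OF scales f] bumpg_eq_0[OF scales disjI2[OF f]] bumpg_jac_eq_0[OF scales f] by blast+
  have cm: "cross_mat 0 = 0" by (simp add: cross_mat_def vec_eq_iff)
  show "corr e i y = 0" "corrJ e i y = 0"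
    by (simp_all add: corr_def corrJ_def z cross_jac_def cm outer_def vec_eq_iff matrix_matrix_mult_def)
qed

text \<open>The defining formula is singular at the centres of the other particles. It is
  differentiated in the ball of radius \<open>3 * R\<close>, which contains none of them, and
  outside the ball of radius \<open>2 * R\<close> the field is zero; the two open regions cover the
  space.\<close>

lemma corr_jacobian:
  assumes i: "i \<in> {1..N}"
  shows "jacobian_on UNIV (corr e i) (corrJ e i)"
proof -
  define B where "B = ball (x i) (3 * R)"
  define E where "E = {y. 2 * R < dist (x i) y}"
  have oE: "open E" unfolding E_def by (intro open_Collect_less continuous_intros)
  have oB: "open B" by (simp add: B_def)
  have sub: "B \<subseteq> {y. y - x j \<in> - {0}}" if "j \<in> others i" for j
  proof
    fix y assume "y \<in> B"
    then have "y - x j \<in> - {0}" unfolding B_def by (rule others_away[OF i that])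
    then show "y \<in> {y. y - x j \<in> - {0}}" by simp
  qed
  have W: "jacobian_on B (\<lambda>y. sphere_velocity R e (y - x j)) (\<lambda>y. sphere_velocity_jac R e (y - x j))"
    and P: "jacobian_on B (\<lambda>y. sphere_potential R e (y - x j)) (\<lambda>y. sphere_potential_jac R e (y - x j))" if "j \<in> others i" for j
    using jacobian_on_subset[OF jacobian_on_shift[OF sphere_velocity_jacobian] sub[OF that]]
      jacobian_on_subset[OF jacobian_on_shift[OF sphere_potential_jacobian] sub[OF that]] by blast+
  have vd: "jacobian_on B (\<lambda>y. background e i y - background e i (x i)) (\<lambda>y. background_jac e i y - 0)"
    unfolding background_def background_jac_def by (intro jacobian_on_diff jacobian_on_sum W jacobian_on_const)
  have L: "jacobian_on B (\<lambda>y. A *v (y - x i)) (\<lambda>y. A)" for A :: "real^3^3"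
  proof -
    have "jacobian_on B (\<lambda>y. A *v y - A *v x i) (\<lambda>y. A - 0)"
      by (intro jacobian_on_diff jacobian_on_const) (auto simp: jacobian_on_def intro!: bounded_linear_imp_has_derivative)
    then show ?thesis by (simp add: matrix_vector_mult_diff_distrib)
  qed
  have pd: "jacobian_on B (pot e i) (\<lambda>y. \<Sum>j\<in>others i. sphere_potential_jac R e (y - x j) - 0 - sphere_potential_jac R e (x i - x j))"
    unfolding pot_def[abs_def] by (intro jacobian_on_sum jacobian_on_diff P jacobian_on_const L)
  have jB: "jacobian_on B (corr e i) (corrJ e i)"
  proof (rule jacobian_on_transform[OF jacobian_on_add[OF jacobian_on_scaleR[OF gradient_on_subset[OF bump_gradient] vd]
          jacobian_on_cross_product[OF jacobian_on_subset[OF bumpg_jacobian] pd]] oB])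
  qed (auto simp: corr_def corrJ_def potJ_def)
  have jE: "jacobian_on E (corr e i) (corrJ e i)"
    by (rule jacobian_on_transform[OF jacobian_on_const[of E 0] oE]) (auto simp: E_def outside_support)
  have "B \<union> E = UNIV" using R by (auto simp: B_def E_def)
  then show ?thesis using jacobian_on_Un[OF jB jE oB oE] by simp
qed

text \<open>The gradient of the cutoff meets the velocity twice, once from the truncated flow and
  once, with opposite sign, from the curl of \<open>pot\<close> in the cross product. The curl of
  the gradient of the cutoff is zero, and the flow itself is divergence free.\<close>

lemma corr_divergence_free:
  assumes i: "i \<in> {1..N}"
  shows "trace (corrJ e i y) = 0"
proof (cases "2 * R \<le> dist (x i) y")
  case True
  then show ?thesis by (simp add: outside_support trace_def)
next
  case False
  then have y: "y \<in> ball (x i) (3 * R)" using R by simp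
  have nz: "y - x j \<noteq> 0" "x i - x j \<noteq> 0" if "j \<in> others i" for j
  proof -
    show "y - x j \<noteq> 0" using others_away[OF i that y] by simp
    show "x i - x j \<noteq> 0" using others_sep[OF i that] R by (metis dist_eq_0_iff eq_iff_diff_eq_0 mult_pos_pos not_le zero_less_numeral)
  qed
  have t0: "trace (background_jac e i y) = 0"
    unfolding background_jac_def trace_sum using nz by (intro sum.neutral) (simp add: trace_sphere_velocity_jac)
  have cs: "curl_mat (\<Sum>j\<in>I. A j) = (\<Sum>j\<in>I. curl_mat (A j))" for I and A :: "nat \<Rightarrow> real^3^3"
    by (simp add: curl_mat_def vec_eq_iff forall_3 sum_component sum_subtractf)
  have c: "curl_mat (potJ e i y) = background e i y - background e i (x i)"
    unfolding potJ_def cs background_def sum_subtractf[symmetric] using nz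
    by (intro sum.cong) (simp_all add: curl_mat_diff curl_sphere_potential)
  show ?thesis
    unfolding corrJ_def
    by (simp add: trace_add trace_scaleR trace_outer trace_cross_jac t0 c curl_bumpg_jac inner_commute)
qed

lemma corr_on_own_sphere:
  assumes "y \<in> sphere (x i) R"
  shows "corr e i y = background e i y - background e i (x i)"
proof -
  have "(norm (y - x i))\<^sup>2 \<le> R\<^sup>2" using assms by (simp add: dist_norm norm_minus_commute)
  then show ?thesis using bump_eq_1[OF scales] bumpg_eq_0[OF scales] by (simp add: corr_def)
qed

end

text \<open>Each derivative of the cutoff costs a factor \<open>1 / R\<close>, and each order of
  Taylor expansion of the background fields gains a factor \<open>R\<close>, so all terms are of the
  size of \<open>near_sum\<close>. The quantifiers make \<open>K\<close> one constant for all
  suspensions.\<close>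

lemma corrJ_bound_exists:
  "\<exists>K\<ge>0. \<forall>N R x e i y. suspension N R x \<longrightarrow> i \<in> {1..N} \<longrightarrow>
     norm (suspension.corrJ N R x e i y) \<le> K * suspension.near_sum N R x e i"
proof -
  obtain b0 where b0: "\<And>t. \<bar>step'' t\<bar> \<le> b0" using step''_bound by blast
  define b where "b = max b0 0"
  have b: "\<bar>step'' t\<bar> \<le> b" "b \<ge> 0" for t using b0[of t] by (auto simp: b_def)
  \<comment> \<open>The three groups come from the truncated gradient, from the gradient of the
    cutoff against the increment of the velocity, and from the cross product; 40 bounds
    \<open>R\<close> times the gradient of the cutoff, and \<open>40 + 2 * b\<close> bounds
    \<open>R^2\<close> times its Hessian.\<close>
  define K where "K = 48 + 96 * 40 + (9 * 40 * 800 + 9 * 1600 * (40 + 2 * b))"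
  show ?thesis
  proof (intro exI conjI allI impI)
    show "K \<ge> 0" using b by (simp add: K_def)
    fix N R x e i y assume "suspension N R x" and i: "i \<in> {1..N}"
    then interpret suspension N R x by simp
    let ?B = "near_sum e i"
    have B0: "?B \<ge> 0" by (rule near_sum_nonneg)
    show "norm (corrJ e i y) \<le> K * ?B"
    proof (cases "2 * R \<le> dist (x i) y")
      case True
      then show ?thesis using B0 \<open>K \<ge> 0\<close> by (simp add: outside_support)
    next
      case False
      then have y: "y \<in> cball (x i) (2 * R)" by simp
      have ny: "norm (y - x i) \<le> 2 * R" using y by (simp add: dist_norm norm_minus_commute)
      note F = sphere_fields_on_ball[OF R others_sep[OF i] y]
      have vJ: "norm (background_jac e i y) \<le> 48 * ?B"
        unfolding background_jac_def near_sum_def sum_distrib_left by (intro sum_norm_le F)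
      have v: "norm (background e i y - background e i (x i)) \<le> 96 * R * ?B"
        unfolding background_def near_sum_def sum_distrib_left sum_subtractf[symmetric] by (intro sum_norm_le F)
      have pJ: "norm (potJ e i y) \<le> 800 * R * ?B"
        unfolding potJ_def near_sum_def sum_distrib_left by (intro sum_norm_le F)
      have p: "norm (pot e i y) \<le> 1600 * R\<^sup>2 * ?B"
        unfolding pot_def near_sum_def sum_distrib_left by (intro sum_norm_le F)
      have g: "norm (bumpg (x i) (R\<^sup>2) (4 * R\<^sup>2) y) \<le> 40 / R"
      proof -
        have "norm (bumpg (x i) (R\<^sup>2) (4 * R\<^sup>2) y) \<le> 60 * norm (y - x i) / (4 * R\<^sup>2 - R\<^sup>2)"
          by (rule norm_bumpg_le[OF scales])
        also have "\<dots> \<le> 60 * (2 * R) / (4 * R\<^sup>2 - R\<^sup>2)" using ny R by (intro divide_right_mono) auto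
        also have "\<dots> = 40 / R" using R by (simp add: power2_eq_square)
        finally show ?thesis .
      qed
      have gJ: "norm (bumpg_jac (x i) (R\<^sup>2) (4 * R\<^sup>2) y) \<le> (40 + 2 * b) / R\<^sup>2"
      proof -
        define w where "w = ((norm (y - x i))\<^sup>2 - R\<^sup>2) / (4 * R\<^sup>2 - R\<^sup>2)"
        have "norm (bumpg_jac (x i) (R\<^sup>2) (4 * R\<^sup>2) y) \<le> 2 * 30 / (4 * R\<^sup>2 - R\<^sup>2) * 2 + 4 * b / (4 * R\<^sup>2 - R\<^sup>2)\<^sup>2 * ((2 * R) * (2 * R))"
          unfolding bumpg_jac_def Let_def w_def[symmetric]
        proof (intro norm_triangle_mono norm_scaleR_le norm_mat_1_le)
          show "\<bar>- (2 * step' w / (4 * R\<^sup>2 - R\<^sup>2))\<bar> \<le> 2 * 30 / (4 * R\<^sup>2 - R\<^sup>2)"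
            using divide_right_mono[of "\<bar>2 * step' w\<bar>" 60 "4 * R\<^sup>2 - R\<^sup>2"] step'_le[of w] R
            by (simp add: abs_mult abs_divide)
          show "\<bar>- (4 * step'' w / (4 * R\<^sup>2 - R\<^sup>2)\<^sup>2)\<bar> \<le> 4 * b / (4 * R\<^sup>2 - R\<^sup>2)\<^sup>2"
            using b(1)[of w] R by (simp add: abs_mult divide_right_mono)
          show "norm (outer (y - x i) (y - x i)) \<le> 2 * R * (2 * R)"
            unfolding norm_outer using ny R by (intro mult_mono) auto
        qed
        also have "\<dots> = (40 + 16 / 9 * b) / R\<^sup>2" using R by (simp add: field_simps power2_eq_square)
        also have "\<dots> \<le> (40 + 2 * b) / R\<^sup>2" using b R by (intro divide_right_mono) auto
        finally show ?thesis .
      qed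
      have "norm (corrJ e i y) \<le> 1 * (48 * ?B) + (96 * R * ?B) * (40 / R)
          + (9 * (40 / R) * (800 * R * ?B) + 9 * (1600 * R\<^sup>2 * ?B) * ((40 + 2 * b) / R\<^sup>2))"
        unfolding corrJ_def
      proof (intro norm_triangle_mono norm_scaleR_le vJ)
        show "\<bar>bump (x i) (R\<^sup>2) (4 * R\<^sup>2) y\<bar> \<le> 1" by (simp add: bump_nonneg bump_le_1)
        show "norm (outer (background e i y - background e i (x i)) (bumpg (x i) (R\<^sup>2) (4 * R\<^sup>2) y)) \<le> (96 * R * ?B) * (40 / R)"
          unfolding norm_outer using v g R B0 by (intro mult_mono) auto
        have "norm (cross_jac (bumpg (x i) (R\<^sup>2) (4 * R\<^sup>2) y) (bumpg_jac (x i) (R\<^sup>2) (4 * R\<^sup>2) y) (pot e i y) (potJ e i y))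
          \<le> 9 * norm (bumpg (x i) (R\<^sup>2) (4 * R\<^sup>2) y) * norm (potJ e i y) + 9 * norm (pot e i y) * norm (bumpg_jac (x i) (R\<^sup>2) (4 * R\<^sup>2) y)"
          by (rule norm_cross_jac_le)
        also have "\<dots> \<le> 9 * (40 / R) * (800 * R * ?B) + 9 * (1600 * R\<^sup>2 * ?B) * ((40 + 2 * b) / R\<^sup>2)"
          using g gJ p pJ R B0 b by (intro add_mono mult_mono mult_left_mono) auto
        finally show "norm (cross_jac (bumpg (x i) (R\<^sup>2) (4 * R\<^sup>2) y) (bumpg_jac (x i) (R\<^sup>2) (4 * R\<^sup>2) y) (pot e i y) (potJ e i y))
          \<le> 9 * (40 / R) * (800 * R * ?B) + 9 * (1600 * R\<^sup>2 * ?B) * ((40 + 2 * b) / R\<^sup>2)" .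
      qed
      also have "\<dots> = K * ?B" using R by (simp add: K_def field_simps)
      finally show ?thesis .
    qed
  qed
qed

section \<open>Work of the particle stresses\<close>

text \<open>The gradient of a rotation is antisymmetric, so a symmetric stress does no work on it in
  the bulk.\<close>

lemma symmetric_inner_cross_mat:
  assumes "transpose A = A"
  shows "A \<bullet> cross_mat b = 0"
proof -
  have "A $ j $ i = A $ i $ j" for i j
    using arg_cong[OF assms, of "\<lambda>B. B $ i $ j"] by (simp add: transpose_def)
  from this[of 2 1] this[of 3 1] this[of 3 2] show ?thesis
    by (simp add: inner_vec_def sum_3 cross_mat_def cross3_def axis_def algebra_simps)
qed

lemma jacobian_on_rigid: "jacobian_on S (\<lambda>y. c + cross3 b (y - a)) (\<lambda>y. cross_mat b)"
proof -
  have "jacobian_on S (\<lambda>y. (c - cross3 b a) + cross3 b y) (\<lambda>y. 0 + cross_mat b)"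
    by (intro jacobian_on_add jacobian_on_const jacobian_on_cross)
  moreover have "(\<lambda>y. (c - cross3 b a) + cross3 b y) = (\<lambda>y. c + cross3 b (y - a))"
    by (simp add: fun_eq_iff cross3_simps)
  ultimately show ?thesis by simp
qed

text \<open>A stress that is regular inside the ball exerts neither net force nor net torque on its
  boundary. The same cutoff is integrated twice, over the shell, where the sphere appears, and over
  the full ball, where nothing does.\<close>

lemma sphint_regular_stress_rigid:
  assumes R: "0 < R" and \<tau>: "stress_on (ball a (2 * R)) \<tau>"
  shows "sphint a R (\<lambda>y. (\<tau> y *v (c + cross3 b (y - a))) \<bullet> ((1 / R) *\<^sub>R (y - a))) = 0"
proof -
  let ?S = "ball a (2 * R)" and ?A = "{y. R < dist a y \<and> dist a y < 2 * R}"
  define h where "h = (\<lambda>y. \<tau> y *v (c + cross3 b (y - a)))"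
  obtain H where H: "jacobian_on ?S h H" "\<And>y. y \<in> ?S \<Longrightarrow> trace (H y) = \<tau> y \<bullet> cross_mat b"
  proof (rule stress_on_mult[OF \<tau> jacobian_on_rigid[of ?S c b a] open_ball])
    fix H assume "jacobian_on ?S (\<lambda>y. \<tau> y *v (c + cross3 b (y - a))) H" "\<And>y. y \<in> ?S \<Longrightarrow> trace (H y) = \<tau> y \<bullet> cross_mat b"
    then show thesis by (rule that[unfolded h_def])
  qed
  have t0: "trace (H y) = 0" if "y \<in> ?S" for y
    using H(2)[OF that] symmetric_inner_cross_mat[of "\<tau> y"] \<tau> that by (auto simp: stress_on_def)
  define s t where "s = 2 * R\<^sup>2" and "t = 3 * R\<^sup>2"
  have st: "R\<^sup>2 < s" "s < t" "t < (2 * R)\<^sup>2" using R by (auto simp: s_def t_def power_mult_distrib)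
  have AS: "?A \<subseteq> ?S" by auto
  have bA: "?A \<in> sets borel"
  proof -
    have "?A = ball a (2 * R) - cball a R" by auto
    then show ?thesis by simp
  qed
  have z: "set_integrable lborel ?A (\<lambda>y. bump a s t y * trace (H y))"
  proof -
    have "(\<lambda>y. indicat_real ?A y *\<^sub>R (bump a s t y * trace (H y))) = (\<lambda>y. 0)"
      using t0 AS by (auto simp: fun_eq_iff indicator_def)
    then show ?thesis by (simp add: set_integrable_def)
  qed
  have sub: "{y. R \<le> dist a y \<and> dist a y < 2 * R} \<subseteq> ?S" by auto
  have ch: "continuous_on {y. R \<le> dist a y \<and> dist a y < 2 * R} h"
    using jacobian_on_continuous[OF H(1)] sub by (rule continuous_on_subset)
  have 1: "(LINT y:?A|lborel. bump a s t y * trace (H y) + bumpg a s t y \<bullet> h y)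
      = - sphint a R (\<lambda>y. h y \<bullet> ((1 / R) *\<^sub>R (y - a)))"
    by (rule local_green(2)[OF R st _ jacobian_on_subset[OF H(1) AS] ch z]) (use R in simp)
  define K where "K = cball a (sqrt 3 * R)"
  have "sqrt 3 < 2" by (rule real_less_lsqrt) auto
  then have "sqrt 3 * R < 2 * R" using R by (rule mult_strict_right_mono)
  then have KS: "K \<subseteq> ?S" by (auto simp: K_def)
  have far: "t \<le> (norm (y - a))\<^sup>2" if "y \<notin> K" for y
  proof -
    have "(sqrt 3 * R)\<^sup>2 \<le> (norm (y - a))\<^sup>2"
      using that R by (intro power_mono) (auto simp: K_def dist_norm norm_minus_commute)
    then show ?thesis by (simp add: t_def power_mult_distrib)
  qed
  have cK: "compact K" by (simp add: K_def)
  have supp: "bump a s t y = 0" if "y \<notin> K" for y by (rule bump_eq_0[OF st(2) far[OF that]])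
  have 2: "(LINT y:?S|lborel. bump a s t y * trace (H y) + bumpg a s t y \<bullet> h y) = 0"
    by (rule integral_divergence_cutoff(2)[OF open_ball H(1) bump_gradient cK KS supp])
  \<comment> \<open>Inside the particle the cutoff is constant and the flux divergence free, so the
    inner ball contributes zero.\<close>
  have "(LINT y:?A|lborel. bump a s t y * trace (H y) + bumpg a s t y \<bullet> h y)
      = (LINT y:?S|lborel. bump a s t y * trace (H y) + bumpg a s t y \<bullet> h y)"
  proof (rule set_integral_cong_support(2))
    fix y assume y: "y \<in> ?S" "y \<notin> ?A"
    then have "dist a y \<le> R" by auto
    then have "(norm (y - a))\<^sup>2 \<le> R\<^sup>2" by (intro power_mono) (auto simp: dist_norm norm_minus_commute)
    then have "(norm (y - a))\<^sup>2 \<le> s" using st by linarith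
    then show "bump a s t y * trace (H y) + bumpg a s t y \<bullet> h y = 0"
      using bumpg_eq_0[OF st(2)] t0[OF y(1)] by simp
  next
    fix y assume "y \<in> ?A" "y \<notin> ?S"
    then show "bump a s t y * trace (H y) + bumpg a s t y \<bullet> h y = 0" using AS by blast
  qed
  then show ?thesis using 1 2 by (simp add: h_def)
qed

context suspension
begin

lemma closure_domain: "y \<in> closure D \<Longrightarrow> i \<in> {1..N} \<Longrightarrow> R \<le> dist (x i) y"
proof -
  assume y: "y \<in> closure D" and i: "i \<in> {1..N}"
  have "closed {y. R \<le> dist (x i) y}" by (intro closed_Collect_le continuous_intros)
  moreover have "D \<subseteq> {y. R \<le> dist (x i) y}" using i by (force simp: fluid_domain_eq)
  ultimately have "closure D \<subseteq> {y. R \<le> dist (x i) y}" by (simp add: closure_minimal)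
  then show ?thesis using y by blast
qed

lemma domain_dist: "y \<in> D \<Longrightarrow> i \<in> {1..N} \<Longrightarrow> R < dist (x i) y"
  by (simp add: fluid_domain_eq)

lemma closure_domain_shift: "y \<in> closure D \<Longrightarrow> i \<in> {1..N} \<Longrightarrow> R \<le> norm (y - x i)"
  using closure_domain[of y i] by (simp add: dist_norm norm_minus_commute)

lemma closure_domain_nonzero: "y \<in> closure D \<Longrightarrow> i \<in> {1..N} \<Longrightarrow> y - x i \<in> - {0}"
  using closure_domain_shift[of y i] R by auto

lemma borel_domain: "D \<in> sets borel"
  using open_fluid_domain by simp

text \<open>The domain lies outside the ball of particle \<open>i\<close>, where the square of the
  field is at most \<open>c^2 * |y - x i|^-4\<close>. With \<open>c\<close> of order
  \<open>R * |e|\<close>, the squared norm is of order \<open>R * |e|^2\<close>, the scale of the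
  energy of one particle.\<close>

lemma square_integrable_decay:
  fixes \<sigma> :: "real^3 \<Rightarrow> real^3^3"
  assumes c\<sigma>: "continuous_on (- {0}) \<sigma>" and b: "\<And>y. R \<le> norm y \<Longrightarrow> norm (\<sigma> y) \<le> c * inverse (norm y) ^ 2"
    and i: "i \<in> {1..N}"
  shows "continuous_on (closure D) (\<lambda>y. \<sigma> (y - x i))"
    "set_integrable lborel D (\<lambda>y. (norm (\<sigma> (y - x i)))\<^sup>2)"
    "(LINT y:D|lborel. (norm (\<sigma> (y - x i)))\<^sup>2) \<le> c\<^sup>2 * (4 * pi / R)"
proof -
  let ?S = "{y. R < dist (x i) y}"
  show cc: "continuous_on (closure D) (\<lambda>y. \<sigma> (y - x i))"
    by (rule continuous_on_compose2[OF c\<sigma>])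
      (use closure_domain_nonzero[OF _ i] in \<open>auto intro!: continuous_intros\<close>)
  have DS: "D \<subseteq> ?S" using domain_dist[OF _ i] by blast
  have p: "(norm (\<sigma> (y - x i)))\<^sup>2 \<le> c\<^sup>2 * inverse (norm (y - x i)) ^ 4" if "y \<in> D" for y
  proof -
    have "R \<le> norm (y - x i)" using domain_dist[OF that i] by (simp add: dist_norm norm_minus_commute)
    from power_mono[OF b[OF this], of 2] show ?thesis
      by (simp add: power_mult_distrib flip: power_mult)
  qed
  have I: "set_integrable lborel ?S (\<lambda>y. c\<^sup>2 * inverse (norm (y - x i)) ^ 4)"
    by (intro set_integrable_mult_right inverse_norm_power4_integral R)
  have ID: "set_integrable lborel D (\<lambda>y. c\<^sup>2 * inverse (norm (y - x i)) ^ 4)"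
    by (rule set_integrable_subset[OF I _ DS]) (use borel_domain in simp)
  have cD: "continuous_on D (\<lambda>y. (norm (\<sigma> (y - x i)))\<^sup>2)"
    by (intro continuous_on_power continuous_on_norm continuous_on_subset[OF cc] closure_subset)
  show sq: "set_integrable lborel D (\<lambda>y. (norm (\<sigma> (y - x i)))\<^sup>2)"
    by (rule set_integrable_bound_continuous[OF ID borel_domain cD]) (use p in simp)
  have "(LINT y:D|lborel. (norm (\<sigma> (y - x i)))\<^sup>2) \<le> (LINT y:?S|lborel. c\<^sup>2 * inverse (norm (y - x i)) ^ 4)"
    unfolding set_lebesgue_integral_def
    by (rule integral_mono[OF sq[unfolded set_integrable_def] I[unfolded set_integrable_def]])
      (use p DS in \<open>auto simp: indicator_def\<close>)
  also have "\<dots> = c\<^sup>2 * (LINT y:?S|lborel. inverse (norm (y - x i)) ^ 4)"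
    by (rule set_integral_mult_right)
  also have "\<dots> \<le> c\<^sup>2 * (4 * pi / R)"
    by (intro mult_left_mono inverse_norm_power4_integral R) simp
  finally show "(LINT y:D|lborel. (norm (\<sigma> (y - x i)))\<^sup>2) \<le> c\<^sup>2 * (4 * pi / R)" .
qed

text \<open>The stress generated by particle \<open>i\<close> is regular in the balls around all
  others, where it does no work on rigid motions by \<open>sphint_regular_stress_rigid\<close>; only
  the sphere of particle \<open>i\<close> remains in Green's formula.\<close>

lemma green_particle_stress:
  assumes \<sigma>: "stress_on (- {0}) \<sigma>" and b: "\<And>y. R \<le> norm y \<Longrightarrow> norm (\<sigma> y) \<le> c * inverse (norm y) ^ 2"
    and i: "i \<in> {1..N}"
    and \<phi>: "jacobian_on D \<phi> J" "continuous_on (closure D) \<phi>" "growth_on D \<phi>"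
    and J: "set_integrable lborel D (\<lambda>y. (norm (J y))\<^sup>2)"
    and rigid: "\<And>i y. i \<in> {1..N} \<Longrightarrow> y \<in> sphere (x i) R \<Longrightarrow> \<phi> y = s i + cross3 (w i) (y - x i)"
  shows "set_integrable lborel D (\<lambda>y. \<sigma> (y - x i) \<bullet> J y)"
    and "(LINT y:D|lborel. \<sigma> (y - x i) \<bullet> J y)
      = - sphint (x i) R (\<lambda>y. (\<sigma> (y - x i) *v (s i + cross3 (w i) (y - x i))) \<bullet> ((1 / R) *\<^sub>R (y - x i)))"
proof -
  let ?\<sigma> = "\<lambda>y. \<sigma> (y - x i)"
  note sq = square_integrable_decay[OF stress_on_continuous[OF \<sigma>] b i]
  have shift: "stress_on {y. y - x i \<in> - {0}} ?\<sigma>"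
    unfolding stress_on_def
  proof (intro conjI ballI allI)
    show "transpose (?\<sigma> y) = ?\<sigma> y" if "y \<in> {y. y - x i \<in> - {0}}" for y
      using \<sigma> that by (auto simp: stress_on_def)
    fix k
    obtain T where T: "jacobian_on (- {0}) (\<lambda>x. \<sigma> x $ k) T" "\<forall>x\<in>- {0}. trace (T x) = 0"
      using \<sigma> unfolding stress_on_def by blast
    show "\<exists>T. jacobian_on {y. y - x i \<in> - {0}} (\<lambda>y. ?\<sigma> y $ k) T \<and> (\<forall>y\<in>{y. y - x i \<in> - {0}}. trace (T y) = 0)"
      using jacobian_on_shift[OF T(1), of "x i"] T(2) by (intro exI[of _ "\<lambda>y. T (y - x i)"]) auto
  qed
  have "D \<subseteq> {y. y - x i \<in> - {0}}" using closure_domain_nonzero[OF _ i] closure_subset by blast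
  then have sD: "stress_on D ?\<sigma>" by (rule stress_on_subset[OF shift])
  obtain \<rho>0 C where g: "\<And>\<rho>. \<rho> \<ge> \<rho>0 \<Longrightarrow>
      (LINT y:{y \<in> D. \<rho>\<^sup>2 \<le> (norm y)\<^sup>2 \<and> (norm y)\<^sup>2 \<le> 2 * \<rho>\<^sup>2}|lborel. (norm (\<phi> y))\<^sup>2) \<le> C * \<rho>\<^sup>2"
    using \<phi>(3) unfolding growth_on_def by blast
  note G = green[OF sD sq(1,2) \<phi>(1,2) J g]
  show "set_integrable lborel D (\<lambda>y. ?\<sigma> y \<bullet> J y)" by (rule G(1))
  define I where "I = (\<lambda>k. sphint (x k) R (\<lambda>y. (?\<sigma> y *v (s k + cross3 (w k) (y - x k))) \<bullet> ((1 / R) *\<^sub>R (y - x k))))"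
  have z: "I k = 0" if k: "k \<in> {1..N} - {i}" for k
    unfolding I_def
  proof (rule sphint_regular_stress_rigid[OF R stress_on_subset[OF shift]])
    have d: "4 * R \<le> dist (x k) (x i)" using sep[of k i] k i by simp
    show "ball (x k) (2 * R) \<subseteq> {y. y - x i \<in> - {0}}"
    proof
      fix y assume "y \<in> ball (x k) (2 * R)"
      then have "dist (x k) y < 2 * R" by simp
      then have "y \<noteq> x i" using d R by auto
      then show "y \<in> {y. y - x i \<in> - {0}}" by simp
    qed
  qed
  have "(LINT y:D|lborel. ?\<sigma> y \<bullet> J y)
      = - (\<Sum>k\<in>{1..N}. sphint (x k) R (\<lambda>y. (?\<sigma> y *v \<phi> y) \<bullet> ((1 / R) *\<^sub>R (y - x k))))"
    by (rule G(2))
  also have "\<dots> = - (\<Sum>k\<in>{1..N}. I k)"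
  proof (intro arg_cong[where f=uminus] sum.cong refl)
    fix k assume k: "k \<in> {1..N}"
    show "sphint (x k) R (\<lambda>y. (?\<sigma> y *v \<phi> y) \<bullet> ((1 / R) *\<^sub>R (y - x k))) = I k"
      unfolding I_def by (rule sphint_cong) (use R rigid[OF k] in simp_all)
  qed
  also have "(\<Sum>k\<in>{1..N}. I k) = I i" using z i by (simp add: sum.remove[of _ i])
  finally show "(LINT y:D|lborel. ?\<sigma> y \<bullet> J y)
      = - sphint (x i) R (\<lambda>y. (?\<sigma> y *v (s i + cross3 (w i) (y - x i))) \<bullet> ((1 / R) *\<^sub>R (y - x i)))"
    by (simp add: I_def)
qed

end

text \<open>The traction is constant on the sphere, so the rotational part of the rigid velocity
  contributes a linear function of \<open>y - a\<close>, which integrates to zero.\<close>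

lemma sphint_sphere_stress:
  assumes R: "0 < R"
  shows "sphint a R (\<lambda>y. (sphere_stress R e (y - a) *v (s + cross3 w (y - a))) \<bullet> ((1 / R) *\<^sub>R (y - a)))
    = - (6 * pi * R) * (e \<bullet> s)"
proof -
  have c: "continuous_on (sphere a R) (\<lambda>y. f \<bullet> (y - a))" for f by (intro continuous_intros)
  have "sphint a R (\<lambda>y. (sphere_stress R e (y - a) *v (s + cross3 w (y - a))) \<bullet> ((1 / R) *\<^sub>R (y - a)))
    = sphint a R (\<lambda>y. - (3 / (2 * R)) * (e \<bullet> s) + (- (3 / (2 * R)) *\<^sub>R cross3 e w) \<bullet> (y - a))"
  proof (rule sphint_cong)
    fix y assume y: "y \<in> sphere a R"
    then have n: "norm (y - a) = R" by (simp add: dist_norm norm_minus_commute)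
    then have "y - a \<in> - {0}" using R by auto
    then have "transpose (sphere_stress R e (y - a)) = sphere_stress R e (y - a)"
      using sphere_stress_on[of R e] unfolding stress_on_def by blast
    then have "(sphere_stress R e (y - a) *v (s + cross3 w (y - a))) \<bullet> ((1 / R) *\<^sub>R (y - a))
      = (s + cross3 w (y - a)) \<bullet> (- (3 / (2 * R)) *\<^sub>R e)"
      by (simp only: matrix_inner_transpose sphere_boundary_values(2)[OF R n])
    also have "\<dots> = - (3 / (2 * R)) * (e \<bullet> s) + (- (3 / (2 * R)) *\<^sub>R cross3 e w) \<bullet> (y - a)"
      using cross_triple[of e w "y - a"] by (simp add: inner_add_left inner_commute algebra_simps)
    finally show "(sphere_stress R e (y - a) *v (s + cross3 w (y - a))) \<bullet> ((1 / R) *\<^sub>R (y - a))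
      = - (3 / (2 * R)) * (e \<bullet> s) + (- (3 / (2 * R)) *\<^sub>R cross3 e w) \<bullet> (y - a)" .
  qed (use R in simp)
  also have "\<dots> = 4 * pi * R\<^sup>2 * (- (3 / (2 * R)) * (e \<bullet> s)) + 0"
    by (subst sphint_add) (use R c in \<open>simp_all only: sphint_const sphint_linear continuous_on_const less_imp_le\<close>)
  also have "\<dots> = - (6 * pi * R) * (e \<bullet> s)" using R by (simp add: power2_eq_square)
  finally show ?thesis .
qed

text \<open>The traction is proportional to the rotation itself, so its work contains
  \<open>|w|^2 * R^2 - (w \<bullet> (y - a))^2\<close>. The mean of the second term is a third of
  the first, and the translational part integrates to zero.\<close>

lemma sphint_rotlet_stress:
  assumes R: "0 < R"
  shows "sphint a R (\<lambda>y. (rotlet_stress R w (y - a) *v (s + cross3 w (y - a))) \<bullet> ((1 / R) *\<^sub>R (y - a)))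
    = - (8 * pi * R ^ 3) * (norm w)\<^sup>2"
proof -
  have "sphint a R (\<lambda>y. (rotlet_stress R w (y - a) *v (s + cross3 w (y - a))) \<bullet> ((1 / R) *\<^sub>R (y - a)))
    = sphint a R (\<lambda>y. ((- (3 / R) *\<^sub>R cross3 s w) \<bullet> (y - a) + - (3 / R) * ((norm w)\<^sup>2 * R\<^sup>2)) + (3 / R) * (w \<bullet> (y - a))\<^sup>2)"
  proof (rule sphint_cong)
    fix y assume y: "y \<in> sphere a R"
    then have n: "norm (y - a) = R" by (simp add: dist_norm norm_minus_commute)
    then have "y - a \<in> - {0}" using R by auto
    then have "transpose (rotlet_stress R w (y - a)) = rotlet_stress R w (y - a)"
      using rotlet_stress_on[of R w] unfolding stress_on_def by blast
    then have "(rotlet_stress R w (y - a) *v (s + cross3 w (y - a))) \<bullet> ((1 / R) *\<^sub>R (y - a))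
      = (s + cross3 w (y - a)) \<bullet> (- (3 / R) *\<^sub>R cross3 w (y - a))"
      by (simp only: matrix_inner_transpose sphere_boundary_values(3)[OF R n])
    also have "\<dots> = - (3 / R) * (cross3 s w \<bullet> (y - a) + cross3 w (y - a) \<bullet> cross3 w (y - a))"
      using cross_triple[of s w "y - a"] by (simp add: inner_add_left inner_commute algebra_simps)
    also have "cross3 w (y - a) \<bullet> cross3 w (y - a) = (norm w)\<^sup>2 * R\<^sup>2 - (w \<bullet> (y - a))\<^sup>2"
      using n norm_cross_dot[of w "y - a"]
      unfolding power2_norm_eq_inner[symmetric] n by (simp add: power_mult_distrib)
    finally show "(rotlet_stress R w (y - a) *v (s + cross3 w (y - a))) \<bullet> ((1 / R) *\<^sub>R (y - a))
      = ((- (3 / R) *\<^sub>R cross3 s w) \<bullet> (y - a) + - (3 / R) * ((norm w)\<^sup>2 * R\<^sup>2)) + (3 / R) * (w \<bullet> (y - a))\<^sup>2"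
      by (simp add: algebra_simps)
  qed (use R in simp)
  also have "\<dots> = sphint a R (\<lambda>y. (- (3 / R) *\<^sub>R cross3 s w) \<bullet> (y - a)) + sphint a R (\<lambda>y. - (3 / R) * ((norm w)\<^sup>2 * R\<^sup>2))
      + sphint a R (\<lambda>y. (3 / R) * (w \<bullet> (y - a))\<^sup>2)"
  proof -
    have c: "continuous_on (sphere a R) (\<lambda>y. f \<bullet> (y - a))" for f by (intro continuous_intros)
    have c2: "continuous_on (sphere a R) (\<lambda>y. (3 / R) * (w \<bullet> (y - a))\<^sup>2)" by (intro continuous_intros)
    have c3: "continuous_on (sphere a R) (\<lambda>y. (- (3 / R) *\<^sub>R cross3 s w) \<bullet> (y - a) + - (3 / R) * ((norm w)\<^sup>2 * R\<^sup>2))"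
      by (intro continuous_on_add c continuous_on_const)
    show ?thesis
      unfolding sphint_add[OF less_imp_le[OF R] c3 c2] sphint_add[OF less_imp_le[OF R] c continuous_on_const] ..
  qed
  also have "\<dots> = - (8 * pi * R ^ 3) * (norm w)\<^sup>2"
    unfolding sphint_linear sphint_const sphint_cmult sphint_quadratic
    using R by (simp add: field_simps eval_nat_numeral)
  finally show ?thesis .
qed

section \<open>The energy estimate\<close>

lemma symm_inner_self: "symm A \<bullet> A = (norm (symm A))\<^sup>2 / 2"
proof -
  have "transpose A \<bullet> transpose A = A \<bullet> A"
    unfolding power2_norm_eq_inner[symmetric] norm_transpose ..
  then show ?thesis
    unfolding symm_def power2_norm_eq_inner by (simp add: inner_add_left inner_add_right inner_commute)
qed

lemma inner_transpose: "transpose A \<bullet> B = A \<bullet> transpose B" for A B :: "real^3^3"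
  unfolding inner_vec_def transpose_def by (simp, rule sum.swap)

lemma symm_inner: "symm A \<bullet> B = A \<bullet> symm B"
  by (simp add: symm_def inner_add_left inner_add_right inner_transpose)

lemma symmetric_inner: "transpose A = A \<Longrightarrow> A \<bullet> B = (A \<bullet> symm B) / 2"
  using inner_transpose[of A B] by (simp add: symm_def inner_add_right)

lemma symm_diff: "symm (A - B) = symm A - symm B"
  by (simp_all add: symm_def transpose_def vec_eq_iff)

lemma symm_sum: "symm (\<Sum>i\<in>I. A i) = (\<Sum>i\<in>I. symm (A i))"
  by (simp add: symm_def transpose_def vec_eq_iff sum_component sum.distrib)

lemma continuous_on_symm:
  fixes A :: "'a::topological_space \<Rightarrow> real^3^3"
  shows "continuous_on S A \<Longrightarrow> continuous_on S (\<lambda>y. symm (A y))"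
  unfolding symm_def transpose_def by (intro continuous_intros)

lemma norm_add_square_le: "(norm (a + b))\<^sup>2 \<le> 2 * (norm a)\<^sup>2 + 2 * (norm b)\<^sup>2" for a b :: "'a::real_normed_vector"
proof -
  have "(norm (a + b))\<^sup>2 \<le> (norm a + norm b)\<^sup>2" by (intro power_mono norm_triangle_ineq) simp
  also have "\<dots> \<le> 2 * (norm a)\<^sup>2 + 2 * (norm b)\<^sup>2"
    using sum_squares_bound[of "norm a" "norm b"] by (simp add: power2_sum)
  finally show ?thesis .
qed

lemma square_integrable_add:
  fixes A B :: "real^3 \<Rightarrow> 'a::real_normed_vector"
  assumes "set_integrable lborel S (\<lambda>y. (norm (A y))\<^sup>2)" "set_integrable lborel S (\<lambda>y. (norm (B y))\<^sup>2)"
    "S \<in> sets borel" "continuous_on S A" "continuous_on S B"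
  shows "set_integrable lborel S (\<lambda>y. (norm (A y + B y))\<^sup>2)"
proof (rule set_integrable_bound_continuous[OF _ assms(3)])
  show "set_integrable lborel S (\<lambda>y. 2 * (norm (A y))\<^sup>2 + 2 * (norm (B y))\<^sup>2)"
    by (intro set_integral_add set_integrable_mult_right assms)
  show "continuous_on S (\<lambda>y. (norm (A y + B y))\<^sup>2)" by (intro continuous_intros assms)
  show "\<bar>(norm (A y + B y))\<^sup>2\<bar> \<le> 2 * (norm (A y))\<^sup>2 + 2 * (norm (B y))\<^sup>2" for y
    using norm_add_square_le[of "A y" "B y"] by simp
qed

lemma square_integrable_sum:
  fixes A :: "'i \<Rightarrow> real^3 \<Rightarrow> 'a::real_normed_vector"
  assumes "finite I" "\<And>i. i \<in> I \<Longrightarrow> set_integrable lborel S (\<lambda>y. (norm (A i y))\<^sup>2)"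
    "S \<in> sets borel" "\<And>i. i \<in> I \<Longrightarrow> continuous_on S (A i)"
  shows "set_integrable lborel S (\<lambda>y. (norm (\<Sum>i\<in>I. A i y))\<^sup>2)"
  using assms(1,2,4)
proof (induction I rule: finite_induct)
  case empty
  then show ?case by (simp add: set_integrable_def)
next
  case (insert j I)
  have "set_integrable lborel S (\<lambda>y. (norm (A j y + (\<Sum>i\<in>I. A i y)))\<^sup>2)"
    by (intro square_integrable_add insert assms(3) continuous_on_sum) (use insert in auto)
  then show ?case using insert by simp
qed

lemma set_integral_mono_add:
  fixes f g h :: "real^3 \<Rightarrow> real"
  assumes "set_integrable lborel S f" "set_integrable lborel S g" "set_integrable lborel S h"
    "\<And>y. y \<in> S \<Longrightarrow> f y \<le> g y + h y"
  shows "(LINT y:S|lborel. f y) \<le> (LINT y:S|lborel. g y) + (LINT y:S|lborel. h y)"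
proof -
  have "(LINT y:S|lborel. f y) \<le> (LINT y:S|lborel. g y + h y)"
    by (rule set_integral_mono[OF assms(1) set_integral_add(1)[OF assms(2,3)] assms(4)])
  then show ?thesis using set_integral_add(2)[OF assms(2,3)] by simp
qed

text \<open>The force is parametrised by \<open>e\<close>, the velocity with which a single isolated
  sphere would settle under it; for the final statement \<open>e\<close> is \<kappa> times
  g.\<close>

locale stokes_suspension = suspension +
  fixes e :: "real^3" and u p V \<Omega>
  assumes solution: "stokes_solution N R x ((6 * pi * R) *\<^sub>R e) u p V \<Omega>"
begin

definition slip :: "nat \<Rightarrow> real^3" where
  "slip i = V i - (e + background e i (x i))"

definition flow :: "real^3 \<Rightarrow> real^3" where
  "flow y = (\<Sum>j\<in>{1..N}. sphere_velocity R e (y - x j))"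

definition flowJ :: "real^3 \<Rightarrow> real^3^3" where
  "flowJ y = (\<Sum>j\<in>{1..N}. sphere_velocity_jac R e (y - x j))"

definition corrs :: "real^3 \<Rightarrow> real^3" where "corrs y = (\<Sum>i\<in>{1..N}. corr e i y)"

definition corrsJ :: "real^3 \<Rightarrow> real^3^3" where "corrsJ y = (\<Sum>i\<in>{1..N}. corrJ e i y)"

text \<open>The correctors are subtracted from \<open>flow\<close>, so that on each sphere the
  comparison field becomes constant.\<close>

definition err :: "real^3 \<Rightarrow> real^3" where "err y = u y - (flow y - corrs y)"

definition errJ :: "real^3 \<Rightarrow> real^3^3" where "errJ y = jacobian u y - (flowJ y - corrsJ y)"

lemma flow_jacobian: "jacobian_on (closure D) flow flowJ"
proof -
  have "jacobian_on (closure D) (\<lambda>y. sphere_velocity R e (y - x j)) (\<lambda>y. sphere_velocity_jac R e (y - x j))" if "j \<in> {1..N}" for j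
    by (rule jacobian_on_subset[OF jacobian_on_shift[OF sphere_velocity_jacobian]])
      (use closure_domain_nonzero[OF _ that] in blast)
  then show ?thesis unfolding flow_def[abs_def] flowJ_def[abs_def] by (intro jacobian_on_sum)
qed

lemma corrs_jacobian: "jacobian_on UNIV corrs corrsJ"
  unfolding corrs_def[abs_def] corrsJ_def[abs_def] by (intro jacobian_on_sum corr_jacobian)

lemma velocity_facts:
  "jacobian_on D u (jacobian u)" "continuous_on (closure D) u" "growth_on D u"
  "set_integrable lborel D (\<lambda>y. (norm (jacobian u y))\<^sup>2)" "y \<in> D \<Longrightarrow> trace (jacobian u y) = 0"
  "i \<in> {1..N} \<Longrightarrow> y \<in> sphere (x i) R \<Longrightarrow> u y = V i + cross3 (\<Omega> i) (y - x i)"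
proof -
  note s = solution[unfolded stokes_solution_def Let_def]
  have "C1_on D u" using s by (simp add: C2_on_def)
  then show j: "jacobian_on D u (jacobian u)" by (rule C1_on_jacobian)
  show "continuous_on (closure D) u" using s by blast
  show i: "set_integrable lborel D (\<lambda>y. (norm (jacobian u y))\<^sup>2)" using s by blast
  show "growth_on D u" by (rule growth_on_stokes[OF j i]) (use s in blast)
  have "\<forall>y\<in>D. divergence u y = 0" using s by blast
  then show "y \<in> D \<Longrightarrow> trace (jacobian u y) = 0"
    by (simp add: trace_def jacobian_component divergence_def)
  show "i \<in> {1..N} \<Longrightarrow> y \<in> sphere (x i) R \<Longrightarrow> u y = V i + cross3 (\<Omega> i) (y - x i)" using s by blast
qed

lemma flow_growth: "growth_on D flow"
proof (rule growth_on_decay[OF borel_domain jacobian_on_continuous[OF flow_jacobian]])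
  define \<rho> where "\<rho> = 2 * (\<Sum>i\<in>{1..N}. norm (x i)) + 1"
  show "norm (flow y) \<le> (\<Sum>j\<in>{1..N}. 6 * R * norm e) / norm y" if y: "y \<in> D" "\<rho> \<le> norm y" for y
    unfolding flow_def sum_divide_distrib
  proof (rule sum_norm_le)
    fix j assume j: "j \<in> {1..N}"
    have "norm (x j) \<le> (\<Sum>i\<in>{1..N}. norm (x i))" using j by (intro member_le_sum) auto
    then have 1: "2 * norm (x j) \<le> norm y" and 2: "0 < norm y"
      using y(2) norm_ge_zero[of "x j"] unfolding \<rho>_def by linarith+
    have "norm y / 2 \<le> norm (y - x j)" using 1 norm_triangle_sub[of y "x j"] by linarith
    then have "inverse (norm (y - x j)) \<le> inverse (norm y / 2)" by (rule le_imp_inverse_le) (use 2 in simp)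
    then have "3 * R * norm e * inverse (norm (y - x j)) \<le> 3 * R * norm e * inverse (norm y / 2)"
      using R by (intro mult_left_mono) auto
    moreover have "R \<le> norm (y - x j)" using y(1) closure_subset j by (intro closure_domain_shift) auto
    ultimately have "norm (sphere_velocity R e (y - x j)) \<le> 3 * R * norm e * inverse (norm y / 2)"
      using norm_sphere_velocity_le[OF R, of "y - x j" e] by linarith
    then show "norm (sphere_velocity R e (y - x j)) \<le> 6 * R * norm e / norm y" by (simp add: field_simps)
  qed
qed

lemma corrs_far:
  assumes "(\<Sum>i\<in>{1..N}. norm (x i)) + 2 * R \<le> norm y"
  shows "corrs y = 0" "corrsJ y = 0"
proof -
  have "2 * R \<le> dist (x i) y" if "i \<in> {1..N}" for i
  proof -
    have "norm (x i) \<le> (\<Sum>i\<in>{1..N}. norm (x i))" using that by (intro member_le_sum) auto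
    then show ?thesis using assms norm_triangle_sub[of y "x i"] by (simp add: dist_norm norm_minus_commute)
  qed
  then show "corrs y = 0" "corrsJ y = 0" by (auto simp: corrs_def corrsJ_def outside_support)
qed

lemma corrs_growth: "growth_on D corrs"
proof (rule growth_on_decay[OF borel_domain])
  show "continuous_on (closure D) corrs"
    using jacobian_on_continuous[OF corrs_jacobian] by (rule continuous_on_subset) simp
  show "norm (corrs y) \<le> 0 / norm y" if "y \<in> D" "(\<Sum>i\<in>{1..N}. norm (x i)) + 2 * R \<le> norm y" for y
    using corrs_far(1)[OF that(2)] by simp
qed

lemma corrs_square_integrable: "set_integrable lborel D (\<lambda>y. (norm (corrsJ y))\<^sup>2)"
proof (rule set_integrable_compact_support[OF compact_cball _ borel_domain])
  let ?r = "(\<Sum>i\<in>{1..N}. norm (x i)) + 2 * R"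
  have "continuous_on UNIV corrsJ" using corrs_jacobian by (simp add: jacobian_on_def)
  then show "continuous_on (cball 0 ?r) (\<lambda>y. (norm (corrsJ y))\<^sup>2)"
    by (intro continuous_on_power continuous_on_norm) (rule continuous_on_subset[OF _ subset_UNIV])
  show "(norm (corrsJ y))\<^sup>2 = 0" if "y \<in> D - cball 0 ?r" for y
    using corrs_far(2)[of y] that by auto
qed

lemma flow_square_integrable: "set_integrable lborel D (\<lambda>y. (norm (flowJ y))\<^sup>2)"
  unfolding flowJ_def
proof (rule square_integrable_sum[OF _ _ borel_domain])
  fix j assume j: "j \<in> {1..N}"
  have "continuous_on (- {0}) (sphere_velocity_jac R e)"
    using sphere_velocity_jacobian by (simp add: jacobian_on_def)
  note q = square_integrable_decay[OF this norm_sphere_velocity_jac_le[OF R] j]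
  show "set_integrable lborel D (\<lambda>y. (norm (sphere_velocity_jac R e (y - x j)))\<^sup>2)" by (rule q(2))
  show "continuous_on D (\<lambda>y. sphere_velocity_jac R e (y - x j))"
    by (rule continuous_on_subset[OF q(1) closure_subset])
qed simp

lemma err_jacobian: "jacobian_on D err errJ"
  unfolding err_def[abs_def] errJ_def[abs_def]
  by (intro jacobian_on_diff velocity_facts jacobian_on_subset[OF flow_jacobian closure_subset]
      jacobian_on_subset[OF corrs_jacobian subset_UNIV])

lemma err_continuous: "continuous_on (closure D) err"
  unfolding err_def[abs_def]
  by (intro continuous_on_diff velocity_facts jacobian_on_continuous[OF flow_jacobian]
      continuous_on_subset[OF jacobian_on_continuous[OF corrs_jacobian] subset_UNIV])

lemma err_growth: "growth_on D err"
  unfolding err_def[abs_def]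
  by (intro growth_on_diff borel_domain velocity_facts flow_growth corrs_growth continuous_on_diff
      jacobian_on_continuous[OF flow_jacobian]
      continuous_on_subset[OF jacobian_on_continuous[OF corrs_jacobian] subset_UNIV])

lemma jac_continuous: "continuous_on D (jacobian u)" "continuous_on D flowJ" "continuous_on D corrsJ" "continuous_on D errJ"
  using velocity_facts(1) jacobian_on_subset[OF flow_jacobian closure_subset]
    jacobian_on_subset[OF corrs_jacobian subset_UNIV] err_jacobian by (auto simp: jacobian_on_def)

lemma err_square_integrable: "set_integrable lborel D (\<lambda>y. (norm (errJ y))\<^sup>2)"
proof -
  have m: "set_integrable lborel D (\<lambda>y. (norm (- flowJ y))\<^sup>2)" using flow_square_integrable by simp
  have "set_integrable lborel D (\<lambda>y. (norm (jacobian u y + (- flowJ y + corrsJ y)))\<^sup>2)"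
    by (intro square_integrable_add velocity_facts m corrs_square_integrable borel_domain
        continuous_intros jac_continuous)
  then show ?thesis by (simp add: errJ_def algebra_simps)
qed

lemma err_divergence_free:
  assumes y: "y \<in> D"
  shows "trace (errJ y) = 0"
proof -
  have "trace (sphere_velocity_jac R e (y - x j)) = 0" if "j \<in> {1..N}" for j
    using closure_domain_nonzero[of y j] y closure_subset that by (intro trace_sphere_velocity_jac) auto
  then have "trace (flowJ y) = 0" by (simp add: flowJ_def trace_sum)
  moreover have "trace (corrsJ y) = 0" by (simp add: corrsJ_def trace_sum corr_divergence_free)
  ultimately show ?thesis using velocity_facts(5)[OF y] by (simp add: errJ_def trace_sub)
qed

text \<open>On the sphere of particle \<open>i\<close> its own flow equals \<open>e\<close>, its own
  corrector freezes the background at the centre, and the correctors of the others vanish by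
  separation. The comparison field is thus a constant, and the whole rotation
  \<open>\<Omega> i\<close> stays in the error.\<close>

lemma err_on_sphere:
  assumes i: "i \<in> {1..N}" and y: "y \<in> sphere (x i) R"
  shows "err y = slip i + cross3 (\<Omega> i) (y - x i)"
proof -
  have n: "norm (y - x i) = R" using y by (simp add: dist_norm norm_minus_commute)
  have "flow y = sphere_velocity R e (y - x i) + background e i y"
    using i by (simp add: flow_def background_def others_def sum.remove[of _ i])
  then have 1: "flow y = e + background e i y" by (simp add: sphere_boundary_values[OF R n])
  have "corr e j y = 0" if "j \<in> {1..N} - {i}" for j
  proof (rule outside_support)
    have "4 * R \<le> dist (x j) (x i)" using sep[of j i] that i by simp
    also have "\<dots> \<le> dist (x j) y + dist y (x i)" by (rule dist_triangle)
    also have "dist y (x i) = R" using y by (simp add: dist_commute)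
    finally show "2 * R \<le> dist (x j) y" using R by linarith
  qed
  then have 2: "corrs y = corr e i y" using i by (simp add: corrs_def sum.remove[of _ i])
  have "err y = V i + cross3 (\<Omega> i) (y - x i) - ((e + background e i y) - (background e i y - background e i (x i)))"
    by (simp only: err_def 1 2 velocity_facts(6)[OF i y] corr_on_own_sphere[OF y])
  then show ?thesis by (simp add: slip_def)
qed

text \<open>The free vector \<open>c\<close> serves two purposes: summed over the particles with
  \<open>c = e\<close> it is the weak formulation of \<open>flow\<close>, and with
  \<open>c = slip i\<close> it measures a single slip.\<close>

lemma sphere_stress_work:
  assumes i: "i \<in> {1..N}"
  shows "set_integrable lborel D (\<lambda>y. sphere_stress R c (y - x i) \<bullet> errJ y)"
    "(LINT y:D|lborel. sphere_stress R c (y - x i) \<bullet> errJ y) = 6 * pi * R * (c \<bullet> slip i)"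
  using green_particle_stress[OF sphere_stress_on norm_sphere_stress_le[OF R] i
      err_jacobian err_continuous err_growth err_square_integrable err_on_sphere]
    sphint_sphere_stress[OF R] by simp_all

lemma rotlet_stress_work:
  assumes i: "i \<in> {1..N}"
  shows "set_integrable lborel D (\<lambda>y. rotlet_stress R (\<Omega> i) (y - x i) \<bullet> errJ y)"
    "(LINT y:D|lborel. rotlet_stress R (\<Omega> i) (y - x i) \<bullet> errJ y) = 8 * pi * R ^ 3 * (norm (\<Omega> i))\<^sup>2"
  using green_particle_stress[OF rotlet_stress_on norm_rotlet_stress_le[OF R] i
      err_jacobian err_continuous err_growth err_square_integrable err_on_sphere]
    sphint_rotlet_stress[OF R] by simp_all

definition energy :: real where "energy = (LINT y:D|lborel. (norm (symm (errJ y)))\<^sup>2)"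

lemma energy_integrable: "set_integrable lborel D (\<lambda>y. (norm (symm (errJ y)))\<^sup>2)"
proof (rule set_integrable_bound_continuous[OF _ borel_domain])
  show "set_integrable lborel D (\<lambda>y. 4 * (norm (errJ y))\<^sup>2)"
    by (intro set_integrable_mult_right err_square_integrable)
  show "continuous_on D (\<lambda>y. (norm (symm (errJ y)))\<^sup>2)"
    by (intro continuous_on_power continuous_on_norm continuous_on_symm jac_continuous)
  show "\<bar>(norm (symm (errJ y)))\<^sup>2\<bar> \<le> 4 * (norm (errJ y))\<^sup>2" for y
    using power_mono[OF norm_symm_le[of "errJ y"], of 2] by (simp add: power_mult_distrib)
qed

text \<open>The forces exerted by \<open>u\<close> and by \<open>flow\<close> on each particle are the same, so only the
  correctors contribute to the energy of the error.\<close>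

lemma energy_le: "energy \<le> 4 * (LINT y:D|lborel. (norm (corrsJ y))\<^sup>2)"
proof -
  define \<tau> where "\<tau> = (\<lambda>y. \<Sum>j\<in>{1..N}. sphere_stress R e (y - x j) \<bullet> errJ y)"
  note I1 = stokes_weak[OF solution err_jacobian err_continuous err_growth err_square_integrable err_divergence_free err_on_sphere]
  have I2: "set_integrable lborel D \<tau>" "(LINT y:D|lborel. \<tau> y) = (\<Sum>j\<in>{1..N}. 6 * pi * R * (e \<bullet> slip j))"
    unfolding \<tau>_def using set_integral_sum[of "{1..N}" D "\<lambda>j y. sphere_stress R e (y - x j) \<bullet> errJ y"] sphere_stress_work
    by simp_all
  \<comment> \<open>Both weak formulations, tested with the error, yield
    \<open>6 * pi * R * (e \<bullet> slip j)\<close> summed over \<open>j\<close>; they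
    cancel.\<close>
  have I: "set_integrable lborel D (\<lambda>y. symm (jacobian u y) \<bullet> errJ y - \<tau> y)"
    "(LINT y:D|lborel. symm (jacobian u y) \<bullet> errJ y - \<tau> y) = 0"
    using set_integral_diff[OF I1(1) I2(1)] I1(2) I2(2) by simp_all
  have pt: "(norm (symm (errJ y)))\<^sup>2 / 4 \<le> (norm (corrsJ y))\<^sup>2 + (symm (jacobian u y) \<bullet> errJ y - \<tau> y)" if y: "y \<in> D" for y
  proof -
    \<comment> \<open>The pressures of the explicit flows multiply the trace of \<open>errJ\<close>,
      which is zero.\<close>
    have "symm (flowJ y) \<bullet> errJ y = (\<Sum>j\<in>{1..N}. sphere_stress R e (y - x j) \<bullet> errJ y + sphere_pressure R e (y - x j) * trace (errJ y))"
      by (simp add: flowJ_def symm_sum inner_sum_left sphere_velocity_stress inner_add_left mat_inner)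
    then have f: "symm (flowJ y) \<bullet> errJ y = \<tau> y" by (simp add: err_divergence_free[OF y] \<tau>_def)
    have d: "symm (errJ y) = symm (jacobian u y) - (symm (flowJ y) - symm (corrsJ y))"
      unfolding errJ_def symm_diff ..
    have "symm (errJ y) \<bullet> errJ y = symm (jacobian u y) \<bullet> errJ y - \<tau> y + corrsJ y \<bullet> symm (errJ y)"
      unfolding arg_cong[OF d, of "\<lambda>A. A \<bullet> errJ y"] by (simp add: inner_diff_left f symm_inner[of "corrsJ y"])
    then have "(norm (symm (errJ y)))\<^sup>2 / 2 = symm (jacobian u y) \<bullet> errJ y - \<tau> y + corrsJ y \<bullet> symm (errJ y)"
      by (simp add: symm_inner_self)
    \<comment> \<open>Of the half of the squared norm on the left a quarter is spent here; the
      remaining quarter is the reason for the factor 4 in the result.\<close>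
    moreover have "corrsJ y \<bullet> symm (errJ y) \<le> (norm (corrsJ y))\<^sup>2 + (norm (symm (errJ y)))\<^sup>2 / 4"
    proof -
      have "corrsJ y \<bullet> symm (errJ y) \<le> norm (corrsJ y) * norm (symm (errJ y))" by (rule norm_cauchy_schwarz)
      also have "\<dots> \<le> (norm (corrsJ y))\<^sup>2 + (norm (symm (errJ y)))\<^sup>2 / 4"
        using sum_squares_bound[of "norm (corrsJ y)" "norm (symm (errJ y)) / 2"] by (simp add: power_divide)
      finally show ?thesis .
    qed
    ultimately show ?thesis by linarith
  qed
  have "(LINT y:D|lborel. (norm (symm (errJ y)))\<^sup>2 / 4) \<le> (LINT y:D|lborel. (norm (corrsJ y))\<^sup>2)
      + (LINT y:D|lborel. symm (jacobian u y) \<bullet> errJ y - \<tau> y)"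
    by (rule set_integral_mono_add[OF _ corrs_square_integrable I(1) pt])
      (use set_integrable_mult_right[OF energy_integrable, of "1/4"] in simp)
  then show ?thesis using I(2) by (simp add: energy_def)
qed

text \<open>Young's inequality with weight \<open>s\<close>, to be optimized by the caller.\<close>

lemma stress_work_le:
  assumes \<sigma>: "stress_on (- {0}) \<sigma>" and b: "\<And>y. R \<le> norm y \<Longrightarrow> norm (\<sigma> y) \<le> c * inverse (norm y) ^ 2"
    and i: "i \<in> {1..N}" and s: "0 < s"
    and int: "set_integrable lborel D (\<lambda>y. \<sigma> (y - x i) \<bullet> errJ y)"
  shows "(LINT y:D|lborel. \<sigma> (y - x i) \<bullet> errJ y) \<le> s / 4 * (c\<^sup>2 * (4 * pi / R)) + 1 / (4 * s) * energy"
proof -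
  note sq = square_integrable_decay[OF stress_on_continuous[OF \<sigma>] b i]
  have "(LINT y:D|lborel. \<sigma> (y - x i) \<bullet> errJ y)
      \<le> (LINT y:D|lborel. s / 4 * (norm (\<sigma> (y - x i)))\<^sup>2) + (LINT y:D|lborel. 1 / (4 * s) * (norm (symm (errJ y)))\<^sup>2)"
  proof (rule set_integral_mono_add[OF int])
    show "set_integrable lborel D (\<lambda>y. s / 4 * (norm (\<sigma> (y - x i)))\<^sup>2)"
      by (rule set_integrable_mult_right[OF sq(2)])
    show "set_integrable lborel D (\<lambda>y. 1 / (4 * s) * (norm (symm (errJ y)))\<^sup>2)"
      by (rule set_integrable_mult_right[OF energy_integrable])
    fix y assume "y \<in> D"
    then have "y - x i \<in> - {0}" using closure_domain_nonzero[OF _ i] closure_subset by blast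
    then have "transpose (\<sigma> (y - x i)) = \<sigma> (y - x i)" using \<sigma> unfolding stress_on_def by blast
    then have "\<sigma> (y - x i) \<bullet> errJ y = (\<sigma> (y - x i) \<bullet> symm (errJ y)) / 2" by (rule symmetric_inner)
    also have "\<dots> \<le> norm (\<sigma> (y - x i)) * norm (symm (errJ y)) / 2"
      by (intro divide_right_mono norm_cauchy_schwarz) simp
    also have "\<dots> \<le> s / 4 * (norm (\<sigma> (y - x i)))\<^sup>2 + 1 / (4 * s) * (norm (symm (errJ y)))\<^sup>2"
    proof -
      have "0 \<le> (s * norm (\<sigma> (y - x i)) - norm (symm (errJ y)))\<^sup>2 / (4 * s)" using s by simp
      also have "\<dots> = s / 4 * (norm (\<sigma> (y - x i)))\<^sup>2 + 1 / (4 * s) * (norm (symm (errJ y)))\<^sup>2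
          - norm (\<sigma> (y - x i)) * norm (symm (errJ y)) / 2"
        using s by (simp add: field_simps power2_eq_square)
      finally show ?thesis by linarith
    qed
    finally show "\<sigma> (y - x i) \<bullet> errJ y \<le> s / 4 * (norm (\<sigma> (y - x i)))\<^sup>2 + 1 / (4 * s) * (norm (symm (errJ y)))\<^sup>2" .
  qed
  also have "(LINT y:D|lborel. s / 4 * (norm (\<sigma> (y - x i)))\<^sup>2) = s / 4 * (LINT y:D|lborel. (norm (\<sigma> (y - x i)))\<^sup>2)"
    by (rule set_integral_mult_right)
  also have "(LINT y:D|lborel. 1 / (4 * s) * (norm (symm (errJ y)))\<^sup>2) = 1 / (4 * s) * energy"
    unfolding energy_def by (rule set_integral_mult_right)
  also have "s / 4 * (LINT y:D|lborel. (norm (\<sigma> (y - x i)))\<^sup>2) \<le> s / 4 * (c\<^sup>2 * (4 * pi / R))"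
    by (rule mult_left_mono[OF sq(3) divide_nonneg_nonneg[OF less_imp_le[OF s] zero_le_numeral]])
  finally show ?thesis by simp
qed

text \<open>Testing with the stress of a sphere that moves with velocity \<open>slip i\<close>
  yields the square of the slip on the left and, since that stress has squared norm of order
  \<open>R * |slip i|^2\<close>, a quantity that Young's inequality can absorb.\<close>

lemma slip_le:
  assumes i: "i \<in> {1..N}"
  shows "R * (norm (slip i))\<^sup>2 \<le> 3 * energy"
proof -
  \<comment> \<open>The weight 1/108 makes the first term on the right
    \<open>3 * pi * R * |slip i|^2\<close>, half of the left side.\<close>
  have "6 * pi * R * (slip i \<bullet> slip i) \<le> (1/108) / 4 * ((18 * R * norm (slip i))\<^sup>2 * (4 * pi / R)) + 1 / (4 * (1/108)) * energy"
    using stress_work_le[OF sphere_stress_on norm_sphere_stress_le[OF R] i _ sphere_stress_work(1)[OF i], of "1/108" "slip i"]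
    unfolding sphere_stress_work(2)[OF i] by simp
  also have "\<dots> = 3 * pi * R * (norm (slip i))\<^sup>2 + 27 * energy"
    using R by (simp add: power_mult_distrib power2_eq_square)
  finally have "pi * (R * (norm (slip i))\<^sup>2) \<le> 9 * energy" by (simp add: power2_norm_eq_inner mult.left_commute)
  moreover have "3 * (R * (norm (slip i))\<^sup>2) \<le> pi * (R * (norm (slip i))\<^sup>2)"
    using pi_gt3 R by (intro mult_right_mono) auto
  ultimately show ?thesis by linarith
qed

text \<open>The rotlet with angular velocity \<open>\<Omega> i\<close> plays the part that the
  translating sphere plays for the slip.\<close>

lemma rotation_le:
  assumes i: "i \<in> {1..N}"
  shows "R ^ 3 * (norm (\<Omega> i))\<^sup>2 \<le> energy"
proof -
  \<comment> \<open>The weight 1/9 again makes the first term half of the left side.\<close>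
  have "8 * pi * R ^ 3 * (norm (\<Omega> i))\<^sup>2 \<le> (1/9) / 4 * ((6 * R\<^sup>2 * norm (\<Omega> i))\<^sup>2 * (4 * pi / R)) + 1 / (4 * (1/9)) * energy"
    using stress_work_le[OF rotlet_stress_on norm_rotlet_stress_le[OF R] i _ rotlet_stress_work(1)[OF i], of "1/9"]
    unfolding rotlet_stress_work(2)[OF i] by simp
  also have "\<dots> = 4 * pi * R ^ 3 * (norm (\<Omega> i))\<^sup>2 + 9 / 4 * energy"
    using R by (simp add: power_mult_distrib power2_eq_square power3_eq_cube)
  finally have "16 * pi * (R ^ 3 * (norm (\<Omega> i))\<^sup>2) \<le> 9 * energy" by (simp add: mult.assoc)
  moreover have "16 * 3 * (R ^ 3 * (norm (\<Omega> i))\<^sup>2) \<le> 16 * pi * (R ^ 3 * (norm (\<Omega> i))\<^sup>2)"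
    using pi_gt3 R by (intro mult_right_mono) auto
  moreover have "0 \<le> R ^ 3 * (norm (\<Omega> i))\<^sup>2" using R by simp
  ultimately show ?thesis by linarith
qed

text \<open>The supports are disjoint up to boundaries where the Jacobians vanish, so at most one
  corrector contributes at each point and the energies add up.\<close>

lemma corrs_energy_le:
  assumes K: "0 \<le> K" "\<And>i y. i \<in> {1..N} \<Longrightarrow> norm (corrJ e i y) \<le> K * near_sum e i"
  shows "(LINT y:D|lborel. (norm (corrsJ y))\<^sup>2) \<le> (\<Sum>i\<in>{1..N}. 64 * R ^ 3 * (K * near_sum e i)\<^sup>2)"
proof -
  have pt: "(norm (corrsJ y))\<^sup>2 \<le> (\<Sum>i\<in>{1..N}. (K * near_sum e i)\<^sup>2 * indicator (cball (x i) (2 * R)) y)" for y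
  proof (cases "\<exists>i\<in>{1..N}. dist (x i) y < 2 * R")
    case True
    then obtain i where i: "i \<in> {1..N}" "dist (x i) y < 2 * R" by blast
    have "corrJ e j y = 0" if "j \<in> {1..N} - {i}" for j
    proof (rule outside_support)
      have "4 * R \<le> dist (x j) (x i)" using sep[of j i] that i by simp
      also have "\<dots> \<le> dist (x j) y + dist (x i) y" by (rule dist_triangle2)
      finally show "2 * R \<le> dist (x j) y" using i by linarith
    qed
    then have "corrsJ y = corrJ e i y" using i by (simp add: corrsJ_def sum.remove[of _ i])
    then have "(norm (corrsJ y))\<^sup>2 \<le> (K * near_sum e i)\<^sup>2" using K(2)[OF i(1), of y] by (intro power_mono) auto
    also have "\<dots> = (K * near_sum e i)\<^sup>2 * indicator (cball (x i) (2 * R)) y" using i by simp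
    also have "\<dots> \<le> (\<Sum>i\<in>{1..N}. (K * near_sum e i)\<^sup>2 * indicator (cball (x i) (2 * R)) y)"
      by (rule member_le_sum[OF i(1)]) auto
    finally show ?thesis .
  next
    case False
    then have "corrsJ y = 0" unfolding corrsJ_def using outside_support(2) by (intro sum.neutral) (auto simp: not_less)
    then show ?thesis by (simp add: sum_nonneg)
  qed
  have int: "integrable lborel (\<lambda>y. (K * near_sum e i)\<^sup>2 * indicat_real (cball (x i) (2 * R)) y)" for i
    using emeasure_bounded_finite[of "cball (x i) (2 * R)"] by (intro integrable_mult_right integrable_real_indicator) auto
  have "(LINT y:D|lborel. (norm (corrsJ y))\<^sup>2)
      \<le> (LINT y|lborel. (\<Sum>i\<in>{1..N}. (K * near_sum e i)\<^sup>2 * indicator (cball (x i) (2 * R)) y))"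
    unfolding set_lebesgue_integral_def
  proof (rule integral_mono)
    show "integrable lborel (\<lambda>y. indicat_real D y *\<^sub>R (norm (corrsJ y))\<^sup>2)"
      using corrs_square_integrable unfolding set_integrable_def .
    show "integrable lborel (\<lambda>y. \<Sum>i = 1..N. (K * near_sum e i)\<^sup>2 * indicat_real (cball (x i) (2 * R)) y)"
      by (intro Bochner_Integration.integrable_sum int)
    show "indicat_real D y *\<^sub>R (norm (corrsJ y))\<^sup>2 \<le> (\<Sum>i = 1..N. (K * near_sum e i)\<^sup>2 * indicat_real (cball (x i) (2 * R)) y)" for y
      using order_trans[OF _ pt[of y], of "indicat_real D y *\<^sub>R (norm (corrsJ y))\<^sup>2"] by (simp add: indicator_def)
  qed
  also have "\<dots> = (\<Sum>i\<in>{1..N}. (K * near_sum e i)\<^sup>2 * measure lborel (cball (x i) (2 * R)))"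
    unfolding Bochner_Integration.integral_sum[OF int] integral_mult_right_zero by simp
  also have "\<dots> \<le> (\<Sum>i\<in>{1..N}. 64 * R ^ 3 * (K * near_sum e i)\<^sup>2)"
  proof (rule sum_mono)
    fix i
    \<comment> \<open>The ball is enclosed in a cube of side \<open>4 * R\<close>; this gives the
      factor 64.\<close>
    have "measure lborel (cball (x i) (2 * R)) \<le> measure lborel (cbox (x i - (\<chi> k. 2 * R)) (x i + (\<chi> k. 2 * R)))"
    proof (rule measure_mono_fmeasurable)
      show "cball (x i) (2 * R) \<subseteq> cbox (x i - (\<chi> k. 2 * R)) (x i + (\<chi> k. 2 * R))"
      proof
        fix y assume "y \<in> cball (x i) (2 * R)"
        then have "norm (x i - y) \<le> 2 * R" by (simp add: dist_norm)
        then have "\<bar>(x i - y) $ k\<bar> \<le> 2 * R" for k using component_le_norm_cart[of "x i - y" k] by linarith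
        then have "\<bar>x i $ k - y $ k\<bar> \<le> 2 * R" for k by simp
        then have "x i $ k - 2 * R \<le> y $ k \<and> y $ k \<le> x i $ k + 2 * R" for k by (simp add: abs_le_iff algebra_simps)
        then show "y \<in> cbox (x i - (\<chi> k. 2 * R)) (x i + (\<chi> k. 2 * R))" by (simp add: mem_box_cart)
      qed
    qed (auto simp: fmeasurable_cbox)
    also have "\<dots> = (\<Prod>k\<in>(UNIV::3 set). 4 * R)"
      using R by (subst content_cbox_cart) (auto simp: interval_ne_empty_cart)
    also have "\<dots> = 64 * R ^ 3" by (simp add: power_mult_distrib)
    finally show "(K * near_sum e i)\<^sup>2 * measure lborel (cball (x i) (2 * R)) \<le> 64 * R ^ 3 * (K * near_sum e i)\<^sup>2"
      by (metis mult.commute mult_right_mono zero_le_power2)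
  qed
  finally show ?thesis .
qed

end

section \<open>Counting neighbours and conclusion\<close>

lemma card_le_max_count: "card {i \<in> {1..N}. infnorm (x i - y) \<le> l} \<le> max_count N x l"
  unfolding max_count_def
proof (rule cSUP_upper[OF UNIV_I])
  have "card {i \<in> {1..N}. infnorm (x i - y) \<le> l} \<le> card {1..N}" for y by (rule card_mono) auto
  then show "bdd_above (range (\<lambda>y. card {i \<in> {1..N}. infnorm (x i - y) \<le> l}))"
    by (intro bdd_aboveI[of _ N]) auto
qed

lemma infnorm_le_iff: "infnorm y \<le> l \<longleftrightarrow> (\<forall>k. \<bar>y $ k\<bar> \<le> l)" for y :: "real^3"
proof -
  have "infnorm y = Sup (range (\<lambda>k. \<bar>y $ k\<bar>))" unfolding infnorm_cart by (rule arg_cong[where f=Sup]) auto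
  then show ?thesis by (subst (asm) cSup_eq_Max) auto
qed

text \<open>A cube is covered by eight cubes of half the side, centred at the midpoints between its
  centre and its corners; the signs of the components of \<open>x i - y\<close> tell which one
  contains the point.\<close>

lemma card_cube_double:
  fixes x :: "nat \<Rightarrow> real^3"
  assumes c: "\<And>y. card {i \<in> {1..N}. infnorm (x i - y) \<le> l} \<le> c"
  shows "card {i \<in> {1..N}. infnorm (x i - y) \<le> 2 * l} \<le> 8 * c"
proof -
  define S where "S = (\<lambda>(a, b, c). vector [a, b, c] :: real^3) ` ({-1, 1} \<times> {-1, 1} \<times> {-1, 1})"
  have fS: "finite S" by (simp add: S_def)
  have cS: "card S \<le> 8" unfolding S_def by (rule order_trans[OF card_image_le]) (auto simp: card_cartesian_product)
  let ?A = "\<lambda>s. {i \<in> {1..N}. infnorm (x i - (y + l *\<^sub>R s)) \<le> l}"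
  have "{i \<in> {1..N}. infnorm (x i - y) \<le> 2 * l} \<subseteq> (\<Union>s\<in>S. ?A s)"
  proof
    fix i assume i: "i \<in> {i \<in> {1..N}. infnorm (x i - y) \<le> 2 * l}"
    define w where "w = x i - y"
    define f where "f = (\<lambda>k. if w $ k \<ge> 0 then 1 else - 1 :: real)"
    define s :: "real^3" where "s = vector [f 1, f 2, f 3]"
    have sf: "s $ k = f k" for k using exhaust_3[of k] by (auto simp: s_def)
    have "(f 1, f 2, f 3) \<in> {-1, 1} \<times> {-1, 1} \<times> {-1, 1}" by (simp add: f_def)
    from imageI[OF this, of "\<lambda>(a, b, c). vector [a, b, c] :: real^3"] have sS: "s \<in> S"
      by (simp add: S_def s_def)
    have w2: "\<bar>w $ k\<bar> \<le> 2 * l" for k using i infnorm_le_iff[of w "2 * l"] by (simp add: w_def)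
    have "\<bar>w $ k - l * f k\<bar> \<le> l" for k
      by (cases "0 \<le> w $ k") (use w2[of k] in \<open>auto simp: f_def abs_le_iff\<close>)
    then have "\<bar>(w - l *\<^sub>R s) $ k\<bar> \<le> l" for k by (simp add: sf)
    then have "infnorm (w - l *\<^sub>R s) \<le> l" unfolding infnorm_le_iff by blast
    then have "i \<in> ?A s" using i by (simp add: w_def algebra_simps)
    then show "i \<in> (\<Union>s\<in>S. ?A s)" using sS by blast
  qed
  then have "card {i \<in> {1..N}. infnorm (x i - y) \<le> 2 * l} \<le> card (\<Union>s\<in>S. ?A s)"
    by (rule card_mono[rotated]) (simp add: fS)
  also have "\<dots> \<le> (\<Sum>s\<in>S. card (?A s))" by (rule card_UN_le[OF fS])
  also have "\<dots> \<le> (\<Sum>s\<in>S. c)" by (intro sum_mono c)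
  also have "\<dots> \<le> 8 * c" using cS by simp
  finally show ?thesis .
qed

lemma card_cube_power: "card {i \<in> {1..N}. infnorm (x i - y) \<le> 2 ^ n * l} \<le> 8 ^ n * max_count N x l"
proof (induction n arbitrary: y)
  case 0
  then show ?case using card_le_max_count by simp
next
  case (Suc n)
  show ?case using card_cube_double[of N x "2 ^ n * l", OF Suc.IH] by (simp add: mult.assoc)
qed

lemma infnorm_le_dist: "infnorm (a - b) \<le> dist a b" for a b :: "real^3"
  by (simp add: dist_norm infnorm_le_norm)

text \<open>The innermost cube holds at most \<open>M * N * l^3\<close> points, each contributing at
  most \<open>1 / d^2\<close>, and \<open>l^3 \<le> E * d^2\<close> turns this into
  \<open>N * M * E\<close>. The shell between \<open>r = 2^n * l\<close> and \<open>2 * r\<close>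
  contributes at most \<open>8 * M * N * r\<close>. Such contributions double from shell to shell,
  so the bound at scale \<open>r\<close> plus one more shell is precisely the bound at scale
  \<open>2 * r\<close>.\<close>

lemma dyadic_sum_le:
  fixes x :: "nat \<Rightarrow> real^3"
  assumes m: "real (max_count N x l) \<le> M * real N * l ^ 3" and l: "0 < l" and d: "0 < d" "l ^ 3 \<le> E * d\<^sup>2"
    and M: "0 \<le> M" and sep: "\<And>j. j \<in> J \<Longrightarrow> d \<le> dist y (x j)" and J: "J \<subseteq> {1..N}"
  shows "(\<Sum>j\<in>{j\<in>J. infnorm (x j - y) \<le> 2 ^ n * l}. 1 / (dist y (x j))\<^sup>2) \<le> real N * (M * E + 8 * M * (2 ^ n * l))"
proof (induction n)
  have fJ: "finite J" using J finite_subset by blast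
  case 0
  let ?A = "{j\<in>J. infnorm (x j - y) \<le> l}"
  have "(\<Sum>j\<in>?A. 1 / (dist y (x j))\<^sup>2) \<le> real (card ?A) * (1 / d\<^sup>2)"
    using d sep by (intro sum_bounded_above) (auto intro!: divide_left_mono power_mono mult_pos_pos zero_less_power dest: order.strict_trans2)
  also have "\<dots> \<le> (M * real N * l ^ 3) * (1 / d\<^sup>2)"
  proof (rule mult_right_mono)
    have "card ?A \<le> card {i \<in> {1..N}. infnorm (x i - y) \<le> l}" by (rule card_mono) (use J in auto)
    also have "\<dots> \<le> max_count N x l" by (rule card_le_max_count)
    finally show "real (card ?A) \<le> M * real N * l ^ 3" using m by linarith
  qed simp
  also have "\<dots> \<le> (M * real N * (E * d\<^sup>2)) * (1 / d\<^sup>2)"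
    using d M by (intro mult_right_mono mult_left_mono) auto
  also have "\<dots> = real N * (M * E)" using d by simp
  also have "\<dots> \<le> real N * (M * E + 8 * M * (2 ^ 0 * l))" using M l by (intro mult_left_mono) auto
  finally show ?case by simp
next
  have fJ: "finite J" using J finite_subset by blast
  case (Suc n)
  define r where "r = 2 ^ n * l"
  have r: "0 < r" using l by (simp add: r_def)
  let ?A = "{j\<in>J. infnorm (x j - y) \<le> r}" and ?B = "{j\<in>J. r < infnorm (x j - y) \<and> infnorm (x j - y) \<le> 2 * r}"
  have "(\<Sum>j\<in>?B. 1 / (dist y (x j))\<^sup>2) \<le> real (card ?B) * (1 / r\<^sup>2)"
  proof (rule sum_bounded_above)
    fix j assume "j \<in> ?B"
    then have "r \<le> dist y (x j)" using infnorm_le_dist[of "x j" y] by (simp add: dist_commute)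
    then show "1 / (dist y (x j))\<^sup>2 \<le> 1 / r\<^sup>2" using r by (intro divide_left_mono power_mono mult_pos_pos) auto
  qed
  also have "\<dots> \<le> (8 ^ Suc n * (M * real N * l ^ 3)) * (1 / r\<^sup>2)"
  proof (rule mult_right_mono)
    have "card ?B \<le> card {i \<in> {1..N}. infnorm (x i - y) \<le> 2 ^ Suc n * l}"
      by (rule card_mono) (use J in \<open>auto simp: r_def mult.assoc\<close>)
    also have "\<dots> \<le> 8 ^ Suc n * max_count N x l" by (rule card_cube_power)
    finally have "real (card ?B) \<le> real (8 ^ Suc n * max_count N x l)" by (rule of_nat_mono)
    also have "\<dots> = 8 ^ Suc n * real (max_count N x l)" by simp
    also have "\<dots> \<le> 8 ^ Suc n * (M * real N * l ^ 3)" using m by (intro mult_left_mono) auto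
    finally show "real (card ?B) \<le> 8 ^ Suc n * (M * real N * l ^ 3)" .
  qed simp
  also have "\<dots> = 8 * M * real N * ((8 ^ n * l ^ 3) * (1 / r\<^sup>2))" by simp
  also have "8 ^ n * l ^ 3 = r ^ 3"
  proof -
    have "((2::real) ^ n) ^ 3 = (2 ^ 3) ^ n" by (simp only: power_mult[symmetric] mult.commute)
    then show ?thesis by (simp add: r_def power_mult_distrib)
  qed
  also have "r ^ 3 * (1 / r\<^sup>2) = r" using r by (simp add: power2_eq_square power3_eq_cube)
  finally have B: "(\<Sum>j\<in>?B. 1 / (dist y (x j))\<^sup>2) \<le> 8 * M * real N * r" .
  have "{j\<in>J. infnorm (x j - y) \<le> 2 ^ Suc n * l} = ?A \<union> ?B" using r by (auto simp: r_def mult.assoc)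
  then have "(\<Sum>j\<in>{j\<in>J. infnorm (x j - y) \<le> 2 ^ Suc n * l}. 1 / (dist y (x j))\<^sup>2)
      = (\<Sum>j\<in>?A. 1 / (dist y (x j))\<^sup>2) + (\<Sum>j\<in>?B. 1 / (dist y (x j))\<^sup>2)"
    using fJ by (simp only:) (rule sum.union_disjoint, auto)
  also have "\<dots> \<le> real N * (M * E + 8 * M * r) + 8 * M * real N * r"
    using Suc.IH B unfolding r_def by (rule add_mono)
  also have "\<dots> = real N * (M * E + 8 * M * (2 ^ Suc n * l))" by (simp add: r_def algebra_simps)
  finally show ?case .
qed

text \<open>The dyadic sum is stopped at a scale of order one, independent of \<open>N\<close>.
  Every point beyond it contributes at most one, which accounts for the summand 1 in the
  bound.\<close>

lemma inverse_square_sum_le: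
  fixes x :: "nat \<Rightarrow> real^3"
  assumes m: "real (max_count N x l) \<le> M * real N * l ^ 3" and l: "0 < l" and d: "0 < d" "l ^ 3 \<le> E * d\<^sup>2" "d / 2 \<le> l"
    and M: "0 \<le> M" and E: "0 \<le> E" and sep: "\<And>j. j \<in> J \<Longrightarrow> d \<le> dist y (x j)" and J: "J \<subseteq> {1..N}"
  shows "(\<Sum>j\<in>J. 1 / (dist y (x j))\<^sup>2) \<le> real N * (M * E + 8 * M * (2 + 4 * E) + 1)"
proof -
  have fJ: "finite J" using J finite_subset by blast
  \<comment> \<open>From \<open>d \<le> 2 * l\<close> the bound \<open>l^3 \<le> E * d^2\<close>
    becomes \<open>l^3 \<le> 4 * E * l^2\<close>.\<close>
  have l4: "l \<le> 4 * E"
  proof -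
    have "l ^ 3 \<le> E * (2 * l)\<^sup>2" using d E by (intro order_trans[OF d(2)] mult_left_mono power_mono) auto
    then have "l * l\<^sup>2 \<le> (4 * E) * l\<^sup>2" by (simp add: power2_eq_square power3_eq_cube)
    then show ?thesis using l by simp
  qed
  \<comment> \<open>The least such \<open>n\<close> overshoots one by a factor of at most two,
    except for \<open>n = 0\<close>, where the scale is \<open>l\<close> itself;
    \<open>2 + l\<close> covers both cases.\<close>
  have "\<exists>n. 1 \<le> 2 ^ n * l \<and> 2 ^ n * l \<le> 2 + l"
  proof -
    have "\<exists>n. 1 / l < 2 ^ n" by (rule real_arch_pow) simp
    then have ex: "\<exists>n. 1 \<le> 2 ^ n * l" using l by (auto simp: field_simps intro: less_imp_le)
    define n where "n = (LEAST n. 1 \<le> 2 ^ n * l)"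
    have n: "1 \<le> 2 ^ n * l" unfolding n_def using LeastI_ex[OF ex] .
    have "2 ^ n * l \<le> 2 + l"
    proof (cases n)
      case (Suc k)
      then have "\<not> 1 \<le> 2 ^ k * l" using not_less_Least[of k "\<lambda>n. 1 \<le> 2 ^ n * l"] by (simp add: n_def)
      then show ?thesis using Suc l by simp
    qed simp
    then show ?thesis using n by blast
  qed
  then obtain n where n: "1 \<le> 2 ^ n * l" "2 ^ n * l \<le> 2 + l" by blast
  let ?A = "{j\<in>J. infnorm (x j - y) \<le> 2 ^ n * l}" and ?B = "{j\<in>J. \<not> infnorm (x j - y) \<le> 2 ^ n * l}"
  have "(\<Sum>j\<in>?B. 1 / (dist y (x j))\<^sup>2) \<le> real (card ?B) * 1"
  proof (rule sum_bounded_above)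
    fix j assume "j \<in> ?B"
    then have "1 \<le> dist y (x j)" using infnorm_le_dist[of "x j" y] n by (simp add: dist_commute)
    then have "1 \<le> (dist y (x j))\<^sup>2" by (rule one_le_power)
    then show "1 / (dist y (x j))\<^sup>2 \<le> 1" by (simp add: divide_le_eq)
  qed
  also have "\<dots> \<le> real N * 1"
  proof -
    have "card ?B \<le> card {1..N}" by (rule card_mono) (use J in auto)
    then show ?thesis by simp
  qed
  finally have B: "(\<Sum>j\<in>?B. 1 / (dist y (x j))\<^sup>2) \<le> real N * 1" .
  have "J = ?A \<union> ?B" by blast
  then have "(\<Sum>j\<in>J. 1 / (dist y (x j))\<^sup>2) = (\<Sum>j\<in>?A \<union> ?B. 1 / (dist y (x j))\<^sup>2)" by (rule arg_cong)
  also have "\<dots> = (\<Sum>j\<in>?A. 1 / (dist y (x j))\<^sup>2) + (\<Sum>j\<in>?B. 1 / (dist y (x j))\<^sup>2)"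
    by (rule sum.union_disjoint) (use fJ in auto)
  also have "\<dots> \<le> real N * (M * E + 8 * M * (2 ^ n * l)) + real N * 1"
    by (rule add_mono[OF dyadic_sum_le[OF m l d(1,2) M sep J] B])
  also have "\<dots> \<le> real N * (M * E + 8 * M * (2 + 4 * E)) + real N * 1"
    using n l4 M by (intro add_right_mono mult_left_mono add_left_mono) auto
  finally show ?thesis by (simp add: algebra_simps)
qed

lemma min_dist_le:
  assumes "i \<in> {1..N}" "j \<in> {1..N}" "i \<noteq> j"
  shows "min_dist N x \<le> dist (x i) (x j)"
  unfolding min_dist_def
proof (rule Min_le)
  have "{dist (x i) (x j) | i j. i \<in> {1..N} \<and> j \<in> {1..N} \<and> i \<noteq> j} \<subseteq> (\<lambda>(i, j). dist (x i) (x j)) ` ({1..N} \<times> {1..N})"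
    by auto
  then show "finite {dist (x i) (x j) | i j. i \<in> {1..N} \<and> j \<in> {1..N} \<and> i \<noteq> j}"
    by (rule finite_subset) simp
qed (use assms in blast)

section \<open>From the admissible configurations to the estimates of one particle\<close>

lemma admissible_facts:
  assumes X: "X \<in> admissible lam M E" and l: "\<forall>N\<ge>1. lam N > 0" and N: "2 \<le> N" and M: "0 < M" and E: "0 < E"
  defines "d \<equiv> min_dist N (X N)"
  shows "real (max_count N (X N) (lam N)) \<le> M * real N * lam N ^ 3" "0 < d" "lam N ^ 3 \<le> E * d\<^sup>2" "d / 2 \<le> lam N"
    "1 \<le> M * E * real N * d\<^sup>2"
proof -
  have lN: "0 < lam N" using l N by simp
  have "real (max_count N (X N) (lam N)) / (real N * \<bar>lam N\<bar> ^ 3) \<le> M" using X N by (simp add: admissible_def)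
  then have "real (max_count N (X N) (lam N)) / (real N * lam N ^ 3) \<le> M" using lN by simp
  then show m: "real (max_count N (X N) (lam N)) \<le> M * real N * lam N ^ 3"
    using lN N by (simp add: divide_le_eq mult.assoc)
  show d: "0 < d" "d / 2 \<le> lam N" using X N by (auto simp: admissible_def d_def)
  have "\<bar>lam N\<bar> ^ 3 / \<bar>d\<bar> ^ 2 \<le> E" using X N by (simp add: admissible_def d_def)
  then show ld: "lam N ^ 3 \<le> E * d\<^sup>2" using lN d by (simp add: divide_le_eq)
  have "1 \<in> {i \<in> {1..N}. infnorm (X N i - X N 1) \<le> lam N}" using N lN by (simp add: infnorm_0)
  then have "card {i \<in> {1..N}. infnorm (X N i - X N 1) \<le> lam N} \<noteq> 0" by (auto simp: card_eq_0_iff)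
  then have "1 \<le> max_count N (X N) (lam N)" using card_le_max_count[of N "X N" "X N 1" "lam N"] by linarith
  then have "1 \<le> M * real N * lam N ^ 3" using m by linarith
  also have "\<dots> \<le> M * real N * (E * d\<^sup>2)" using M by (intro mult_left_mono ld) simp
  finally show "1 \<le> M * E * real N * d\<^sup>2" by (simp add: mult_ac)
qed

context stokes_suspension
begin

text \<open>The flow of a sphere and its Oseen approximation differ by
  \<open>O(R^3 / |x|^3)\<close>. As the particles are separated, one factor \<open>R / |x|\<close>
  is at most one and the sum is \<open>R\<close> times \<open>near_sum\<close>.\<close>

lemma velocity_minus_oseen:
  assumes i: "i \<in> {1..N}"
  shows "norm (V i - (e + (6 * pi * R) *\<^sub>R (\<Sum>j\<in>{1..N} - {i}. oseen (x i - x j) *v e))) \<le> norm (slip i) + R * near_sum e i"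
proof -
  have "norm (\<Sum>j\<in>others i. sphere_velocity R e (x i - x j) - (6 * pi * R) *\<^sub>R (oseen (x i - x j) *v e))
      \<le> (\<Sum>j\<in>others i. R * (R * norm e / (dist (x i) (x j))\<^sup>2))"
  proof (rule sum_norm_le)
    fix j assume "j \<in> others i"
    then have "4 * R \<le> dist (x i) (x j)" by (rule others_sep[OF i])
    then have r: "0 < dist (x i) (x j)" "R \<le> dist (x i) (x j)" using R by linarith+
    then have r: "0 < dist (x i) (x j)" "R \<le> norm (x i - x j)" "R / dist (x i) (x j) \<le> 1"
      by (simp_all only: dist_norm divide_le_eq_1_pos)
    have "norm (sphere_velocity R e (x i - x j) - (6 * pi * R) *\<^sub>R (oseen (x i - x j) *v e))
      \<le> R ^ 3 * norm e * inverse (norm (x i - x j)) ^ 3" by (rule sphere_velocity_oseen[OF R r(2)])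
    also have "\<dots> = (R / dist (x i) (x j)) * (R * (R * norm e / (dist (x i) (x j))\<^sup>2))"
      by (simp add: dist_norm divide_inverse power2_eq_square power3_eq_cube mult_ac)
    also have "\<dots> \<le> 1 * (R * (R * norm e / (dist (x i) (x j))\<^sup>2))" using r R by (intro mult_right_mono) auto
    finally show "norm (sphere_velocity R e (x i - x j) - (6 * pi * R) *\<^sub>R (oseen (x i - x j) *v e))
      \<le> R * (R * norm e / (dist (x i) (x j))\<^sup>2)" by simp
  qed
  then have 1: "norm (background e i (x i) - (6 * pi * R) *\<^sub>R (\<Sum>j\<in>others i. oseen (x i - x j) *v e)) \<le> R * near_sum e i"
    by (simp add: background_def near_sum_def sum_subtractf scaleR_sum_right sum_distrib_left)
  have "V i - (e + (6 * pi * R) *\<^sub>R (\<Sum>j\<in>{1..N} - {i}. oseen (x i - x j) *v e))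
      = slip i + (background e i (x i) - (6 * pi * R) *\<^sub>R (\<Sum>j\<in>others i. oseen (x i - x j) *v e))"
    by (simp add: slip_def others_def)
  then show ?thesis using norm_triangle_ineq[of "slip i"] 1 by (smt (verit))
qed

text \<open>The energy is of order \<open>N * R^3 * s^2\<close>. Of the three factors
  \<open>R\<close>, one pairs with \<open>N\<close> to a constant, one is bounded by
  \<open>b * d^2\<close> and supplies the \<open>d\<close> of the result, and one cancels against
  the \<open>R\<close> in front of the squared slip.\<close>

lemma motion_bounds:
  assumes K: "0 \<le> K" "\<And>i y. i \<in> {1..N} \<Longrightarrow> norm (corrJ e i y) \<le> K * near_sum e i"
    and s: "\<And>i. i \<in> {1..N} \<Longrightarrow> near_sum e i \<le> s" and s0: "0 \<le> s" and i: "i \<in> {1..N}"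
    and d: "R \<le> b * d\<^sup>2" "0 \<le> b" "0 < d"
  shows "norm (slip i) \<le> 28 * K * s * sqrt (real N * R * b) * d"
    and "norm (R *\<^sub>R \<Omega> i) \<le> 28 * K * s * sqrt (real N * R * b) * d"
proof -
  have "energy \<le> 4 * (\<Sum>i\<in>{1..N}. 64 * R ^ 3 * (K * near_sum e i)\<^sup>2)"
    using energy_le corrs_energy_le[OF K] by linarith
  also have "\<dots> \<le> 4 * (\<Sum>i\<in>{1..N}. 64 * R ^ 3 * (K * s)\<^sup>2)"
    using R K(1) s near_sum_nonneg by (intro mult_left_mono sum_mono power_mono) auto
  also have "\<dots> = 256 * K\<^sup>2 * s\<^sup>2 * (real N * R) * R * R"
    by (simp add: power_mult_distrib power3_eq_cube)
  also have "\<dots> \<le> 256 * K\<^sup>2 * s\<^sup>2 * (real N * R) * R * (b * d\<^sup>2)"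
    using R d by (intro mult_left_mono) auto
  finally have E: "3 * energy \<le> R * (768 * K\<^sup>2 * s\<^sup>2 * (real N * R * b) * d\<^sup>2)" by (simp add: algebra_simps)
  have key: "z \<le> 28 * K * s * sqrt (real N * R * b) * d" if z: "R * z\<^sup>2 \<le> 3 * energy" for z
  proof (rule power2_le_imp_le)
    have "R * z\<^sup>2 \<le> R * (768 * K\<^sup>2 * s\<^sup>2 * (real N * R * b) * d\<^sup>2)" using z E by linarith
    then have "z\<^sup>2 \<le> 768 * K\<^sup>2 * s\<^sup>2 * (real N * R * b) * d\<^sup>2" using R by simp
    \<comment> \<open>The factor \<open>768 = 3 * 4 * 64\<close> is rounded up to the square of
      28.\<close>
    also have "\<dots> \<le> 784 * K\<^sup>2 * s\<^sup>2 * (real N * R * b) * d\<^sup>2"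
      using R d by (intro mult_right_mono) auto
    also have "\<dots> = (28 * K * s * sqrt (real N * R * b) * d)\<^sup>2"
      using R d by (simp add: power_mult_distrib)
    finally show "z\<^sup>2 \<le> (28 * K * s * sqrt (real N * R * b) * d)\<^sup>2" .
    show "0 \<le> 28 * K * s * sqrt (real N * R * b) * d" using K s0 R d by simp
  qed
  show "norm (slip i) \<le> 28 * K * s * sqrt (real N * R * b) * d" by (rule key[OF slip_le[OF i]])
  have "R * (norm (R *\<^sub>R \<Omega> i))\<^sup>2 = R ^ 3 * (norm (\<Omega> i))\<^sup>2"
    by (simp add: power_mult_distrib power2_eq_square power3_eq_cube)
  moreover have "0 \<le> R ^ 3 * (norm (\<Omega> i))\<^sup>2" using R by simp
  ultimately have "R * (norm (R *\<^sub>R \<Omega> i))\<^sup>2 \<le> 3 * energy" using rotation_le[OF i] by linarith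
  then show "norm (R *\<^sub>R \<Omega> i) \<le> 28 * K * s * sqrt (real N * R * b) * d" by (rule key)
qed

end

text \<open>The permitted dependence of the constants is expressed by the order of the quantifiers:
  the threshold is a function of \<open>r0\<close>, \<open>M\<close>, \<open>E\<close> and the bound
  a function of these and \<kappa> |g|, both fixed before the configurations are given.\<close>

theorem proposition3p7:
  shows "\<exists>\<delta>>0.
    \<exists>(N0 :: real \<Rightarrow> real \<Rightarrow> real \<Rightarrow> nat) (C :: real \<Rightarrow> real \<Rightarrow> real \<Rightarrow> real \<Rightarrow> real).
    \<forall>(r0 :: real) (\<kappa> :: real) (g :: real^3) (M :: real) (E :: real)
      (lam :: nat \<Rightarrow> real) (X :: nat \<Rightarrow> nat \<Rightarrow> real^3).
      r0 > 0 \<longrightarrow> \<kappa> > 0 \<longrightarrow> M > 0 \<longrightarrow> E > 0 \<longrightarrow>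
      (\<forall>N\<ge>1. lam N > 0) \<longrightarrow>
      X \<in> admissible lam M E \<longrightarrow>
      M powr (1/3) * r0 < \<delta> \<longrightarrow>
      N0 r0 M E \<ge> 1 \<and>
      (\<forall>N \<ge> N0 r0 M E. \<forall>u p V \<Omega>.
         stokes_solution N (r0 / real N) (X N) ((6 * pi * (r0 / real N)) *\<^sub>R (\<kappa> *\<^sub>R g)) u p V \<Omega> \<longrightarrow>
         (\<forall>i\<in>{1..N}.
            norm (V i - (\<kappa> *\<^sub>R g + (6 * pi * (r0 / real N)) *\<^sub>R
                    (\<Sum>j\<in>{1..N} - {i}. oseen (X N i - X N j) *v (\<kappa> *\<^sub>R g))))
              \<le> C r0 M E (\<kappa> * norm g) * min_dist N (X N) \<and>
            norm ((r0 / real N) *\<^sub>R \<Omega> i)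
              \<le> C r0 M E (\<kappa> * norm g) * min_dist N (X N)))"
proof -
  obtain K where K: "K \<ge> 0"
    "\<And>N R x e i y. suspension N R x \<Longrightarrow> i \<in> {1..N} \<Longrightarrow> norm (suspension.corrJ N R x e i y) \<le> K * suspension.near_sum N R x e i"
    using corrJ_bound_exists by blast
  \<comment> \<open>With \<open>R \<le> r0 * M * E * d^2\<close> the separation
    \<open>(4 * R)^2 \<le> d^2\<close> follows from \<open>16 * r0^2 * M * E \<le> N\<close>. The
    summand 2 ensures that the minimal distance is that of at least two points.\<close>
  define N0 where "N0 = (\<lambda>(r0::real) M E. nat \<lceil>16 * r0\<^sup>2 * (M * E)\<rceil> + (2::nat))"
  \<comment> \<open>A bound for \<open>near_sum\<close> that is uniform in \<open>N\<close>: the sum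
    of inverse squares is \<open>O(N)\<close>, and \<open>N * R = r0\<close>.\<close>
  define S where "S = (\<lambda>(r0::real) M E q. r0 * q * (M * E + 8 * M * (2 + 4 * E) + 1))"
  \<comment> \<open>The first summand bounds slip and rotation; the second pays for replacing the
    flows by Oseen tensors, an error of at most \<open>R * S\<close> with
    \<open>R \<le> d\<close>.\<close>
  define C where "C = (\<lambda>r0 M E q. 28 * K * S r0 M E q * sqrt (r0 * (r0 * M * E)) + S r0 M E q)"
  show ?thesis
  proof (intro exI[of _ "1::real"] exI[of _ N0] exI[of _ C] conjI allI impI)
    show "(0::real) < 1" by simp
    fix r0 \<kappa> :: real and g :: "real^3" and M E :: real and lam :: "nat \<Rightarrow> real" and X :: "nat \<Rightarrow> nat \<Rightarrow> real^3"
    assume pos: "r0 > 0" "\<kappa> > 0" "M > 0" "E > 0" and l: "\<forall>N\<ge>1. lam N > 0" and X: "X \<in> admissible lam M E"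
    show "1 \<le> N0 r0 M E" by (simp add: N0_def)
    fix N u p V \<Omega>
    assume N: "N0 r0 M E \<le> N"
      and sol: "stokes_solution N (r0 / real N) (X N) ((6 * pi * (r0 / real N)) *\<^sub>R (\<kappa> *\<^sub>R g)) u p V \<Omega>"
    have N2: "2 \<le> N" using N by (simp add: N0_def)
    have "nat \<lceil>16 * r0\<^sup>2 * (M * E)\<rceil> \<le> N" using N unfolding N0_def by (rule add_leD1)
    then have Nbig: "16 * r0\<^sup>2 * (M * E) \<le> real N" by (simp only: nat_ceiling_le_eq)
    define d where "d = min_dist N (X N)"
    define R where "R = r0 / real N"
    note A = admissible_facts[OF X l N2 pos(3,4), folded d_def]
    have Np: "0 < real N" using N2 by simp
    have R: "0 < R" using pos Np by (simp add: R_def)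
    have NR: "real N * R = r0" using Np by (simp add: R_def)
    have Rd: "R \<le> (r0 * M * E) * d\<^sup>2"
    proof -
      have "R * 1 \<le> R * (M * E * real N * d\<^sup>2)" using A(5) R by (intro mult_left_mono) auto
      also have "\<dots> = (real N * R) * M * E * d\<^sup>2" by simp
      finally show ?thesis by (simp add: NR)
    qed
    have R4: "4 * R \<le> d"
    proof (rule power2_le_imp_le)
      have "(4 * R)\<^sup>2 = 16 * R * R" by (simp add: power2_eq_square)
      also have "\<dots> \<le> 16 * R * ((r0 * M * E) * d\<^sup>2)" using R by (intro mult_left_mono Rd) simp
      also have "\<dots> = 16 * r0\<^sup>2 * (M * E) / real N * d\<^sup>2" by (simp add: R_def power2_eq_square)
      also have "\<dots> \<le> 1 * d\<^sup>2" using Nbig Np by (intro mult_right_mono) auto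
      finally show "(4 * R)\<^sup>2 \<le> d\<^sup>2" by simp
    qed (use A(2) in simp)
    interpret stokes_suspension N R "X N" "\<kappa> *\<^sub>R g" u p V \<Omega>
    proof
      show "0 < R" by (rule R)
      show "4 * R \<le> dist (X N i) (X N j)" if "i \<in> {1..N}" "j \<in> {1..N}" "i \<noteq> j" for i j
        using min_dist_le[OF that, of "X N"] R4 unfolding d_def by linarith
      show "stokes_solution N R (X N) ((6 * pi * R) *\<^sub>R (\<kappa> *\<^sub>R g)) u p V \<Omega>" using sol unfolding R_def .
    qed
    define s where "s = S r0 M E (\<kappa> * norm g)"
    have s: "near_sum (\<kappa> *\<^sub>R g) i \<le> s" if i: "i \<in> {1..N}" for i
    proof -
      have dj: "d \<le> dist (X N i) (X N j)" if "j \<in> others i" for j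
        using that i unfolding d_def others_def by (intro min_dist_le) auto
      have "(\<Sum>j\<in>others i. 1 / (dist (X N i) (X N j))\<^sup>2) \<le> real N * (M * E + 8 * M * (2 + 4 * E) + 1)"
        by (rule inverse_square_sum_le[OF A(1) _ A(2,3,4) _ _ dj]) (use l N2 pos in \<open>auto simp: others_def\<close>)
      then have "R * norm (\<kappa> *\<^sub>R g) * (\<Sum>j\<in>others i. 1 / (dist (X N i) (X N j))\<^sup>2)
          \<le> R * norm (\<kappa> *\<^sub>R g) * (real N * (M * E + 8 * M * (2 + 4 * E) + 1))"
        using R by (intro mult_left_mono) auto
      also have "\<dots> = (real N * R) * norm (\<kappa> *\<^sub>R g) * (M * E + 8 * M * (2 + 4 * E) + 1)" by (simp add: mult_ac)
      also have "\<dots> = s" using pos unfolding s_def S_def NR by simp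
      finally show ?thesis unfolding near_sum_def by (simp add: sum_distrib_left)
    qed
    have s0: "0 \<le> s" using pos unfolding s_def S_def by simp
    have b: "0 \<le> r0 * M * E" using pos by simp
    show "\<forall>i\<in>{1..N}.
            norm (V i - (\<kappa> *\<^sub>R g + (6 * pi * (r0 / real N)) *\<^sub>R
                    (\<Sum>j\<in>{1..N} - {i}. oseen (X N i - X N j) *v (\<kappa> *\<^sub>R g))))
              \<le> C r0 M E (\<kappa> * norm g) * min_dist N (X N) \<and>
            norm ((r0 / real N) *\<^sub>R \<Omega> i)
              \<le> C r0 M E (\<kappa> * norm g) * min_dist N (X N)"
    proof (unfold R_def[symmetric] d_def[symmetric], intro ballI)
      fix i assume i: "i \<in> {1..N}"
      define B where "B = 28 * K * s * sqrt (real N * R * (r0 * M * E))"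
      note m = motion_bounds[OF K(1) K(2)[OF suspension_axioms] s s0 i Rd b A(2), folded B_def]
      have C: "C r0 M E (\<kappa> * norm g) = B + s" unfolding C_def B_def s_def NR ..
      have "R * near_sum (\<kappa> *\<^sub>R g) i \<le> d * s" using s[OF i] s0 R R4 near_sum_nonneg by (intro mult_mono) auto
      then have "norm (V i - (\<kappa> *\<^sub>R g + (6 * pi * R) *\<^sub>R (\<Sum>j\<in>{1..N} - {i}. oseen (X N i - X N j) *v (\<kappa> *\<^sub>R g)))) \<le> B * d + d * s"
        using velocity_minus_oseen[OF i] m(1) by linarith
      moreover have "0 \<le> s * d" using s0 A(2) by simp
      ultimately show "norm (V i - (\<kappa> *\<^sub>R g + (6 * pi * R) *\<^sub>R (\<Sum>j\<in>{1..N} - {i}. oseen (X N i - X N j) *v (\<kappa> *\<^sub>R g))))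
          \<le> C r0 M E (\<kappa> * norm g) * d \<and> norm (R *\<^sub>R \<Omega> i) \<le> C r0 M E (\<kappa> * norm g) * d"
        using m(2) unfolding C distrib_right by (simp add: mult.commute)
    qed
  qed
qed

end
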